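(* Let $U$ be an $N\times N$ Haar-distributed random unitary matrix with (unordered) eigenvalues $e^{\mathrm{i}\theta_1},\dots,e^{\mathrm{i}\theta_N}$, $\theta_i\in[0,2\pi]$, let $F_N(x)=\#\{i: 0\le\theta_i\le x\}/N$ for $x\in[0,2\pi]$, and let $$\mathcal{A}_N^{\mathrm{CUE}}=\int_{0}^{2\pi}\int_{0}^{2\pi} \Big(\big(F_N(y)-F_N(x)\big)-\frac{y-x}{2\pi }\Big)^2\, dx\,dy .$$ Let $\{Y_j\}_{j=1}^\infty$ be i.i.d. complex standard Gaussian random variables, i.e. with i.i.d. $N(0,\frac12)$ real and imaginary parts. Then, as $N\to\infty$, $$\frac{N^2}{4}\mathcal{A}_N^{\mathrm{CUE}}-(\log N+\gamma+1)\ \Longrightarrow\ \sum_{j=1}^\infty \frac{1}{j}\big(|Y_j|^2-1\big)$$ in distribution, where $\gamma$ is Euler's constant. *)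

theory Defs
  imports "HOL-Probability.Probability" "Jordan_Normal_Form.Schur_Decomposition"
begin

definition unitary_group :: "nat \<Rightarrow> complex mat set" where
  "unitary_group N = {V \<in> carrier_mat N N. mat_adjoint V * V = 1\<^sub>m N}"

(* Matrices carry no topology here, so the Borel sets are pulled back along the embedding of U(N)
   into the N * N complex matrix entries. *)
definition unitary_borel :: "nat \<Rightarrow> complex mat measure" where
  "unitary_borel N =
     vimage_algebra (unitary_group N)
       (\<lambda>V. \<lambda>ij\<in>{..<N} \<times> {..<N}. V $$ ij)
       (\<Pi>\<^sub>M ij\<in>{..<N} \<times> {..<N}. (borel :: complex measure))"

(* Left invariance determines the normalised Haar measure uniquely, and by compactness of U(N)
   it implies right invariance. *)
definition haar_unitary :: "nat \<Rightarrow> complex mat measure \<Rightarrow> bool" where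
  "haar_unitary N \<mu> \<longleftrightarrow>
     prob_space \<mu> \<and> sets \<mu> = sets (unitary_borel N) \<and>
     (\<forall>V\<in>unitary_group N. distr \<mu> (unitary_borel N) (\<lambda>W. V * W) = \<mu>)"

definition haar_distributed :: "nat \<Rightarrow> 'a measure \<Rightarrow> ('a \<Rightarrow> complex mat) \<Rightarrow> bool" where
  "haar_distributed N M U \<longleftrightarrow>
     U \<in> measurable M (unitary_borel N) \<and> haar_unitary N (distr M (unitary_borel N) U)"

(* The eigenvalues are listed with algebraic multiplicity, in arbitrary order. For the eigenvalue 1
   both angles 0 and 2 * pi are permitted. *)
definition eigenangles :: "nat \<Rightarrow> complex mat \<Rightarrow> (nat \<Rightarrow> real) \<Rightarrow> bool" where
  "eigenangles N V \<theta> \<longleftrightarrow>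
     (\<forall>i\<in>{1..N}. \<theta> i \<in> {0..2 * pi}) \<and>
     char_poly V = (\<Prod>i\<in>{1..N}. [:- cis (\<theta> i), 1:])"

definition empirical_cdf :: "nat \<Rightarrow> (nat \<Rightarrow> real) \<Rightarrow> real \<Rightarrow> real" where
  "empirical_cdf N \<theta> x = real (card {i \<in> {1..N}. 0 \<le> \<theta> i \<and> \<theta> i \<le> x}) / real N"

definition A_CUE :: "nat \<Rightarrow> (nat \<Rightarrow> real) \<Rightarrow> real" where
  "A_CUE N \<theta> =
     (LBINT y:{0..2 * pi}. (LBINT x:{0..2 * pi}.
        ((empirical_cdf N \<theta> y - empirical_cdf N \<theta> x) - (y - x) / (2 * pi))\<^sup>2))"

definition std_complex_gaussian :: "'a measure \<Rightarrow> ('a \<Rightarrow> complex) \<Rightarrow> bool" where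
  "std_complex_gaussian P Z \<longleftrightarrow>
     prob_space.indep_var P borel (\<lambda>\<omega>. Re (Z \<omega>)) borel (\<lambda>\<omega>. Im (Z \<omega>)) \<and>
     distributed P lborel (\<lambda>\<omega>. Re (Z \<omega>)) (normal_density 0 (sqrt (1 / 2))) \<and>
     distributed P lborel (\<lambda>\<omega>. Im (Z \<omega>)) (normal_density 0 (sqrt (1 / 2)))"

end

theory Submission
  imports Defs "HOL-Real_Asymp.Real_Asymp"
begin

text \<open>Let \<open>p\<^sub>k = Tr U\<^sup>k\<close>. Expanding the counting function in a Fourier series gives
\<open>N\<^sup>2 / 4 * A = (\<Sum>k\<ge>1. \<bar>p\<^sub>k\<bar>\<^sup>2 / k\<^sup>2)\<close>. Differentiating the invariance of Haar measure along the one-parameter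
groups generated by rank-one projections yields the loop equations
\<open>E[(\<Sum>l<m. p\<^sub>l * p\<^sub>m\<^sub>-\<^sub>l) * G + V\<^sub>m G] = 0\<close>, where \<open>V\<^sub>m\<close> is the derivation taking \<open>p\<^sub>j\<close> to \<open>j * p\<^sub>m\<^sub>+\<^sub>j\<close>. They are used twice.

First, they make the mean of every Laplacian vanish. Power sums act on antisymmetric families of Fourier
coefficients, and there the Laplacian is diagonal with a simple zero eigenvalue, so the mean of a
polynomial in the \<open>p\<^sub>k\<close> is its vacuum matrix element, as in Weyl's integration formula. This gives
\<open>E \<bar>p\<^sub>k\<bar>\<^sup>2 = min k N\<close> and enough about fourth moments to bound the variance of the tail of the series
beyond \<open>K\<close> by a multiple of \<open>1 / K\<close>, uniformly in \<open>N\<close>.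

Second, for the partial sum \<open>X\<close> up to \<open>K\<close> and \<open>G = p\<^sub>-\<^sub>m * exp (i t X)\<close> with \<open>m \<le> K\<close> they become
\<open>(1 - i t / m) * E[\<bar>p\<^sub>m\<bar>\<^sup>2 exp (i t X)] = m * E[exp (i t X)] + O(1 / N)\<close>, a differential equation in \<open>t\<close> showing that
\<open>E[exp (i t X)]\<close> tends to \<open>(\<Prod>m\<le>K. 1 / (1 - i t / m))\<close>, the characteristic function of \<open>\<Sum>j\<le>K. \<bar>Y\<^sub>j\<bar>\<^sup>2 / j\<close>.\<close>

section \<open>Power sums acting on antisymmetric coefficients\<close>

text \<open>The hypotheses provide invariance alone, so exact moments and the limit law must both
  come out of the loop equations. The obstacle is uniformity in N. Solving the differential equation
  in t costs factors such as \<open>(1 + \<bar>t\<bar>) ^ K\<close>, so it controls finitely many k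
  at a time, whereas the series runs over all k, including those beyond N, where E |p_k|^2 stays at
  N. Exact moments close the gap: for j \<noteq> k the covariance of |p_j|^2 and |p_k|^2 vanishes if
  j + k \<le> N and is at most N otherwise, and in the second case one index exceeds N/2, so the
  weights 1/k^2 absorb the factor N. Functions of the p_k are represented by syntax trees because
  for fixed N the power sums satisfy algebraic relations: derivations and the Laplacian can be
  defined by recursion on a tree without any check that they respect these relations. The centring
  is the sum of min k N / k^2. The part k \<le> N is a harmonic number, which yields log N +
  \<gamma>; the part k > N tends to 1.\<close>

text \<open>The symbol \<open>Pw k\<close> stands for \<open>p\<^sub>k\<close>. The map \<open>S N f\<close> is the transpose of multiplication by \<open>f\<close> on Laurent
polynomials in the \<open>N\<close> eigenvalues, whose monomials are indexed by exponents \<open>\<mu>\<close>.\<close>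

datatype trace_expr = Cst complex | Pw int | Add trace_expr trace_expr | Mul trace_expr trace_expr | Ex trace_expr

primrec ev :: "(int \<Rightarrow> complex) \<Rightarrow> trace_expr \<Rightarrow> complex" where
  "ev p (Cst c) = c"
| "ev p (Pw k) = p k"
| "ev p (Add f g) = ev p f + ev p g"
| "ev p (Mul f g) = ev p f * ev p g"
| "ev p (Ex f) = exp (ev p f)"

primrec exp_free :: "trace_expr \<Rightarrow> bool" where
  "exp_free (Cst c) = True"
| "exp_free (Pw k) = True"
| "exp_free (Add f g) = (exp_free f \<and> exp_free g)"
| "exp_free (Mul f g) = (exp_free f \<and> exp_free g)"
| "exp_free (Ex f) = False"

text \<open>On the torus this is the vector field \<Sum> z_i^(m+1) d/dz_i. Exponentials get the
  genuine chain rule, because the Stein identity is tested against one.\<close>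

primrec power_field :: "int \<Rightarrow> trace_expr \<Rightarrow> trace_expr" where
  "power_field m (Cst c) = Cst 0"
| "power_field m (Pw j) = Mul (Cst (of_int j)) (Pw (m + j))"
| "power_field m (Add f g) = Add (power_field m f) (power_field m g)"
| "power_field m (Mul f g) = Add (Mul (power_field m f) g) (Mul f (power_field m g))"
| "power_field m (Ex f) = Mul (power_field m f) (Ex f)"

text \<open>The form \<Sum> (D_i f) (D_i g) with D_i = z_i d/dz_i, so that p_j and p_k yield j k
  p_(j+k). The recursion runs over the first argument only, whence symmetry is a separate lemma,
  \<open>ev_carre_du_champ_sym\<close>. The value at \<open>Ex\<close> is a default; the first
  argument is always a polynomial.\<close>

primrec carre_du_champ :: "trace_expr \<Rightarrow> trace_expr \<Rightarrow> trace_expr" where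
  "carre_du_champ (Cst c) g = Cst 0"
| "carre_du_champ (Pw j) g = Mul (Cst (of_int j)) (power_field j g)"
| "carre_du_champ (Add a b) g = Add (carre_du_champ a g) (carre_du_champ b g)"
| "carre_du_champ (Mul a b) g = Add (Mul (carre_du_champ a g) b) (Mul a (carre_du_champ b g))"
| "carre_du_champ (Ex f) g = Cst 0"

definition expr_sum :: "trace_expr list \<Rightarrow> trace_expr" where "expr_sum = (\<lambda>l. foldr Add l (Cst 0))"

text \<open>Up to normalisation, minus the Laplace-Beltrami operator of U(N) on class functions,
  written in power sums. The summand l = \<bar>k\<bar> contains the factor p_0 = N. The clause for
  products is the Leibniz rule of a second-order operator.\<close>

primrec laplacian :: "trace_expr \<Rightarrow> trace_expr" where
  "laplacian (Cst c) = Cst 0"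
| "laplacian (Pw k) = Mul (Cst (of_int \<bar>k\<bar>))
     (expr_sum (map (\<lambda>l. Mul (Pw (sgn k * int l)) (Pw (k - sgn k * int l))) [1..<Suc (nat \<bar>k\<bar>)]))"
| "laplacian (Add a b) = Add (laplacian a) (laplacian b)"
| "laplacian (Mul a b) = Add (Add (Mul (laplacian a) b) (Mul (laplacian b) a)) (Mul (Cst 2) (carre_du_champ a b))"
| "laplacian (Ex f) = Cst 0"

primrec S :: "nat \<Rightarrow> trace_expr \<Rightarrow> ((nat \<Rightarrow> int) \<Rightarrow> complex) \<Rightarrow> (nat \<Rightarrow> int) \<Rightarrow> complex" where
  "S N (Cst c) w = (\<lambda>\<mu>. c * w \<mu>)"
| "S N (Pw k) w = (\<lambda>\<mu>. \<Sum>i<N. w (\<mu>(i := \<mu> i + k)))"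
| "S N (Add f g) w = (\<lambda>\<mu>. S N f w \<mu> + S N g w \<mu>)"
| "S N (Mul f g) w = S N f (S N g w)"
| "S N (Ex f) w = w"

section \<open>Algebra of the transposed multiplication operators\<close>

lemma exp_free_power_field [simp]: "exp_free g \<Longrightarrow> exp_free (power_field m g)"
  by (induction g) auto

lemma exp_free_carre_du_champ [simp]: "exp_free f \<Longrightarrow> exp_free g \<Longrightarrow> exp_free (carre_du_champ f g)"
  by (induction f) auto

lemma exp_free_expr_sum [simp]: "exp_free (expr_sum l) \<longleftrightarrow> (\<forall>f\<in>set l. exp_free f)"
  by (induction l) (auto simp: expr_sum_def)

lemma exp_free_laplacian [simp]: "exp_free f \<Longrightarrow> exp_free (laplacian f)"
  by (induction f) auto

lemma ev_expr_sum: "ev p (expr_sum l) = (\<Sum>f\<leftarrow>l. ev p f)"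
  by (induction l) (auto simp: expr_sum_def)

lemma S_expr_sum: "S N (expr_sum l) w \<mu> = (\<Sum>f\<leftarrow>l. S N f w \<mu>)"
  by (induction l) (auto simp: expr_sum_def)

lemma S_add: "S N f (\<lambda>\<mu>. u \<mu> + v \<mu>) \<mu> = S N f u \<mu> + S N f v \<mu>"
proof (induction f arbitrary: u v \<mu>)
  case (Mul f1 f2)
  have "S N f2 (\<lambda>\<mu>. u \<mu> + v \<mu>) = (\<lambda>\<mu>. S N f2 u \<mu> + S N f2 v \<mu>)"
    using Mul by blast
  then show ?case using Mul by simp
qed (auto simp: algebra_simps sum.distrib)

lemma S_scale: "S N f (\<lambda>\<mu>. c * u \<mu>) \<mu> = c * S N f u \<mu>"
proof (induction f arbitrary: u \<mu>)
  case (Mul f1 f2)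
  have "S N f2 (\<lambda>\<mu>. c * u \<mu>) = (\<lambda>\<mu>. c * S N f2 u \<mu>)"
    using Mul by blast
  then show ?case using Mul by simp
qed (auto simp: algebra_simps sum_distrib_left)

lemma S_diff: "S N f (\<lambda>\<mu>. u \<mu> - v \<mu>) \<mu> = S N f u \<mu> - S N f v \<mu>"
  using S_add[of N f u "\<lambda>\<mu>. -1 * v \<mu>" \<mu>] S_scale[of N f "-1" v \<mu>] by simp

lemma S_zero: "S N f (\<lambda>\<mu>. 0) \<mu> = 0"
  using S_scale[of N f 0 "\<lambda>_. 0" \<mu>] by simp

lemma S_sum: "finite A \<Longrightarrow> S N f (\<lambda>\<mu>. \<Sum>x\<in>A. u x \<mu>) \<mu> = (\<Sum>x\<in>A. S N f (u x) \<mu>)"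
  by (induction A rule: finite_induct) (simp_all add: S_zero S_add)

lemma S_Pw_commute: "S N (Pw j) (S N g w) \<mu> = S N g (S N (Pw j) w) \<mu>"
proof (induction g arbitrary: w \<mu>)
  case (Pw k)
  have "(\<mu>(i := \<mu> i + j))(l := (\<mu>(i := \<mu> i + j)) l + k) = (\<mu>(l := \<mu> l + k))(i := (\<mu>(l := \<mu> l + k)) i + j)" for i l
    by (auto simp: fun_eq_iff)
  then show ?case by (simp del: fun_upd_apply) (rule sum.swap)
next
  case (Mul g1 g2)
  have e: "S N (Pw j) (S N g2 w) = S N g2 (S N (Pw j) w)" using Mul by blast
  show ?case unfolding S.simps(4) by (subst Mul.IH(1)) (simp only: e)
qed (auto simp: algebra_simps sum_distrib_left sum.distrib)

lemma S_commute: "S N f (S N g w) \<mu> = S N g (S N f w) \<mu>"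
proof (induction f arbitrary: w \<mu>)
  case (Cst c) then show ?case by (simp add: S_scale)
next
  case (Pw k) show ?case by (rule S_Pw_commute)
next
  case (Add f1 f2) then show ?case by (simp add: S_add)
next
  case (Mul f1 f2)
  have e: "S N f2 (S N g w) = S N g (S N f2 w)" using Mul by blast
  show ?case by (simp add: e Mul)
qed auto

text \<open>Completing the square gives the sum of (\<mu> i - (N-1)/2)^2 minus the same sum for
  \<open>int\<close>: the Casimir eigenvalue of the exponents \<mu>. The subtraction makes it vanish
  at the vacuum \<open>int\<close>, whose exponents are 0, ..., N-1.\<close>

definition lap_symbol :: "nat \<Rightarrow> (nat \<Rightarrow> int) \<Rightarrow> int" where
  "lap_symbol N \<mu> = (\<Sum>i<N. \<mu> i * (\<mu> i - (int N - 1)) - int i * (int i - (int N - 1)))"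

text \<open>The commutator of multiplication by \<open>f\<close> with the diagonal operator
  \<open>lap_symbol\<close>; the order of the two terms reflects the transposition in
  \<open>S\<close>.\<close>

definition lap_commutator :: "nat \<Rightarrow> trace_expr \<Rightarrow> ((nat \<Rightarrow> int) \<Rightarrow> complex) \<Rightarrow> (nat \<Rightarrow> int) \<Rightarrow> complex" where
  "lap_commutator N f w \<mu> = S N f (\<lambda>\<nu>. of_int (lap_symbol N \<nu>) * w \<nu>) \<mu> - of_int (lap_symbol N \<mu>) * S N f w \<mu>"

lemma lap_symbol_upd:
  assumes "i < N"
  shows "lap_symbol N (\<mu>(i := \<mu> i + k)) = lap_symbol N \<mu> + 2 * k * \<mu> i + k\<^sup>2 - (int N - 1) * k"
proof -
  have "lap_symbol N \<nu> = (\<nu> i * (\<nu> i - (int N - 1)) - int i * (int i - (int N - 1))) +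
     (\<Sum>j\<in>{..<N}-{i}. \<nu> j * (\<nu> j - (int N - 1)) - int j * (int j - (int N - 1)))" for \<nu>
    unfolding lap_symbol_def using assms by (subst sum.remove[of _ i]) auto
  from this[of \<mu>] this[of "\<mu>(i := \<mu> i + k)"] show ?thesis
    by (simp add: algebra_simps power2_eq_square)
qed

lemma lap_commutator_Pw: "lap_commutator N (Pw k) w \<mu> = (\<Sum>i<N. of_int (2 * k * \<mu> i + k\<^sup>2 - (int N - 1) * k) * w (\<mu>(i := \<mu> i + k)))"
proof -
  have "lap_commutator N (Pw k) w \<mu> = (\<Sum>i<N. of_int (lap_symbol N (\<mu>(i := \<mu> i + k))) * w (\<mu>(i := \<mu> i + k)) - of_int (lap_symbol N \<mu>) * w (\<mu>(i := \<mu> i + k)))"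
    unfolding lap_commutator_def S.simps sum_distrib_left sum_subtractf ..
  also have "\<dots> = (\<Sum>i<N. of_int (2 * k * \<mu> i + k\<^sup>2 - (int N - 1) * k) * w (\<mu>(i := \<mu> i + k)))"
  proof (intro sum.cong refl)
    fix i assume "i \<in> {..<N}"
    then have e: "lap_symbol N (\<mu>(i := \<mu> i + k)) = lap_symbol N \<mu> + (2 * k * \<mu> i + k\<^sup>2 - (int N - 1) * k)"
      by (subst lap_symbol_upd) auto
    show "of_int (lap_symbol N (\<mu>(i := \<mu> i + k))) * w (\<mu>(i := \<mu> i + k)) - of_int (lap_symbol N \<mu>) * w (\<mu>(i := \<mu> i + k))
       = of_int (2 * k * \<mu> i + k\<^sup>2 - (int N - 1) * k) * w (\<mu>(i := \<mu> i + k))"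
      unfolding e of_int_add[of "lap_symbol N \<mu>"] distrib_right add_diff_cancel_left' ..
  qed
  finally show ?thesis .
qed

lemma lap_commutator_Mul: "lap_commutator N (Mul a b) w \<mu> = S N a (lap_commutator N b w) \<mu> + lap_commutator N a (S N b w) \<mu>"
proof -
  have "lap_commutator N b w = (\<lambda>\<mu>. S N b (\<lambda>\<nu>. of_int (lap_symbol N \<nu>) * w \<nu>) \<mu> - of_int (lap_symbol N \<mu>) * S N b w \<mu>)"
    by (auto simp: lap_commutator_def)
  then show ?thesis by (simp add: lap_commutator_def S_diff)
qed

lemma lap_commutator_add: "lap_commutator N f (\<lambda>\<mu>. u \<mu> + v \<mu>) \<mu> = lap_commutator N f u \<mu> + lap_commutator N f v \<mu>"
  by (simp add: lap_commutator_def S_add algebra_simps)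

lemma lap_commutator_scale: "lap_commutator N f (\<lambda>\<mu>. c * u \<mu>) \<mu> = c * lap_commutator N f u \<mu>"
  using S_scale[of N f c "\<lambda>\<nu>. of_int (lap_symbol N \<nu>) * u \<nu>" \<mu>]
  by (simp add: lap_commutator_def S_scale algebra_simps)

lemma lap_commutator_Add: "lap_commutator N (Add a b) w \<mu> = lap_commutator N a w \<mu> + lap_commutator N b w \<mu>"
  by (simp add: lap_commutator_def algebra_simps)

text \<open>The commutator with \<open>Pw k\<close> weights each shift by an affine function of the
  shifted coordinate, of slope 2k. A further shift by j changes this weight by 2jk if it hits the
  same coordinate and leaves it alone otherwise. In other words, the double commutator of a
  second-order operator is multiplication by twice its carre du champ.\<close>

lemma lap_commutator_double_Pw:
  "exp_free b \<Longrightarrow> S N (Pw j) (lap_commutator N b w) \<mu> = lap_commutator N b (S N (Pw j) w) \<mu> + 2 * of_int j * S N (power_field j b) w \<mu>"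
proof (induction b arbitrary: w \<mu>)
  case (Cst c)
  have "lap_commutator N (Cst c) w \<mu> = 0" for w \<mu> by (simp add: lap_commutator_def)
  then show ?case by simp
next
  case (Pw k)
  define c where "c = k\<^sup>2 - (int N - 1) * k"
  have K: "lap_commutator N (Pw k) w \<mu> = (\<Sum>l<N. of_int (2 * k * \<mu> l + c) * w (\<mu>(l := \<mu> l + k)))" for w \<mu>
    unfolding lap_commutator_Pw c_def add_diff_eq ..
  have comm: "(\<mu>(i := \<mu> i + j))(l := (\<mu>(i := \<mu> i + j)) l + k) = (\<mu>(l := \<mu> l + k))(i := (\<mu>(l := \<mu> l + k)) i + j)" for i l
    by (auto simp: fun_eq_iff)
  define X where "X i l = w ((\<mu>(l := \<mu> l + k))(i := (\<mu>(l := \<mu> l + k)) i + j))" for i l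
  have "S N (Pw j) (lap_commutator N (Pw k) w) \<mu> = (\<Sum>i<N. \<Sum>l<N. of_int (2 * k * (\<mu>(i := \<mu> i + j)) l + c) * X i l)"
    unfolding S.simps(2) K X_def comm ..
  \<comment> \<open>Only on the diagonal l = i does the shift by j reach the coordinate that carries
    the weight.\<close>
  also have "\<dots> = (\<Sum>i<N. \<Sum>l<N. of_int (2 * k * \<mu> l + c) * X i l + (if l = i then of_int (2 * k * j) * X i l else 0))"
    by (intro sum.cong refl) (auto simp: algebra_simps)
  also have "\<dots> = (\<Sum>i<N. \<Sum>l<N. of_int (2 * k * \<mu> l + c) * X i l) + (\<Sum>i<N. of_int (2 * k * j) * X i i)"
    by (simp add: sum.distrib)
  also have "(\<Sum>i<N. \<Sum>l<N. of_int (2 * k * \<mu> l + c) * X i l) = lap_commutator N (Pw k) (S N (Pw j) w) \<mu>"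
    unfolding K S.simps(2) X_def sum_distrib_left by (rule sum.swap)
  also have "(\<Sum>i<N. of_int (2 * k * j) * X i i) = 2 * of_int j * S N (power_field j (Pw k)) w \<mu>"
    by (simp add: X_def sum_distrib_left algebra_simps)
  finally show ?case .
next
  case (Add b1 b2)
  have "lap_commutator N (Add b1 b2) w = (\<lambda>\<mu>. lap_commutator N b1 w \<mu> + lap_commutator N b2 w \<mu>)" for w by (auto simp: lap_commutator_Add)
  then have "S N (Pw j) (lap_commutator N (Add b1 b2) w) \<mu> = S N (Pw j) (lap_commutator N b1 w) \<mu> + S N (Pw j) (lap_commutator N b2 w) \<mu>"
    by (simp only: S_add)
  also have "S N (Pw j) (lap_commutator N b1 w) \<mu> = lap_commutator N b1 (S N (Pw j) w) \<mu> + 2 * of_int j * S N (power_field j b1) w \<mu>"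
    using Add.prems by (intro Add.IH) simp
  also have "S N (Pw j) (lap_commutator N b2 w) \<mu> = lap_commutator N b2 (S N (Pw j) w) \<mu> + 2 * of_int j * S N (power_field j b2) w \<mu>"
    using Add.prems by (intro Add.IH) simp
  finally show ?case by (simp only: lap_commutator_Add power_field.simps S.simps(3) distrib_left) (simp only: ac_simps)
next
  case (Mul b1 b2)
  have E1: "lap_commutator N (Mul b1 b2) w = (\<lambda>\<mu>. S N b1 (lap_commutator N b2 w) \<mu> + lap_commutator N b1 (S N b2 w) \<mu>)"
    by (auto simp: lap_commutator_Mul)
  have p: "exp_free b1" "exp_free b2" using Mul.prems by auto
  have E2: "S N (Pw j) (lap_commutator N b2 w) = (\<lambda>\<mu>. lap_commutator N b2 (S N (Pw j) w) \<mu> + (2 * of_int j) * S N (power_field j b2) w \<mu>)"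
    using Mul.IH(2)[OF p(2)] by blast
  have E3: "S N (Pw j) (S N b2 w) = S N b2 (S N (Pw j) w)" using S_commute by blast
  have "S N (Pw j) (lap_commutator N (Mul b1 b2) w) \<mu> = S N (Pw j) (S N b1 (lap_commutator N b2 w)) \<mu> + S N (Pw j) (lap_commutator N b1 (S N b2 w)) \<mu>"
    unfolding E1 by (rule S_add)
  also have "S N (Pw j) (S N b1 (lap_commutator N b2 w)) \<mu> = S N b1 (S N (Pw j) (lap_commutator N b2 w)) \<mu>"
    by (rule S_commute)
  also have "\<dots> = S N b1 (lap_commutator N b2 (S N (Pw j) w)) \<mu> + (2 * of_int j) * S N b1 (S N (power_field j b2) w) \<mu>"
    unfolding E2 S_add S_scale ..
  also have "S N (Pw j) (lap_commutator N b1 (S N b2 w)) \<mu> = lap_commutator N b1 (S N b2 (S N (Pw j) w)) \<mu> + 2 * of_int j * S N (power_field j b1) (S N b2 w) \<mu>"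
    using Mul.IH(1)[OF p(1)] by (simp only: E3)
  finally show ?case by (simp only: lap_commutator_Mul power_field.simps S.simps ring_distribs) (simp only: ac_simps)
qed auto

lemma lap_commutator_double:
  "exp_free a \<Longrightarrow> exp_free b \<Longrightarrow> S N a (lap_commutator N b w) \<mu> = lap_commutator N b (S N a w) \<mu> + 2 * S N (carre_du_champ a b) w \<mu>"
proof (induction a arbitrary: w \<mu>)
  case (Cst c)
  then show ?case by (simp add: lap_commutator_scale)
next
  case (Pw k)
  then show ?case using lap_commutator_double_Pw[of b N k w \<mu>] by simp
next
  case (Add a1 a2)
  then show ?case by (simp add: lap_commutator_add algebra_simps)
next
  case (Mul a1 a2)
  have p: "exp_free a1" "exp_free a2" using Mul.prems by auto
  have E: "S N a2 (lap_commutator N b w) = (\<lambda>\<mu>. lap_commutator N b (S N a2 w) \<mu> + 2 * S N (carre_du_champ a2 b) w \<mu>)"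
    using Mul.IH(2)[OF p(2) Mul.prems(2)] by blast
  show ?case unfolding S.simps(4) E S_add S_scale
    by (simp add: Mul.IH(1)[OF p(1) Mul.prems(2)])
qed auto

text \<open>Coefficients of antisymmetric Laurent polynomials, that is, of symmetric ones multiplied
  by the Vandermonde determinant.\<close>

definition antisym :: "nat \<Rightarrow> ((nat \<Rightarrow> int) \<Rightarrow> complex) \<Rightarrow> bool" where
  "antisym N w \<longleftrightarrow> (\<forall>\<pi> \<mu>. \<pi> permutes {..<N} \<longrightarrow> w (\<mu> \<circ> \<pi>) = of_int (sign \<pi>) * w \<mu>)"

text \<open>Power sums are symmetric: a permutation of the coordinates merely permutes the summands
  of a shift.\<close>

lemma antisym_S: "antisym N w \<Longrightarrow> antisym N (S N f w)"
proof (induction f arbitrary: w)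
  case (Pw k)
  show ?case unfolding antisym_def
  proof (intro allI impI)
    fix \<pi> :: "nat \<Rightarrow> nat" and \<mu> :: "nat \<Rightarrow> int" assume pi: "\<pi> permutes {..<N}"
    have inj: "inj \<pi>" using pi by (rule permutes_inj)
    have "S N (Pw k) w (\<mu> \<circ> \<pi>) = (\<Sum>i<N. w ((\<mu>(\<pi> i := \<mu> (\<pi> i) + k)) \<circ> \<pi>))"
      using inj by (auto intro!: sum.cong arg_cong[of _ _ w] simp: fun_eq_iff inj_eq)
    also have "\<dots> = of_int (sign \<pi>) * (\<Sum>i<N. w (\<mu>(\<pi> i := \<mu> (\<pi> i) + k)))"
      using Pw pi by (auto simp: antisym_def sum_distrib_left simp del: fun_upd_apply)
    also have "(\<Sum>i<N. w (\<mu>(\<pi> i := \<mu> (\<pi> i) + k))) = (\<Sum>i<N. w (\<mu>(i := \<mu> i + k)))"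
      by (rule sum.reindex_bij_betw[OF permutes_imp_bij[OF pi], of "\<lambda>i. w (\<mu>(i := \<mu> i + k))"])
    finally show "S N (Pw k) w (\<mu> \<circ> \<pi>) = of_int (sign \<pi>) * S N (Pw k) w \<mu>" unfolding S.simps .
  qed
next
  case (Cst c)
  then show ?case unfolding antisym_def S.simps by (metis mult.left_commute)
next
  case (Add f1 f2)
  from Add.IH(1)[OF Add.prems] Add.IH(2)[OF Add.prems] show ?case
    unfolding antisym_def S.simps by (metis distrib_left)
next
  case (Mul f1 f2)
  then show ?case by simp
next
  case (Ex f)
  then show ?case by simp
qed

section \<open>Cancellation at the vacuum by antisymmetry\<close>

lemma antisym_swap:
  assumes "antisym N w" "i < N" "j < N" "i \<noteq> j" "\<mu> i = \<nu> j" "\<mu> j = \<nu> i" "\<And>l. l \<noteq> i \<Longrightarrow> l \<noteq> j \<Longrightarrow> \<mu> l = \<nu> l"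
  shows "w \<mu> = - w \<nu>"
proof -
  have "Transposition.transpose i j permutes {..<N}" using assms by (intro permutes_swap_id) auto
  moreover have "\<mu> = \<nu> \<circ> Transposition.transpose i j" using assms by (auto simp: fun_eq_iff Transposition.transpose_def)
  ultimately show ?thesis using assms by (auto simp: antisym_def sign_swap_id)
qed

lemma antisym_eq0:
  assumes "antisym N w" "i < N" "j < N" "i \<noteq> j" "\<mu> i = \<mu> j"
  shows "w \<mu> = 0"
proof -
  have "w \<mu> = - w \<mu>" using antisym_swap[OF assms(1-4), of \<mu> \<mu>] assms(5) by metis
  then have "2 * w \<mu> = 0" by (simp only: eq_neg_iff_add_eq_0 mult_2)
  then show ?thesis by simp
qed

text \<open>Terms whose mirror image falls outside A vanish; the others form a set stable under the
  reflection and cancel in pairs. In the applications the reflection exchanges two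
  exponents.\<close>

lemma sum_reflect_zero:
  fixes u :: "int \<Rightarrow> complex"
  assumes "finite A" "\<And>s. u (c - s) = - u s" "\<And>s. s \<in> A \<Longrightarrow> c - s \<notin> A \<Longrightarrow> u s = 0"
  shows "sum u A = 0"
proof -
  define B where "B = {s\<in>A. c - s \<in> A}"
  have AB: "sum u A = sum u B" unfolding B_def using assms by (intro sum.mono_neutral_right) auto
  have "sum u B = (\<Sum>s\<in>B. u (c - s))"
    by (rule sum.reindex_bij_witness[of _ "\<lambda>s. c - s" "\<lambda>s. c - s"]) (auto simp: B_def)
  also have "\<dots> = - sum u B" unfolding assms(2) by (rule sum_negf)
  finally have "2 * sum u B = 0" by (simp only: eq_neg_iff_add_eq_0 mult_2)
  then have "sum u B = 0" by simp
  with AB show ?thesis by (simp only:)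
qed

text \<open>The reflection s \<mapsto> c - s swaps the exponents at i and j. If c - s leaves the
  range, it lies strictly between j and i, where the untouched coordinate \<open>nat (c - s)\<close>
  carries the same exponent, so the repeated exponent gives 0.\<close>

lemma base_sum_pos:
  assumes w: "antisym N w" and ij: "j < i" "i < N"
  shows "(\<Sum>s\<in>{int i..int i + int k - 1}. w (int (i := s, j := int i + int j + int k - s))) = 0"
proof -
  define c where "c = int i + int j + int k"
  have b1: "w (int(i := c - s, j := c - (c - s))) = - w (int(i := s, j := c - s))" for s
    by (rule antisym_swap[OF w, of i j]) (use ij in auto)
  have "w (int(i := s, j := c - s)) = 0" if s: "s \<in> {int i..int i + int k - 1}" "c - s \<notin> {int i..int i + int k - 1}" for s
    by (rule antisym_eq0[OF w, of j "nat (c - s)"]) (use ij s in \<open>auto simp: c_def\<close>)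
  then show ?thesis unfolding c_def[symmetric]
    by (intro sum_reflect_zero[where c=c] b1) auto
qed

lemma base_sum_neg:
  assumes w: "antisym N w" and ij: "i < j" "j < N"
  shows "(\<Sum>s\<in>{int i - int k + 1..int i}. w (int (i := s, j := int i + int j - int k - s))) = 0"
proof -
  define c where "c = int i + int j - int k"
  have b1: "w (int(i := c - s, j := c - (c - s))) = - w (int(i := s, j := c - s))" for s
    by (rule antisym_swap[OF w, of i j]) (use ij in auto)
  have "w (int(i := s, j := c - s)) = 0" if s: "s \<in> {int i - int k + 1..int i}" "c - s \<notin> {int i - int k + 1..int i}" for s
    by (rule antisym_eq0[OF w, of j "nat (c - s)"]) (use ij s in \<open>auto simp: c_def\<close>)
  then show ?thesis unfolding c_def[symmetric]
    by (intro sum_reflect_zero[where c=c] b1) auto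
qed

text \<open>\<open>W i\<close> is added once for every j < i and subtracted once for every larger
  index below N, and i - (N - 1 - i) = 2i - (N - 1). This produces the linear part of the weights in
  \<open>lap_commutator_Pw\<close>.\<close>

lemma dsum_pos:
  fixes W :: "nat \<Rightarrow> complex"
  shows "(\<Sum>i<N. \<Sum>j<N. if i = j then c * W i else if j < i then W i - W j else 0) =
    (\<Sum>i<N. (c + of_int (2 * int i - (int N - 1))) * W i)"
proof (induction N)
  case (Suc N)
  let ?F = "\<lambda>i j. if i = j then c * W i else if j < i then W i - W j else 0"
  have "(\<Sum>i<Suc N. \<Sum>j<Suc N. ?F i j) = (\<Sum>i<N. \<Sum>j<N. ?F i j) + (\<Sum>i<N. ?F i N) + (\<Sum>j<N. ?F N j) + c * W N"
    by (simp add: sum.distrib)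
  also have "(\<Sum>i<N. ?F i N) = 0" by (intro sum.neutral) auto
  also have "(\<Sum>j<N. ?F N j) = of_nat N * W N - (\<Sum>j<N. W j)"
    by (simp add: sum_subtractf)
  finally show ?case unfolding Suc.IH
    by (simp add: algebra_simps sum.distrib sum_subtractf)
qed simp

lemma dsum_neg:
  fixes W :: "nat \<Rightarrow> complex"
  shows "(\<Sum>i<N. \<Sum>j<N. if i = j then c * W i else if i < j then W i - W j else 0) =
    (\<Sum>i<N. (c - of_int (2 * int i - (int N - 1))) * W i)"
proof -
  have "(\<Sum>i<N. \<Sum>j<N. if i = j then c * W i else if i < j then W i - W j else 0) =
     (\<Sum>i<N. \<Sum>j<N. - (if i = j then (- c) * W i else if j < i then W i - W j else 0))"
    by (subst sum.swap) (intro sum.cong, auto)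
  also have "\<dots> = - (\<Sum>i<N. (- c + of_int (2 * int i - (int N - 1))) * W i)"
    unfolding sum_negf dsum_pos ..
  also have "\<dots> = (\<Sum>i<N. (c - of_int (2 * int i - (int N - 1))) * W i)"
    unfolding sum_negf[symmetric] by (intro sum.cong) (auto simp: algebra_simps)
  finally show ?thesis .
qed

text \<open>For i \<noteq> j the sum over the splittings l + (k - l) of k is, up to end points, a
  sum killed by \<open>base_sum_pos\<close>; the order of i and j decides whether end points
  survive.\<close>

lemma inner_pos:
  assumes w: "antisym N w" and ij: "i < N" "j < N"
  shows "(\<Sum>l\<in>{1..int k}. w ((int(i := int i + l))(j := (int(i := int i + l)) j + (int k - l)))) =
    (if i = j then of_nat k * w (int(i := int i + int k)) else if j < i then w (int(i := int i + int k)) - w (int(j := int j + int k)) else 0)"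
proof -
  consider "i = j" | "j < i" | "i < j" by linarith
  then show ?thesis
  proof cases
    case 1 then show ?thesis by simp
  next
    case 2
    let ?u = "\<lambda>s. w (int (i := s, j := int i + int j + int k - s))"
    have "(\<Sum>l\<in>{1..int k}. w ((int(i := int i + l))(j := (int(i := int i + l)) j + (int k - l)))) = (\<Sum>s\<in>{int i + 1..int i + int k}. ?u s)"
      by (rule sum.reindex_bij_witness[of _ "\<lambda>s. s - int i" "\<lambda>l. l + int i"]) (use 2 in \<open>auto simp: algebra_simps\<close>)
    \<comment> \<open>The window is moved down by one to become the vanishing one. The two end
      points exchanged in the process are the configurations in which i alone, or j alone, is raised
      by k.\<close>
    also have "\<dots> = (\<Sum>s\<in>{int i..int i + int k - 1}. ?u s) + ?u (int i + int k) - ?u (int i)"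
    proof -
      have "(\<Sum>s\<in>{int i..int i + int k}. ?u s) = ?u (int i) + (\<Sum>s\<in>{int i + 1..int i + int k}. ?u s)"
        by (subst sum.remove[of _ "int i"]) (auto intro!: sum.cong)
      moreover have "(\<Sum>s\<in>{int i..int i + int k}. ?u s) = ?u (int i + int k) + (\<Sum>s\<in>{int i..int i + int k - 1}. ?u s)"
        by (subst sum.remove[of _ "int i + int k"]) (auto intro!: sum.cong)
      ultimately show ?thesis by (simp add: algebra_simps)
    qed
    also have "(\<Sum>s\<in>{int i..int i + int k - 1}. ?u s) = 0" by (rule base_sum_pos[OF w 2 ij(1)])
    finally have "(\<Sum>l\<in>{1..int k}. w ((int(i := int i + l))(j := (int(i := int i + l)) j + (int k - l)))) = ?u (int i + int k) - ?u (int i)"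
      by (simp only: add_0)
    moreover have "int (i := int i + int k, j := int i + int j + int k - (int i + int k)) = int (i := int i + int k)"
      "int (i := int i, j := int i + int j + int k - int i) = int (j := int j + int k)"
      using 2 by (auto simp: fun_eq_iff)
    ultimately show ?thesis using 2 by simp
  next
    case 3
    let ?u = "\<lambda>s. w (int (j := s, i := int j + int i + int k - s))"
    \<comment> \<open>Read from the coordinate j, the window is already the vanishing one, so no end
      point is left over.\<close>
    have "(\<Sum>l\<in>{1..int k}. w ((int(i := int i + l))(j := (int(i := int i + l)) j + (int k - l)))) = (\<Sum>s\<in>{int j..int j + int k - 1}. ?u s)"
      by (rule sum.reindex_bij_witness[of _ "\<lambda>s. int j + int k - s" "\<lambda>l. int j + int k - l"])
        (use 3 in \<open>auto intro!: arg_cong[of _ _ w]\<close>)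
    also have "\<dots> = 0" by (rule base_sum_pos[OF w 3 ij(2)])
    finally show ?thesis using 3 by auto
  qed
qed

lemma inner_neg:
  assumes w: "antisym N w" and ij: "i < N" "j < N"
  shows "(\<Sum>l\<in>{1..int k}. w ((int(i := int i - l))(j := (int(i := int i - l)) j + (l - int k)))) =
    (if i = j then of_nat k * w (int(i := int i - int k)) else if i < j then w (int(i := int i - int k)) - w (int(j := int j - int k)) else 0)"
proof -
  consider "i = j" | "i < j" | "j < i" by linarith
  then show ?thesis
  proof cases
    case 1 then show ?thesis by simp
  next
    case 2
    let ?u = "\<lambda>s. w (int (i := s, j := int i + int j - int k - s))"
    have "(\<Sum>l\<in>{1..int k}. w ((int(i := int i - l))(j := (int(i := int i - l)) j + (l - int k)))) = (\<Sum>s\<in>{int i - int k..int i - 1}. ?u s)"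
      by (rule sum.reindex_bij_witness[of _ "\<lambda>s. int i - s" "\<lambda>l. int i - l"]) (use 2 in \<open>auto simp: algebra_simps\<close>)
    also have "\<dots> = (\<Sum>s\<in>{int i - int k + 1..int i}. ?u s) + ?u (int i - int k) - ?u (int i)"
    proof -
      have "(\<Sum>s\<in>{int i - int k..int i}. ?u s) = ?u (int i) + (\<Sum>s\<in>{int i - int k..int i - 1}. ?u s)"
        by (subst sum.remove[of _ "int i"]) (auto intro!: sum.cong)
      moreover have "(\<Sum>s\<in>{int i - int k..int i}. ?u s) = ?u (int i - int k) + (\<Sum>s\<in>{int i - int k + 1..int i}. ?u s)"
        by (subst sum.remove[of _ "int i - int k"]) (auto intro!: sum.cong)
      ultimately show ?thesis by (simp add: algebra_simps)
    qed
    also have "(\<Sum>s\<in>{int i - int k + 1..int i}. ?u s) = 0" by (rule base_sum_neg[OF w 2 ij(2)])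
    finally have "(\<Sum>l\<in>{1..int k}. w ((int(i := int i - l))(j := (int(i := int i - l)) j + (l - int k)))) = ?u (int i - int k) - ?u (int i)"
      by (simp only: add_0)
    moreover have "int (i := int i - int k, j := int i + int j - int k - (int i - int k)) = int (i := int i - int k)"
      "int (i := int i, j := int i + int j - int k - int i) = int (j := int j - int k)"
      using 2 by (auto simp: fun_eq_iff)
    ultimately show ?thesis using 2 by simp
  next
    case 3
    let ?u = "\<lambda>s. w (int (j := s, i := int j + int i - int k - s))"
    have "(\<Sum>l\<in>{1..int k}. w ((int(i := int i - l))(j := (int(i := int i - l)) j + (l - int k)))) = (\<Sum>s\<in>{int j - int k + 1..int j}. ?u s)"
      by (rule sum.reindex_bij_witness[of _ "\<lambda>s. s - int j + int k" "\<lambda>l. int j - int k + l"])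
        (use 3 in \<open>auto intro!: arg_cong[of _ _ w]\<close>)
    also have "\<dots> = 0" by (rule base_sum_neg[OF w 3 ij(1)])
    finally show ?thesis using 3 by auto
  qed
qed

lemma sum_list_upt_int: "(\<Sum>l\<leftarrow>[1..<Suc n]. f (int l)) = (\<Sum>l\<in>{1..int n}. f l)" for f :: "int \<Rightarrow> complex"
proof -
  have "(\<Sum>l\<leftarrow>[1..<Suc n]. f (int l)) = (\<Sum>l\<in>{1..<Suc n}. f (int l))"
    by (simp add: interv_sum_list_conv_sum_set_nat del: upt_Suc)
  also have "\<dots> = (\<Sum>l\<in>{1..int n}. f l)"
    by (rule sum.reindex_bij_witness[of _ nat int]) auto
  finally show ?thesis .
qed

lemma lap_commutator_int: "lap_commutator N f w int = S N f (\<lambda>\<nu>. of_int (lap_symbol N \<nu>) * w \<nu>) int"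
  by (simp add: lap_commutator_def lap_symbol_def)

text \<open>Each product p_l p_(k-l) moves the exponents at i and j. Antisymmetry cancels all terms
  that move two different exponents, apart from end points, and single shifts by k remain. Their
  total weights are those of \<open>lap_commutator_Pw\<close> at the vacuum.\<close>

lemma S_laplacian_Pw:
  assumes w: "antisym N w"
  shows "S N (laplacian (Pw k)) w int = S N (Pw k) (\<lambda>\<nu>. of_int (lap_symbol N \<nu>) * w \<nu>) int"
proof -
  define n where "n = nat \<bar>k\<bar>"
  have L: "S N (laplacian (Pw k)) w int = of_nat n * (\<Sum>l\<in>{1..int n}. S N (Mul (Pw (sgn k * l)) (Pw (k - sgn k * l))) w int)"
    using sum_list_upt_int[of "\<lambda>l. S N (Mul (Pw (sgn k * l)) (Pw (k - sgn k * l))) w int" n]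
    by (simp add: S_expr_sum o_def n_def del: upt_Suc)
  have R: "S N (Pw k) (\<lambda>\<nu>. of_int (lap_symbol N \<nu>) * w \<nu>) int = (\<Sum>i<N. of_int (2 * k * int i + k\<^sup>2 - (int N - 1) * k) * w (int(i := int i + k)))"
    using lap_commutator_Pw[of N k w int] lap_commutator_int[of N "Pw k" w] by metis
  consider "k = 0" | "k > 0" | "k < 0" by linarith
  then show ?thesis
  proof cases
    case 1 then show ?thesis unfolding L R by (simp add: n_def)
  next
    case 2
    have k: "k = int n" "sgn k = 1" using 2 by (auto simp: n_def)
    have "(\<Sum>l\<in>{1..int n}. S N (Mul (Pw (sgn k * l)) (Pw (k - sgn k * l))) w int) =
      (\<Sum>l\<in>{1..int n}. \<Sum>i<N. \<Sum>j<N. w ((int(i := int i + l))(j := (int(i := int i + l)) j + (int n - l))))"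
      unfolding S.simps k(2) mult_1 k(1)[symmetric] ..
    also have "\<dots> = (\<Sum>i<N. \<Sum>j<N. \<Sum>l\<in>{1..int n}. w ((int(i := int i + l))(j := (int(i := int i + l)) j + (int n - l))))"
      by (subst sum.swap, rule sum.cong[OF refl], rule sum.swap)
    also have "\<dots> = (\<Sum>i<N. \<Sum>j<N. (if i = j then of_nat n * w (int(i := int i + int n)) else if j < i then w (int(i := int i + int n)) - w (int(j := int j + int n)) else 0))"
      by (intro sum.cong refl inner_pos[OF w]) auto
    also have "\<dots> = (\<Sum>i<N. (of_nat n + of_int (2 * int i - (int N - 1))) * w (int(i := int i + int n)))"
      by (rule dsum_pos)
    finally have A: "(\<Sum>l\<in>{1..int n}. S N (Mul (Pw (sgn k * l)) (Pw (k - sgn k * l))) w int) = \<dots>" .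
    show ?thesis unfolding L A R sum_distrib_left
      by (intro sum.cong refl) (simp add: k(1) algebra_simps power2_eq_square del: fun_upd_apply)
  next
    case 3
    have k: "k = - int n" "sgn k = -1" using 3 by (auto simp: n_def)
    have "(\<Sum>l\<in>{1..int n}. S N (Mul (Pw (sgn k * l)) (Pw (k - sgn k * l))) w int) =
      (\<Sum>l\<in>{1..int n}. \<Sum>i<N. \<Sum>j<N. w ((int(i := int i - l))(j := (int(i := int i - l)) j + (l - int n))))"
      unfolding S.simps k(2) k(1) by (intro sum.cong refl arg_cong[of _ _ w]) (auto simp: fun_eq_iff)
    also have "\<dots> = (\<Sum>i<N. \<Sum>j<N. \<Sum>l\<in>{1..int n}. w ((int(i := int i - l))(j := (int(i := int i - l)) j + (l - int n))))"
      by (subst sum.swap, rule sum.cong[OF refl], rule sum.swap)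
    also have "\<dots> = (\<Sum>i<N. \<Sum>j<N. (if i = j then of_nat n * w (int(i := int i - int n)) else if i < j then w (int(i := int i - int n)) - w (int(j := int j - int n)) else 0))"
      by (intro sum.cong refl inner_neg[OF w]) auto
    also have "\<dots> = (\<Sum>i<N. (of_nat n - of_int (2 * int i - (int N - 1))) * w (int(i := int i - int n)))"
      by (rule dsum_neg)
    finally have A: "(\<Sum>l\<in>{1..int n}. S N (Mul (Pw (sgn k * l)) (Pw (k - sgn k * l))) w int) = \<dots>" .
    show ?thesis unfolding L A R sum_distrib_left
      by (intro sum.cong refl) (simp add: k(1) algebra_simps power2_eq_square del: fun_upd_apply)
  qed
qed

text \<open>Both sides follow the same product rule. Moving the diagonal operator past b creates the
  commutator of b, moving that past a creates twice the carre du champ, and at the vacuum, where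
  \<open>lap_symbol\<close> is 0, the remaining commutator is again the diagonal operator inside
  \<open>S N b\<close>, hence the Laplacian of b by induction.\<close>

theorem S_laplacian:
  "exp_free f \<Longrightarrow> antisym N w \<Longrightarrow> S N (laplacian f) w int = S N f (\<lambda>\<nu>. of_int (lap_symbol N \<nu>) * w \<nu>) int"
proof (induction f arbitrary: w)
  case (Cst c) then show ?case by (simp add: lap_symbol_def)
next
  case (Pw k) then show ?case by (intro S_laplacian_Pw)
next
  case (Add a b) then show ?case by simp
next
  case (Mul a b)
  let ?D = "\<lambda>w \<nu>. of_int (lap_symbol N \<nu>) * w \<nu> :: complex"
  have p: "exp_free a" "exp_free b" using Mul.prems by auto
  have A: "antisym N (S N b w)" "antisym N (S N a w)" using antisym_S[OF Mul.prems(2)] by auto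
  have "S N b (?D w) = (\<lambda>\<nu>. ?D (S N b w) \<nu> + lap_commutator N b w \<nu>)" by (auto simp: lap_commutator_def)
  then have "S N (Mul a b) (?D w) int = S N a (?D (S N b w)) int + S N a (lap_commutator N b w) int"
    by (simp add: S_add)
  also have "S N a (?D (S N b w)) int = S N (laplacian a) (S N b w) int"
    using Mul.IH(1)[OF p(1) A(1)] by simp
  also have "S N a (lap_commutator N b w) int = lap_commutator N b (S N a w) int + 2 * S N (carre_du_champ a b) w int"
    by (rule lap_commutator_double[OF p])
  also have "lap_commutator N b (S N a w) int = S N (laplacian b) (S N a w) int"
    using Mul.IH(2)[OF p(2) A(2)] by (simp add: lap_commutator_int)
  finally show ?case by simp
qed auto

section \<open>Alternants and the vacuum matrix element\<close>

definition alternant :: "nat \<Rightarrow> (nat \<Rightarrow> int \<Rightarrow> complex) \<Rightarrow> (nat \<Rightarrow> int) \<Rightarrow> complex" where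
  "alternant N \<phi> \<mu> = (\<Sum>\<sigma> | \<sigma> permutes {..<N}. of_int (sign \<sigma>) * (\<Prod>i<N. \<phi> i (\<mu> (\<sigma> i))))"

lemma antisym_alternant: "antisym N (alternant N \<phi>)"
  unfolding antisym_def
proof (intro allI impI)
  fix \<pi> :: "nat \<Rightarrow> nat" and \<mu> :: "nat \<Rightarrow> int" assume pi: "\<pi> permutes {..<N}"
  have perm: "permutation \<sigma>" if "\<sigma> permutes {..<N}" for \<sigma>
    using that by (auto simp: permutation_permutes)
  have "alternant N \<phi> \<mu> = (\<Sum>\<sigma> | \<sigma> permutes {..<N}. of_int (sign (\<pi> \<circ> \<sigma>)) * (\<Prod>i<N. \<phi> i (\<mu> ((\<pi> \<circ> \<sigma>) i))))"
    unfolding alternant_def by (rule setum_permutations_compose_left[OF pi])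
  also have "\<dots> = (\<Sum>\<sigma> | \<sigma> permutes {..<N}. of_int (sign \<pi>) * (of_int (sign \<sigma>) * (\<Prod>i<N. \<phi> i ((\<mu> \<circ> \<pi>) (\<sigma> i)))))"
    by (intro sum.cong refl) (simp add: sign_compose perm pi)
  also have "\<dots> = of_int (sign \<pi>) * alternant N \<phi> (\<mu> \<circ> \<pi>)"
    by (simp add: alternant_def sum_distrib_left)
  finally have X: "alternant N \<phi> \<mu> = of_int (sign \<pi>) * alternant N \<phi> (\<mu> \<circ> \<pi>)" .
  have "of_int (sign \<pi>) * of_int (sign \<pi>) = (1 :: complex)"
    by (simp flip: of_int_mult add: sign_idempotent)
  then show "alternant N \<phi> (\<mu> \<circ> \<pi>) = of_int (sign \<pi>) * alternant N \<phi> \<mu>"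
    by (simp only: X mult.assoc[symmetric] mult_1)
qed

lemma S_Pw_alternant: "S N (Pw k) (alternant N \<phi>) \<mu> = (\<Sum>j<N. alternant N (\<phi>(j := \<lambda>m. \<phi> j (m + k))) \<mu>)"
proof -
  have *: "(\<Sum>l<N. \<Prod>i<N. \<phi> i ((\<mu>(l := \<mu> l + k)) (\<sigma> i))) = (\<Sum>j<N. \<Prod>i<N. (\<phi>(j := \<lambda>m. \<phi> j (m + k))) i (\<mu> (\<sigma> i)))"
    if s: "\<sigma> permutes {..<N}" for \<sigma>
  proof -
    have "(\<Sum>l<N. \<Prod>i<N. \<phi> i ((\<mu>(l := \<mu> l + k)) (\<sigma> i))) = (\<Sum>j<N. \<Prod>i<N. \<phi> i ((\<mu>(\<sigma> j := \<mu> (\<sigma> j) + k)) (\<sigma> i)))"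
      by (rule sum.reindex_bij_betw[OF permutes_imp_bij[OF s], symmetric])
    also have "\<dots> = (\<Sum>j<N. \<Prod>i<N. (\<phi>(j := \<lambda>m. \<phi> j (m + k))) i (\<mu> (\<sigma> i)))"
      by (intro sum.cong prod.cong refl) (use permutes_inj[OF s] in \<open>auto simp: inj_eq\<close>)
    finally show ?thesis .
  qed
  have "S N (Pw k) (alternant N \<phi>) \<mu> = (\<Sum>\<sigma> | \<sigma> permutes {..<N}. of_int (sign \<sigma>) * (\<Sum>l<N. \<Prod>i<N. \<phi> i ((\<mu>(l := \<mu> l + k)) (\<sigma> i))))"
    unfolding S.simps alternant_def sum_distrib_left by (rule sum.swap)
  also have "\<dots> = (\<Sum>\<sigma> | \<sigma> permutes {..<N}. of_int (sign \<sigma>) * (\<Sum>j<N. \<Prod>i<N. (\<phi>(j := \<lambda>m. \<phi> j (m + k))) i (\<mu> (\<sigma> i))))"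
    by (rule sum.cong[OF refl]) (simp only: mem_Collect_eq *)
  also have "\<dots> = (\<Sum>j<N. alternant N (\<phi>(j := \<lambda>m. \<phi> j (m + k))) \<mu>)"
    unfolding alternant_def sum_distrib_left by (rule sum.swap)
  finally show ?thesis .
qed

definition power_sums :: "nat \<Rightarrow> (nat \<Rightarrow> real) \<Rightarrow> int \<Rightarrow> complex" where
  "power_sums N \<theta> k = (\<Sum>i<N. cis (of_int k * \<theta> i))"

text \<open>The determinant with entries e^(i \<mu>_j \<theta>_i), the numerator in Weyl's character
  formula; at \<open>int\<close> it is the Vandermonde determinant of the eigenvalues.\<close>

definition alt :: "nat \<Rightarrow> (nat \<Rightarrow> real) \<Rightarrow> (nat \<Rightarrow> int) \<Rightarrow> complex" where
  "alt N \<theta> = alternant N (\<lambda>i m. cis (of_int m * \<theta> i))"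

text \<open>An antisymmetrised Kronecker delta: for distinct exponents it is the sign of the
  permutation that matches \<mu> with \<nu>, or 0 if there is none, i.e. the inner product of two
  Slater determinants.\<close>

definition antisym_delta :: "nat \<Rightarrow> (nat \<Rightarrow> int) \<Rightarrow> (nat \<Rightarrow> int) \<Rightarrow> complex" where
  "antisym_delta N \<nu> = alternant N (\<lambda>i m. of_bool (m = \<nu> i))"

lemma antisym_alt: "antisym N (alt N \<theta>)" and antisym_antisym_delta: "antisym N (antisym_delta N \<nu>)"
  by (auto simp: alt_def antisym_delta_def antisym_alternant)

text \<open>Shifting the exponent of one eigenvalue by k multiplies the corresponding term by the
  k-th power of that eigenvalue. Hence \<open>alt\<close> is a joint eigenvector whose eigenvalues
  are the actual power sums; here pointwise values enter the algebra.\<close>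

lemma S_alt: "exp_free f \<Longrightarrow> S N f (alt N \<theta>) \<mu> = ev (power_sums N \<theta>) f * alt N \<theta> \<mu>"
proof (induction f arbitrary: \<mu>)
  case (Pw k)
  have "alternant N ((\<lambda>i m. cis (of_int m * \<theta> i))(j := \<lambda>m. cis (of_int (m + k) * \<theta> j))) \<mu> = cis (of_int k * \<theta> j) * alt N \<theta> \<mu>" if "j < N" for j
  proof -
    have "(\<Prod>i<N. ((\<lambda>i m. cis (of_int m * \<theta> i))(j := \<lambda>m. cis (of_int (m + k) * \<theta> j))) i (\<mu> (\<sigma> i))) =
       cis (of_int k * \<theta> j) * (\<Prod>i<N. cis (of_int (\<mu> (\<sigma> i)) * \<theta> i))" for \<sigma>
    proof -
      have "(\<Prod>i<N. ((\<lambda>i m. cis (of_int m * \<theta> i))(j := \<lambda>m. cis (of_int (m + k) * \<theta> j))) i (\<mu> (\<sigma> i))) =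
        (\<Prod>i<N. (if i = j then cis (of_int k * \<theta> j) else 1) * cis (of_int (\<mu> (\<sigma> i)) * \<theta> i))"
        by (intro prod.cong refl) (auto simp: cis_mult algebra_simps)
      then show ?thesis using that by (simp add: prod.distrib)
    qed
    then show ?thesis by (simp add: alternant_def alt_def sum_distrib_left algebra_simps)
  qed
  then have "S N (Pw k) (alt N \<theta>) \<mu> = (\<Sum>j<N. cis (of_int k * \<theta> j) * alt N \<theta> \<mu>)"
    unfolding alt_def S_Pw_alternant by (intro sum.cong refl) (auto simp: alt_def)
  then show ?case by (simp add: power_sums_def sum_distrib_right)
next
  case (Mul f g)
  have "S N g (alt N \<theta>) = (\<lambda>\<mu>. ev (power_sums N \<theta>) g * alt N \<theta> \<mu>)"
    using Mul by auto
  then show ?case using Mul by (simp add: S_scale)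
qed (auto simp: algebra_simps)

lemma S_Pw_antisym_delta: "S N (Pw k) (antisym_delta N \<nu>) \<mu> = (\<Sum>j<N. antisym_delta N (\<nu>(j := \<nu> j - k)) \<mu>)"
proof -
  have "((\<lambda>i m. of_bool (m = \<nu> i) :: complex)(j := \<lambda>m. of_bool (m + k = \<nu> j))) = (\<lambda>i m. of_bool (m = (\<nu>(j := \<nu> j - k)) i))" for j
    by (auto simp: fun_eq_iff)
  then show ?thesis unfolding antisym_delta_def S_Pw_alternant by simp
qed

lemma lap_symbol_comp: "\<pi> permutes {..<N} \<Longrightarrow> lap_symbol N (\<mu> \<circ> \<pi>) = lap_symbol N \<mu>"
proof -
  assume pi: "\<pi> permutes {..<N}"
  have "(\<Sum>i<N. (\<lambda>i. \<mu> i * (\<mu> i - (int N - 1))) (\<pi> i)) = (\<Sum>i<N. \<mu> i * (\<mu> i - (int N - 1)))"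
    by (rule sum.reindex_bij_betw[OF permutes_imp_bij[OF pi]])
  then show ?thesis by (simp add: lap_symbol_def sum_subtractf)
qed

text \<open>The parabola x (x - (N - 1)) is nonpositive on 0, ..., N-1 and positive at all other
  integers when N > 0, so replacing any of these levels by another integer strictly increases the
  sum.\<close>

lemma lap_symbol_zero_imp:
  assumes inj: "inj_on \<mu> {..<N}" and lap_symbol: "lap_symbol N \<mu> = 0"
  shows "\<mu> ` {..<N} = int ` {..<N}"
proof -
  define q where "q = (\<lambda>x::int. x * (x - (int N - 1)))"
  define X where "X = \<mu> ` {..<N}" define I where "I = int ` {..<N}"
  have fin: "finite X" "finite I" by (auto simp: X_def I_def)
  have "sum q X = (\<Sum>i<N. q (\<mu> i))" "sum q I = (\<Sum>i<N. q (int i))"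
    unfolding X_def I_def using inj by (auto simp: sum.reindex)
  then have eq: "sum q X = sum q I" using lap_symbol by (simp add: lap_symbol_def q_def sum_subtractf)
  have "sum q X = sum q (X - I) + sum q (X \<inter> I)" "sum q I = sum q (I - X) + sum q (X \<inter> I)"
    using fin by (metis sum.Int_Diff add.commute) (metis fin(2) sum.Int_Diff add.commute Int_commute)
  with eq have e: "sum q (X - I) = sum q (I - X)" by simp
  have neg: "sum q (I - X) \<le> 0"
    by (intro sum_nonpos) (auto simp: I_def q_def mult_nonneg_nonpos)
  have pos: "q x > 0" if "N > 0" "x \<notin> I" for x
  proof -
    have "x < 0 \<or> x \<ge> int N" using that(2) unfolding I_def by (metis imageI lessThan_iff linorder_not_less nat_less_iff nat_0_le)
    then show ?thesis
    proof
      assume "x < 0" then show ?thesis unfolding q_def using that(1) by (intro mult_neg_neg) auto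
    next
      assume "x \<ge> int N" then show ?thesis unfolding q_def
        using that(1) by (auto simp: zero_less_mult_iff)
    qed
  qed
  have "X - I = {}"
  proof (rule ccontr)
    assume "X - I \<noteq> {}"
    moreover from this have "N > 0" by (auto simp: X_def)
    ultimately have "sum q (X - I) > 0" using pos fin by (intro sum_pos) auto
    then show False using e neg by simp
  qed
  then have "X \<subseteq> I" by auto
  moreover have "card X = card I" unfolding X_def I_def using inj by (simp add: card_image)
  ultimately show ?thesis using card_subset_eq[OF fin(2)] X_def I_def by auto
qed

lemma perm_of_image:
  assumes im: "\<mu> ` {..<N} = int ` {..<N}" and out: "\<And>i. i \<ge> N \<Longrightarrow> \<mu> i = int i"
  shows "\<exists>\<pi>. \<pi> permutes {..<N} \<and> \<mu> = int \<circ> \<pi>"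
proof -
  have "inj_on \<mu> {..<N}" by (rule eq_card_imp_inj_on) (use im in \<open>auto simp: card_image\<close>)
  define \<pi> where "\<pi> = nat \<circ> \<mu>"
  have nn: "\<mu> i = int (\<pi> i)" for i
  proof (cases "i < N")
    case True then have "\<mu> i \<in> int ` {..<N}" using im by auto
    then show ?thesis by (auto simp: \<pi>_def)
  qed (auto simp: \<pi>_def out)
  have "bij_betw \<pi> {..<N} {..<N}"
    unfolding bij_betw_def
  proof
    show "inj_on \<pi> {..<N}" using \<open>inj_on \<mu> {..<N}\<close> by (auto simp: inj_on_def nn)
    have "int ` (\<pi> ` {..<N}) = int ` {..<N}" unfolding im[symmetric] image_image by (intro image_cong refl) (auto simp: nn)
    then show "\<pi> ` {..<N} = {..<N}" by (simp add: inj_image_eq_iff)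
  qed
  then have "\<pi> permutes {..<N}" by (rule bij_imp_permutes) (auto simp: \<pi>_def out)
  moreover have "\<mu> = int \<circ> \<pi>" using nn by auto
  ultimately show ?thesis by blast
qed

lemma antisym_delta_nonzero_image:
  assumes "antisym_delta N \<nu> \<mu> \<noteq> 0"
  shows "\<mu> ` {..<N} = \<nu> ` {..<N}"
proof -
  from assms obtain \<sigma> where s: "\<sigma> permutes {..<N}" and "(\<Prod>i<N. of_bool (\<mu> (\<sigma> i) = \<nu> i)) \<noteq> (0::complex)"
    unfolding antisym_delta_def alternant_def by (metis (mono_tags, lifting) mem_Collect_eq mult_zero_right sum.neutral)
  then have "\<mu> (\<sigma> i) = \<nu> i" if "i < N" for i using that by auto
  then have "\<nu> ` {..<N} = \<mu> ` (\<sigma> ` {..<N})" unfolding image_image by (intro image_cong) auto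
  then show ?thesis using permutes_image[OF s] by simp
qed

lemma antisym_delta_self: "inj_on \<nu> {..<N} \<Longrightarrow> antisym_delta N \<nu> \<nu> = 1"
proof -
  assume inj: "inj_on \<nu> {..<N}"
  have z: "(\<Prod>i<N. of_bool (\<nu> (\<sigma> i) = \<nu> i)) = (of_bool (\<sigma> = id) :: complex)" if s: "\<sigma> permutes {..<N}" for \<sigma>
  proof (cases "\<sigma> = id")
    case False
    then obtain i where "\<sigma> i \<noteq> i" by (auto simp: fun_eq_iff)
    then have "i < N" "\<sigma> i < N" using s permutes_not_in[OF s, of i] permutes_in_image[OF s, of i] by auto
    then have "\<nu> (\<sigma> i) \<noteq> \<nu> i" using inj \<open>\<sigma> i \<noteq> i\<close> by (auto simp: inj_on_def)
    then show ?thesis using \<open>i < N\<close> False by (auto simp: prod_zero_iff)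
  qed simp
  have "antisym_delta N \<nu> \<nu> = (\<Sum>\<sigma> | \<sigma> permutes {..<N}. if \<sigma> = id then 1 else 0)"
    unfolding antisym_delta_def alternant_def by (intro sum.cong refl) (auto simp: z sign_id)
  also have "\<dots> = 1" by (subst sum.delta) (auto simp: finite_permutations permutes_id)
  finally show ?thesis .
qed

text \<open>\<open>S N f w \<mu>\<close> inspects finitely many values of w. Finiteness provides a
  finite list of eigenvalues to annihilate, and the agreement of all coordinates from N on lets
  \<open>perm_of_image\<close> apply.\<close>

lemma S_reach:
  "\<exists>F. finite F \<and> (\<forall>\<nu>\<in>F. \<forall>i\<ge>N. \<nu> i = \<mu> i) \<and> (\<forall>w w'. (\<forall>\<nu>\<in>F. w \<nu> = w' \<nu>) \<longrightarrow> S N f w \<mu> = S N f w' \<mu>)"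
proof (induction f arbitrary: \<mu>)
  case (Cst c) show ?case by (rule exI[of _ "{\<mu>}"]) auto
next
  case (Pw k) show ?case
    by (rule exI[of _ "(\<lambda>i. \<mu>(i := \<mu> i + k)) ` {..<N}"]) (auto simp del: fun_upd_apply intro!: sum.cong, auto)
next
  case (Add f g)
  from Add.IH(1)[of \<mu>] obtain F where F: "finite F" "\<forall>\<nu>\<in>F. \<forall>i\<ge>N. \<nu> i = \<mu> i"
    "\<forall>w w'. (\<forall>\<nu>\<in>F. w \<nu> = w' \<nu>) \<longrightarrow> S N f w \<mu> = S N f w' \<mu>" by (elim exE conjE)
  from Add.IH(2)[of \<mu>] obtain G where G: "finite G" "\<forall>\<nu>\<in>G. \<forall>i\<ge>N. \<nu> i = \<mu> i"
    "\<forall>w w'. (\<forall>\<nu>\<in>G. w \<nu> = w' \<nu>) \<longrightarrow> S N g w \<mu> = S N g w' \<mu>" by (elim exE conjE)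
  show ?case
  proof (intro exI[of _ "F \<union> G"] conjI allI impI)
    show "finite (F \<union> G)" using F(1) G(1) by blast
    show "\<forall>\<nu>\<in>F \<union> G. \<forall>i\<ge>N. \<nu> i = \<mu> i" using F(2) G(2) by blast
    fix w w' :: "(nat \<Rightarrow> int) \<Rightarrow> complex" assume a: "\<forall>\<nu>\<in>F \<union> G. w \<nu> = w' \<nu>"
    have "S N f w \<mu> = S N f w' \<mu>" by (rule F(3)[rule_format]) (use a in blast)
    moreover have "S N g w \<mu> = S N g w' \<mu>" by (rule G(3)[rule_format]) (use a in blast)
    ultimately show "S N (Add f g) w \<mu> = S N (Add f g) w' \<mu>" by simp
  qed
next
  case (Mul f g)
  from Mul.IH(1)[of \<mu>] obtain F where F: "finite F" "\<forall>\<nu>\<in>F. \<forall>i\<ge>N. \<nu> i = \<mu> i"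
    "\<forall>w w'. (\<forall>\<nu>\<in>F. w \<nu> = w' \<nu>) \<longrightarrow> S N f w \<mu> = S N f w' \<mu>" by (elim exE conjE)
  have "\<forall>\<mu>. \<exists>F. finite F \<and> (\<forall>\<nu>\<in>F. \<forall>i\<ge>N. \<nu> i = \<mu> i) \<and>
    (\<forall>w w'. (\<forall>\<nu>\<in>F. w \<nu> = w' \<nu>) \<longrightarrow> S N g w \<mu> = S N g w' \<mu>)" using Mul.IH(2) by (rule allI)
  from choice[OF this] obtain G where G: "\<forall>\<mu>. finite (G \<mu>) \<and> (\<forall>\<nu>\<in>G \<mu>. \<forall>i\<ge>N. \<nu> i = \<mu> i) \<and>
    (\<forall>w w'. (\<forall>\<nu>\<in>G \<mu>. w \<nu> = w' \<nu>) \<longrightarrow> S N g w \<mu> = S N g w' \<mu>)" by (elim exE)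
  show ?case
  proof (intro exI[of _ "\<Union> (G ` F)"] conjI allI impI)
    show "finite (\<Union> (G ` F))" using F(1) G by blast
    show "\<forall>\<nu>\<in>\<Union> (G ` F). \<forall>i\<ge>N. \<nu> i = \<mu> i"
    proof (intro ballI allI impI)
      fix \<nu> i assume "\<nu> \<in> \<Union> (G ` F)" "N \<le> i"
      then obtain \<rho> where "\<rho> \<in> F" "\<nu> \<in> G \<rho>" by blast
      then have "\<nu> i = \<rho> i" "\<rho> i = \<mu> i" using G F(2) \<open>N \<le> i\<close> by blast+
      then show "\<nu> i = \<mu> i" by simp
    qed
    fix w w' :: "(nat \<Rightarrow> int) \<Rightarrow> complex" assume a: "\<forall>\<nu>\<in>\<Union> (G ` F). w \<nu> = w' \<nu>"
    have a2: "\<forall>\<rho>\<in>F. S N g w \<rho> = S N g w' \<rho>"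
    proof
      fix \<rho> assume "\<rho> \<in> F"
      then have "\<forall>\<nu>\<in>G \<rho>. w \<nu> = w' \<nu>" using a by blast
      then show "S N g w \<rho> = S N g w' \<rho>" using G by blast
    qed
    show "S N (Mul f g) w \<mu> = S N (Mul f g) w' \<mu>"
      unfolding S.simps by (rule F(3)[rule_format]) (use a2 in blast)
  qed
next
  case (Ex f) show ?case by (rule exI[of _ "{\<mu>}"]) auto
qed

text \<open>The product of the operators \<open>laplacian - c\<close>. With \<open>c\<close> ranging over the nonzero eigenvalues that \<open>f\<close> can reach,
it leaves only the vacuum component of \<open>f\<close>, while the functional \<open>L\<close> below sees only the factors \<open>- c\<close>.\<close>

primrec annihilate :: "complex list \<Rightarrow> trace_expr \<Rightarrow> trace_expr" where
  "annihilate [] f = f"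
| "annihilate (c # cs) f = annihilate cs (Add (laplacian f) (Mul (Cst (- c)) f))"

lemma exp_free_annihilate [simp]: "exp_free f \<Longrightarrow> exp_free (annihilate cs f)"
  by (induction cs arbitrary: f) auto

text \<open>The factors can be absorbed into w one at a time: \<open>lap_symbol\<close> is invariant
  under permutations, so the weighted family is still antisymmetric and \<open>S_laplacian\<close>
  applies to it.\<close>

lemma S_annihilate:
  assumes "exp_free f" "antisym N w"
  shows "S N (annihilate cs f) w int = S N f (\<lambda>\<nu>. (\<Prod>c\<leftarrow>cs. of_int (lap_symbol N \<nu>) - c) * w \<nu>) int"
  using assms
proof (induction cs arbitrary: f)
  case (Cons c cs)
  let ?w = "\<lambda>\<nu>. (\<Prod>c\<leftarrow>cs. of_int (lap_symbol N \<nu>) - c) * w \<nu>"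
  have A: "antisym N ?w" using Cons.prems(2) by (auto simp: antisym_def lap_symbol_comp)
  have "S N (annihilate (c # cs) f) w int = S N (Add (laplacian f) (Mul (Cst (- c)) f)) ?w int"
    unfolding annihilate.simps by (rule Cons.IH) (use Cons.prems in auto)
  also have "\<dots> = S N f (\<lambda>\<nu>. of_int (lap_symbol N \<nu>) * ?w \<nu>) int - S N f (\<lambda>\<nu>. c * ?w \<nu>) int"
    using S_laplacian[OF Cons.prems(1) A] by (simp add: S_scale)
  also have "\<dots> = S N f (\<lambda>\<nu>. of_int (lap_symbol N \<nu>) * ?w \<nu> - c * ?w \<nu>) int"
    by (simp add: S_diff)
  also have "(\<lambda>\<nu>. of_int (lap_symbol N \<nu>) * ?w \<nu> - c * ?w \<nu>) = (\<lambda>\<nu>. (\<Prod>c\<leftarrow>c # cs. of_int (lap_symbol N \<nu>) - c) * w \<nu>)"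
    by (auto simp: algebra_simps)
  finally show ?case .
qed simp

text \<open>A kernel vector of the Vandermonde matrix would be the coefficient list of a nonzero
  polynomial of degree below N with N distinct roots.\<close>

lemma alt_int_nonzero:
  assumes dist: "inj_on (\<lambda>i. cis (\<theta> i)) {..<N}"
  shows "alt N \<theta> int \<noteq> 0"
proof
  assume 0: "alt N \<theta> int = 0"
  define A where "A = mat N N (\<lambda>(i, j). cis (\<theta> i) ^ j)"
  have A: "A \<in> carrier_mat N N" by (simp add: A_def)
  have "Determinant.det A = (\<Sum>p | p permutes {0..<N}. of_int (sign p) * (\<Prod>i = 0..<N. A $$ (i, p i)))"
    by (rule Determinant.det_def'[OF A])
  also have "\<dots> = alt N \<theta> int"
    unfolding alt_def alternant_def lessThan_atLeast0[symmetric]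
  proof (intro sum.cong refl arg_cong2[of _ _ _ _ "(*)"] prod.cong)
    fix p i assume "p \<in> {p. p permutes {..<N}}" "i \<in> {..<N}"
    then have "p i < N" "i < N" using permutes_in_image[of p "{..<N}" i] by auto
    then show "A $$ (i, p i) = cis (of_int (int (p i)) * \<theta> i)" by (simp add: A_def) (rule Complex.DeMoivre)
  qed
  finally have "Determinant.det A = 0" using 0 by simp
  then obtain v where v: "v \<in> carrier_vec N" "v \<noteq> 0\<^sub>v N" "A *\<^sub>v v = 0\<^sub>v N"
    using det_0_iff_vec_prod_zero_field[OF A] by auto
  define q where "q = (\<Sum>j<N. monom (v $ j) j)"
  have ev: "poly q (cis (\<theta> i)) = 0" if "i < N" for i
  proof -
    have "(A *\<^sub>v v) $ i = (\<Sum>j<N. cis (\<theta> i) ^ j * v $ j)"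
      using that v(1) A by (simp add: scalar_prod_def A_def lessThan_atLeast0)
    also have "\<dots> = poly q (cis (\<theta> i))" by (simp add: q_def poly_sum poly_monom mult.commute)
    finally show ?thesis using v(3) that by simp
  qed
  have coeff: "coeff q j = v $ j" if "j < N" for j
    using that by (simp add: q_def coeff_sum coeff_monom)
  have "\<exists>j<N. v $ j \<noteq> 0" using v(1,2) by (metis carrier_vecD eq_vecI index_zero_vec(1) index_zero_vec(2))
  then have q0: "q \<noteq> 0" using coeff by (metis coeff_0)
  then have N: "N > 0" by (auto simp: q_def intro: ccontr)
  have "degree q \<le> N - 1" unfolding q_def
    by (intro degree_sum_le) (auto intro: order_trans[OF degree_monom_le])
  moreover have "card ((\<lambda>i. cis (\<theta> i)) ` {..<N}) \<le> card {x. poly q x = 0}"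
    by (rule card_mono) (use ev q0 poly_roots_finite in auto)
  ultimately have "N \<le> N - 1" using card_poly_roots_bound[OF q0] dist by (simp add: card_image)
  then show False using N by simp
qed

lemma tendsto_ev_power_sums:
  assumes "\<And>i. i < N \<Longrightarrow> ((\<lambda>s. \<theta> s i) \<longlongrightarrow> \<theta>0 i) F"
  shows "((\<lambda>s. ev (power_sums N (\<theta> s)) f) \<longlongrightarrow> ev (power_sums N \<theta>0) f) F"
proof (induction f)
  case (Pw k)
  show ?case unfolding ev.simps power_sums_def
    by (intro tendsto_sum) (use assms in \<open>auto intro!: tendsto_intros simp: cis_conv_exp\<close>)
qed (auto intro!: tendsto_intros)

text \<open>Displacing the angle with index i by s i separates coinciding eigenvalues for all small
  s > 0. Identities proved where the Vandermonde determinant is nonzero thus extend to all angles by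
  continuity.\<close>

lemma perturb_distinct:
  shows "\<forall>\<^sub>F s in at_right 0. inj_on (\<lambda>i. cis (\<theta> i + s * real i)) {..<N}"
proof -
  have pair: "\<forall>\<^sub>F s in at_right 0. cis (\<theta> i + s * real i) \<noteq> cis (\<theta> j + s * real j)" if ij: "i < j" "j < N" for i j
  proof (cases "cis (\<theta> i) = cis (\<theta> j)")
    case True
    have "\<forall>\<^sub>F s in at_right (0::real). s \<in> {0<..<1 / real N}"
      using ij by (intro eventually_at_right_real) auto
    then show ?thesis
    proof (rule eventually_mono)
      \<comment> \<open>The bound 1 / N keeps all relative displacements below 1, hence below pi,
        where the sine is positive.\<close>
      fix s :: real assume s: "s \<in> {0<..<1 / real N}"
      define x where "x = s * (real j - real i)"
      have x0: "x > 0" using s ij by (auto simp: x_def)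
      have "x \<le> s * real N" using s ij by (auto simp: x_def intro!: mult_left_mono)
      also have "\<dots> < 1" using s ij by (auto simp: field_simps)
      finally have "x < pi" using pi_gt3 by simp
      then have "sin x > 0" using x0 by (intro sin_gt_zero) auto
      show "cis (\<theta> i + s * real i) \<noteq> cis (\<theta> j + s * real j)"
      proof
        assume "cis (\<theta> i + s * real i) = cis (\<theta> j + s * real j)"
        then have "cis (s * real i) = cis (s * real j)" using True by (simp flip: cis_mult)
        then have "cis (s * real j) * cis (- (s * real i)) = 1" by (metis cis_mult add.right_inverse cis_zero)
        then have "cis x = 1" by (simp add: cis_mult x_def algebra_simps)
        then have "Im (cis x) = 0" by simp
        then have "sin x = 0" by simp
        then show False using \<open>sin x > 0\<close> by simp
      qed
    qed
  next
    case False
    have "((\<lambda>s. cis (\<theta> i + s * real i) - cis (\<theta> j + s * real j)) \<longlongrightarrow> cis (\<theta> i + 0 * real i) - cis (\<theta> j + 0 * real j)) (at_right 0)"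
      unfolding cis_conv_exp by (intro tendsto_intros)
    then have "\<forall>\<^sub>F s in at_right 0. cis (\<theta> i + s * real i) - cis (\<theta> j + s * real j) \<noteq> 0"
      by (rule tendsto_imp_eventually_ne) (use False in auto)
    then show ?thesis by (rule eventually_mono) auto
  qed
  have "\<forall>\<^sub>F s in at_right 0. \<forall>p\<in>{p\<in>{..<N}\<times>{..<N}. fst p < snd p}. cis (\<theta> (fst p) + s * real (fst p)) \<noteq> cis (\<theta> (snd p) + s * real (snd p))"
    by (intro eventually_ball_finite) (auto intro: pair)
  then show ?thesis
  proof (rule eventually_mono)
    fix s assume a: "\<forall>p\<in>{p\<in>{..<N}\<times>{..<N}. fst p < snd p}. cis (\<theta> (fst p) + s * real (fst p)) \<noteq> cis (\<theta> (snd p) + s * real (snd p))"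
    show "inj_on (\<lambda>i. cis (\<theta> i + s * real i)) {..<N}"
    proof (rule inj_onI)
      fix i j assume ij: "i \<in> {..<N}" "j \<in> {..<N}" "cis (\<theta> i + s * real i) = cis (\<theta> j + s * real j)"
      show "i = j"
      proof (rule ccontr)
        assume "i \<noteq> j" then consider "i < j" | "j < i" by linarith
        then show False
          using a[rule_format, of "(i,j)"] a[rule_format, of "(j,i)"] ij by cases auto
      qed
    qed
  qed
qed

text \<open>No measure is involved: linearity, vanishing on Laplacians and the right value on
  pointwise constant expressions determine L. Indeed \<open>annihilate cs f\<close> is pointwise
  constant with value K times the vacuum element of f, while L maps it to K times L f, and K
  \<noteq> 0.\<close>

theorem expectation_S:
  fixes L :: "trace_expr \<Rightarrow> complex"
  assumes Ladd: "\<And>f g. exp_free f \<Longrightarrow> exp_free g \<Longrightarrow> L (Add f g) = L f + L g"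
    and Lscale: "\<And>c f. exp_free f \<Longrightarrow> L (Mul (Cst c) f) = c * L f"
    and LLap: "\<And>f. exp_free f \<Longrightarrow> L (laplacian f) = 0"
    and Lconst: "\<And>f C. exp_free f \<Longrightarrow> (\<And>\<theta>. ev (power_sums N \<theta>) f = C) \<Longrightarrow> L f = C"
    and f: "exp_free f"
  shows "L f = S N f (antisym_delta N int) int"
proof -
  obtain F where F': "finite F \<and> (\<forall>\<nu>\<in>F. \<forall>i\<ge>N. \<nu> i = int i)
      \<and> (\<forall>w w'. (\<forall>\<nu>\<in>F. w \<nu> = w' \<nu>) \<longrightarrow> S N f w int = S N f w' int)"
    using S_reach[of N int f] ..
  note F = F'[THEN conjunct1] F'[THEN conjunct2, THEN conjunct1, rule_format] F'[THEN conjunct2, THEN conjunct2, rule_format]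
  \<comment> \<open>The eigenvalue 0 is left out, so that K, a product of the negated eigenvalues,
    is nonzero.\<close>
  define Z where "Z = (\<lambda>\<nu>. of_int (lap_symbol N \<nu>) :: complex) ` {\<nu>\<in>F. lap_symbol N \<nu> \<noteq> 0}"
  have "finite Z" using F by (auto simp: Z_def)
  then obtain cs where cs: "set cs = Z" using finite_list by blast
  define K where "K = (\<Prod>c\<leftarrow>cs. - c)"
  have K0: "K \<noteq> 0" unfolding K_def using cs by (auto simp: prod_list_zero_iff Z_def)
  \<comment> \<open>If the eigenvalue of \<nu> is not 0, some factor kills the left side, and \<nu>
    is no rearrangement of the vacuum. If it is 0, then \<nu> repeats an exponent or is such a
    rearrangement, and antisymmetry fixes both sides up to their values at
    \<open>int\<close>.\<close>
  have key: "(\<Prod>c\<leftarrow>cs. of_int (lap_symbol N \<nu>) - c) * alt N \<theta> \<nu> = (K * alt N \<theta> int) * antisym_delta N int \<nu>" if nu: "\<nu> \<in> F" for \<nu> \<theta>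
  proof (cases "lap_symbol N \<nu> = 0")
    case False
    then have "of_int (lap_symbol N \<nu>) \<in> set cs" using nu cs by (auto simp: Z_def)
    then have "(\<Prod>c\<leftarrow>cs. of_int (lap_symbol N \<nu>) - c) = 0" by (auto simp: prod_list_zero_iff)
    moreover have "antisym_delta N int \<nu> = 0"
    proof (rule ccontr)
      assume "antisym_delta N int \<nu> \<noteq> 0"
      then have "\<nu> ` {..<N} = int ` {..<N}" by (rule antisym_delta_nonzero_image)
      from perm_of_image[OF this F(2)[OF nu]] obtain \<pi> where "\<pi> permutes {..<N}" "\<nu> = int \<circ> \<pi>" by blast
      then have "lap_symbol N \<nu> = lap_symbol N int" by (simp only: lap_symbol_comp)
      then show False using False by (simp add: lap_symbol_def)
    qed
    ultimately show ?thesis by simp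
  next
    case True
    have "alt N \<theta> \<nu> = alt N \<theta> int * antisym_delta N int \<nu>"
    proof (cases "inj_on \<nu> {..<N}")
      case False
      then obtain i j where "i < N" "j < N" "i \<noteq> j" "\<nu> i = \<nu> j" by (auto simp: inj_on_def)
      then show ?thesis using antisym_eq0[OF antisym_alt] antisym_eq0[OF antisym_antisym_delta] by simp
    next
      case inj: True
      from perm_of_image[OF lap_symbol_zero_imp[OF inj True] F(2)[OF nu]]
      obtain \<pi> where p: "\<pi> permutes {..<N}" "\<nu> = int \<circ> \<pi>" by blast
      have "alt N \<theta> \<nu> = of_int (sign \<pi>) * alt N \<theta> int" "antisym_delta N int \<nu> = of_int (sign \<pi>) * antisym_delta N int int"
        using antisym_alt[of N \<theta>] antisym_antisym_delta[of N int] p unfolding antisym_def by auto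
      moreover have "antisym_delta N int int = 1" by (rule antisym_delta_self) auto
      ultimately show ?thesis by simp
    qed
    then show ?thesis by (simp add: True K_def)
  qed
  define C where "C = K * S N f (antisym_delta N int) int"
  have gen: "ev (power_sums N \<theta>) (annihilate cs f) = C" if "inj_on (\<lambda>i. cis (\<theta> i)) {..<N}" for \<theta>
  proof -
    have "ev (power_sums N \<theta>) (annihilate cs f) * alt N \<theta> int = S N (annihilate cs f) (alt N \<theta>) int"
      using f by (simp add: S_alt)
    also have "\<dots> = S N f (\<lambda>\<nu>. (\<Prod>c\<leftarrow>cs. of_int (lap_symbol N \<nu>) - c) * alt N \<theta> \<nu>) int"
      by (rule S_annihilate[OF f antisym_alt])
    also have "\<dots> = S N f (\<lambda>\<nu>. (K * alt N \<theta> int) * antisym_delta N int \<nu>) int"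
      by (rule F(3)) (rule key)
    also have "\<dots> = C * alt N \<theta> int" by (simp add: S_scale C_def)
    finally show ?thesis using alt_int_nonzero[OF that] by simp
  qed
  have all: "ev (power_sums N \<theta>) (annihilate cs f) = C" for \<theta>
  proof -
    have "((\<lambda>s. ev (power_sums N (\<lambda>i. \<theta> i + s * real i)) (annihilate cs f)) \<longlongrightarrow> ev (power_sums N (\<lambda>i. \<theta> i + 0 * real i)) (annihilate cs f)) (at_right 0)"
      by (intro tendsto_ev_power_sums tendsto_intros)
    moreover have "((\<lambda>s. ev (power_sums N (\<lambda>i. \<theta> i + s * real i)) (annihilate cs f)) \<longlongrightarrow> C) (at_right 0)"
      by (rule tendsto_eventually) (rule eventually_mono[OF perturb_distinct[of \<theta> N]], rule gen)
    ultimately show ?thesis using tendsto_unique[of "at_right (0::real)"] by force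
  qed
  have LH: "exp_free g \<Longrightarrow> L (annihilate cs' g) = (\<Prod>c\<leftarrow>cs'. - c) * L g" for cs' g
    by (induction cs' arbitrary: g) (auto simp: Ladd Lscale LLap)
  have "K * L f = C" using LH[OF f, of cs] Lconst[OF exp_free_annihilate[OF f] all] by (simp add: K_def)
  then show ?thesis using K0 by (simp add: C_def)
qed

section \<open>Second and fourth moments of power sums\<close>

lemma antisym_delta_sym: "antisym_delta N \<nu> \<mu> = antisym_delta N \<mu> \<nu>"
proof -
  have "antisym_delta N \<nu> \<mu> = (\<Sum>\<sigma> | \<sigma> permutes {..<N}. of_int (sign (inv_into UNIV \<sigma>)) * (\<Prod>i<N. of_bool (\<mu> (inv_into UNIV \<sigma> i) = \<nu> i)))"
    unfolding antisym_delta_def alternant_def by (rule sum_permutations_inverse)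
  also have "\<dots> = (\<Sum>\<sigma> | \<sigma> permutes {..<N}. of_int (sign \<sigma>) * (\<Prod>i<N. of_bool (\<nu> (\<sigma> i) = \<mu> i)))"
  proof (rule sum.cong[OF refl])
    fix \<sigma> assume "\<sigma> \<in> {\<sigma>. \<sigma> permutes {..<N}}"
    then have s: "\<sigma> permutes {..<N}" by simp
    have "permutation \<sigma>" using s by (auto simp: permutation_permutes)
    then have sg: "sign (inv_into UNIV \<sigma>) = sign \<sigma>" by (rule sign_inverse)
    have "(\<Prod>i<N. of_bool (\<mu> (inv_into UNIV \<sigma> i) = \<nu> i)) = (\<Prod>i<N. of_bool (\<mu> (inv_into UNIV \<sigma> (\<sigma> i)) = \<nu> (\<sigma> i)) :: complex)"
      by (rule prod.reindex_bij_betw[OF permutes_imp_bij[OF s], of "\<lambda>i. of_bool (\<mu> (inv_into UNIV \<sigma> i) = \<nu> i)", symmetric])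
    also have "\<dots> = (\<Prod>i<N. of_bool (\<nu> (\<sigma> i) = \<mu> i))"
      by (intro prod.cong refl) (auto simp: permutes_inverses[OF s])
    finally show "of_int (sign (inv_into UNIV \<sigma>)) * (\<Prod>i<N. of_bool (\<mu> (inv_into UNIV \<sigma> i) = \<nu> i)) =
      (of_int (sign \<sigma>) * (\<Prod>i<N. of_bool (\<nu> (\<sigma> i) = \<mu> i)) :: complex)" by (simp only: sg)
  qed
  finally show ?thesis by (simp only: antisym_delta_def alternant_def)
qed

text \<open>Multiplications by p_k and by its conjugate p_(-k) are adjoint for the pairing
  \<open>antisym_delta\<close>. A moment thereby becomes the squared norm of a vector obtained from
  the vacuum.\<close>

lemma S_Pw_adjoint: "S N (Pw (- k)) (antisym_delta N \<nu>) \<mu> = S N (Pw k) (antisym_delta N \<mu>) \<nu>"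
  unfolding S_Pw_antisym_delta[of N "- k"] S.simps(2)[of N k] by (intro sum.cong refl) (simp add: antisym_delta_sym[of N \<mu>])

lemma S_Pw2_adjoint:
  "S N (Mul (Pw (- k)) (Pw (- j))) (antisym_delta N int) \<mu> = S N (Mul (Pw k) (Pw j)) (antisym_delta N \<mu>) int"
proof -
  have "S N (Pw (- j)) (antisym_delta N int) = (\<lambda>\<mu>. \<Sum>i<N. antisym_delta N (int(i := int i + j)) \<mu>)"
    by (rule ext) (simp only: S_Pw_antisym_delta diff_minus_eq_add)
  then have "S N (Mul (Pw (- k)) (Pw (- j))) (antisym_delta N int) \<mu> = S N (Pw (- k)) (\<lambda>\<mu>. \<Sum>i<N. antisym_delta N (int(i := int i + j)) \<mu>) \<mu>"
    by (simp only: S.simps(4))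
  also have "\<dots> = (\<Sum>i<N. S N (Pw (- k)) (antisym_delta N (int(i := int i + j))) \<mu>)"
    by (rule S_sum) simp
  also have "\<dots> = (\<Sum>i<N. S N (Pw k) (antisym_delta N \<mu>) (int(i := int i + j)))"
    by (simp only: S_Pw_adjoint)
  also have "\<dots> = S N (Pw j) (S N (Pw k) (antisym_delta N \<mu>)) int" by (simp only: S.simps(2))
  also have "\<dots> = S N (Mul (Pw k) (Pw j)) (antisym_delta N \<mu>) int" unfolding S.simps(4) by (rule S_commute)
  finally show ?thesis .
qed

text \<open>The filled levels that leave 0, ..., N-1 when raised by k. Their number is the source of
  the cutoff min k N.\<close>

definition top_set :: "nat \<Rightarrow> nat \<Rightarrow> nat set" where
  "top_set N k = {x. x < N \<and> N \<le> x + k}"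

lemma finite_top_set [simp]: "finite (top_set N k)" by (simp add: top_set_def)

lemma card_top_set: "card (top_set N k) = min k N"
proof -
  have "top_set N k = {N - k..<N}" by (auto simp: top_set_def)
  then show ?thesis by auto
qed

text \<open>Exclusion principle: an exponent raised onto an occupied level is repeated and
  contributes 0.\<close>

lemma S_Pw_vac:
  assumes w: "antisym N w" and k: "k \<ge> 1"
  shows "S N (Pw (int k)) w int = (\<Sum>x\<in>top_set N k. w (int(x := int x + int k)))"
proof -
  have z: "w (int(x := int x + int k)) = 0" if "x \<in> {..<N} - top_set N k" for x
    by (rule antisym_eq0[OF w, of x "x + k"]) (use that k in \<open>auto simp: top_set_def\<close>)
  show ?thesis unfolding S.simps
    by (intro sum.mono_neutral_right ballI z) (auto simp: top_set_def)
qed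

text \<open>The coefficient of the configuration with the single level z raised by j + k. It arises
  with sign + by raising z first by k and then by j, and with sign - by raising z + j by k and then
  z by j into the hole left behind, which differs by a transposition.\<close>

definition shift_sign :: "nat \<Rightarrow> nat \<Rightarrow> nat \<Rightarrow> nat \<Rightarrow> complex" where
  "shift_sign N k j z = of_bool (N \<le> z + k) - of_bool (z + j < N)"

definition shift_pairs :: "nat \<Rightarrow> nat \<Rightarrow> nat \<Rightarrow> (nat \<times> nat) set" where
  "shift_pairs N k j = {(x, y). x \<in> top_set N k \<and> y \<in> top_set N j \<and> x \<noteq> y \<and> x + k \<noteq> y + j}"

definition shift1 :: "nat \<Rightarrow> nat \<Rightarrow> nat \<Rightarrow> int" where
  "shift1 n z = int(z := int z + int n)"

definition shift2 :: "nat \<Rightarrow> nat \<Rightarrow> nat \<times> nat \<Rightarrow> nat \<Rightarrow> int" where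
  "shift2 k j q = int(fst q := int (fst q) + int k, snd q := int (snd q) + int j)"

lemma finite_shift_pairs [simp]: "finite (shift_pairs N k j)"
  by (rule finite_subset[of _ "top_set N k \<times> top_set N j"]) (auto simp: shift_pairs_def)

lemma S_Pw2_vac:
  assumes w: "antisym N w" and k: "k \<ge> 1" "j \<ge> 1"
  shows "S N (Mul (Pw (int k)) (Pw (int j))) w int =
    (\<Sum>z\<in>top_set N (j + k). shift_sign N k j z * w (shift1 (j + k) z)) + (\<Sum>q\<in>shift_pairs N k j. w (shift2 k j q))"
proof -
  define T where "T x y = w ((int(x := int x + int k))(y := (int(x := int x + int k)) y + int j))" for x y
  have "S N (Mul (Pw (int k)) (Pw (int j))) w int = (\<Sum>x\<in>top_set N k. \<Sum>y<N. T x y)"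
    unfolding S.simps(4) by (subst S_Pw_vac[OF antisym_S[OF w] k(1)]) (intro sum.cong refl, simp only: S.simps(2), intro sum.cong refl, simp only: T_def)
  also have "\<dots> = (\<Sum>x\<in>top_set N k. \<Sum>y<N. (if y = x then w (shift1 (j + k) x) else 0)
      + (if y + j = x then - w (shift1 (j + k) y) else 0) + (if (x, y) \<in> shift_pairs N k j then w (shift2 k j (x, y)) else 0))"
  proof (intro sum.cong refl)
    fix x y assume x: "x \<in> top_set N k" and "y \<in> {..<N}"
    then have xN: "x < N" "N \<le> x + k" and y: "y < N" by (auto simp: top_set_def)
    \<comment> \<open>The second move acts on the same exponent, fills the hole just vacated, hits
      an occupied level below N, hits the level reached by the first move, or reaches a free level.
      The third and fourth cases contribute 0.\<close>
    consider "y = x" | "y \<noteq> x" "y + j = x" | "y \<noteq> x" "y + j \<noteq> x" "y + j < N" | "y \<noteq> x" "N \<le> y + j" "x + k = y + j"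
      | "y \<noteq> x" "N \<le> y + j" "x + k \<noteq> y + j" by linarith
    then show "T x y = (if y = x then w (shift1 (j + k) x) else 0)
      + (if y + j = x then - w (shift1 (j + k) y) else 0) + (if (x, y) \<in> shift_pairs N k j then w (shift2 k j (x, y)) else 0)"
    proof cases
      case 1
      have "T x y = w (shift1 (j + k) x)" unfolding T_def shift1_def using 1 by (intro arg_cong[of _ _ w]) (auto simp: fun_eq_iff)
      then show ?thesis using 1 k by (auto simp: shift_pairs_def)
    next
      case 2
      have "T x y = - w (shift1 (j + k) y)" unfolding T_def shift1_def
        by (rule antisym_swap[OF w, of x y]) (use 2 xN y in auto)
      then show ?thesis using 2 xN by (auto simp: shift_pairs_def top_set_def)
    next
      case 3
      have "T x y = 0" unfolding T_def
        by (rule antisym_eq0[OF w, of y "y + j"]) (use 3 xN y k in auto)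
      then show ?thesis using 3 by (auto simp: shift_pairs_def top_set_def)
    next
      case 4
      have "T x y = 0" unfolding T_def
        by (rule antisym_eq0[OF w, of y x]) (use 4 xN y k in auto)
      then show ?thesis using 4 xN by (auto simp: shift_pairs_def top_set_def)
    next
      case 5
      have "T x y = w (shift2 k j (x, y))" unfolding T_def shift2_def using 5 by (intro arg_cong[of _ _ w]) (auto simp: fun_eq_iff)
      moreover have "(x, y) \<in> shift_pairs N k j" using 5 xN y by (auto simp: shift_pairs_def top_set_def)
      ultimately show ?thesis using 5 xN by auto
    qed
  qed
  also have "\<dots> = (\<Sum>x\<in>top_set N k. \<Sum>y<N. if y = x then w (shift1 (j + k) x) else 0)
      + (\<Sum>x\<in>top_set N k. \<Sum>y<N. if y + j = x then - w (shift1 (j + k) y) else 0)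
      + (\<Sum>x\<in>top_set N k. \<Sum>y<N. if (x, y) \<in> shift_pairs N k j then w (shift2 k j (x, y)) else 0)"
    by (simp only: sum.distrib)
  also have "(\<Sum>x\<in>top_set N k. \<Sum>y<N. if y = x then w (shift1 (j + k) x) else 0) = (\<Sum>x\<in>top_set N k. w (shift1 (j + k) x))"
    by (intro sum.cong refl) (auto simp: top_set_def)
  also have "\<dots> = (\<Sum>z\<in>top_set N (j + k). of_bool (N \<le> z + k) * w (shift1 (j + k) z))"
    by (intro sum.mono_neutral_cong_left) (auto simp: top_set_def)
  also have "(\<Sum>x\<in>top_set N k. \<Sum>y<N. if y + j = x then - w (shift1 (j + k) y) else 0) =
      (\<Sum>y<N. \<Sum>x\<in>top_set N k. if x = y + j then - w (shift1 (j + k) y) else 0)"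
    by (subst sum.swap) (intro sum.cong, auto)
  also have "\<dots> = (\<Sum>y<N. if y + j \<in> top_set N k then - w (shift1 (j + k) y) else 0)"
    by (simp add: sum.delta)
  also have "\<dots> = (\<Sum>z\<in>top_set N (j + k). - (of_bool (z + j < N) * w (shift1 (j + k) z)))"
    by (intro sum.mono_neutral_cong_right) (auto simp: top_set_def)
  also have "(\<Sum>x\<in>top_set N k. \<Sum>y<N. if (x, y) \<in> shift_pairs N k j then w (shift2 k j (x, y)) else 0) =
      (\<Sum>q\<in>top_set N k \<times> {..<N}. if q \<in> shift_pairs N k j then w (shift2 k j q) else 0)"
    by (simp add: sum.cartesian_product)
  also have "\<dots> = (\<Sum>q\<in>shift_pairs N k j. w (shift2 k j q))"
    by (intro sum.mono_neutral_cong_right) (auto simp: shift_pairs_def top_set_def)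
  also have "(\<Sum>z\<in>top_set N (j + k). of_bool (N \<le> z + k) * w (shift1 (j + k) z)) + (\<Sum>z\<in>top_set N (j + k). - (of_bool (z + j < N) * w (shift1 (j + k) z)))
     = (\<Sum>z\<in>top_set N (j + k). shift_sign N k j z * w (shift1 (j + k) z))"
    unfolding sum.distrib[symmetric] by (intro sum.cong refl) (simp add: shift_sign_def algebra_simps)
  finally show ?thesis .
qed

section \<open>Orthogonality of the raised configurations\<close>

lemma image_shift1: "z < N \<Longrightarrow> shift1 n z ` {..<N} = int ` ({..<N} - {z}) \<union> {int (z + n)}"
  by (auto simp: shift1_def image_iff)

lemma antisym_delta_shift1: 
  assumes "z \<in> top_set N n" "z' \<in> top_set N n"
  shows "antisym_delta N (shift1 n z) (shift1 n z') = of_bool (z = z')"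
proof (cases "z = z'")
  case True
  have "inj_on (shift1 n z) {..<N}" using assms by (auto simp: inj_on_def shift1_def top_set_def)
  then show ?thesis using True by (simp add: antisym_delta_self)
next
  case False
  have "antisym_delta N (shift1 n z) (shift1 n z') = 0"
  proof (rule ccontr)
    assume "antisym_delta N (shift1 n z) (shift1 n z') \<noteq> 0"
    then have "shift1 n z' ` {..<N} = shift1 n z ` {..<N}" by (rule antisym_delta_nonzero_image)
    moreover have "int z \<in> shift1 n z' ` {..<N}" "int z \<notin> shift1 n z ` {..<N}"
      using assms False by (auto simp: image_shift1 top_set_def)
    ultimately show False by simp
  qed
  then show ?thesis using False by simp
qed

lemma image_shift2: "x < N \<Longrightarrow> y < N \<Longrightarrow> x \<noteq> y \<Longrightarrow> shift2 k j (x, y) ` {..<N} = int ` ({..<N} - {x, y}) \<union> {int (x + k), int (y + j)}"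
  by (auto simp: shift2_def image_iff)

text \<open>A single raise leaves one hole among 0, ..., N-1 and a double raise leaves two.\<close>

lemma antisym_delta_shift1_shift2:
  assumes "z \<in> top_set N (j + k)" "q \<in> shift_pairs N k j"
  shows "antisym_delta N (shift1 (j + k) z) (shift2 k j q) = 0"
proof (rule ccontr)
  assume "antisym_delta N (shift1 (j + k) z) (shift2 k j q) \<noteq> 0"
  then have e: "shift2 k j q ` {..<N} = shift1 (j + k) z ` {..<N}" by (rule antisym_delta_nonzero_image)
  obtain x y where q: "q = (x, y)" by (cases q)
  have xy: "x < N" "y < N" "x \<noteq> y" "N \<le> x + k" "N \<le> y + j" and z: "z < N" using assms by (auto simp: shift_pairs_def q top_set_def)
  have "int x \<notin> shift2 k j q ` {..<N}" "int y \<notin> shift2 k j q ` {..<N}"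
    using xy by (auto simp: q image_shift2)
  then have "x = z" "y = z" using xy z unfolding e by (auto simp: image_shift1)
  then show False using xy by simp
qed

text \<open>The holes determine the pair up to order and the landing levels determine the order,
  except that for j = k both orders give the same configuration.\<close>

lemma antisym_delta_shift2:
  assumes "q \<in> shift_pairs N k j" "q' \<in> shift_pairs N k j"
  shows "antisym_delta N (shift2 k j q) (shift2 k j q') = of_bool (q = q' \<or> (j = k \<and> q = prod.swap q'))"
proof -
  obtain x y where q: "q = (x, y)" by (cases q)
  obtain x' y' where q': "q' = (x', y')" by (cases q')
  have xy: "x < N" "y < N" "x \<noteq> y" "N \<le> x + k" "N \<le> y + j" "x + k \<noteq> y + j"
    using assms by (auto simp: shift_pairs_def q top_set_def)
  have xy': "x' < N" "y' < N" "x' \<noteq> y'" "N \<le> x' + k" "N \<le> y' + j" "x' + k \<noteq> y' + j"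
    using assms by (auto simp: shift_pairs_def q' top_set_def)
  have self: "antisym_delta N (shift2 k j q) (shift2 k j q) = 1"
    by (rule antisym_delta_self) (use xy in \<open>auto simp: q shift2_def inj_on_def\<close>)
  show ?thesis
  proof (cases "q = q' \<or> (j = k \<and> q = prod.swap q')")
    case True
    then have "shift2 k j q' = shift2 k j q" using xy by (auto simp: q q' shift2_def fun_eq_iff)
    then show ?thesis using self True by simp
  next
    case False
    have "antisym_delta N (shift2 k j q) (shift2 k j q') = 0"
    proof (rule ccontr)
      assume "antisym_delta N (shift2 k j q) (shift2 k j q') \<noteq> 0"
      then have e: "shift2 k j q' ` {..<N} = shift2 k j q ` {..<N}" by (rule antisym_delta_nonzero_image)
      have "int x \<notin> shift2 k j q ` {..<N}" "int y \<notin> shift2 k j q ` {..<N}"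
        using xy by (auto simp: q image_shift2)
      then have xs: "x = x' \<or> x = y'" "y = x' \<or> y = y'" using xy xy' unfolding e[symmetric] by (auto simp: image_shift2 q')
      have im: "shift2 k j q ` {..<N} = int ` ({..<N} - {x', y'}) \<union> {int (x' + k), int (y' + j)}"
        unfolding e[symmetric] q' by (rule image_shift2[OF xy'(1-3)])
      have "int (x + k) \<in> shift2 k j q ` {..<N}" "int (y + j) \<in> shift2 k j q ` {..<N}"
        using xy(1-3) by (simp_all add: q image_shift2)
      then have "x + k = x' + k \<or> x + k = y' + j" "y + j = x' + k \<or> y + j = y' + j"
        unfolding im using xy(4,5) by auto
      then have a: "x = x' \<or> x + k = y' + j" "y = y' \<or> y + j = x' + k" by auto
      show False
      proof (cases "x = x'")
        case True
        then have "y = y'" using a(2) xs(2) xy(3,6) by auto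
        then show False using True False q q' by simp
      next
        case neq: False
        then have "x = y'" using xs(1) by simp
        then have "j = k" using a(1) neq by simp
        moreover have "y = x'" using xs(2) \<open>x = y'\<close> xy(3) by simp
        ultimately show False using False \<open>x = y'\<close> q q' by simp
      qed
    qed
    then show ?thesis using False by simp
  qed
qed

text \<open>By adjointness this is the squared norm of a sum of \<open>min m N\<close> orthonormal
  configurations.\<close>

theorem S_second_moment:
  assumes "m \<ge> 1"
  shows "S N (Mul (Pw (int m)) (Pw (- int m))) (antisym_delta N int) int = of_nat (min m N)"
proof -
  have "S N (Mul (Pw (int m)) (Pw (- int m))) (antisym_delta N int) int = (\<Sum>x\<in>top_set N m. S N (Pw (- int m)) (antisym_delta N int) (int(x := int x + int m)))"
    unfolding S.simps(4) by (rule S_Pw_vac[OF antisym_S[OF antisym_antisym_delta] assms])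
  also have "\<dots> = (\<Sum>x\<in>top_set N m. \<Sum>x'\<in>top_set N m. antisym_delta N (shift1 m x) (shift1 m x'))"
    unfolding S_Pw_adjoint S_Pw_vac[OF antisym_antisym_delta assms] shift1_def ..
  also have "\<dots> = (\<Sum>x\<in>top_set N m. \<Sum>x'\<in>top_set N m. if x = x' then 1 else 0)"
    by (intro sum.cong refl) (simp add: antisym_delta_shift1)
  also have "\<dots> = of_nat (min m N)" by (simp add: card_top_set)
  finally show ?thesis .
qed

text \<open>The squared norm of the vector decomposed in \<open>S_Pw2_vac\<close>. For j = k a pair
  and its swap are the same configuration, so each pair meets two pairs with inner product 1; this
  gives the factor 2.\<close>

lemma S_fourth_moment_eq:
  assumes k: "k \<ge> 1" "j \<ge> 1"
  shows "S N (Mul (Mul (Pw (int k)) (Pw (int j))) (Mul (Pw (- int k)) (Pw (- int j)))) (antisym_delta N int) int =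
    (\<Sum>z\<in>top_set N (j + k). (shift_sign N k j z)\<^sup>2) + (if j = k then 2 else 1) * of_nat (card (shift_pairs N k j))"
proof -
  let ?F = "Mul (Pw (int k)) (Pw (int j))"
  define G where "G = (\<lambda>\<mu>. (\<Sum>z\<in>top_set N (j + k). shift_sign N k j z * antisym_delta N (shift1 (j + k) z) \<mu>) + (\<Sum>q\<in>shift_pairs N k j. antisym_delta N (shift2 k j q) \<mu>))"
  have G: "S N (Mul (Pw (- int k)) (Pw (- int j))) (antisym_delta N int) = G"
    unfolding S_Pw2_adjoint S_Pw2_vac[OF antisym_antisym_delta k] G_def
    by (rule ext) (simp only: S_Pw2_adjoint S_Pw2_vac[OF antisym_antisym_delta k] antisym_delta_sym[of N _ "shift1 _ _"] antisym_delta_sym[of N _ "shift2 _ _ _"])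
  have AG: "antisym N G" using antisym_S[OF antisym_antisym_delta] G by metis
  have "S N (Mul ?F (Mul (Pw (- int k)) (Pw (- int j)))) (antisym_delta N int) int = S N ?F G int"
    by (simp only: S.simps(4)[of N ?F] G)
  also have "\<dots> = (\<Sum>z\<in>top_set N (j + k). shift_sign N k j z * G (shift1 (j + k) z)) + (\<Sum>q\<in>shift_pairs N k j. G (shift2 k j q))"
    by (rule S_Pw2_vac[OF AG k])
  also have "(\<Sum>z\<in>top_set N (j + k). shift_sign N k j z * G (shift1 (j + k) z)) = (\<Sum>z\<in>top_set N (j + k). (shift_sign N k j z)\<^sup>2)"
  proof (intro sum.cong refl)
    fix z assume z: "z \<in> top_set N (j + k)"
    have "(\<Sum>q\<in>shift_pairs N k j. antisym_delta N (shift2 k j q) (shift1 (j + k) z)) = 0"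
      by (intro sum.neutral ballI) (simp add: antisym_delta_shift1_shift2 z antisym_delta_sym[of N "shift2 _ _ _"])
    moreover have "(\<Sum>z'\<in>top_set N (j + k). shift_sign N k j z' * antisym_delta N (shift1 (j + k) z') (shift1 (j + k) z)) = (\<Sum>z'\<in>top_set N (j + k). if z' = z then shift_sign N k j z else 0)"
      by (intro sum.cong refl) (auto simp: antisym_delta_shift1 z)
    ultimately show "shift_sign N k j z * G (shift1 (j + k) z) = (shift_sign N k j z)\<^sup>2"
      using z by (simp add: G_def power2_eq_square)
  qed
  also have "(\<Sum>q\<in>shift_pairs N k j. G (shift2 k j q)) = (\<Sum>q\<in>shift_pairs N k j. (if j = k then 2 else 1))"
  proof (intro sum.cong refl)
    fix q assume q: "q \<in> shift_pairs N k j"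
    have "(\<Sum>z\<in>top_set N (j + k). shift_sign N k j z * antisym_delta N (shift1 (j + k) z) (shift2 k j q)) = 0"
      by (intro sum.neutral ballI) (simp add: antisym_delta_shift1_shift2 q)
    moreover have "(\<Sum>q'\<in>shift_pairs N k j. antisym_delta N (shift2 k j q') (shift2 k j q)) = (\<Sum>q'\<in>shift_pairs N k j. of_bool (q' = q \<or> (j = k \<and> q' = prod.swap q)))"
      by (intro sum.cong refl) (simp add: antisym_delta_shift2 q)
    moreover have "\<dots> = of_nat (card (shift_pairs N k j \<inter> {q'. q' = q \<or> (j = k \<and> q' = prod.swap q)}))"
      by (rule sum_of_bool_eq) simp_all
    moreover have "card (shift_pairs N k j \<inter> {q'. q' = q \<or> (j = k \<and> q' = prod.swap q)}) = (if j = k then 2 else 1)"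
    proof (cases "j = k")
      case True
      have "shift_pairs N k j \<inter> {q'. q' = q \<or> (j = k \<and> q' = prod.swap q)} = {q, prod.swap q}"
        using q True by (auto simp: shift_pairs_def)
      moreover have "q \<noteq> prod.swap q" using q by (cases q) (auto simp: shift_pairs_def)
      ultimately show ?thesis using True by simp
    next
      case False
      have "shift_pairs N k j \<inter> {q'. q' = q \<or> (j = k \<and> q' = prod.swap q)} = {q}" using q False by auto
      then show ?thesis using False by simp
    qed
    ultimately show "G (shift2 k j q) = (if j = k then 2 else 1)" by (simp add: G_def)
  qed
  also have "(\<Sum>q\<in>shift_pairs N k j. if j = k then 2 else 1 :: complex) = (if j = k then 2 else 1) * of_nat (card (shift_pairs N k j))"
    by (simp only: sum_constant mult.commute)
  finally show ?thesis .
qed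

text \<open>The exact value j k is the product of the two second moments, so the covariance
  vanishes; the general bound is for the remaining pairs of indices.\<close>

theorem S_fourth_moment:
  assumes k: "k \<ge> 1" "j \<ge> 1"
  shows "\<exists>r. S N (Mul (Mul (Pw (int k)) (Pw (int j))) (Mul (Pw (- int k)) (Pw (- int j)))) (antisym_delta N int) int = of_nat r \<and>
     r \<le> (if j = k then 2 else 1) * (min k N * min j N) + min (j + k) N \<and>
     (j < k \<and> j + k \<le> N \<longrightarrow> r = j * k)"
proof -
  define C where "C = {z\<in>top_set N (j + k). N \<le> z + k \<longleftrightarrow> \<not> z + j < N}"
  define r where "r = card C + (if j = k then 2 else 1) * card (shift_pairs N k j)"
  have "(\<Sum>z\<in>top_set N (j + k). (shift_sign N k j z)\<^sup>2) = (\<Sum>z\<in>top_set N (j + k). of_bool (z \<in> C))"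
    by (intro sum.cong refl) (auto simp: shift_sign_def C_def)
  also have "\<dots> = of_nat (card (top_set N (j + k) \<inter> {z. z \<in> C}))" by (rule sum_of_bool_eq) simp_all
  also have "top_set N (j + k) \<inter> {z. z \<in> C} = C" by (auto simp: C_def)
  finally have e: "S N (Mul (Mul (Pw (int k)) (Pw (int j))) (Mul (Pw (- int k)) (Pw (- int j)))) (antisym_delta N int) int = of_nat r"
    unfolding S_fourth_moment_eq[OF k] r_def by simp
  have c1: "card C \<le> min (j + k) N" unfolding card_top_set[symmetric] by (rule card_mono) (auto simp: C_def)
  have "card (shift_pairs N k j) \<le> card (top_set N k \<times> top_set N j)" by (rule card_mono) (auto simp: shift_pairs_def)
  then have c2: "card (shift_pairs N k j) \<le> min k N * min j N" by (simp add: card_top_set)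
  have "r = j * k" if jk: "j < k" "j + k \<le> N"
  proof -
    \<comment> \<open>Among the top j + k levels, the two contributions to \<open>shift_sign\<close>
      cancel except at the lowest j and the highest j levels.\<close>
    have "C = {N - j - k..<N - k} \<union> {N - j..<N}" unfolding C_def top_set_def using jk by auto
    then have "card C = card {N - j - k..<N - k} + card {N - j..<N}"
      using jk by (simp add: card_Un_disjoint)
    then have cC: "card C = 2 * j" using jk by simp
    \<comment> \<open>The excluded pairs: j with equal starting levels and j with equal landing
      levels. The loss of 2j pairs is exactly the gain from the single raises in C.\<close>
    define D where "D = (\<lambda>x. (x, x)) ` {N - j..<N} \<union> (\<lambda>x. (x, x + (k - j))) ` {N - k..<N - k + j}"
    have "card D = card ((\<lambda>x. (x, x)) ` {N - j..<N}) + card ((\<lambda>x. (x, x + (k - j))) ` {N - k..<N - k + j})"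
      unfolding D_def using jk by (intro card_Un_disjoint) auto
    also have "\<dots> = 2 * j" using jk by (simp add: card_image inj_on_def)
    finally have cD: "card D = 2 * j" .
    have sub: "D \<subseteq> top_set N k \<times> top_set N j" unfolding D_def top_set_def using jk by auto
    have "shift_pairs N k j = top_set N k \<times> top_set N j - D"
    proof (intro equalityI subsetI)
      fix q assume "q \<in> shift_pairs N k j"
      then show "q \<in> top_set N k \<times> top_set N j - D" using jk by (auto simp: shift_pairs_def D_def)
    next
      fix q assume q: "q \<in> top_set N k \<times> top_set N j - D"
      obtain x y where xy: "q = (x, y)" by (cases q)
      have a: "x < N" "N \<le> x + k" "y < N" "N \<le> y + j" using q by (auto simp: xy top_set_def)
      have "x \<noteq> y" using q a by (auto simp: D_def xy)
      moreover have "x + k \<noteq> y + j"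
      proof
        assume "x + k = y + j"
        then have "y = x + (k - j)" "x \<in> {N - k..<N - k + j}" using a jk by auto
        then show False using q by (auto simp: D_def xy)
      qed
      ultimately show "q \<in> shift_pairs N k j" using a by (auto simp: shift_pairs_def xy top_set_def)
    qed
    then have "card (shift_pairs N k j) = min k N * min j N - 2 * j"
      using card_Diff_subset[OF finite_subset[OF sub] sub] cD by (simp add: card_top_set)
    then have "card (shift_pairs N k j) = k * j - 2 * j" using jk by simp
    \<comment> \<open>The subtraction of naturals is not truncated, as 1 \<le> j < k forces k \<ge>
      2.\<close>
    moreover have "2 * j \<le> k * j" using jk k by simp
    ultimately show ?thesis using cC jk unfolding r_def by (simp add: mult.commute)
  qed
  moreover have "r \<le> (if j = k then 2 else 1) * (min k N * min j N) + min (j + k) N"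
    unfolding r_def using c1 mult_le_mono2[OF c2] by (simp only: add.commute[of "card C"]) (rule add_le_mono)
  ultimately show ?thesis using e by blast
qed

section \<open>Fourier series of the area functional\<close>

text \<open>The summand n = 0 is 0, since division by zero yields zero.\<close>

definition dilog :: "complex \<Rightarrow> complex" where
  "dilog z = (\<Sum>n. z ^ n / of_nat n ^ 2)"

lemma summable_inverse_squares: "summable (\<lambda>n. 1 / real n ^ 2)"
  using inverse_power_summable[of 2, where 'a=real] by (simp add: field_simps)

lemma summable_dilog: "norm z \<le> 1 \<Longrightarrow> summable (\<lambda>n. z ^ n / of_nat n ^ 2 :: complex)"
  by (rule summable_comparison_test[OF _ summable_inverse_squares])
    (auto intro!: exI[of _ 0] simp: norm_divide norm_power divide_right_mono power_le_one)

lemma continuous_on_dilog: "continuous_on (cball 0 1) dilog"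
proof -
  have "uniform_limit (cball 0 1) (\<lambda>n z. \<Sum>i<n. z ^ i / of_nat i ^ 2 :: complex) (\<lambda>z. \<Sum>i. z ^ i / of_nat i ^ 2) sequentially"
    by (rule Weierstrass_m_test[OF _ summable_inverse_squares])
      (auto simp: norm_divide norm_power divide_right_mono power_le_one)
  then have "continuous_on (cball 0 1) (\<lambda>z. \<Sum>i. z ^ i / of_nat i ^ 2 :: complex)"
    unfolding divide_inverse by (rule uniform_limit_theorem[rotated]) (auto intro!: always_eventually continuous_intros)
  then show ?thesis by (simp add: dilog_def[abs_def])
qed

lemma has_field_derivative_dilog:
  assumes "norm z < 1" "z \<noteq> 0"
  shows "(dilog has_field_derivative (- Ln (1 - z) / z)) (at z)"
proof -
  let ?c = "\<lambda>n. 1 / of_nat n ^ 2 :: complex"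
  have D: "((\<lambda>z. \<Sum>n. ?c n * z ^ n) has_field_derivative (\<Sum>n. diffs ?c n * z ^ n)) (at z)"
    by (rule termdiffs_strong[where K=1]) (use assms summable_dilog[of 1] in auto)
  have "(\<lambda>n. - ((- (- z)) ^ n) / of_nat n) sums ln (1 + (- z))"
    by (rule Ln_series') (use assms in auto)
  then have "(\<lambda>n. - (z ^ Suc n) / of_nat (Suc n)) sums ln (1 - z)"
    using sums_Suc_iff[of "\<lambda>n. - (z ^ n) / of_nat n" "ln (1 - z)"] by simp
  then have "(\<lambda>n. (- 1 / z) * (- (z ^ Suc n) / of_nat (Suc n))) sums ((- 1 / z) * ln (1 - z))"
    by (rule sums_mult)
  moreover have "(\<lambda>n. (- 1 / z) * (- (z ^ Suc n) / of_nat (Suc n))) = (\<lambda>n. diffs ?c n * z ^ n)"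
  proof
    fix n
    have "of_nat (Suc n) \<noteq> (0::complex)" by (rule of_nat_neq_0)
    then show "(- 1 / z) * (- (z ^ Suc n) / of_nat (Suc n)) = diffs ?c n * z ^ n"
      using assms(2) unfolding diffs_def by (simp add: power2_eq_square del: of_nat_Suc)
  qed
  ultimately have "(\<Sum>n. diffs ?c n * z ^ n) = - Ln (1 - z) / z"
    by (simp add: sums_iff)
  with D show ?thesis by (simp add: dilog_def[abs_def])
qed

text \<open>1 - cis t = 2 sin (t/2) cis ((t - pi)/2), where the first factor is positive and the
  angle lies in the principal range.\<close>

lemma Im_Ln_circle:
  assumes "0 < t" "t < 2 * pi"
  shows "Im (Ln (1 - cis t)) = (t - pi) / 2"
proof -
  have s: "sin (t / 2) > 0" using assms by (intro sin_gt_zero) auto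
  define w where "w = Complex (ln (2 * sin (t / 2))) ((t - pi) / 2)"
  have "exp w = of_real (2 * sin (t / 2)) * cis ((t - pi) / 2)"
    unfolding w_def using s by (simp add: exp_eq_polar)
  also have "\<dots> = 1 - cis t"
  proof -
    have a: "cos ((t - pi) / 2) = sin (t / 2)" "sin ((t - pi) / 2) = - cos (t / 2)"
      by (simp_all add: diff_divide_distrib cos_diff sin_diff)
    have "cos t = 1 - 2 * (sin (t / 2))\<^sup>2" "sin t = 2 * sin (t / 2) * cos (t / 2)"
      using cos_double_sin[of "t / 2"] sin_double[of "t / 2"] by simp_all
    then show ?thesis by (simp add: complex_eq_iff a power2_eq_square)
  qed
  finally have "Ln (1 - cis t) = w"
    by (intro Ln_unique) (use assms in \<open>auto simp: w_def\<close>)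
  then show ?thesis by (simp add: w_def)
qed

text \<open>pi^2 B_2 (x / (2 pi)) with the second Bernoulli polynomial B_2.\<close>

definition bern :: "real \<Rightarrow> real" where "bern x = pi\<^sup>2 / 6 - pi * x / 2 + x\<^sup>2 / 4"

text \<open>On the unit circle the differentiated series is only conditionally convergent, so the
  derivative is taken on circles of radius r < 1 and the limit is carried out under the integral.
  This shows that the difference of both sides is constant on the open interval; continuity carries
  this to the end points, and the Basel sum at 0 identifies the constant.\<close>

lemma dilog_bern:
  assumes "x \<in> {0..2 * pi}"
  shows "Re (dilog (cis x)) = bern x"
proof -
  define r where "r n = 1 - 1 / (real n + 2)" for n
  have r: "0 < r n" "r n < 1" for n by (auto simp: r_def field_simps)
  have r1: "\<bar>r n\<bar> \<le> 1" for n using r[of n] by simp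
  have rlim: "r \<longlonglongrightarrow> 1" unfolding r_def by real_asymp
  define H where "H = (\<lambda>x. Re (dilog (cis x)) - bern x)"
  define Hr where "Hr n x = Re (dilog (of_real (r n) * cis x)) - bern x" for n x
  define \<phi> where "\<phi> n t = Im (Ln (1 - of_real (r n) * cis t)) - (t - pi) / 2" for n t
  have deriv: "(Hr n has_real_derivative \<phi> n t) (at t)" for n t
  proof -
    have n0: "norm (of_real (r n) * cis t) < 1" "of_real (r n) * cis t \<noteq> 0"
      using r[of n] by (auto simp: norm_mult)
    have "((\<lambda>t. of_real (r n) * cis t) has_vector_derivative (of_real (r n) * (\<i> * cis t))) (at t)"
    proof -
      have "((\<lambda>z. of_real (r n) * exp (\<i> * z)) has_field_derivative (of_real (r n) * (\<i> * exp (\<i> * of_real t)))) (at (of_real t))"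
        by (auto intro!: derivative_eq_intros)
      from has_vector_derivative_real_field[OF this] show ?thesis by (simp add: cis_conv_exp)
    qed
    from field_vector_diff_chain_at[OF this has_field_derivative_dilog[OF n0]]
    have "((\<lambda>t. dilog (of_real (r n) * cis t)) has_vector_derivative (- \<i> * Ln (1 - of_real (r n) * cis t))) (at t)"
      using n0 by (simp add: o_def)
    then have "((\<lambda>t. Re (dilog (of_real (r n) * cis t))) has_vector_derivative Re (- \<i> * Ln (1 - of_real (r n) * cis t))) (at t)"
      by (rule bounded_linear.has_vector_derivative[OF bounded_linear_Re])
    then have "((\<lambda>t. Re (dilog (of_real (r n) * cis t))) has_real_derivative Im (Ln (1 - of_real (r n) * cis t))) (at t)"
      by (simp add: has_real_derivative_iff_has_vector_derivative)
    moreover have "(bern has_real_derivative (t - pi) / 2) (at t)"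
      unfolding bern_def[abs_def] by (auto intro!: derivative_eq_intros simp: field_simps)
    ultimately show ?thesis unfolding Hr_def[abs_def] \<phi>_def by (rule DERIV_diff)
  qed
  have Hrlim: "(\<lambda>n. Hr n x) \<longlonglongrightarrow> H x" for x
  proof -
    have "(\<lambda>n. of_real (r n) * cis x) \<longlonglongrightarrow> of_real 1 * cis x"
      by (intro tendsto_intros rlim)
    then have "(\<lambda>n. dilog (of_real (r n) * cis x)) \<longlonglongrightarrow> dilog (of_real 1 * cis x)"
      by (rule continuous_on_tendsto_compose[OF continuous_on_dilog])
        (use r1 in \<open>auto intro!: always_eventually simp: norm_mult\<close>)
    then show ?thesis unfolding Hr_def H_def by (auto intro!: tendsto_intros)
  qed
  \<comment> \<open>The interval stays away from 0 and 2 pi, where 1 - cis t vanishes and the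
    logarithm has no limit.\<close>
  have const: "H a = H b" if ab: "0 < a" "a \<le> b" "b < 2 * pi" for a b
  proof -
    have int: "(\<phi> n has_integral (Hr n b - Hr n a)) {a..b}" for n
      by (rule fundamental_theorem_of_calculus[OF ab(2)])
        (use deriv in \<open>auto simp: has_real_derivative_iff_has_vector_derivative intro: has_vector_derivative_at_within\<close>)
    have lim: "(\<lambda>n. \<phi> n t) \<longlonglongrightarrow> 0" if t: "t \<in> {a..b}" for t
    proof -
      have t': "0 < t" "t < 2 * pi" using t ab by auto
      have "sin (t / 2) > 0" using t' by (intro sin_gt_zero) auto
      then have "cos t < 1" using cos_double_sin[of "t / 2"] by simp
      then have "1 - of_real 1 * cis t \<notin> \<real>\<^sub>\<le>\<^sub>0" by (auto simp: complex_nonpos_Reals_iff)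
      then have "(\<lambda>n. Im (Ln (1 - of_real (r n) * cis t)) - (t - pi) / 2) \<longlonglongrightarrow> Im (Ln (1 - of_real 1 * cis t)) - (t - pi) / 2"
        by (intro tendsto_intros rlim) auto
      then show ?thesis using Im_Ln_circle[OF t'] by (simp add: \<phi>_def)
    qed
    \<comment> \<open>The imaginary part of the principal logarithm and the linear term are each at
      most pi in modulus, so a constant dominates near the singular points as well.\<close>
    have bd: "norm (\<phi> n t) \<le> 2 * pi" if t: "t \<in> {a..b}" for n t
    proof -
      have "1 - of_real (r n) * cis t \<noteq> 0"
      proof
        assume "1 - of_real (r n) * cis t = 0"
        then have "norm (of_real (r n) * cis t) = 1" by simp
        then show False using r[of n] by (simp add: norm_mult)
      qed
      then have "\<bar>Im (Ln (1 - of_real (r n) * cis t))\<bar> \<le> pi"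
        using mpi_less_Im_Ln Im_Ln_le_pi by (smt (verit, best))
      moreover have "\<bar>(t - pi) / 2\<bar> \<le> pi" using t ab by (auto simp: abs_le_iff)
      ultimately show ?thesis unfolding \<phi>_def real_norm_def by linarith
    qed
    have "(\<lambda>n. integral {a..b} (\<phi> n)) \<longlonglongrightarrow> integral {a..b} (\<lambda>t. 0)"
    proof (rule dominated_convergence(2)[where h="\<lambda>_. 2 * pi"])
      show "\<phi> n integrable_on {a..b}" for n using int by (rule has_integral_integrable)
      show "(\<lambda>_. 2 * pi) integrable_on {a..b}" by (rule integrable_const_ivl)
      show "norm (\<phi> n t) \<le> 2 * pi" if "t \<in> {a..b}" for n t using that by (rule bd)
      show "(\<lambda>n. \<phi> n t) \<longlonglongrightarrow> 0" if "t \<in> {a..b}" for t using that by (rule lim)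
    qed
    then have "(\<lambda>n. Hr n b - Hr n a) \<longlonglongrightarrow> 0"
      by (simp only: integral_unique[OF int] integral_0)
    moreover have "(\<lambda>n. Hr n b - Hr n a) \<longlonglongrightarrow> H b - H a" by (intro tendsto_intros Hrlim)
    ultimately have "H b - H a = 0" by (rule LIMSEQ_unique[rotated])
    then show ?thesis by simp
  qed
  have cH: "continuous_on (closure {0<..<2 * pi}) H"
    unfolding H_def bern_def
    by (intro continuous_intros continuous_on_compose2[OF continuous_on_dilog])
      (auto intro!: continuous_intros)
  have c1: "H y = H pi" if "y \<in> {0<..<2 * pi}" for y
    using const[of y pi] const[of pi y] that by (cases "y \<le> pi") auto
  have cl: "closure {0<..<2 * pi} = {0..2 * pi}" by (rule closure_greaterThanLessThan) simp
  have c2: "H y = H pi" if "y \<in> {0..2 * pi}" for y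
  proof -
    have "y \<in> closure {0<..<2 * pi}" using that cl by simp
    with continuous_constant_on_closure[OF cH c1] show ?thesis by blast
  qed
  have "H 0 = 0"
  proof -
    have "(\<lambda>n. 1 / real (n + 1) ^ 2) sums (pi\<^sup>2 / 6)" using inverse_squares_sums by simp
    then have "(\<lambda>n. 1 / real n ^ 2) sums (pi\<^sup>2 / 6)"
      using sums_Suc_iff[of "\<lambda>n. 1 / real n ^ 2" "pi\<^sup>2 / 6"] by simp
    then have "(\<lambda>n. of_real (1 / real n ^ 2) :: complex) sums of_real (pi\<^sup>2 / 6)" by (rule sums_of_real)
    then have "dilog 1 = of_real (pi\<^sup>2 / 6)" unfolding dilog_def by (simp add: sums_iff)
    then have "Re (dilog 1) = pi\<^sup>2 / 6" by (simp only: Re_complex_of_real)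
    then show ?thesis by (simp add: H_def bern_def)
  qed
  then have "H x = 0" using c2[of 0] c2[OF assms] by simp
  then show ?thesis by (simp add: H_def)
qed

lemma sums_cos_bern:
  assumes "\<bar>x\<bar> \<le> 2 * pi"
  shows "(\<lambda>k. cos (real (Suc k) * x) / (real (Suc k))\<^sup>2) sums bern \<bar>x\<bar>"
proof -
  have "(\<lambda>n. cis \<bar>x\<bar> ^ n / of_nat n ^ 2) sums dilog (cis \<bar>x\<bar>)"
    unfolding dilog_def by (intro summable_sums summable_dilog) simp
  from sums_Re[OF this] have "(\<lambda>n. Re (cis \<bar>x\<bar> ^ n / of_nat n ^ 2)) sums bern \<bar>x\<bar>"
    using dilog_bern[of "\<bar>x\<bar>"] assms by simp
  moreover have "Re (cis \<bar>x\<bar> ^ n / of_nat n ^ 2) = cos (real n * x) / (real n)\<^sup>2" for n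
  proof -
    have "Re (cis \<bar>x\<bar> ^ n / of_nat n ^ 2) = cos (real n * \<bar>x\<bar>) / (real n)\<^sup>2"
      by (simp add: Complex.DeMoivre flip: of_nat_power)
    also have "cos (real n * \<bar>x\<bar>) = cos (real n * x)" by (simp add: abs_if)
    finally show ?thesis .
  qed
  ultimately have "(\<lambda>n. cos (real n * x) / (real n)\<^sup>2) sums bern \<bar>x\<bar>" by simp
  then show ?thesis using sums_Suc_iff[of "\<lambda>n. cos (real n * x) / (real n)\<^sup>2" "bern \<bar>x\<bar>"] by simp
qed

section \<open>Sawtooth integrals and the double sum over eigenangles\<close>

lemma has_bochner_integral_power_segment:
  fixes t T :: real
  assumes "t \<le> T"
  shows "has_bochner_integral lborel (\<lambda>x. x ^ k * indicator {t..T} x) ((T ^ Suc k - t ^ Suc k) / Suc k)"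
proof -
  have "integrable lborel (\<lambda>x. x ^ k * indicator {t..T} x)"
    using borel_integrable_atLeastAtMost[of t T "\<lambda>x. x ^ k"] by (simp add: mult.commute)
  then show ?thesis using integral_power[OF assms, of k] by (simp add: has_bochner_integral_iff)
qed

text \<open>The contribution of one eigenangle t to N times the deviation of the counting function
  from its mean.\<close>

definition saw :: "real \<Rightarrow> real \<Rightarrow> real" where
  "saw t x = of_bool (t \<le> x) - x / (2 * pi)"

lemma has_bochner_integral_saw:
  assumes "t \<in> {0..2 * pi}"
  shows "has_bochner_integral lborel (\<lambda>x. indicator {0..2 * pi} x * saw t x) (pi - t)"
proof -
  have "has_bochner_integral lborel (\<lambda>x. x ^ 0 * indicator {t..2 * pi} x - (1 / (2 * pi)) * (x ^ 1 * indicator {0..2 * pi} x))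
     (((2 * pi) ^ Suc 0 - t ^ Suc 0) / real (Suc 0) - (1 / (2 * pi)) * (((2 * pi) ^ Suc 1 - 0 ^ Suc 1) / real (Suc 1)))"
    using assms by (intro has_bochner_integral_diff has_bochner_integral_mult_right has_bochner_integral_power_segment) auto
  moreover have "((2 * pi) ^ Suc 0 - t ^ Suc 0) / real (Suc 0) - (1 / (2 * pi)) * (((2 * pi) ^ Suc 1 - 0 ^ Suc 1) / real (Suc 1)) = pi - t"
    by (simp add: power2_eq_square)
  moreover have "x ^ 0 * indicator {t..2 * pi} x - (1 / (2 * pi)) * (x ^ 1 * indicator {0..2 * pi} x) = indicator {0..2 * pi} x * saw t x" for x
    using assms by (auto simp: saw_def indicator_def)
  ultimately show ?thesis by simp
qed

lemma has_bochner_integral_saw_mult: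
  assumes "s \<in> {0..2 * pi}" "t \<in> {0..2 * pi}"
  shows "has_bochner_integral lborel (\<lambda>x. indicator {0..2 * pi} x * (saw s x * saw t x))
    ((s\<^sup>2 + t\<^sup>2) / (4 * pi) + 2 * pi / 3 - max s t)"
proof -
  let ?f = "\<lambda>k t x. x ^ k * indicator {t..2 * pi} x :: real"
  have a: "has_bochner_integral lborel
     (\<lambda>x. ?f 0 (max s t) x - (1 / (2 * pi)) * ?f 1 s x - (1 / (2 * pi)) * ?f 1 t x + (1 / (2 * pi))\<^sup>2 * ?f 2 0 x)
     (((2 * pi) ^ Suc 0 - (max s t) ^ Suc 0) / real (Suc 0) - (1 / (2 * pi)) * (((2 * pi) ^ Suc 1 - s ^ Suc 1) / real (Suc 1))
      - (1 / (2 * pi)) * (((2 * pi) ^ Suc 1 - t ^ Suc 1) / real (Suc 1)) + (1 / (2 * pi))\<^sup>2 * (((2 * pi) ^ Suc 2 - 0 ^ Suc 2) / real (Suc 2)))"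
    using assms by (intro has_bochner_integral_diff has_bochner_integral_add has_bochner_integral_mult_right has_bochner_integral_power_segment) auto
  have b: "((2 * pi) ^ Suc 0 - (max s t) ^ Suc 0) / real (Suc 0) - (1 / (2 * pi)) * (((2 * pi) ^ Suc 1 - s ^ Suc 1) / real (Suc 1))
      - (1 / (2 * pi)) * (((2 * pi) ^ Suc 1 - t ^ Suc 1) / real (Suc 1)) + (1 / (2 * pi))\<^sup>2 * (((2 * pi) ^ Suc 2 - 0 ^ Suc 2) / real (Suc 2))
      = (s\<^sup>2 + t\<^sup>2) / (4 * pi) + 2 * pi / 3 - max s t"
    by (simp add: power2_eq_square power3_eq_cube numeral_2_eq_2 field_simps)
  have c: "?f 0 (max s t) x - (1 / (2 * pi)) * ?f 1 s x - (1 / (2 * pi)) * ?f 1 t x + (1 / (2 * pi))\<^sup>2 * ?f 2 0 x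
     = indicator {0..2 * pi} x * (saw s x * saw t x)" for x
    using assms by (auto simp: saw_def indicator_def power2_eq_square algebra_simps)
  show ?thesis using a unfolding b c .
qed

lemma empirical_cdf_saw:
  assumes "N \<ge> 1" "\<And>i. i \<in> {1..N} \<Longrightarrow> \<theta> i \<in> {0..2 * pi}"
  shows "empirical_cdf N \<theta> x - x / (2 * pi) = (\<Sum>i\<in>{1..N}. saw (\<theta> i) x) / real N"
proof -
  have "{i \<in> {1..N}. 0 \<le> \<theta> i \<and> \<theta> i \<le> x} = {1..N} \<inter> {i. \<theta> i \<le> x}" using assms(2) by auto
  then have "empirical_cdf N \<theta> x = (\<Sum>i\<in>{1..N}. of_bool (\<theta> i \<le> x)) / real N"
    unfolding empirical_cdf_def by (simp add: sum_of_bool_eq)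
  then show ?thesis using assms(1) by (simp add: saw_def sum_subtractf diff_divide_distrib)
qed

text \<open>With I1 and I2 the integrals of the deviation D and of its square, expanding the square
  gives 4 pi I2 - 2 I1^2. Both parts are double sums over eigenangles, and their kernels combine
  into a function of the difference alone.\<close>

lemma A_CUE_bern:
  assumes N: "N \<ge> 1" and th: "\<And>i. i \<in> {1..N} \<Longrightarrow> \<theta> i \<in> {0..2 * pi}"
  shows "(real N)\<^sup>2 / 4 * A_CUE N \<theta> = (\<Sum>i\<in>{1..N}. \<Sum>j\<in>{1..N}. bern \<bar>\<theta> i - \<theta> j\<bar>)"
proof -
  define D where "D x = (\<Sum>i\<in>{1..N}. saw (\<theta> i) x) / real N" for x
  define I1 where "I1 = (\<Sum>i\<in>{1..N}. pi - \<theta> i) / real N"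
  define I2 where "I2 = (\<Sum>i\<in>{1..N}. \<Sum>j\<in>{1..N}. ((\<theta> i)\<^sup>2 + (\<theta> j)\<^sup>2) / (4 * pi) + 2 * pi / 3 - max (\<theta> i) (\<theta> j)) / (real N)\<^sup>2"
  let ?I = "indicator {0..2 * pi} :: real \<Rightarrow> real"
  have "has_bochner_integral lborel (\<lambda>x. (\<Sum>i\<in>{1..N}. ?I x * saw (\<theta> i) x) / real N) I1"
    unfolding I1_def by (intro has_bochner_integral_divide_zero has_bochner_integral_sum has_bochner_integral_saw th)
  then have i1: "has_bochner_integral lborel (\<lambda>x. ?I x * D x) I1"
    by (simp add: D_def sum_distrib_left)
  have "has_bochner_integral lborel (\<lambda>x. (\<Sum>i\<in>{1..N}. \<Sum>j\<in>{1..N}. ?I x * (saw (\<theta> i) x * saw (\<theta> j) x)) / (real N)\<^sup>2) I2"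
    unfolding I2_def by (intro has_bochner_integral_divide_zero has_bochner_integral_sum has_bochner_integral_saw_mult th)
  moreover have "(\<Sum>i\<in>{1..N}. \<Sum>j\<in>{1..N}. ?I x * (saw (\<theta> i) x * saw (\<theta> j) x)) / (real N)\<^sup>2 = ?I x * (D x)\<^sup>2" for x
  proof -
    have "(D x)\<^sup>2 = (\<Sum>i\<in>{1..N}. \<Sum>j\<in>{1..N}. saw (\<theta> i) x * saw (\<theta> j) x) / (real N)\<^sup>2"
      by (simp only: D_def power_divide power2_eq_square[of "\<Sum>i\<in>{1..N}. saw (\<theta> i) x"] sum_product)
    then show ?thesis by (simp only: times_divide_eq_right sum_distrib_left)
  qed
  ultimately have i2: "has_bochner_integral lborel (\<lambda>x. ?I x * (D x)\<^sup>2) I2" by simp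
  have i0: "has_bochner_integral lborel (\<lambda>x. ?I x * c) (2 * pi * c)" for c
    using has_bochner_integral_mult_left[OF has_bochner_integral_power_segment[of 0 "2 * pi" 0], of c] by simp
  have e: "empirical_cdf N \<theta> x - x / (2 * pi) = D x" for x
    unfolding D_def by (rule empirical_cdf_saw) (use N th in auto)
  have quad: "(empirical_cdf N \<theta> y - empirical_cdf N \<theta> x) - (y - x) / (2 * pi) = D y - D x" for x y
    using e[of x] e[of y] unfolding diff_divide_distrib by linarith
  have inner: "(LBINT x:{0..2 * pi}. (D y - D x)\<^sup>2) = 2 * pi * (D y)\<^sup>2 - 2 * D y * I1 + I2" for y
  proof -
    have "has_bochner_integral lborel (\<lambda>x. ?I x * (D y)\<^sup>2 - 2 * D y * (?I x * D x) + ?I x * (D x)\<^sup>2)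
      (2 * pi * (D y)\<^sup>2 - 2 * D y * I1 + I2)"
      by (intro has_bochner_integral_add has_bochner_integral_diff has_bochner_integral_mult_right i0 i1 i2)
    moreover have "?I x * (D y)\<^sup>2 - 2 * D y * (?I x * D x) + ?I x * (D x)\<^sup>2 = ?I x * (D y - D x)\<^sup>2" for x
      by (simp add: power2_eq_square algebra_simps)
    ultimately show ?thesis by (simp add: set_lebesgue_integral_def has_bochner_integral_iff)
  qed
  have "A_CUE N \<theta> = (LBINT y:{0..2 * pi}. 2 * pi * (D y)\<^sup>2 - 2 * D y * I1 + I2)"
    unfolding A_CUE_def quad inner ..
  also have "\<dots> = 2 * pi * I2 - 2 * I1 * I1 + 2 * pi * I2"
  proof -
    have "has_bochner_integral lborel (\<lambda>x. 2 * pi * (?I x * (D x)\<^sup>2) - 2 * I1 * (?I x * D x) + ?I x * I2)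
      (2 * pi * I2 - 2 * I1 * I1 + 2 * pi * I2)"
      by (intro has_bochner_integral_add has_bochner_integral_diff has_bochner_integral_mult_right i0 i1 i2)
    moreover have "2 * pi * (?I x * (D x)\<^sup>2) - 2 * I1 * (?I x * D x) + ?I x * I2 = ?I x * (2 * pi * (D x)\<^sup>2 - 2 * D x * I1 + I2)" for x
      by (simp add: algebra_simps)
    ultimately show ?thesis by (simp add: set_lebesgue_integral_def has_bochner_integral_iff)
  qed
  finally have A: "A_CUE N \<theta> = 4 * pi * I2 - 2 * I1\<^sup>2" by (simp add: power2_eq_square)
  \<comment> \<open>By max s t = (s + t + |s - t|) / 2 all terms that do not depend on the
    difference cancel.\<close>
  have b: "pi * (((\<theta> i)\<^sup>2 + (\<theta> j)\<^sup>2) / (4 * pi) + 2 * pi / 3 - max (\<theta> i) (\<theta> j)) - (pi - \<theta> i) * (pi - \<theta> j) / 2 = bern \<bar>\<theta> i - \<theta> j\<bar>" for i j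
    by (auto simp: bern_def max_def abs_if power2_eq_square field_simps)
  have "(real N)\<^sup>2 / 4 * A_CUE N \<theta> = pi * (I2 * (real N)\<^sup>2) - (I1 * real N)\<^sup>2 / 2"
    unfolding A by (simp add: field_simps)
  also have "I2 * (real N)\<^sup>2 = (\<Sum>i\<in>{1..N}. \<Sum>j\<in>{1..N}. ((\<theta> i)\<^sup>2 + (\<theta> j)\<^sup>2) / (4 * pi) + 2 * pi / 3 - max (\<theta> i) (\<theta> j))"
    using N by (simp add: I2_def)
  also have "I1 * real N = (\<Sum>i\<in>{1..N}. pi - \<theta> i)"
    using N by (simp add: I1_def)
  also have "(\<Sum>i\<in>{1..N}. pi - \<theta> i)\<^sup>2 = (\<Sum>i\<in>{1..N}. \<Sum>j\<in>{1..N}. (pi - \<theta> i) * (pi - \<theta> j))"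
    by (simp only: power2_eq_square sum_product)
  also have "pi * (\<Sum>i\<in>{1..N}. \<Sum>j\<in>{1..N}. ((\<theta> i)\<^sup>2 + (\<theta> j)\<^sup>2) / (4 * pi) + 2 * pi / 3 - max (\<theta> i) (\<theta> j)) -
      (\<Sum>i\<in>{1..N}. \<Sum>j\<in>{1..N}. (pi - \<theta> i) * (pi - \<theta> j)) / 2 = (\<Sum>i\<in>{1..N}. \<Sum>j\<in>{1..N}. bern \<bar>\<theta> i - \<theta> j\<bar>)"
    unfolding sum_distrib_left sum_divide_distrib sum_subtractf[symmetric] b ..
  finally show ?thesis .
qed

lemma cmod_sum_cis_power2:
  "(cmod (\<Sum>i\<in>A. cis (k * \<theta> i)))\<^sup>2 = (\<Sum>i\<in>A. \<Sum>j\<in>A. cos (k * (\<theta> i - \<theta> j)))"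
proof -
  have "complex_of_real ((cmod (\<Sum>i\<in>A. cis (k * \<theta> i)))\<^sup>2) = (\<Sum>i\<in>A. cis (k * \<theta> i)) * cnj (\<Sum>i\<in>A. cis (k * \<theta> i))"
    by (rule complex_norm_square)
  also have "\<dots> = (\<Sum>i\<in>A. \<Sum>j\<in>A. cis (k * (\<theta> i - \<theta> j)))"
    by (simp add: sum_product cis_cnj cis_mult algebra_simps)
  finally have "Re (complex_of_real ((cmod (\<Sum>i\<in>A. cis (k * \<theta> i)))\<^sup>2)) = Re (\<Sum>i\<in>A. \<Sum>j\<in>A. cis (k * (\<theta> i - \<theta> j)))"
    by (rule arg_cong)
  then show ?thesis by simp
qed

theorem A_CUE_sums:
  assumes N: "N \<ge> 1" and th: "\<And>i. i \<in> {1..N} \<Longrightarrow> \<theta> i \<in> {0..2 * pi}"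
  shows "(\<lambda>k. (cmod (\<Sum>i\<in>{1..N}. cis (real (Suc k) * \<theta> i)))\<^sup>2 / (real (Suc k))\<^sup>2) sums ((real N)\<^sup>2 / 4 * A_CUE N \<theta>)"
proof -
  have "(\<lambda>k. \<Sum>i\<in>{1..N}. \<Sum>j\<in>{1..N}. cos (real (Suc k) * (\<theta> i - \<theta> j)) / (real (Suc k))\<^sup>2) sums
    (\<Sum>i\<in>{1..N}. \<Sum>j\<in>{1..N}. bern \<bar>\<theta> i - \<theta> j\<bar>)"
  proof (intro sums_sum sums_cos_bern)
    fix i j assume "i \<in> {1..N}" "j \<in> {1..N}"
    then show "\<bar>\<theta> i - \<theta> j\<bar> \<le> 2 * pi" using th[of i] th[of j] by auto
  qed
  moreover have "(real N)\<^sup>2 / 4 * A_CUE N \<theta> = (\<Sum>i\<in>{1..N}. \<Sum>j\<in>{1..N}. bern \<bar>\<theta> i - \<theta> j\<bar>)"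
    by (rule A_CUE_bern) (use N th in auto)
  ultimately show ?thesis by (simp only: cmod_sum_cis_power2 sum_divide_distrib)
qed

section \<open>Integrals\<close>

lemma norm_diff_le_vector_derivative:
  fixes f :: "real \<Rightarrow> 'b::real_normed_vector"
  assumes "\<And>s. (f has_vector_derivative f' s) (at s)" "\<And>s. s \<in> closed_segment a b \<Longrightarrow> norm (f' s) \<le> C"
  shows "norm (f b - f a) \<le> C * norm (b - a)"
proof (rule differentiable_bound[of "closed_segment a b" f "\<lambda>s h. h *\<^sub>R f' s"])
  show "(f has_derivative (\<lambda>h. h *\<^sub>R f' s)) (at s within closed_segment a b)" for s
    using assms(1)[of s] by (simp add: has_vector_derivative_def has_derivative_at_withinI)
  show "onorm (\<lambda>h. h *\<^sub>R f' s) \<le> C" if "s \<in> closed_segment a b" for s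
  proof (rule onorm_le)
    fix h :: real
    show "norm (h *\<^sub>R f' s) \<le> C * norm h"
      using mult_right_mono[OF assms(2)[OF that] abs_ge_zero[of h]] by (simp add: mult.commute)
  qed
qed auto

text \<open>The mean value inequality bounds the difference quotients by w, hence the remainder
  quotients by 2 w, and dominated convergence applies along every null sequence of
  increments.\<close>

lemma has_vector_derivative_integral_dominated:
  fixes f :: "real \<Rightarrow> 'a \<Rightarrow> complex"
  assumes int: "\<And>t. integrable M (f t)"
    and meas: "f' t0 \<in> borel_measurable M"
    and deriv: "\<And>t x. x \<in> space M \<Longrightarrow> ((\<lambda>t. f t x) has_vector_derivative f' t x) (at t)"
    and bound: "\<And>t x. x \<in> space M \<Longrightarrow> norm (f' t x) \<le> w x"
    and w: "integrable M w"
  shows "((\<lambda>t. \<integral>x. f t x \<partial>M) has_vector_derivative (\<integral>x. f' t0 x \<partial>M)) (at t0)"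
proof -
  have intf': "integrable M (f' t0)"
    by (rule Bochner_Integration.integrable_bound[OF w meas]) (use bound in \<open>auto intro!: AE_I2 intro: order_trans[OF _ abs_ge_self]\<close>)
  define R where "R h x = norm (f (t0 + h) x - f t0 x - h *\<^sub>R f' t0 x) / norm h" for h x
  have intR: "integrable M (R h)" for h
    unfolding R_def by (intro integrable_divide integrable_norm Bochner_Integration.integrable_diff integrable_scaleR_right int intf')
  have Rbound: "norm (R h x) \<le> 2 * w x" if x: "x \<in> space M" and h: "h \<noteq> 0" for h x
  proof -
    have "norm (f (t0 + h) x - f t0 x) \<le> w x * norm (t0 + h - t0)"
      by (rule norm_diff_le_vector_derivative[OF deriv[OF x] bound[OF x]])
    moreover have "norm (h *\<^sub>R f' t0 x) \<le> w x * norm h"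
      using mult_right_mono[OF bound[OF x, of t0] abs_ge_zero[of h]] by (simp add: mult.commute)
    ultimately have "norm (f (t0 + h) x - f t0 x - h *\<^sub>R f' t0 x) \<le> 2 * w x * norm h"
      using norm_triangle_ineq4[of "f (t0 + h) x - f t0 x" "h *\<^sub>R f' t0 x"] by simp
    then show ?thesis using h by (simp add: R_def divide_le_eq)
  qed
  have "(\<lambda>h. norm ((\<integral>x. f (t0 + h) x \<partial>M) - (\<integral>x. f t0 x \<partial>M) - h *\<^sub>R (\<integral>x. f' t0 x \<partial>M)) / norm h) \<midarrow>0\<rightarrow> 0"
    unfolding LIMSEQ_SEQ_conv[symmetric]
  proof (intro allI impI)
    fix h :: "nat \<Rightarrow> real" assume h: "(\<forall>n. h n \<noteq> 0) \<and> h \<longlonglongrightarrow> 0"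
    have "(\<lambda>n. \<integral>x. R (h n) x \<partial>M) \<longlonglongrightarrow> (\<integral>x. 0 \<partial>M)"
    proof (rule integral_dominated_convergence[where w="\<lambda>x. 2 * w x"])
      show "AE x in M. (\<lambda>n. R (h n) x) \<longlonglongrightarrow> 0"
      proof (rule AE_I2)
        fix x assume "x \<in> space M"
        then have "(\<lambda>h. R h x) \<midarrow>0\<rightarrow> 0"
          using deriv[of x t0] unfolding has_vector_derivative_def has_derivative_at R_def by auto
        then show "(\<lambda>n. R (h n) x) \<longlonglongrightarrow> 0" using h unfolding LIMSEQ_SEQ_conv[symmetric] by blast
      qed
      show "AE x in M. norm (R (h n) x) \<le> 2 * w x" for n
        using Rbound h by (intro AE_I2) auto
    qed (use intR w in auto)
    then have lim: "(\<lambda>n. \<integral>x. R (h n) x \<partial>M) \<longlonglongrightarrow> 0" by simp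
    show "(\<lambda>n. norm ((\<integral>x. f (t0 + h n) x \<partial>M) - (\<integral>x. f t0 x \<partial>M) - h n *\<^sub>R (\<integral>x. f' t0 x \<partial>M)) / norm (h n)) \<longlonglongrightarrow> 0"
    proof (rule tendsto_sandwich[OF _ _ tendsto_const lim])
      have "norm ((\<integral>x. f (t0 + h n) x \<partial>M) - (\<integral>x. f t0 x \<partial>M) - h n *\<^sub>R (\<integral>x. f' t0 x \<partial>M)) / norm (h n) \<le> (\<integral>x. R (h n) x \<partial>M)" for n
      proof -
        have "(\<integral>x. f (t0 + h n) x \<partial>M) - (\<integral>x. f t0 x \<partial>M) - h n *\<^sub>R (\<integral>x. f' t0 x \<partial>M) = (\<integral>x. f (t0 + h n) x - f t0 x - h n *\<^sub>R f' t0 x \<partial>M)"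
          using int intf' by simp
        then show ?thesis
          using integral_norm_bound[of M "\<lambda>x. f (t0 + h n) x - f t0 x - h n *\<^sub>R f' t0 x"]
          unfolding R_def by (simp add: divide_right_mono)
      qed
      then show "\<forall>\<^sub>F n in sequentially. norm ((\<integral>x. f (t0 + h n) x \<partial>M) - (\<integral>x. f t0 x \<partial>M) - h n *\<^sub>R (\<integral>x. f' t0 x \<partial>M)) / norm (h n) \<le> (\<integral>x. R (h n) x \<partial>M)"
        by simp
    qed simp
  qed
  then show ?thesis unfolding has_vector_derivative_def has_derivative_at
    by (auto intro: bounded_linear_scaleR_left)
qed

lemma has_vector_derivative_integral:
  fixes f :: "real \<Rightarrow> 'a \<Rightarrow> complex"
  assumes M: "finite_measure M"
    and int: "\<And>t. integrable M (f t)"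
    and meas: "f' t0 \<in> borel_measurable M"
    and deriv: "\<And>t x. x \<in> space M \<Longrightarrow> ((\<lambda>t. f t x) has_vector_derivative f' t x) (at t)"
    and bound: "\<And>t x. x \<in> space M \<Longrightarrow> norm (f' t x) \<le> C"
  shows "((\<lambda>t. \<integral>x. f t x \<partial>M) has_vector_derivative (\<integral>x. f' t0 x \<partial>M)) (at t0)"
proof -
  interpret finite_measure M by fact
  show ?thesis by (rule has_vector_derivative_integral_dominated[where w="\<lambda>_. C"]) (use int meas deriv bound in auto)
qed

section \<open>Unitary matrices\<close>

lemma adj_carrier [simp]: "A \<in> carrier_mat n m \<Longrightarrow> mat_adjoint A \<in> carrier_mat m n"
  unfolding mat_adjoint_def by auto

lemma adj_dim [simp]: "dim_row (mat_adjoint A) = dim_col A" "dim_col (mat_adjoint A) = dim_row A"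
  unfolding mat_adjoint_def by auto

lemma adj_index:
  fixes A :: "complex mat"
  shows "A \<in> carrier_mat n m \<Longrightarrow> i < m \<Longrightarrow> j < n \<Longrightarrow> mat_adjoint A $$ (i, j) = cnj (A $$ (j, i))"
  unfolding mat_adjoint_def by (auto simp: mat_of_rows_def)

lemma mult_index:
  fixes A B :: "complex mat"
  assumes "A \<in> carrier_mat n m" "B \<in> carrier_mat m k" "i < n" "j < k"
  shows "(A * B) $$ (i, j) = (\<Sum>l<m. A $$ (i, l) * B $$ (l, j))"
  using assms by (simp add: scalar_prod_def lessThan_atLeast0)

lemma adj_mult:
  fixes A B :: "complex mat"
  assumes "A \<in> carrier_mat n m" "B \<in> carrier_mat m k"
  shows "mat_adjoint (A * B) = mat_adjoint B * mat_adjoint A"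
proof (rule eq_matI)
  have AB: "A * B \<in> carrier_mat n k" using assms by simp
  note c = adj_carrier[OF AB] adj_carrier[OF assms(1)] adj_carrier[OF assms(2)]
  show "dim_row (mat_adjoint (A * B)) = dim_row (mat_adjoint B * mat_adjoint A)"
    "dim_col (mat_adjoint (A * B)) = dim_col (mat_adjoint B * mat_adjoint A)" using c by auto
  fix i j assume "i < dim_row (mat_adjoint B * mat_adjoint A)" "j < dim_col (mat_adjoint B * mat_adjoint A)"
  then have ij: "i < k" "j < n" using c by auto
  show "mat_adjoint (A * B) $$ (i, j) = (mat_adjoint B * mat_adjoint A) $$ (i, j)"
    using ij assms by (simp add: adj_index[OF AB] mult_index[OF assms] mult_index[OF c(3,2)] adj_index[OF assms(1)] adj_index[OF assms(2)] mult.commute del: index_mult_mat(1))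
qed

lemma adj_adj: fixes A :: "complex mat" assumes "A \<in> carrier_mat n m" shows "mat_adjoint (mat_adjoint A) = A"
  by (rule eq_matI) (use assms adj_carrier[OF assms] adj_carrier[OF adj_carrier[OF assms]] in \<open>auto simp: adj_index[OF adj_carrier[OF assms]] adj_index[OF assms]\<close>)

lemma adj_one: "mat_adjoint (1\<^sub>m n :: complex mat) = 1\<^sub>m n"
  by (rule eq_matI) (use adj_carrier[OF one_carrier_mat[of n]] in \<open>auto simp: adj_index[OF one_carrier_mat]\<close>)

lemma pow_mat_comm:
  fixes A :: "complex mat"
  assumes A: "A \<in> carrier_mat n n"
  shows "A * A ^\<^sub>m k = A ^\<^sub>m k * A"
proof (induction k)
  case (Suc k)
  have "A * (A ^\<^sub>m k * A) = (A * A ^\<^sub>m k) * A"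
    by (rule assoc_mult_mat[OF A pow_carrier_mat[OF A] A, symmetric])
  then show ?case using Suc by simp
qed (use A in simp)

lemma adj_pow:
  fixes A :: "complex mat"
  assumes A: "A \<in> carrier_mat n n"
  shows "mat_adjoint (A ^\<^sub>m k) = mat_adjoint A ^\<^sub>m k"
proof (induction k)
  case 0 then show ?case using A adj_carrier[OF A] by (simp add: adj_one)
next
  case (Suc k)
  have "mat_adjoint A * mat_adjoint A ^\<^sub>m k = mat_adjoint A ^\<^sub>m k * mat_adjoint A"
    by (rule pow_mat_comm[OF adj_carrier[OF A]])
  then show ?case using Suc by (simp add: adj_mult[OF pow_carrier_mat[OF A] A])
qed

lemma unitary_carrier: "V \<in> unitary_group N \<Longrightarrow> V \<in> carrier_mat N N"
  by (simp add: unitary_group_def)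

lemma unitary_right:
  assumes "V \<in> unitary_group N" shows "V * mat_adjoint V = 1\<^sub>m N"
proof -
  have V: "V \<in> carrier_mat N N" "mat_adjoint V * V = 1\<^sub>m N" using assms by (auto simp: unitary_group_def)
  show ?thesis using mat_mult_left_right_inverse[OF adj_carrier[OF V(1)] V(1) V(2)] .
qed

lemma unitary_mult:
  assumes "V \<in> unitary_group N" "W \<in> unitary_group N" shows "V * W \<in> unitary_group N"
proof -
  have V: "V \<in> carrier_mat N N" "mat_adjoint V * V = 1\<^sub>m N" and W: "W \<in> carrier_mat N N" "mat_adjoint W * W = 1\<^sub>m N"
    using assms by (auto simp: unitary_group_def)
  note c = V(1) W(1) adj_carrier[OF V(1)] adj_carrier[OF W(1)]
  have "mat_adjoint (V * W) * (V * W) = mat_adjoint W * (mat_adjoint V * (V * W))"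
    unfolding adj_mult[OF c(1,2)] by (rule assoc_mult_mat[OF c(4,3) mult_carrier_mat[OF c(1,2)]])
  also have "mat_adjoint V * (V * W) = W"
    unfolding assoc_mult_mat[OF c(3,1,2), symmetric] V(2) using c(2) by (rule left_mult_one_mat)
  finally show ?thesis using V W by (simp add: unitary_group_def)
qed

lemma unitary_adj: "V \<in> unitary_group N \<Longrightarrow> mat_adjoint V \<in> unitary_group N"
  using unitary_right[of V N] adj_adj[OF unitary_carrier, of V N] adj_carrier[OF unitary_carrier, of V N] by (simp add: unitary_group_def)

lemma unitary_one: "1\<^sub>m N \<in> unitary_group N"
  by (simp add: unitary_group_def adj_one)

lemma unitary_pow: "V \<in> unitary_group N \<Longrightarrow> V ^\<^sub>m k \<in> unitary_group N"
proof (induction k)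
  case 0 then show ?case using unitary_one unitary_carrier[of V N] by auto
next
  case (Suc k) then show ?case by (simp add: unitary_mult)
qed

text \<open>The columns have norm 1. Every polynomial in the entries and their conjugates is
  therefore bounded on the group.\<close>

lemma unitary_entry:
  assumes V: "V \<in> unitary_group N" and ij: "i < N" "j < N"
  shows "cmod (V $$ (i, j)) \<le> 1"
proof -
  have c: "V \<in> carrier_mat N N" using V by (rule unitary_carrier)
  have "(\<Sum>l<N. complex_of_real ((cmod (V $$ (l, j)))\<^sup>2)) = (mat_adjoint V * V) $$ (j, j)"
    unfolding mult_index[OF adj_carrier[OF c] c ij(2) ij(2)]
    by (intro sum.cong refl) (use ij in \<open>simp add: adj_index[OF c] complex_norm_square[symmetric] mult.commute[of "cnj _"] del: of_real_power\<close>)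
  also have "\<dots> = 1" using V ij by (simp add: unitary_group_def)
  finally have "complex_of_real (\<Sum>l<N. (cmod (V $$ (l, j)))\<^sup>2) = of_real 1" by simp
  then have "(\<Sum>l<N. (cmod (V $$ (l, j)))\<^sup>2) = 1" by (simp only: of_real_eq_iff)
  moreover have "(cmod (V $$ (i, j)))\<^sup>2 \<le> (\<Sum>l<N. (cmod (V $$ (l, j)))\<^sup>2)"
    using ij by (intro member_le_sum) auto
  ultimately have "(cmod (V $$ (i, j)))\<^sup>2 \<le> 1\<^sup>2" by simp
  then show ?thesis by (rule power2_le_imp_le) simp
qed

definition mat_tr :: "nat \<Rightarrow> complex mat \<Rightarrow> complex" where "mat_tr N A = (\<Sum>i<N. A $$ (i, i))"

text \<open>Integer powers of a unitary matrix, with the adjoint in place of the inverse.\<close>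

definition ipow :: "complex mat \<Rightarrow> int \<Rightarrow> complex mat" where
  "ipow U k = (if k \<ge> 0 then U ^\<^sub>m nat k else mat_adjoint U ^\<^sub>m nat (- k))"

definition trace_pow :: "nat \<Rightarrow> complex mat \<Rightarrow> int \<Rightarrow> complex" where
  "trace_pow N U k = mat_tr N (ipow U k)"

lemma ipow_unitary: "U \<in> unitary_group N \<Longrightarrow> ipow U k \<in> unitary_group N"
  by (simp add: ipow_def unitary_pow unitary_adj)

lemma mat_tr_adj: "A \<in> carrier_mat N N \<Longrightarrow> mat_tr N (mat_adjoint A) = cnj (mat_tr N A)"
  by (simp add: mat_tr_def adj_index)

lemma mat_tr_mult: "A \<in> carrier_mat N N \<Longrightarrow> B \<in> carrier_mat N N \<Longrightarrow> mat_tr N (A * B) = (\<Sum>i<N. \<Sum>j<N. A $$ (i, j) * B $$ (j, i))"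
  unfolding mat_tr_def by (intro sum.cong refl) (simp add: mult_index del: index_mult_mat)

lemma mat_tr_comm:
  assumes "A \<in> carrier_mat N N" "B \<in> carrier_mat N N" shows "mat_tr N (A * B) = mat_tr N (B * A)"
  unfolding mat_tr_mult[OF assms] mat_tr_mult[OF assms(2,1)] by (subst sum.swap) (simp add: mult.commute)

lemma trace_pow_minus: "U \<in> carrier_mat N N \<Longrightarrow> trace_pow N U (- k) = cnj (trace_pow N U k)"
proof -
  assume U: "U \<in> carrier_mat N N"
  consider "k > 0" | "k = 0" | "k < 0" by linarith
  then show ?thesis
  proof cases
    case 1 then show ?thesis using U by (simp add: trace_pow_def ipow_def flip: adj_pow mat_tr_adj)
  next
    case 2 then show ?thesis using U by (simp add: trace_pow_def ipow_def mat_tr_def)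
  next
    case 3
    then have "trace_pow N U k = cnj (trace_pow N U (- k))" using U by (simp add: trace_pow_def ipow_def flip: adj_pow mat_tr_adj)
    then show ?thesis by simp
  qed
qed

lemma trace_pow_0: "U \<in> carrier_mat N N \<Longrightarrow> trace_pow N U 0 = of_nat N"
  by (simp add: trace_pow_def ipow_def mat_tr_def)

lemma ipow_add_pos:
  assumes U: "U \<in> unitary_group N"
  shows "U ^\<^sub>m m * ipow U k = ipow U (int m + k)"
proof -
  have c: "U \<in> carrier_mat N N" using U by (rule unitary_carrier)
  note cp = pow_carrier_mat[OF c] note ca = pow_carrier_mat[OF adj_carrier[OF c]]
  have add: "A ^\<^sub>m a * A ^\<^sub>m b = A ^\<^sub>m (a + b)" if "A \<in> carrier_mat N N" for A :: "complex mat" and a b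
    using that by (induction b) (auto simp: assoc_mult_mat[symmetric, where n\<^sub>1=N and n\<^sub>2=N and n\<^sub>3=N and n\<^sub>4=N])
  have canc: "U ^\<^sub>m n * mat_adjoint U ^\<^sub>m n = 1\<^sub>m N" for n
    using unitary_right[OF unitary_pow[OF U, of n]] by (simp add: adj_pow[OF c])
  show ?thesis
  proof (cases "k \<ge> 0")
    case True
    then show ?thesis using add[OF c, of m "nat k"] by (simp add: ipow_def nat_add_distrib)
  next
    case False
    define n where "n = nat (- k)"
    have k: "k = - int n" "n > 0" using False by (auto simp: n_def)
    show ?thesis
    proof (cases "m \<ge> n")
      case True
      have "U ^\<^sub>m m * mat_adjoint U ^\<^sub>m n = U ^\<^sub>m (m - n) * (U ^\<^sub>m n * mat_adjoint U ^\<^sub>m n)"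
        using add[OF c, of "m - n" n] True by (simp add: assoc_mult_mat[OF cp cp ca, symmetric])
      also have "\<dots> = U ^\<^sub>m (m - n)" unfolding canc by (rule right_mult_one_mat[OF cp])
      finally show ?thesis using True k by (simp add: ipow_def nat_diff_distrib' of_nat_diff flip: of_nat_diff)
    next
      case F: False
      have "U ^\<^sub>m m * mat_adjoint U ^\<^sub>m n = (U ^\<^sub>m m * mat_adjoint U ^\<^sub>m m) * mat_adjoint U ^\<^sub>m (n - m)"
        using add[OF adj_carrier[OF c], of m "n - m"] F by (simp add: assoc_mult_mat[OF cp ca ca])
      also have "\<dots> = mat_adjoint U ^\<^sub>m (n - m)" unfolding canc by (rule left_mult_one_mat[OF ca])
      finally show ?thesis using F k by (simp add: ipow_def nat_diff_distrib')
    qed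
  qed
qed

section \<open>Traces of powers and eigenvalues\<close>

lemma upper_triangular_pow:
  fixes B :: "complex mat"
  assumes B: "B \<in> carrier_mat n n" "upper_triangular B"
  shows "upper_triangular (B ^\<^sub>m k) \<and> (\<forall>i<n. (B ^\<^sub>m k) $$ (i, i) = (B $$ (i, i)) ^ k)"
proof (induction k)
  case 0 then show ?case using B by auto
next
  case (Suc k)
  note P = pow_carrier_mat[OF B(1), of k]
  have z: "(B ^\<^sub>m k) $$ (i, l) * B $$ (l, j) = 0" if "i < n" "l < n" "j < n" "j \<le> i" "\<not> (l = i \<and> j = i)" for i j l
  proof (cases "l < i")
    case True then have "(B ^\<^sub>m k) $$ (i, l) = 0" using Suc P that by (auto simp: upper_triangular_def)
    then show ?thesis by simp
  next
    case False then have "j < l" using that by auto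
    then have "B $$ (l, j) = 0" using B that by (auto simp: upper_triangular_def)
    then show ?thesis by simp
  qed
  have e: "(B ^\<^sub>m Suc k) $$ (i, j) = (\<Sum>l<n. (B ^\<^sub>m k) $$ (i, l) * B $$ (l, j))" if "i < n" "j < n" for i j
    using mult_index[OF P B(1) that] by simp
  have "(B ^\<^sub>m Suc k) $$ (i, j) = 0" if "j < i" "i < n" for i j
    unfolding e[OF that(2) less_trans[OF that]] by (intro sum.neutral ballI z) (use that in auto)
  moreover have "(B ^\<^sub>m Suc k) $$ (i, i) = (B $$ (i, i)) ^ Suc k" if "i < n" for i
  proof -
    have "(B ^\<^sub>m Suc k) $$ (i, i) = (\<Sum>l<n. if l = i then (B ^\<^sub>m k) $$ (i, i) * B $$ (i, i) else 0)"
      unfolding e[OF that that] by (intro sum.cong refl) (use z that in auto)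
    then show ?thesis using that Suc by simp
  qed
  ultimately show ?case using pow_carrier_mat[OF B(1), of "Suc k"] by (auto simp: upper_triangular_def)
qed

text \<open>Schur triangularisation puts the eigenvalues on the diagonal with multiplicity, and
  powers of a triangular matrix have the powers of its diagonal entries on the diagonal.\<close>

lemma trace_pow_eigenangles:
  assumes V: "V \<in> carrier_mat N N" and cp: "char_poly V = (\<Prod>i\<in>{1..N}. [:- cis (\<theta> i), 1:])"
  shows "mat_tr N (V ^\<^sub>m k) = (\<Sum>i\<in>{1..N}. cis (real k * \<theta> i))"
proof -
  define es where "es = map (\<lambda>i. cis (\<theta> i)) [1..<Suc N]"
  have cp': "char_poly V = (\<Prod>e\<leftarrow>es. [:- e, 1:])"
  proof -
    have "(\<Prod>i\<in>{1..N}. [:- cis (\<theta> i), 1:]) = prod (\<lambda>i. [:- cis (\<theta> i), 1:]) (set [1..<Suc N])"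
      by (intro prod.cong) auto
    also have "\<dots> = prod_list (map (\<lambda>i. [:- cis (\<theta> i), 1:]) [1..<Suc N])"
      by (rule prod.distinct_set_conv_list) simp
    finally show ?thesis unfolding cp es_def by (simp add: o_def del: upt_Suc)
  qed
  obtain B P Q where s: "schur_decomposition V es = (B, P, Q)" by (cases "schur_decomposition V es") auto
  from schur_decomposition[OF V cp' s] have sim: "similar_mat_wit V B P Q" and ut: "upper_triangular B" and dg: "diag_mat B = es"
    by auto
  from similar_mat_witD2[OF V sim] have c: "B \<in> carrier_mat N N" "P \<in> carrier_mat N N" "Q \<in> carrier_mat N N" and QP: "Q * P = 1\<^sub>m N" by auto
  note Bk = pow_carrier_mat[OF c(1), of k]
  have "V ^\<^sub>m k = P * B ^\<^sub>m k * Q"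
    using similar_mat_wit_pow[OF sim, of k] unfolding similar_mat_wit_def by (auto simp: Let_def)
  then have "mat_tr N (V ^\<^sub>m k) = mat_tr N (Q * (P * B ^\<^sub>m k))"
    by (simp only: mat_tr_comm[OF mult_carrier_mat[OF c(2) Bk] c(3)])
  also have "Q * (P * B ^\<^sub>m k) = B ^\<^sub>m k"
    unfolding assoc_mult_mat[OF c(3,2) Bk, symmetric] QP by (rule left_mult_one_mat[OF Bk])
  also have "mat_tr N (B ^\<^sub>m k) = (\<Sum>i<N. (B $$ (i, i)) ^ k)"
    unfolding mat_tr_def by (intro sum.cong refl) (use upper_triangular_pow[OF c(1) ut, of k] in auto)
  also have "\<dots> = (\<Sum>i<N. (es ! i) ^ k)"
    by (intro sum.cong refl) (use c(1) in \<open>auto simp: dg[symmetric] diag_mat_def\<close>)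
  also have "\<dots> = (\<Sum>i<N. cis (real k * \<theta> (Suc i)))"
    by (intro sum.cong refl) (auto simp: es_def Complex.DeMoivre simp del: upt_Suc)
  also have "\<dots> = (\<Sum>i\<in>{1..N}. cis (real k * \<theta> i))"
    by (rule sum.reindex_bij_witness[of _ "\<lambda>i. i - 1" Suc]) auto
  finally show ?thesis .
qed

section \<open>Bounded measurable functions of a unitary matrix\<close>

lemma space_unitary_borel [simp]: "space (unitary_borel N) = unitary_group N"
  by (simp add: unitary_borel_def)

lemma embed_measurable:
  "(\<lambda>V. \<lambda>ij\<in>{..<N} \<times> {..<N}. V $$ ij) \<in> measurable (unitary_borel N) (\<Pi>\<^sub>M ij\<in>{..<N} \<times> {..<N}. (borel :: complex measure))"
  unfolding unitary_borel_def by (rule measurable_vimage_algebra1) (auto simp: space_PiM)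

lemma entry_measurable:
  assumes "i < N" "j < N"
  shows "(\<lambda>W. W $$ (i, j)) \<in> borel_measurable (unitary_borel N)"
proof -
  have "(\<lambda>W. (\<lambda>ij\<in>{..<N} \<times> {..<N}. W $$ ij) (i, j)) \<in> borel_measurable (unitary_borel N)"
    using measurable_compose[OF embed_measurable measurable_component_singleton[of "(i, j)" "{..<N} \<times> {..<N}" "\<lambda>_. borel"]] assms by simp
  then show ?thesis using assms by simp
qed

text \<open>This class is closed under all operations used in the loop equations and consists of
  functions integrable for Haar measure, so integrability can be read off the shape of an
  expression.\<close>

definition bdd_meas :: "nat \<Rightarrow> (complex mat \<Rightarrow> complex) \<Rightarrow> bool" where
  "bdd_meas N f \<longleftrightarrow> f \<in> borel_measurable (unitary_borel N) \<and> (\<exists>C. \<forall>W\<in>unitary_group N. cmod (f W) \<le> C)"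

lemma bdd_meas_cong: "bdd_meas N g" if "bdd_meas N f" "\<And>W. W \<in> unitary_group N \<Longrightarrow> f W = g W"
proof -
  have "f \<in> borel_measurable (unitary_borel N) \<longleftrightarrow> g \<in> borel_measurable (unitary_borel N)"
    by (rule measurable_cong) (use that(2) in simp)
  then show ?thesis using that unfolding bdd_meas_def by metis
qed

lemma bdd_meas_const: "bdd_meas N (\<lambda>_. c)"
  by (auto simp: bdd_meas_def)

lemma bdd_meas_add: "bdd_meas N (\<lambda>W. f W + g W)" if "bdd_meas N f" "bdd_meas N g"
proof -
  from that obtain C D where "\<forall>W\<in>unitary_group N. cmod (f W) \<le> C" "\<forall>W\<in>unitary_group N. cmod (g W) \<le> D"
    by (auto simp: bdd_meas_def)
  then have "\<forall>W\<in>unitary_group N. cmod (f W + g W) \<le> C + D" by (auto intro: norm_triangle_mono)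
  moreover have "(\<lambda>W. f W + g W) \<in> borel_measurable (unitary_borel N)" using that by (auto simp: bdd_meas_def)
  ultimately show ?thesis unfolding bdd_meas_def by blast
qed

lemma bdd_meas_mult: "bdd_meas N (\<lambda>W. f W * g W)" if "bdd_meas N f" "bdd_meas N g"
proof -
  from that obtain C D where "\<forall>W\<in>unitary_group N. cmod (f W) \<le> C" "\<forall>W\<in>unitary_group N. cmod (g W) \<le> D"
    by (auto simp: bdd_meas_def)
  then have "\<forall>W\<in>unitary_group N. cmod (f W * g W) \<le> \<bar>C\<bar> * \<bar>D\<bar>"
    by (auto simp: norm_mult intro!: mult_mono elim: order_trans[OF _ abs_ge_self])
  moreover have "(\<lambda>W. f W * g W) \<in> borel_measurable (unitary_borel N)" using that by (auto simp: bdd_meas_def)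
  ultimately show ?thesis unfolding bdd_meas_def by blast
qed

lemma bdd_meas_sum: "finite A \<Longrightarrow> (\<And>x. x \<in> A \<Longrightarrow> bdd_meas N (f x)) \<Longrightarrow> bdd_meas N (\<lambda>W. \<Sum>x\<in>A. f x W)"
  by (induction A rule: finite_induct) (auto intro: bdd_meas_const bdd_meas_add)

lemma bdd_meas_cnj: "bdd_meas N f \<Longrightarrow> bdd_meas N (\<lambda>W. cnj (f W))"
  by (auto simp: bdd_meas_def intro: borel_measurable_continuous_on[where f=cnj] continuous_intros)

lemma bdd_meas_exp: "bdd_meas N (\<lambda>W. exp (f W))" if "bdd_meas N f"
proof -
  from that obtain C where C: "\<forall>W\<in>unitary_group N. cmod (f W) \<le> C" by (auto simp: bdd_meas_def)
  have "\<forall>W\<in>unitary_group N. cmod (exp (f W)) \<le> exp C"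
  proof
    fix W assume "W \<in> unitary_group N"
    then have "Re (f W) \<le> C" using C complex_Re_le_cmod[of "f W"] by force
    then show "cmod (exp (f W)) \<le> exp C" by (simp add: norm_exp_eq_Re)
  qed
  moreover have "(\<lambda>W. exp (f W)) \<in> borel_measurable (unitary_borel N)"
    using that by (auto simp: bdd_meas_def intro: borel_measurable_continuous_on[where f=exp] continuous_intros)
  ultimately show ?thesis unfolding bdd_meas_def by blast
qed

lemma bdd_meas_entry: "i < N \<Longrightarrow> j < N \<Longrightarrow> bdd_meas N (\<lambda>W. W $$ (i, j))"
  unfolding bdd_meas_def using entry_measurable unitary_entry by blast

lemma bdd_meas_matmul:
  assumes A: "\<And>W. W \<in> unitary_group N \<Longrightarrow> A W \<in> carrier_mat N N" and B: "\<And>W. W \<in> unitary_group N \<Longrightarrow> B W \<in> carrier_mat N N"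
    and "\<And>i j. i < N \<Longrightarrow> j < N \<Longrightarrow> bdd_meas N (\<lambda>W. A W $$ (i, j))" "\<And>i j. i < N \<Longrightarrow> j < N \<Longrightarrow> bdd_meas N (\<lambda>W. B W $$ (i, j))"
    and ij: "i < N" "j < N"
  shows "bdd_meas N (\<lambda>W. (A W * B W) $$ (i, j))"
proof (rule bdd_meas_cong)
  show "bdd_meas N (\<lambda>W. \<Sum>l<N. A W $$ (i, l) * B W $$ (l, j))"
    by (intro bdd_meas_sum bdd_meas_mult assms) (use ij in auto)
  show "(\<Sum>l<N. A W $$ (i, l) * B W $$ (l, j)) = (A W * B W) $$ (i, j)" if "W \<in> unitary_group N" for W
    by (rule mult_index[OF A[OF that] B[OF that] ij, symmetric])
qed

lemma bdd_meas_pow: "i < N \<Longrightarrow> j < N \<Longrightarrow> bdd_meas N (\<lambda>W. (W ^\<^sub>m k) $$ (i, j))"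
proof (induction k arbitrary: i j)
  case 0
  show ?case
  proof (rule bdd_meas_cong[OF bdd_meas_const])
    fix W assume "W \<in> unitary_group N"
    then have "W \<in> carrier_mat N N" by (rule unitary_carrier)
    then show "of_bool (i = j) = (W ^\<^sub>m 0) $$ (i, j)" using 0 by simp
  qed
next
  case (Suc k)
  show ?case unfolding pow_mat.simps
    by (rule bdd_meas_matmul) (use Suc unitary_carrier unitary_carrier[OF unitary_pow] bdd_meas_entry in auto)
qed

lemma bdd_meas_ipow: "i < N \<Longrightarrow> j < N \<Longrightarrow> bdd_meas N (\<lambda>W. ipow W k $$ (i, j))"
proof (cases "k \<ge> 0")
  case False
  assume ij: "i < N" "j < N"
  show ?thesis
  proof (rule bdd_meas_cong[OF bdd_meas_cnj[OF bdd_meas_pow[OF ij(2,1), of "nat (- k)"]]])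
    fix W assume "W \<in> unitary_group N"
    then have W: "W \<in> carrier_mat N N" by (rule unitary_carrier)
    show "cnj ((W ^\<^sub>m nat (- k)) $$ (j, i)) = ipow W k $$ (i, j)"
      using False by (simp add: ipow_def adj_pow[OF W, symmetric] adj_index[OF pow_carrier_mat[OF W] ij])
  qed
qed (simp add: ipow_def bdd_meas_pow)

lemma bdd_meas_trace_pow: "bdd_meas N (\<lambda>W. trace_pow N W k)"
  unfolding trace_pow_def mat_tr_def by (intro bdd_meas_sum bdd_meas_ipow) auto

lemma bdd_meas_ev: "bdd_meas N (\<lambda>W. ev (trace_pow N W) G)"
  by (induction G) (auto intro: bdd_meas_const bdd_meas_trace_pow bdd_meas_add bdd_meas_mult bdd_meas_exp)

text \<open>The derivative of \<open>ev\<close> along a curve with dW = i H W, with the factor i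
  removed. There p_k moves at the rate k tr (H W^k), and \<open>\<tau> k\<close> stands for that
  trace; an arbitrary \<tau> makes linearity in the direction expressible.\<close>

primrec dir_deriv :: "(int \<Rightarrow> complex) \<Rightarrow> (int \<Rightarrow> complex) \<Rightarrow> trace_expr \<Rightarrow> complex" where
  "dir_deriv p \<tau> (Cst c) = 0"
| "dir_deriv p \<tau> (Pw k) = of_int k * \<tau> k"
| "dir_deriv p \<tau> (Add f g) = dir_deriv p \<tau> f + dir_deriv p \<tau> g"
| "dir_deriv p \<tau> (Mul f g) = dir_deriv p \<tau> f * ev p g + ev p f * dir_deriv p \<tau> g"
| "dir_deriv p \<tau> (Ex f) = dir_deriv p \<tau> f * exp (ev p f)"

lemma bdd_meas_dir_deriv: "(\<And>k. bdd_meas N (\<lambda>W. \<tau> W k)) \<Longrightarrow> bdd_meas N (\<lambda>W. dir_deriv (trace_pow N W) (\<tau> W) G)"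
proof (induction G)
  case (Mul f g)
  then show ?case unfolding dir_deriv.simps by (intro bdd_meas_add bdd_meas_mult bdd_meas_ev) blast+
next
  case (Ex f)
  then show ?case unfolding dir_deriv.simps by (intro bdd_meas_mult bdd_meas_exp bdd_meas_ev) blast+
qed (auto intro: bdd_meas_const bdd_meas_add bdd_meas_mult)

lemma dir_deriv_sum: "dir_deriv p (\<lambda>k. \<Sum>x\<in>A. c x * \<tau> x k) f = (\<Sum>x\<in>A. c x * dir_deriv p (\<tau> x) f)"
  by (induction f) (auto simp: sum_distrib_left sum_distrib_right sum.distrib algebra_simps)

lemma ev_power_field: "ev p (power_field m f) = dir_deriv p (\<lambda>k. p (m + k)) f"
  by (induction f) auto

section \<open>One-parameter groups\<close>

definition orth_proj :: "nat \<Rightarrow> complex mat \<Rightarrow> bool" where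
  "orth_proj N H \<longleftrightarrow> H \<in> carrier_mat N N \<and> H * H = H \<and> mat_adjoint H = H"

text \<open>The group exp (i t H) in closed form, as H is idempotent.\<close>

definition rot :: "nat \<Rightarrow> complex mat \<Rightarrow> real \<Rightarrow> complex mat" where
  "rot N H t = mat N N (\<lambda>(i, j). of_bool (i = j) + (cis t - 1) * H $$ (i, j))"

lemma rot_dim [simp]: "dim_row (rot N H t) = N" "dim_col (rot N H t) = N" by (simp_all add: rot_def)

lemma rot_carrier [simp]: "rot N H t \<in> carrier_mat N N" by (simp add: rot_def)

lemma rot_index: "i < N \<Longrightarrow> j < N \<Longrightarrow> rot N H t $$ (i, j) = of_bool (i = j) + (cis t - 1) * H $$ (i, j)"
  by (simp add: rot_def)

lemma sum_of_bool_mult: 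
  assumes "i < (N::nat)"
  shows "(\<Sum>l<N. of_bool (i = l) * f l) = (f i :: complex)" "(\<Sum>l<N. f l * of_bool (l = i)) = f i"
  using assms by (simp_all add: of_bool_def if_distrib[of "\<lambda>x. x * _"] if_distrib[of "\<lambda>x. _ * x"] sum.delta cong: if_cong)

lemma rot_add:
  assumes H: "orth_proj N H"
  shows "rot N H s * rot N H t = rot N H (s + t)"
proof (rule eq_matI)
  fix i j assume "i < dim_row (rot N H (s + t))" "j < dim_col (rot N H (s + t))"
  then have ij: "i < N" "j < N" by (auto simp: rot_def)
  have Hc: "H \<in> carrier_mat N N" and HH: "(\<Sum>l<N. H $$ (i, l) * H $$ (l, j)) = H $$ (i, j)"
    using H mult_index[of H N N H N i j] ij by (auto simp: orth_proj_def)
  let ?a = "cis s - 1" let ?b = "cis t - 1"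
  have "(rot N H s * rot N H t) $$ (i, j) = (\<Sum>l<N. (of_bool (i = l) + ?a * H $$ (i, l)) * (of_bool (l = j) + ?b * H $$ (l, j)))"
    unfolding mult_index[OF rot_carrier rot_carrier ij] by (intro sum.cong refl) (use ij in \<open>simp add: rot_index\<close>)
  also have "\<dots> = (\<Sum>l<N. of_bool (i = l) * (of_bool (l = j) + ?b * H $$ (l, j)) + (?a * H $$ (i, l)) * of_bool (l = j) + ?a * ?b * (H $$ (i, l) * H $$ (l, j)))"
    by (intro sum.cong refl) (simp add: algebra_simps)
  also have "\<dots> = (of_bool (i = j) + ?b * H $$ (i, j)) + ?a * H $$ (i, j) + ?a * ?b * H $$ (i, j)"
    unfolding sum.distrib sum_of_bool_mult[OF ij(1)] sum_of_bool_mult[OF ij(2)] sum_distrib_left[symmetric] HH ..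
  also have "\<dots> = rot N H (s + t) $$ (i, j)"
    using ij by (simp add: rot_index algebra_simps flip: cis_mult)
  finally show "(rot N H s * rot N H t) $$ (i, j) = rot N H (s + t) $$ (i, j)" .
qed (auto simp: rot_def)

lemma rot_0: "rot N H 0 = 1\<^sub>m N"
  by (rule eq_matI) (auto simp: rot_def)

lemma rot_unitary: assumes H: "orth_proj N H" shows "rot N H t \<in> unitary_group N"
proof -
  have Hc: "H \<in> carrier_mat N N" "mat_adjoint H = H" using H by (auto simp: orth_proj_def)
  have "mat_adjoint (rot N H t) = rot N H (- t)"
  proof (rule eq_matI)
    fix i j assume "i < dim_row (rot N H (- t))" "j < dim_col (rot N H (- t))"
    then have ij: "i < N" "j < N" by (auto simp: rot_def)
    have "cnj (H $$ (j, i)) = H $$ (i, j)" using adj_index[OF Hc(1) ij] Hc(2) by simp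
    then show "mat_adjoint (rot N H t) $$ (i, j) = rot N H (- t) $$ (i, j)"
      using ij by (auto simp: adj_index[OF rot_carrier ij] rot_index cis_cnj)
  qed (auto simp: rot_def)
  then have "mat_adjoint (rot N H t) * rot N H t = rot N H (- t + t)" using rot_add[OF H] by simp
  then show ?thesis by (simp add: unitary_group_def rot_0)
qed

lemma rot_deriv:
  assumes H: "orth_proj N H" and U: "U \<in> carrier_mat N N" and ij: "i < N" "j < N"
  shows "((\<lambda>t. (rot N H t * U) $$ (i, j)) has_vector_derivative \<i> * (H * (rot N H t * U)) $$ (i, j)) (at t)"
proof -
  have Hc: "H \<in> carrier_mat N N" and HH: "H * H = H" using H by (auto simp: orth_proj_def)
  note HU = mult_carrier_mat[OF Hc U] and rU = mult_carrier_mat[OF rot_carrier U]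
  have e: "(rot N H t * U) $$ (i, j) = U $$ (i, j) + (cis t - 1) * (H * U) $$ (i, j)" if ij: "i < N" "j < N" for t i j
  proof -
    have "(rot N H t * U) $$ (i, j) = (\<Sum>l<N. of_bool (i = l) * U $$ (l, j) + (cis t - 1) * (H $$ (i, l) * U $$ (l, j)))"
      unfolding mult_index[OF rot_carrier U ij] by (intro sum.cong refl) (use ij in \<open>simp add: rot_index algebra_simps\<close>)
    then show ?thesis unfolding sum.distrib sum_of_bool_mult[OF ij(1)] sum_distrib_left[symmetric] mult_index[OF Hc U ij] .
  qed
  have "(H * (rot N H t * U)) $$ (i, j) = (\<Sum>l<N. H $$ (i, l) * U $$ (l, j) + (cis t - 1) * (H $$ (i, l) * (H * U) $$ (l, j)))"
    unfolding mult_index[OF Hc rU ij] by (intro sum.cong refl) (use ij in \<open>simp add: e algebra_simps del: index_mult_mat(1)\<close>)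
  also have "\<dots> = (H * U) $$ (i, j) + (cis t - 1) * (H * (H * U)) $$ (i, j)"
    unfolding sum.distrib sum_distrib_left[symmetric] mult_index[OF Hc U ij] mult_index[OF Hc HU ij] ..
  also have "H * (H * U) = H * U" unfolding assoc_mult_mat[OF Hc Hc U, symmetric] HH ..
  finally have e2: "(H * (rot N H t * U)) $$ (i, j) = cis t * (H * U) $$ (i, j)" by (simp add: algebra_simps del: index_mult_mat(1))
  have "((\<lambda>z. U $$ (i, j) + (exp (\<i> * z) - 1) * (H * U) $$ (i, j)) has_field_derivative (\<i> * (exp (\<i> * of_real t) * (H * U) $$ (i, j)))) (at (of_real t))"
    by (auto intro!: derivative_eq_intros)
  from has_vector_derivative_real_field[OF this] show ?thesis
    unfolding e[OF ij] e2 by (simp add: cis_conv_exp del: index_mult_mat(1))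
qed

text \<open>The Leibniz rule for W^k when dW = X W: each of the k factors W is replaced by X W in
  turn.\<close>

definition pow_deriv :: "nat \<Rightarrow> complex mat \<Rightarrow> complex mat \<Rightarrow> nat \<Rightarrow> nat \<Rightarrow> nat \<Rightarrow> complex" where
  "pow_deriv N X W k i j = (\<Sum>l<k. (W ^\<^sub>m l * (X * W ^\<^sub>m (k - l))) $$ (i, j))"

lemma rot_pow_deriv:
  assumes H: "orth_proj N H" and U: "U \<in> carrier_mat N N"
  shows "i < N \<Longrightarrow> j < N \<Longrightarrow> ((\<lambda>t. ((rot N H t * U) ^\<^sub>m k) $$ (i, j)) has_vector_derivative \<i> * pow_deriv N H (rot N H t * U) k i j) (at t)"
proof (induction k arbitrary: i j)
  case 0
  have "((rot N H t * U) ^\<^sub>m 0) $$ (i, j) = of_bool (i = j)" for t using 0 U mult_carrier_mat[OF rot_carrier U] by simp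
  then show ?case by (simp add: pow_deriv_def del: pow_mat.simps)
next
  case (Suc k)
  have Hc: "H \<in> carrier_mat N N" using H by (auto simp: orth_proj_def)
  let ?W = "\<lambda>t. rot N H t * U"
  have Wc: "?W t \<in> carrier_mat N N" for t using mult_carrier_mat[OF rot_carrier U] .
  note Wk = pow_carrier_mat[OF Wc]
  have e: "((?W t) ^\<^sub>m Suc k) $$ (i, j) = (\<Sum>r<N. ((?W t) ^\<^sub>m k) $$ (i, r) * (?W t) $$ (r, j))" for t
    using mult_index[OF Wk[of t k] Wc[of t] Suc.prems] by simp
  have "((\<lambda>t. \<Sum>r<N. ((?W t) ^\<^sub>m k) $$ (i, r) * (?W t) $$ (r, j)) has_vector_derivative
     (\<Sum>r<N. ((?W t) ^\<^sub>m k) $$ (i, r) * (\<i> * (H * ?W t) $$ (r, j)) + \<i> * pow_deriv N H (?W t) k i r * (?W t) $$ (r, j))) (at t)"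
    by (intro has_vector_derivative_sum has_vector_derivative_mult Suc.IH rot_deriv[OF H U]) (use Suc.prems in auto)
  moreover have "(\<Sum>r<N. ((?W t) ^\<^sub>m k) $$ (i, r) * (\<i> * (H * ?W t) $$ (r, j)) + \<i> * pow_deriv N H (?W t) k i r * (?W t) $$ (r, j))
     = \<i> * pow_deriv N H (?W t) (Suc k) i j"
  proof -
    let ?V = "?W t"
    note V = Wc[of t] and Vk = Wk[of t]
    have "(\<Sum>r<N. pow_deriv N H ?V k i r * ?V $$ (r, j)) = (\<Sum>l<k. \<Sum>r<N. (?V ^\<^sub>m l * (H * ?V ^\<^sub>m (k - l))) $$ (i, r) * ?V $$ (r, j))"
      unfolding pow_deriv_def sum_distrib_right by (rule sum.swap)
    also have "\<dots> = (\<Sum>l<k. (?V ^\<^sub>m l * (H * ?V ^\<^sub>m (k - l)) * ?V) $$ (i, j))"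
      by (intro sum.cong refl mult_index[symmetric, OF mult_carrier_mat[OF Vk mult_carrier_mat[OF Hc Vk]] V Suc.prems])
    also have "\<dots> = (\<Sum>l<k. (?V ^\<^sub>m l * (H * ?V ^\<^sub>m (Suc k - l))) $$ (i, j))"
    proof (rule sum.cong[OF refl])
      fix l assume "l \<in> {..<k}"
      then have "Suc k - l = Suc (k - l)" by auto
      then show "(?V ^\<^sub>m l * (H * ?V ^\<^sub>m (k - l)) * ?V) $$ (i, j) = (?V ^\<^sub>m l * (H * ?V ^\<^sub>m (Suc k - l))) $$ (i, j)"
        by (simp only: pow_mat.simps assoc_mult_mat[OF Vk mult_carrier_mat[OF Hc Vk] V] assoc_mult_mat[OF Hc Vk V])
    qed
    finally have a: "(\<Sum>r<N. pow_deriv N H ?V k i r * ?V $$ (r, j)) = (\<Sum>l<k. (?V ^\<^sub>m l * (H * ?V ^\<^sub>m (Suc k - l))) $$ (i, j))" .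
    have b: "(\<Sum>r<N. (?V ^\<^sub>m k) $$ (i, r) * (H * ?V) $$ (r, j)) = (?V ^\<^sub>m k * (H * ?V ^\<^sub>m (Suc k - k))) $$ (i, j)"
      using mult_index[OF Vk mult_carrier_mat[OF Hc V] Suc.prems] V by simp
    have "(\<Sum>r<N. (?V ^\<^sub>m k) $$ (i, r) * (\<i> * (H * ?V) $$ (r, j)) + \<i> * pow_deriv N H ?V k i r * ?V $$ (r, j))
      = \<i> * (\<Sum>r<N. (?V ^\<^sub>m k) $$ (i, r) * (H * ?V) $$ (r, j)) + \<i> * (\<Sum>r<N. pow_deriv N H ?V k i r * ?V $$ (r, j))"
      unfolding sum_distrib_left sum.distrib[symmetric] by (intro sum.cong refl) (simp only: ac_simps)
    also have "\<dots> = \<i> * pow_deriv N H ?V (Suc k) i j"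
    proof -
      have e3: "pow_deriv N H ?V (Suc k) i j = (\<Sum>l<k. (?V ^\<^sub>m l * (H * ?V ^\<^sub>m (Suc k - l))) $$ (i, j)) + (?V ^\<^sub>m k * (H * ?V ^\<^sub>m (Suc k - k))) $$ (i, j)"
        unfolding pow_deriv_def by (rule sum.lessThan_Suc)
      show ?thesis unfolding a b e3 by (simp only: distrib_left add.commute)
    qed
    finally show ?thesis .
  qed
  ultimately show ?case unfolding e by simp
qed

text \<open>Cyclicity of the trace makes all k summands equal.\<close>

lemma pow_deriv_trace:
  assumes X: "X \<in> carrier_mat N N" and W: "W \<in> carrier_mat N N"
  shows "(\<Sum>i<N. pow_deriv N X W k i i) = of_nat k * mat_tr N (X * W ^\<^sub>m k)"
proof -
  note Wk = pow_carrier_mat[OF W]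
  have add: "W ^\<^sub>m a * W ^\<^sub>m b = W ^\<^sub>m (a + b)" for a b
    using W by (induction b) (auto simp: assoc_mult_mat[symmetric, where n\<^sub>1=N and n\<^sub>2=N and n\<^sub>3=N and n\<^sub>4=N])
  have "(\<Sum>i<N. pow_deriv N X W k i i) = (\<Sum>l<k. mat_tr N (W ^\<^sub>m l * (X * W ^\<^sub>m (k - l))))"
    unfolding pow_deriv_def mat_tr_def by (rule sum.swap)
  also have "\<dots> = (\<Sum>l<k. mat_tr N (X * W ^\<^sub>m k))"
  proof (rule sum.cong[OF refl])
    fix l assume "l \<in> {..<k}"
    then have "W ^\<^sub>m (k - l) * W ^\<^sub>m l = W ^\<^sub>m k" by (simp add: add)
    then show "mat_tr N (W ^\<^sub>m l * (X * W ^\<^sub>m (k - l))) = mat_tr N (X * W ^\<^sub>m k)"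
      by (simp only: mat_tr_comm[OF Wk mult_carrier_mat[OF X Wk]] assoc_mult_mat[OF X Wk Wk])
  qed
  finally show ?thesis by simp
qed

text \<open>Negative powers follow by conjugation: H is self-adjoint, and the sign from conjugating
  i is absorbed by the sign of k.\<close>

lemma trace_pow_deriv:
  assumes H: "orth_proj N H" and U: "U \<in> unitary_group N"
  shows "((\<lambda>t. trace_pow N (rot N H t * U) k) has_vector_derivative \<i> * (of_int k * mat_tr N (H * ipow (rot N H t * U) k))) (at t)"
proof -
  have Uc: "U \<in> carrier_mat N N" using U by (rule unitary_carrier)
  have Hc: "H \<in> carrier_mat N N" "mat_adjoint H = H" using H by (auto simp: orth_proj_def)
  note Wc = mult_carrier_mat[OF rot_carrier[of N H] Uc]
  have pos: "((\<lambda>t. mat_tr N ((rot N H t * U) ^\<^sub>m n)) has_vector_derivative \<i> * (of_nat n * mat_tr N (H * (rot N H t * U) ^\<^sub>m n))) (at t)" for n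
  proof -
    have e: "\<i> * (of_nat n * mat_tr N (H * (rot N H t * U) ^\<^sub>m n)) = (\<Sum>i<N. \<i> * pow_deriv N H (rot N H t * U) n i i)"
      by (simp only: pow_deriv_trace[OF Hc(1) Wc, symmetric] sum_distrib_left)
    show ?thesis unfolding e unfolding mat_tr_def
      by (intro has_vector_derivative_sum rot_pow_deriv[OF H Uc]) auto
  qed
  show ?thesis
  proof (cases "k \<ge> 0")
    case True
    then show ?thesis using pos[of "nat k"] by (simp add: trace_pow_def ipow_def)
  next
    case False
    define n where "n = nat (- k)"
    have k: "k = - int n" "\<not> 0 \<le> k" using False by (auto simp: n_def)
    have "((\<lambda>t. cnj (mat_tr N ((rot N H t * U) ^\<^sub>m n))) has_vector_derivative cnj (\<i> * (of_nat n * mat_tr N (H * (rot N H t * U) ^\<^sub>m n)))) (at t)"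
      by (rule bounded_linear.has_vector_derivative[OF bounded_linear_cnj pos])
    moreover have "cnj (mat_tr N ((rot N H t * U) ^\<^sub>m n)) = trace_pow N (rot N H t * U) k" for t
      using k by (simp add: trace_pow_def ipow_def mat_tr_adj[OF pow_carrier_mat[OF Wc], symmetric] adj_pow[OF Wc])
    moreover have "cnj (mat_tr N (H * (rot N H t * U) ^\<^sub>m n)) = mat_tr N (H * ipow (rot N H t * U) k)"
      using k mat_tr_comm[OF Hc(1) pow_carrier_mat[OF adj_carrier[OF Wc]]]
      by (simp add: ipow_def mat_tr_adj[OF mult_carrier_mat[OF Hc(1) pow_carrier_mat[OF Wc]], symmetric] adj_mult[OF Hc(1) pow_carrier_mat[OF Wc]] Hc(2) adj_pow[OF Wc])
    ultimately show ?thesis using k by simp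
  qed
qed

lemma ev_deriv:
  assumes H: "orth_proj N H" and U: "U \<in> unitary_group N"
  shows "((\<lambda>t. ev (trace_pow N (rot N H t * U)) G) has_vector_derivative
     \<i> * dir_deriv (trace_pow N (rot N H t * U)) (\<lambda>k. mat_tr N (H * ipow (rot N H t * U) k)) G) (at t)"
proof (induction G)
  case (Pw k) show ?case using trace_pow_deriv[OF H U] by simp
next
  case (Add f g) then show ?case by (auto intro!: derivative_eq_intros simp: algebra_simps)
next
  case (Mul f g) show ?case using has_vector_derivative_mult[OF Mul] by (simp add: algebra_simps)
next
  case (Ex f)
  from field_vector_diff_chain_at[OF Ex DERIV_exp] show ?case by (simp add: o_def algebra_simps)
qed simp

section \<open>Loop equations\<close>

lemma left_mult_measurable:
  assumes V: "V \<in> unitary_group N"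
  shows "(\<lambda>W. V * W) \<in> measurable (unitary_borel N) (unitary_borel N)"
proof -
  have "(\<lambda>W. \<lambda>ij\<in>{..<N} \<times> {..<N}. (V * W) $$ ij) \<in> measurable (unitary_borel N) (\<Pi>\<^sub>M ij\<in>{..<N} \<times> {..<N}. (borel :: complex measure))"
  proof (rule measurable_restrict)
    fix ij assume "ij \<in> {..<N} \<times> {..<N}"
    then obtain i j where ij: "ij = (i, j)" "i < N" "j < N" by auto
    have "bdd_meas N (\<lambda>W. (V * W) $$ (i, j))"
      by (rule bdd_meas_matmul) (use V ij unitary_carrier bdd_meas_const bdd_meas_entry in auto)
    then show "(\<lambda>W. (V * W) $$ ij) \<in> borel_measurable (unitary_borel N)" by (simp add: bdd_meas_def ij)
  qed
  then show ?thesis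
    unfolding unitary_borel_def[of N] by (intro measurable_vimage_algebra2) (use V unitary_mult in \<open>auto simp: unitary_borel_def\<close>)
qed

lemma sets_haar: "haar_unitary N \<mu> \<Longrightarrow> sets \<mu> = sets (unitary_borel N)"
  by (simp add: haar_unitary_def)

lemma space_haar: "haar_unitary N \<mu> \<Longrightarrow> space \<mu> = unitary_group N"
  using sets_eq_imp_space_eq[OF sets_haar] by simp

lemma haar_invariant:
  fixes g :: "complex mat \<Rightarrow> complex"
  assumes h: "haar_unitary N \<mu>" and V: "V \<in> unitary_group N" and g: "g \<in> borel_measurable (unitary_borel N)"
  shows "(\<integral>W. g (V * W) \<partial>\<mu>) = (\<integral>W. g W \<partial>\<mu>)"
proof -
  have "(\<lambda>W. V * W) \<in> measurable \<mu> (unitary_borel N)"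
    using left_mult_measurable[OF V] by (simp add: measurable_cong_sets[OF sets_haar[OF h] refl])
  then have "(\<integral>W. g W \<partial>distr \<mu> (unitary_borel N) (\<lambda>W. V * W)) = (\<integral>W. g (V * W) \<partial>\<mu>)"
    by (rule integral_distr[OF _ g])
  moreover have "distr \<mu> (unitary_borel N) (\<lambda>W. V * W) = \<mu>" using h V by (auto simp: haar_unitary_def)
  ultimately show ?thesis by simp
qed

lemma bdd_meas_integrable:
  assumes h: "haar_unitary N \<mu>" and f: "bdd_meas N f"
  shows "integrable \<mu> f"
proof -
  interpret prob_space \<mu> using h by (simp add: haar_unitary_def)
  obtain C where C: "\<And>W. W \<in> unitary_group N \<Longrightarrow> cmod (f W) \<le> C" using f by (auto simp: bdd_meas_def)
  have "f \<in> borel_measurable \<mu>" using f by (simp add: bdd_meas_def measurable_cong_sets[OF sets_haar[OF h] refl])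
  then show ?thesis by (rule integrable_const_bound[where B=C, rotated]) (intro AE_I2, use C in \<open>simp add: space_haar[OF h]\<close>)
qed

lemma bdd_meas_left_mult:
  assumes "bdd_meas N f" "V \<in> unitary_group N"
  shows "bdd_meas N (\<lambda>W. f (V * W))"
  using assms measurable_compose[OF left_mult_measurable] unitary_mult unfolding bdd_meas_def by blast

text \<open>The derivative of (W^m)_ab G in the direction of the matrix unit at (r, s). A matrix
  unit off the diagonal is not Hermitian and generates no unitary group, so this direction is
  reached only by linear combination of projections.\<close>

definition loop_entry :: "nat \<Rightarrow> nat \<Rightarrow> nat \<Rightarrow> nat \<Rightarrow> trace_expr \<Rightarrow> nat \<Rightarrow> nat \<Rightarrow> complex mat \<Rightarrow> complex" where
  "loop_entry N a b m G r s W = (\<Sum>l<m. (W ^\<^sub>m l) $$ (a, r) * (W ^\<^sub>m (m - l)) $$ (s, b)) * ev (trace_pow N W) G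
     + (W ^\<^sub>m m) $$ (a, b) * dir_deriv (trace_pow N W) (\<lambda>k. ipow W k $$ (s, r)) G"

lemma bdd_meas_loop_entry: "a < N \<Longrightarrow> b < N \<Longrightarrow> r < N \<Longrightarrow> s < N \<Longrightarrow> bdd_meas N (loop_entry N a b m G r s)"
  unfolding loop_entry_def[abs_def] by (intro bdd_meas_add bdd_meas_mult bdd_meas_sum bdd_meas_pow bdd_meas_ev bdd_meas_dir_deriv bdd_meas_ipow) auto

lemma loop_entry_sum:
  assumes W: "W \<in> carrier_mat N N" and H: "H \<in> carrier_mat N N" and ab: "a < N" "b < N"
    and ip: "\<And>k. ipow W k \<in> carrier_mat N N"
  shows "(\<Sum>r<N. \<Sum>s<N. H $$ (r, s) * loop_entry N a b m G r s W) =
    pow_deriv N H W m a b * ev (trace_pow N W) G + (W ^\<^sub>m m) $$ (a, b) * dir_deriv (trace_pow N W) (\<lambda>k. mat_tr N (H * ipow W k)) G"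
proof -
  note Wk = pow_carrier_mat[OF W]
  let ?I = "{..<N} \<times> {..<N}"
  have d: "pow_deriv N H W m a b = (\<Sum>x\<in>?I. H $$ x * (\<Sum>l<m. (W ^\<^sub>m l) $$ (a, fst x) * (W ^\<^sub>m (m - l)) $$ (snd x, b)))"
  proof -
    have "pow_deriv N H W m a b = (\<Sum>l<m. \<Sum>r<N. (W ^\<^sub>m l) $$ (a, r) * (\<Sum>s<N. H $$ (r, s) * (W ^\<^sub>m (m - l)) $$ (s, b)))"
      unfolding pow_deriv_def by (intro sum.cong refl) (use ab in \<open>simp add: mult_index[OF Wk mult_carrier_mat[OF H Wk]] mult_index[OF H Wk] del: index_mult_mat(1)\<close>)
    also have "\<dots> = (\<Sum>l<m. \<Sum>x\<in>?I. H $$ x * ((W ^\<^sub>m l) $$ (a, fst x) * (W ^\<^sub>m (m - l)) $$ (snd x, b)))"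
      unfolding sum_distrib_left sum.cartesian_product by (intro sum.cong refl) (auto simp: ac_simps)
    also have "\<dots> = (\<Sum>x\<in>?I. H $$ x * (\<Sum>l<m. (W ^\<^sub>m l) $$ (a, fst x) * (W ^\<^sub>m (m - l)) $$ (snd x, b)))"
      unfolding sum_distrib_left by (rule sum.swap)
    finally show ?thesis .
  qed
  have t: "(\<lambda>k. mat_tr N (H * ipow W k)) = (\<lambda>k. \<Sum>x\<in>?I. H $$ x * ipow W k $$ (snd x, fst x))"
    unfolding mat_tr_mult[OF H ip] sum.cartesian_product by (intro ext sum.cong refl) auto
  have "(\<Sum>r<N. \<Sum>s<N. H $$ (r, s) * loop_entry N a b m G r s W) = (\<Sum>x\<in>?I. H $$ x * loop_entry N a b m G (fst x) (snd x) W)"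
    unfolding sum.cartesian_product by (intro sum.cong refl) auto
  also have "\<dots> = (\<Sum>x\<in>?I. (H $$ x * (\<Sum>l<m. (W ^\<^sub>m l) $$ (a, fst x) * (W ^\<^sub>m (m - l)) $$ (snd x, b))) * ev (trace_pow N W) G
      + (W ^\<^sub>m m) $$ (a, b) * (H $$ x * dir_deriv (trace_pow N W) (\<lambda>k. ipow W k $$ (snd x, fst x)) G))"
    by (intro sum.cong refl) (simp add: loop_entry_def algebra_simps)
  also have "\<dots> = pow_deriv N H W m a b * ev (trace_pow N W) G + (W ^\<^sub>m m) $$ (a, b) * dir_deriv (trace_pow N W) (\<lambda>k. mat_tr N (H * ipow W k)) G"
    unfolding sum.distrib sum_distrib_left[symmetric] sum_distrib_right[symmetric] d[symmetric] t dir_deriv_sum ..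
  finally show ?thesis .
qed

text \<open>By invariance the integral of g along the group generated by H is constant in t, and the
  sum below is, up to the factor i, its derivative at 0.\<close>

lemma haar_orth_proj:
  assumes h: "haar_unitary N \<mu>" and H: "orth_proj N H" and ab: "a < N" "b < N"
  shows "(\<Sum>r<N. \<Sum>s<N. H $$ (r, s) * (\<integral>W. loop_entry N a b m G r s W \<partial>\<mu>)) = 0"
proof -
  interpret prob_space \<mu> using h by (simp add: haar_unitary_def)
  have Hc: "H \<in> carrier_mat N N" using H by (simp add: orth_proj_def)
  define g where "g W = (W ^\<^sub>m m) $$ (a, b) * ev (trace_pow N W) G" for W
  define D where "D W = (\<Sum>r<N. \<Sum>s<N. H $$ (r, s) * loop_entry N a b m G r s W)" for W
  have ng: "bdd_meas N g" unfolding g_def[abs_def] by (intro bdd_meas_mult bdd_meas_pow bdd_meas_ev ab)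
  have nD: "bdd_meas N D" unfolding D_def[abs_def] by (intro bdd_meas_sum bdd_meas_mult bdd_meas_const bdd_meas_loop_entry ab) auto
  then obtain C where C: "\<And>W. W \<in> unitary_group N \<Longrightarrow> cmod (D W) \<le> C" by (auto simp: bdd_meas_def)
  have deriv: "((\<lambda>t. g (rot N H t * W)) has_vector_derivative \<i> * D (rot N H t * W)) (at t)" if W: "W \<in> unitary_group N" for t W
  proof -
    have Wc: "W \<in> carrier_mat N N" using W by (rule unitary_carrier)
    have rW: "rot N H t * W \<in> unitary_group N" by (rule unitary_mult[OF rot_unitary[OF H] W])
    have "D (rot N H t * W) = pow_deriv N H (rot N H t * W) m a b * ev (trace_pow N (rot N H t * W)) G
       + ((rot N H t * W) ^\<^sub>m m) $$ (a, b) * dir_deriv (trace_pow N (rot N H t * W)) (\<lambda>k. mat_tr N (H * ipow (rot N H t * W) k)) G"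
      unfolding D_def by (rule loop_entry_sum[OF unitary_carrier[OF rW] Hc ab unitary_carrier[OF ipow_unitary[OF rW]]])
    then show ?thesis unfolding g_def
      using has_vector_derivative_mult[OF rot_pow_deriv[OF H Wc ab, of m t] ev_deriv[OF H W, of G t]]
      by (simp add: algebra_simps)
  qed
  have "((\<lambda>t. \<integral>W. g (rot N H t * W) \<partial>\<mu>) has_vector_derivative (\<integral>W. \<i> * D (rot N H 0 * W) \<partial>\<mu>)) (at 0)"
  proof (rule has_vector_derivative_integral[where C=C and f'="\<lambda>t W. \<i> * D (rot N H t * W)"])
    show "finite_measure \<mu>" by unfold_locales
    show "integrable \<mu> (\<lambda>W. g (rot N H t * W))" for t
      by (rule bdd_meas_integrable[OF h bdd_meas_left_mult[OF ng rot_unitary[OF H]]])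
    show "(\<lambda>W. \<i> * D (rot N H 0 * W)) \<in> borel_measurable \<mu>"
      using bdd_meas_integrable[OF h bdd_meas_left_mult[OF nD rot_unitary[OF H, of 0]]] by auto
    show "((\<lambda>t. g (rot N H t * W)) has_vector_derivative \<i> * D (rot N H t * W)) (at t)" if "W \<in> space \<mu>" for t W
      using deriv that by (simp add: space_haar[OF h])
    show "cmod (\<i> * D (rot N H t * W)) \<le> C" if "W \<in> space \<mu>" for t W
      using C[OF unitary_mult[OF rot_unitary[OF H]]] that by (simp add: space_haar[OF h] norm_mult)
  qed
  moreover have "(\<lambda>t. \<integral>W. g (rot N H t * W) \<partial>\<mu>) = (\<lambda>t. \<integral>W. g W \<partial>\<mu>)"
    by (rule ext, rule haar_invariant[OF h rot_unitary[OF H]]) (use ng in \<open>simp add: bdd_meas_def\<close>)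
  ultimately have "((\<lambda>t::real. \<integral>W. g W \<partial>\<mu>) has_vector_derivative (\<integral>W. \<i> * D (rot N H 0 * W) \<partial>\<mu>)) (at 0)" by simp
  then have "(\<integral>W. \<i> * D (rot N H 0 * W) \<partial>\<mu>) = 0"
    by (rule vector_derivative_unique_at[OF _ has_vector_derivative_const])
  moreover have "(\<integral>W. \<i> * D (rot N H 0 * W) \<partial>\<mu>) = (\<integral>W. \<i> * D W \<partial>\<mu>)"
    by (rule Bochner_Integration.integral_cong[OF refl]) (simp add: rot_0 space_haar[OF h] left_mult_one_mat[OF unitary_carrier])
  ultimately have "(\<integral>W. D W \<partial>\<mu>) = 0" by simp
  moreover have "(\<integral>W. D W \<partial>\<mu>) = (\<Sum>r<N. \<Sum>s<N. H $$ (r, s) * (\<integral>W. loop_entry N a b m G r s W \<partial>\<mu>))"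
  proof -
    have i: "integrable \<mu> (loop_entry N a b m G r s)" if "r < N" "s < N" for r s
      using that by (intro bdd_meas_integrable[OF h] bdd_meas_loop_entry ab)
    have "(\<integral>W. D W \<partial>\<mu>) = (\<Sum>r<N. \<integral>W. (\<Sum>s<N. H $$ (r, s) * loop_entry N a b m G r s W) \<partial>\<mu>)"
      unfolding D_def by (rule Bochner_Integration.integral_sum) (auto intro!: Bochner_Integration.integrable_sum integrable_mult_right i)
    also have "\<dots> = (\<Sum>r<N. \<Sum>s<N. \<integral>W. H $$ (r, s) * loop_entry N a b m G r s W \<partial>\<mu>)"
      by (intro sum.cong refl Bochner_Integration.integral_sum) (auto intro!: integrable_mult_right i)
    finally show ?thesis by simp
  qed
  ultimately show ?thesis by simp
qed

section \<open>Polarisation over rank-one projections\<close>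

definition rank_one :: "nat \<Rightarrow> (nat \<Rightarrow> complex) \<Rightarrow> complex mat" where
  "rank_one N v = mat N N (\<lambda>(i, j). v i * cnj (v j))"

lemma orth_proj_rank_one:
  assumes "(\<Sum>l<N. v l * cnj (v l)) = 1"
  shows "orth_proj N (rank_one N v)"
proof -
  have c: "rank_one N v \<in> carrier_mat N N" by (simp add: rank_one_def)
  have "rank_one N v * rank_one N v = rank_one N v"
  proof (rule eq_matI)
    fix i j assume "i < dim_row (rank_one N v)" "j < dim_col (rank_one N v)"
    then have ij: "i < N" "j < N" by (auto simp: rank_one_def)
    have "(rank_one N v * rank_one N v) $$ (i, j) = (\<Sum>l<N. (v i * cnj (v j)) * (v l * cnj (v l)))"
      unfolding mult_index[OF c c ij] by (intro sum.cong refl) (use ij in \<open>simp add: rank_one_def\<close>)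
    also have "\<dots> = v i * cnj (v j)" unfolding sum_distrib_left[symmetric] assms by simp
    finally show "(rank_one N v * rank_one N v) $$ (i, j) = rank_one N v $$ (i, j)" using ij by (simp add: rank_one_def)
  qed (auto simp: rank_one_def)
  moreover have "mat_adjoint (rank_one N v) = rank_one N v"
  proof (rule eq_matI)
    fix i j assume "i < dim_row (rank_one N v)" "j < dim_col (rank_one N v)"
    then have ij: "i < N" "j < N" by (auto simp: rank_one_def)
    show "mat_adjoint (rank_one N v) $$ (i, j) = rank_one N v $$ (i, j)"
      unfolding adj_index[OF c ij] using ij by (simp add: rank_one_def)
  qed (auto simp: rank_one_def)
  ultimately show ?thesis using c by (simp add: orth_proj_def)
qed

lemma prod_expand: "(A + c * B) * (A' + c' * B') = A * A' + c' * (A * B') + c * (B * A') + c * c' * (B * B')" for A :: complex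
  by (simp add: algebra_simps)

lemma prod_expand2: "(A * A' + c' * (A * B') + c * (B * A') + c * c' * (B * B')) / 2 * k =
    A * (A' * (k / 2)) + A * (B' * (c' * k / 2)) + B * (A' * (c * k / 2)) + B * (B' * (c * c' * k / 2))" for A :: complex
  by (simp add: field_simps)

text \<open>A sesquilinear form that vanishes at all pairs (v, v) with v a unit vector has zero
  coefficients. The vectors e_x, (e_r + e_s) / sqrt 2 and (e_r + i e_s) / sqrt 2 suffice.\<close>

lemma haar_loop_entry_zero:
  assumes h: "haar_unitary N \<mu>" and ab: "a < N" "b < N" and rs: "r < N" "s < N"
  shows "(\<integral>W. loop_entry N a b m G r s W \<partial>\<mu>) = 0"
proof -
  define \<kappa> where "\<kappa> r s = (\<integral>W. loop_entry N a b m G r s W \<partial>\<mu>)" for r s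
  have q: "(\<Sum>r<N. \<Sum>s<N. v r * cnj (v s) * \<kappa> r s) = 0" if v: "(\<Sum>l<N. v l * cnj (v l)) = 1" for v
  proof -
    have "(\<Sum>r<N. \<Sum>s<N. rank_one N v $$ (r, s) * \<kappa> r s) = 0"
      unfolding \<kappa>_def by (rule haar_orth_proj[OF h orth_proj_rank_one[OF v] ab])
    moreover have "(\<Sum>r<N. \<Sum>s<N. rank_one N v $$ (r, s) * \<kappa> r s) = (\<Sum>r<N. \<Sum>s<N. v r * cnj (v s) * \<kappa> r s)"
      by (intro sum.cong refl) (simp add: rank_one_def)
    ultimately show ?thesis by simp
  qed
  have delta: "(\<Sum>l<N. of_bool (l = x) * f l) = (f x :: complex)" if "x < N" for x f
  proof -
    have "(\<Sum>l<N. of_bool (l = x) * f l) = (\<Sum>l<N. of_bool (x = l) * f l)" by (intro sum.cong refl) (auto simp: of_bool_def)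
    then show ?thesis by (simp only: sum_of_bool_mult(1)[OF that])
  qed
  have cob: "cnj (of_bool Q) = of_bool Q" for Q by (simp add: of_bool_def)
  have diag: "\<kappa> x x = 0" if x: "x < N" for x
    using q[of "\<lambda>l. of_bool (l = x)"] x by (simp add: cob delta mult.assoc sum_distrib_left[symmetric])
  have off: "cnj c * \<kappa> r s + c * \<kappa> s r = 0" if c: "c * cnj c = 1" and ne: "r \<noteq> s" for c
  proof -
    let ?v = "\<lambda>l. (of_bool (l = r) + c * of_bool (l = s)) / of_real (sqrt 2) :: complex"
    have shift2: "complex_of_real (sqrt 2) * of_real (sqrt 2) = 2" by (simp flip: of_real_mult)
    have P: "?v x * cnj (?v y) = (of_bool (x = r) * of_bool (y = r) + cnj c * (of_bool (x = r) * of_bool (y = s))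
       + c * (of_bool (x = s) * of_bool (y = r)) + c * cnj c * (of_bool (x = s) * of_bool (y = s))) / 2" for x y
    proof -
      have "?v x * cnj (?v y) = ((of_bool (x = r) + c * of_bool (x = s)) * (of_bool (y = r) + cnj c * of_bool (y = s))) / (of_real (sqrt 2) * of_real (sqrt 2))"
        by simp
      then show ?thesis unfolding shift2 prod_expand .
    qed
    have "(\<Sum>l<N. ?v l * cnj (?v l)) = (\<Sum>l<N. of_bool (l = r) * (1/2) + of_bool (l = s) * (1/2))"
      unfolding P by (intro sum.cong refl) (use ne c in auto)
    also have "\<dots> = 1" unfolding sum.distrib delta[OF rs(1)] delta[OF rs(2)] by simp
    finally have "(\<Sum>x<N. \<Sum>y<N. ?v x * cnj (?v y) * \<kappa> x y) = 0" by (rule q)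
    also have "(\<Sum>x<N. \<Sum>y<N. ?v x * cnj (?v y) * \<kappa> x y) =
      (\<Sum>x<N. \<Sum>y<N. of_bool (x = r) * (of_bool (y = r) * (\<kappa> x y / 2)) + of_bool (x = r) * (of_bool (y = s) * (cnj c * \<kappa> x y / 2))
        + of_bool (x = s) * (of_bool (y = r) * (c * \<kappa> x y / 2)) + of_bool (x = s) * (of_bool (y = s) * (c * cnj c * \<kappa> x y / 2)))"
      unfolding P prod_expand2 ..
    also have "\<dots> = \<kappa> r r / 2 + cnj c * \<kappa> r s / 2 + c * \<kappa> s r / 2 + c * cnj c * \<kappa> s s / 2"
      using rs by (simp only: sum.distrib sum_distrib_left[symmetric] delta)
    finally have "cnj c * \<kappa> r s / 2 + c * \<kappa> s r / 2 = 0" using diag rs by simp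
    then have "2 * (cnj c * \<kappa> r s / 2 + c * \<kappa> s r / 2) = 0" by simp
    then show ?thesis by (simp add: distrib_left)
  qed
  have "\<kappa> r s = 0"
  proof (cases "r = s")
    case False
    have "\<kappa> r s + \<kappa> s r = 0" using off[of 1] False by simp
    moreover have "\<i> * (\<kappa> s r - \<kappa> r s) = 0" using off[of \<i>] False by (simp add: algebra_simps)
    then have "\<kappa> s r = \<kappa> r s" by simp
    ultimately have "2 * \<kappa> r s = 0" by simp
    then show ?thesis by simp
  qed (use diag rs in simp)
  then show ?thesis by (simp add: \<kappa>_def)
qed

text \<open>Contracting the entrywise identities along r = a and s = b turns the products of entries
  into products of traces, and (W^m)_ab (W^k)_ba into p_(m+k). The summand l = 0 carries the factor
  p_0 = N, which later supplies the leading order.\<close>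

theorem haar_loop:
  assumes h: "haar_unitary N \<mu>"
  shows "(\<integral>W. (\<Sum>l<m. trace_pow N W (int l) * trace_pow N W (int (m - l))) * ev (trace_pow N W) G + ev (trace_pow N W) (power_field (int m) G) \<partial>\<mu>) = 0"
proof -
  have "(\<integral>W. (\<Sum>a<N. \<Sum>b<N. loop_entry N a b m G a b W) \<partial>\<mu>) = (\<Sum>a<N. \<integral>W. (\<Sum>b<N. loop_entry N a b m G a b W) \<partial>\<mu>)"
    by (rule Bochner_Integration.integral_sum) (auto intro!: bdd_meas_integrable[OF h] bdd_meas_sum bdd_meas_loop_entry)
  also have "\<dots> = (\<Sum>a<N. \<Sum>b<N. \<integral>W. loop_entry N a b m G a b W \<partial>\<mu>)"
    by (intro sum.cong refl Bochner_Integration.integral_sum) (auto intro!: bdd_meas_integrable[OF h] bdd_meas_loop_entry)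
  also have "\<dots> = 0" by (intro sum.neutral ballI haar_loop_entry_zero[OF h]) auto
  finally have z: "(\<integral>W. (\<Sum>a<N. \<Sum>b<N. loop_entry N a b m G a b W) \<partial>\<mu>) = 0" .
  have "(\<Sum>a<N. \<Sum>b<N. loop_entry N a b m G a b W) = (\<Sum>l<m. trace_pow N W (int l) * trace_pow N W (int (m - l))) * ev (trace_pow N W) G + ev (trace_pow N W) (power_field (int m) G)"
    if W: "W \<in> unitary_group N" for W
  proof -
    have Wc: "W \<in> carrier_mat N N" using W by (rule unitary_carrier)
    note ipc = unitary_carrier[OF ipow_unitary[OF W]]
    let ?I = "{..<N} \<times> {..<N}"
    have "(\<Sum>a<N. \<Sum>b<N. \<Sum>l<m. (W ^\<^sub>m l) $$ (a, a) * (W ^\<^sub>m (m - l)) $$ (b, b)) = (\<Sum>l<m. mat_tr N (W ^\<^sub>m l) * mat_tr N (W ^\<^sub>m (m - l)))"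
      unfolding mat_tr_def sum_product by (rule trans[OF sum.cong[OF refl sum.swap] sum.swap])
    also have "\<dots> = (\<Sum>l<m. trace_pow N W (int l) * trace_pow N W (int (m - l)))"
      by (intro sum.cong refl) (simp only: trace_pow_def ipow_def of_nat_0_le_iff if_True nat_int)
    finally have A: "(\<Sum>a<N. \<Sum>b<N. \<Sum>l<m. (W ^\<^sub>m l) $$ (a, a) * (W ^\<^sub>m (m - l)) $$ (b, b)) = (\<Sum>l<m. trace_pow N W (int l) * trace_pow N W (int (m - l)))" .
    have "(\<Sum>a<N. \<Sum>b<N. (W ^\<^sub>m m) $$ (a, b) * dir_deriv (trace_pow N W) (\<lambda>k. ipow W k $$ (b, a)) G) =
       (\<Sum>x\<in>?I. (W ^\<^sub>m m) $$ x * dir_deriv (trace_pow N W) (\<lambda>k. ipow W k $$ (snd x, fst x)) G)"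
      unfolding sum.cartesian_product by (intro sum.cong refl) auto
    also have "\<dots> = dir_deriv (trace_pow N W) (\<lambda>k. \<Sum>x\<in>?I. (W ^\<^sub>m m) $$ x * ipow W k $$ (snd x, fst x)) G"
      by (rule dir_deriv_sum[symmetric])
    also have "(\<lambda>k. \<Sum>x\<in>?I. (W ^\<^sub>m m) $$ x * ipow W k $$ (snd x, fst x)) = (\<lambda>k. trace_pow N W (int m + k))"
    proof
      fix k
      have "(\<Sum>x\<in>?I. (W ^\<^sub>m m) $$ x * ipow W k $$ (snd x, fst x)) = mat_tr N (W ^\<^sub>m m * ipow W k)"
        unfolding mat_tr_mult[OF pow_carrier_mat[OF Wc] ipc] sum.cartesian_product by (intro sum.cong refl) auto
      then show "(\<Sum>x\<in>?I. (W ^\<^sub>m m) $$ x * ipow W k $$ (snd x, fst x)) = trace_pow N W (int m + k)"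
        by (simp add: ipow_add_pos[OF W] trace_pow_def)
    qed
    finally have B: "(\<Sum>a<N. \<Sum>b<N. (W ^\<^sub>m m) $$ (a, b) * dir_deriv (trace_pow N W) (\<lambda>k. ipow W k $$ (b, a)) G) = ev (trace_pow N W) (power_field (int m) G)"
      by (simp only: ev_power_field)
    show ?thesis unfolding loop_entry_def sum.distrib sum_distrib_right[symmetric] A B ..
  qed
  then have "(\<integral>W. (\<Sum>a<N. \<Sum>b<N. loop_entry N a b m G a b W) \<partial>\<mu>) =
    (\<integral>W. (\<Sum>l<m. trace_pow N W (int l) * trace_pow N W (int (m - l))) * ev (trace_pow N W) G + ev (trace_pow N W) (power_field (int m) G) \<partial>\<mu>)"
    by (intro Bochner_Integration.integral_cong refl) (simp add: space_haar[OF h])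
  with z show ?thesis by simp
qed

text \<open>Conjugation for families with p_(-k) = cnj p_k; it carries the loop equation of index m
  to the one of index -m.\<close>

primrec conj_expr :: "trace_expr \<Rightarrow> trace_expr" where
  "conj_expr (Cst c) = Cst (cnj c)"
| "conj_expr (Pw k) = Pw (- k)"
| "conj_expr (Add f g) = Add (conj_expr f) (conj_expr g)"
| "conj_expr (Mul f g) = Mul (conj_expr f) (conj_expr g)"
| "conj_expr (Ex f) = Ex (conj_expr f)"

lemma ev_conj_expr: "(\<And>k. p (- k) = cnj (p k)) \<Longrightarrow> ev p (conj_expr f) = cnj (ev p f)"
  by (induction f) (auto simp: exp_cnj)

lemma ev_power_field_conj_expr:
  assumes p: "\<And>k. p (- k) = cnj (p k)"
  shows "ev p (power_field m (conj_expr f)) = - cnj (ev p (power_field (- m) f))"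
proof (induction f)
  case (Pw k)
  have "p (m - k) = cnj (p (- m + k))" using p[of "- m + k"] by simp
  then show ?case by simp
qed (auto simp: ev_conj_expr[of p, OF p] exp_cnj)

lemma ev_carre_du_champ_Cst: "exp_free f \<Longrightarrow> ev p (carre_du_champ f (Cst c)) = 0"
  by (induction f) auto

lemma ev_carre_du_champ_Mul: "exp_free f \<Longrightarrow> ev p (carre_du_champ f (Mul a b)) = ev p a * ev p (carre_du_champ f b) + ev p b * ev p (carre_du_champ f a)"
  by (induction f) (auto simp: algebra_simps)

lemma ev_carre_du_champ_Pw: "exp_free f \<Longrightarrow> ev p (carre_du_champ f (Pw j)) = of_int j * ev p (power_field j f)"
  by (induction f) (auto simp: algebra_simps)

lemma ev_carre_du_champ_Add: "exp_free f \<Longrightarrow> ev p (carre_du_champ f (Add a b)) = ev p (carre_du_champ f a) + ev p (carre_du_champ f b)"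
  by (induction f) (auto simp: algebra_simps)

lemma ev_carre_du_champ_sym: "exp_free f \<Longrightarrow> exp_free g \<Longrightarrow> ev p (carre_du_champ f g) = ev p (carre_du_champ g f)"
  by (induction g) (auto simp: ev_carre_du_champ_Cst ev_carre_du_champ_Mul ev_carre_du_champ_Pw ev_carre_du_champ_Add algebra_simps)

section \<open>Expectations for a fixed matrix size\<close>

locale cue =
  fixes N :: nat and M :: "'a measure" and U :: "'a \<Rightarrow> complex mat" and \<theta> :: "'a \<Rightarrow> nat \<Rightarrow> real"
  assumes N: "N \<ge> 1" and prob: "prob_space M" and haar: "haar_distributed N M U"
    and eig: "\<And>\<omega>. \<omega> \<in> space M \<Longrightarrow> eigenangles N (U \<omega>) (\<theta> \<omega>)"
begin

sublocale prob_space M by (rule prob)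

definition power_sum :: "'a \<Rightarrow> int \<Rightarrow> complex" where "power_sum \<omega> = trace_pow N (U \<omega>)"

lemma U_measurable: "U \<in> measurable M (unitary_borel N)"
  using haar by (simp add: haar_distributed_def)

lemma U_unitary: "\<omega> \<in> space M \<Longrightarrow> U \<omega> \<in> unitary_group N"
  using measurable_space[OF U_measurable] by simp

lemma power_sum_measurable [measurable]: "(\<lambda>\<omega>. power_sum \<omega> k) \<in> borel_measurable M"
  unfolding power_sum_def using bdd_meas_trace_pow[of N k] measurable_compose[OF U_measurable] by (auto simp: bdd_meas_def)

lemma ev_measurable [measurable]: "(\<lambda>\<omega>. ev (power_sum \<omega>) f) \<in> borel_measurable M"
  unfolding power_sum_def using bdd_meas_ev[of N f] measurable_compose[OF U_measurable] by (auto simp: bdd_meas_def)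

lemma ev_bounded: "\<exists>C. \<forall>\<omega>\<in>space M. cmod (ev (power_sum \<omega>) f) \<le> C"
  using bdd_meas_ev[of N f] U_unitary unfolding bdd_meas_def power_sum_def by meson

lemma ev_integrable [simp]: "integrable M (\<lambda>\<omega>. ev (power_sum \<omega>) f)"
proof -
  obtain C where "\<forall>\<omega>\<in>space M. cmod (ev (power_sum \<omega>) f) \<le> C" using ev_bounded by blast
  then show ?thesis by (intro integrable_const_bound[where B=C] AE_I2) auto
qed

lemma power_sum_minus: "\<omega> \<in> space M \<Longrightarrow> power_sum \<omega> (- k) = cnj (power_sum \<omega> k)"
  unfolding power_sum_def by (intro trace_pow_minus unitary_carrier U_unitary)

lemma power_sum_0: "\<omega> \<in> space M \<Longrightarrow> power_sum \<omega> 0 = of_nat N"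
  unfolding power_sum_def by (intro trace_pow_0 unitary_carrier U_unitary)

text \<open>Ties the traces to points of the torus, so that an expression constant on the torus is
  constant on the probability space. The index shift is there because \<open>power_sums\<close>
  counts from 0 and \<open>eigenangles\<close> from 1.\<close>

lemma power_sum_power_sums:
  assumes w: "\<omega> \<in> space M"
  shows "power_sum \<omega> = power_sums N (\<lambda>i. \<theta> \<omega> (Suc i))"
proof
  fix k
  have c: "U \<omega> \<in> carrier_mat N N" using U_unitary[OF w] by (rule unitary_carrier)
  have pos: "power_sum \<omega> (int n) = power_sums N (\<lambda>i. \<theta> \<omega> (Suc i)) (int n)" for n
  proof -
    have "power_sum \<omega> (int n) = (\<Sum>i\<in>{1..N}. cis (real n * \<theta> \<omega> i))"
      unfolding power_sum_def trace_pow_def ipow_def using trace_pow_eigenangles[OF c, of "\<theta> \<omega>" n] eig[OF w] by (simp add: eigenangles_def)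
    also have "\<dots> = power_sums N (\<lambda>i. \<theta> \<omega> (Suc i)) (int n)"
      unfolding power_sums_def by (rule sum.reindex_bij_witness[of _ Suc "\<lambda>i. i - 1"]) auto
    finally show ?thesis .
  qed
  show "power_sum \<omega> k = power_sums N (\<lambda>i. \<theta> \<omega> (Suc i)) k"
  proof (cases "k \<ge> 0")
    case True then show ?thesis using pos[of "nat k"] by simp
  next
    case False
    have "power_sums N (\<lambda>i. \<theta> \<omega> (Suc i)) (- l) = cnj (power_sums N (\<lambda>i. \<theta> \<omega> (Suc i)) l)" for l
      by (simp add: power_sums_def cis_cnj)
    then show ?thesis using pos[of "nat (- k)"] power_sum_minus[OF w, of "- k"] False by (metis add.inverse_inverse nat_0_le neg_0_le_iff_le linear)
  qed
qed

lemma loop_pos: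
  "(\<integral>\<omega>. (\<Sum>l<m. power_sum \<omega> (int l) * power_sum \<omega> (int (m - l))) * ev (power_sum \<omega>) G + ev (power_sum \<omega>) (power_field (int m) G) \<partial>M) = 0"
proof -
  define g where "g W = (\<Sum>l<m. trace_pow N W (int l) * trace_pow N W (int (m - l))) * ev (trace_pow N W) G + ev (trace_pow N W) (power_field (int m) G)" for W
  have "bdd_meas N g" unfolding g_def[abs_def] by (intro bdd_meas_add bdd_meas_mult bdd_meas_sum bdd_meas_trace_pow bdd_meas_ev) auto
  then have gm: "g \<in> borel_measurable (unitary_borel N)" by (simp add: bdd_meas_def)
  have "haar_unitary N (distr M (unitary_borel N) U)" using haar by (simp add: haar_distributed_def)
  then have "(\<integral>W. g W \<partial>distr M (unitary_borel N) U) = 0" unfolding g_def by (rule haar_loop)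
  then have "(\<integral>\<omega>. g (U \<omega>) \<partial>M) = 0" by (subst (asm) integral_distr[OF U_measurable gm])
  then show ?thesis by (simp only: g_def power_sum_def)
qed

text \<open>The substitution of m - l for l brings the loop sum to the range 1, ..., m that occurs
  in \<open>laplacian\<close>.\<close>

lemma loop_laplacian_pos:
  assumes "m \<ge> 1"
  shows "(\<integral>\<omega>. (\<Sum>l\<in>{1..m}. power_sum \<omega> (int l) * power_sum \<omega> (int m - int l)) * ev (power_sum \<omega>) G + ev (power_sum \<omega>) (power_field (int m) G) \<partial>M) = 0"
proof -
  have "(\<Sum>l<m. power_sum \<omega> (int l) * power_sum \<omega> (int (m - l))) = (\<Sum>l\<in>{1..m}. power_sum \<omega> (int l) * power_sum \<omega> (int m - int l))" for \<omega>
    by (rule sum.reindex_bij_witness[of _ "\<lambda>l. m - l" "\<lambda>l. m - l"]) (use assms in \<open>auto simp: of_nat_diff mult.commute\<close>)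
  then show ?thesis using loop_pos[of m G] by simp
qed

lemma loop_laplacian_neg:
  assumes "m \<ge> 1"
  shows "(\<integral>\<omega>. (\<Sum>l\<in>{1..m}. power_sum \<omega> (- int l) * power_sum \<omega> (- int m + int l)) * ev (power_sum \<omega>) G - ev (power_sum \<omega>) (power_field (- int m) G) \<partial>M) = 0"
proof -
  have "(\<integral>\<omega>. cnj ((\<Sum>l\<in>{1..m}. power_sum \<omega> (int l) * power_sum \<omega> (int m - int l)) * ev (power_sum \<omega>) (conj_expr G) + ev (power_sum \<omega>) (power_field (int m) (conj_expr G))) \<partial>M) = cnj 0"
    unfolding loop_laplacian_pos[OF assms, of "conj_expr G", symmetric] by (rule Bochner_Integration.integral_cnj)
  moreover have "cnj ((\<Sum>l\<in>{1..m}. power_sum \<omega> (int l) * power_sum \<omega> (int m - int l)) * ev (power_sum \<omega>) (conj_expr G) + ev (power_sum \<omega>) (power_field (int m) (conj_expr G)))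
     = (\<Sum>l\<in>{1..m}. power_sum \<omega> (- int l) * power_sum \<omega> (- int m + int l)) * ev (power_sum \<omega>) G - ev (power_sum \<omega>) (power_field (- int m) G)" if w: "\<omega> \<in> space M" for \<omega>
  proof -
    have "cnj (power_sum \<omega> (int m - int l)) = power_sum \<omega> (- int m + int l)" for l using power_sum_minus[OF w, of "int m - int l"] by simp
    moreover have "cnj (power_sum \<omega> (int l)) = power_sum \<omega> (- int l)" for l using power_sum_minus[OF w] by simp
    ultimately show ?thesis by (simp add: ev_conj_expr[of "power_sum \<omega>", OF power_sum_minus[OF w]] ev_power_field_conj_expr[of "power_sum \<omega>", OF power_sum_minus[OF w]])
  qed
  ultimately show ?thesis by (simp cong: Bochner_Integration.integral_cong)
qed

text \<open>Integration by parts. For a power sum it is a loop equation multiplied by \<bar>k\<bar>;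
  in a product, one factor at a time is moved into the test function, which is why G is arbitrary in
  the induction.\<close>

lemma loop_laplacian_gen:
  "exp_free f \<Longrightarrow> exp_free G \<Longrightarrow> (\<integral>\<omega>. ev (power_sum \<omega>) (Add (Mul (laplacian f) G) (carre_du_champ f G)) \<partial>M) = 0"
proof (induction f arbitrary: G)
  case (Pw k)
  define n where "n = nat \<bar>k\<bar>"
  have L: "ev (power_sum \<omega>) (laplacian (Pw k)) = of_nat n * (\<Sum>l\<in>{1..n}. power_sum \<omega> (sgn k * int l) * power_sum \<omega> (k - sgn k * int l))" for \<omega>
    by (simp add: ev_expr_sum o_def n_def interv_sum_list_conv_sum_set_nat atLeastLessThanSuc_atLeastAtMost del: upt_Suc)
  consider "k = 0" | "k > 0" | "k < 0" by linarith
  then show ?case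
  proof cases
    case 1 then show ?thesis by (simp add: expr_sum_def)
  next
    case 2
    have k: "k = int n" "sgn k = 1" "n \<ge> 1" using 2 by (auto simp: n_def)
    have L2: "ev (power_sum \<omega>) (laplacian (Pw (int n))) = of_nat n * (\<Sum>l\<in>{1..n}. power_sum \<omega> (int l) * power_sum \<omega> (int n - int l))" for \<omega>
      using L[of \<omega>] unfolding k(2) mult_1 unfolding k(1) .
    have "(\<integral>\<omega>. ev (power_sum \<omega>) (Add (Mul (laplacian (Pw k)) G) (carre_du_champ (Pw k) G)) \<partial>M) =
      (\<integral>\<omega>. of_nat n * ((\<Sum>l\<in>{1..n}. power_sum \<omega> (int l) * power_sum \<omega> (int n - int l)) * ev (power_sum \<omega>) G + ev (power_sum \<omega>) (power_field (int n) G)) \<partial>M)"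
      by (rule Bochner_Integration.integral_cong[OF refl]) (simp add: L2 k(1) algebra_simps del: laplacian.simps(2))
    also have "\<dots> = 0" by (subst integral_mult_right_zero) (simp only: loop_laplacian_pos[OF k(3)] mult_zero_right)
    finally show ?thesis .
  next
    case 3
    have k: "k = - int n" "sgn k = -1" "n \<ge> 1" using 3 by (auto simp: n_def)
    have L2: "ev (power_sum \<omega>) (laplacian (Pw (- int n))) = of_nat n * (\<Sum>l\<in>{1..n}. power_sum \<omega> (- int l) * power_sum \<omega> (- int n + int l))" for \<omega>
      using L[of \<omega>] unfolding k(2) unfolding k(1) by (simp del: laplacian.simps(2))
    have "(\<integral>\<omega>. ev (power_sum \<omega>) (Add (Mul (laplacian (Pw k)) G) (carre_du_champ (Pw k) G)) \<partial>M) =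
      (\<integral>\<omega>. of_nat n * ((\<Sum>l\<in>{1..n}. power_sum \<omega> (- int l) * power_sum \<omega> (- int n + int l)) * ev (power_sum \<omega>) G - ev (power_sum \<omega>) (power_field (- int n) G)) \<partial>M)"
      by (rule Bochner_Integration.integral_cong[OF refl]) (simp add: L2 k(1) algebra_simps del: laplacian.simps(2))
    also have "\<dots> = 0" by (subst integral_mult_right_zero) (simp only: loop_laplacian_neg[OF k(3)] mult_zero_right)
    finally show ?thesis .
  qed
next
  case (Add a b)
  have p: "exp_free a" "exp_free b" using Add.prems by auto
  have "(\<integral>\<omega>. ev (power_sum \<omega>) (Add (Mul (laplacian (Add a b)) G) (carre_du_champ (Add a b) G)) \<partial>M) =
    (\<integral>\<omega>. ev (power_sum \<omega>) (Add (Mul (laplacian a) G) (carre_du_champ a G)) + ev (power_sum \<omega>) (Add (Mul (laplacian b) G) (carre_du_champ b G)) \<partial>M)"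
    by (rule Bochner_Integration.integral_cong[OF refl]) (simp add: algebra_simps)
  also have "\<dots> = 0"
    unfolding Bochner_Integration.integral_add[OF ev_integrable ev_integrable] Add.IH(1)[OF p(1) Add.prems(2)] Add.IH(2)[OF p(2) Add.prems(2)] by simp
  finally show ?case .
next
  case (Mul a b)
  have p: "exp_free a" "exp_free b" using Mul.prems by auto
  have pG: "exp_free (Mul b G)" "exp_free (Mul a G)" using p Mul.prems by auto
  have "(\<integral>\<omega>. ev (power_sum \<omega>) (Add (Mul (laplacian (Mul a b)) G) (carre_du_champ (Mul a b) G)) \<partial>M) =
    (\<integral>\<omega>. ev (power_sum \<omega>) (Add (Mul (laplacian a) (Mul b G)) (carre_du_champ a (Mul b G))) + ev (power_sum \<omega>) (Add (Mul (laplacian b) (Mul a G)) (carre_du_champ b (Mul a G))) \<partial>M)"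
    by (rule Bochner_Integration.integral_cong[OF refl])
      (simp add: ev_carre_du_champ_Mul[OF p(1)] ev_carre_du_champ_Mul[OF p(2)] ev_carre_du_champ_sym[OF p(2,1)] algebra_simps)
  also have "\<dots> = 0"
    unfolding Bochner_Integration.integral_add[OF ev_integrable ev_integrable] Mul.IH(1)[OF p(1) pG(1)] Mul.IH(2)[OF p(2) pG(2)] by simp
  finally show ?case .
qed auto

text \<open>Expectation satisfies the characterisation in \<open>expectation_S\<close>; it vanishes
  on Laplacians by integration by parts against the constant 1.\<close>

theorem expectation_exp_free:
  assumes "exp_free f"
  shows "(\<integral>\<omega>. ev (power_sum \<omega>) f \<partial>M) = S N f (antisym_delta N int) int"
proof (rule expectation_S[OF _ _ _ _ assms])
  show "(\<integral>\<omega>. ev (power_sum \<omega>) (Add f g) \<partial>M) = (\<integral>\<omega>. ev (power_sum \<omega>) f \<partial>M) + (\<integral>\<omega>. ev (power_sum \<omega>) g \<partial>M)" for f g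
    unfolding ev.simps by (rule Bochner_Integration.integral_add) simp_all
  show "(\<integral>\<omega>. ev (power_sum \<omega>) (Mul (Cst c) f) \<partial>M) = c * (\<integral>\<omega>. ev (power_sum \<omega>) f \<partial>M)" for c f by simp
  show "(\<integral>\<omega>. ev (power_sum \<omega>) (laplacian f) \<partial>M) = 0" if "exp_free f" for f
    using loop_laplacian_gen[OF that, of "Cst 1"] ev_carre_du_champ_Cst[OF that] by simp
  fix f :: trace_expr and C assume C: "\<And>\<theta>. ev (power_sums N \<theta>) f = C"
  have "(\<integral>\<omega>. ev (power_sum \<omega>) f \<partial>M) = (\<integral>\<omega>. C \<partial>M)"
    by (rule Bochner_Integration.integral_cong[OF refl]) (simp only: power_sum_power_sums C)
  then show "(\<integral>\<omega>. ev (power_sum \<omega>) f \<partial>M) = C" by (simp add: prob_space)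
qed

lemma cmod_power_sum_square: "\<omega> \<in> space M \<Longrightarrow> of_real ((cmod (power_sum \<omega> k))\<^sup>2) = power_sum \<omega> k * power_sum \<omega> (- k)"
  by (simp add: power_sum_minus complex_norm_square del: of_real_power)

lemma power_sum_bound: "\<omega> \<in> space M \<Longrightarrow> cmod (power_sum \<omega> k) \<le> real N"
  unfolding power_sum_power_sums power_sums_def by (rule order_trans[OF norm_sum]) simp

lemma integrable_bounded_real:
  "f \<in> borel_measurable M \<Longrightarrow> (\<And>\<omega>. \<omega> \<in> space M \<Longrightarrow> \<bar>f \<omega>\<bar> \<le> C) \<Longrightarrow> integrable M (f :: 'a \<Rightarrow> real)"
  by (rule integrable_const_bound[where B=C]) auto

lemma integral_eq_of_real:
  fixes f :: "'a \<Rightarrow> real" and g :: "'a \<Rightarrow> complex"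
  assumes "\<And>\<omega>. \<omega> \<in> space M \<Longrightarrow> of_real (f \<omega>) = g \<omega>" "(\<integral>\<omega>. g \<omega> \<partial>M) = of_real c"
  shows "(\<integral>\<omega>. f \<omega> \<partial>M) = (c :: real)"
proof -
  have "complex_of_real (\<integral>\<omega>. f \<omega> \<partial>M) = (\<integral>\<omega>. complex_of_real (f \<omega>) \<partial>M)" by simp
  also have "\<dots> = (\<integral>\<omega>. g \<omega> \<partial>M)" by (rule Bochner_Integration.integral_cong[OF refl]) (simp add: assms(1))
  finally show ?thesis using assms(2) by simp
qed

theorem second_moment:
  assumes "m \<ge> 1"
  shows "(\<integral>\<omega>. (cmod (power_sum \<omega> (int m)))\<^sup>2 \<partial>M) = real (min m N)"
proof (rule integral_eq_of_real)
  show "of_real ((cmod (power_sum \<omega> (int m)))\<^sup>2) = ev (power_sum \<omega>) (Mul (Pw (int m)) (Pw (- int m)))" if "\<omega> \<in> space M" for \<omega>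
    using cmod_power_sum_square[OF that] by simp
  show "(\<integral>\<omega>. ev (power_sum \<omega>) (Mul (Pw (int m)) (Pw (- int m))) \<partial>M) = complex_of_real (real (min m N))"
    by (subst expectation_exp_free) (simp_all only: S_second_moment[OF assms] exp_free.simps of_real_of_nat_eq simp_thms)
qed

theorem fourth_moment:
  assumes kj: "k \<ge> 1" "j \<ge> 1"
  shows "(\<integral>\<omega>. (cmod (power_sum \<omega> (int k)))\<^sup>2 * (cmod (power_sum \<omega> (int j)))\<^sup>2 \<partial>M) \<le> (if j = k then 2 else 1) * (real (min k N) * real (min j N)) + real (min (j + k) N)"
    and "j < k \<Longrightarrow> j + k \<le> N \<Longrightarrow> (\<integral>\<omega>. (cmod (power_sum \<omega> (int k)))\<^sup>2 * (cmod (power_sum \<omega> (int j)))\<^sup>2 \<partial>M) = real j * real k"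
proof -
  let ?F = "Mul (Mul (Pw (int k)) (Pw (int j))) (Mul (Pw (- int k)) (Pw (- int j)))"
  obtain r where r: "S N ?F (antisym_delta N int) int = of_nat r" "r \<le> (if j = k then 2 else 1) * (min k N * min j N) + min (j + k) N"
    "j < k \<and> j + k \<le> N \<longrightarrow> r = j * k"
    using S_fourth_moment[OF kj, of N] by blast
  have e: "(\<integral>\<omega>. (cmod (power_sum \<omega> (int k)))\<^sup>2 * (cmod (power_sum \<omega> (int j)))\<^sup>2 \<partial>M) = real r"
  proof (rule integral_eq_of_real)
    show "of_real ((cmod (power_sum \<omega> (int k)))\<^sup>2 * (cmod (power_sum \<omega> (int j)))\<^sup>2) = ev (power_sum \<omega>) ?F" if "\<omega> \<in> space M" for \<omega>
      unfolding of_real_mult cmod_power_sum_square[OF that] ev.simps by (simp only: ac_simps)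
    show "(\<integral>\<omega>. ev (power_sum \<omega>) ?F \<partial>M) = complex_of_real (real r)"
      by (subst expectation_exp_free) (simp_all only: r(1) exp_free.simps of_real_of_nat_eq simp_thms)
  qed
  show "j < k \<Longrightarrow> j + k \<le> N \<Longrightarrow> (\<integral>\<omega>. (cmod (power_sum \<omega> (int k)))\<^sup>2 * (cmod (power_sum \<omega> (int j)))\<^sup>2 \<partial>M) = real j * real k"
    using e r(3) by simp
  have "real r \<le> real ((if j = k then 2 else 1) * (min k N * min j N) + min (j + k) N)" using r(2) by (simp only: of_nat_le_iff)
  then show "(\<integral>\<omega>. (cmod (power_sum \<omega> (int k)))\<^sup>2 * (cmod (power_sum \<omega> (int j)))\<^sup>2 \<partial>M) \<le> (if j = k then 2 else 1) * (real (min k N) * real (min j N)) + real (min (j + k) N)"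
    unfolding e by (simp split: if_splits)
qed

end

section \<open>Tail variance and the Stein identity\<close>

lemma sum_inverse_squares_le:
  assumes "1 \<le> K" "K \<le> R"
  shows "(\<Sum>k\<in>{K<..R}. 1 / (real k)\<^sup>2) \<le> 1 / real K - 1 / real R"
  using assms(2)
proof (induction R rule: dec_induct)
  case base then show ?case by simp
next
  case (step R)
  have R: "real R > 0" using step assms by simp
  have e: "{K<..Suc R} = insert (Suc R) {K<..R}" using step by auto
  have "1 / (real (Suc R))\<^sup>2 \<le> 1 / real R - 1 / real (Suc R)"
  proof -
    have "1 / (real (Suc R))\<^sup>2 \<le> 1 / (real R * real (Suc R))"
      using R unfolding power2_eq_square by (intro divide_left_mono mult_right_mono) auto
    also have "\<dots> = 1 / real R - 1 / real (Suc R)" using R by (simp add: field_simps)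
    finally show ?thesis .
  qed
  then show ?case using step.IH unfolding e by simp
qed

lemma sum_inverse_squares_le': "1 \<le> K \<Longrightarrow> (\<Sum>k\<in>{K<..R}. 1 / (real k)\<^sup>2) \<le> 1 / real K"
  using sum_inverse_squares_le[of K R] by (cases "K \<le> R") (auto intro: order_trans)

text \<open>The range starts at N/2 because one of two indices with j + k > N exceeds N/2. The
  factor 4 comes from N \<le> 4 (N div 2) for N \<ge> 2.\<close>

lemma sum_inverse_squares_half:
  assumes "N \<ge> 1"
  shows "(\<Sum>k\<in>{N div 2<..R}. 1 / (real k)\<^sup>2) \<le> 4 / real N"
proof (cases "N = 1")
  case True
  have "(\<Sum>k\<in>{0<..R}. 1 / (real k)\<^sup>2) \<le> (\<Sum>k\<in>insert 1 {1<..R}. 1 / (real k)\<^sup>2)"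
    by (rule sum_mono2) auto
  also have "\<dots> \<le> 1 + 1" using sum_inverse_squares_le'[of 1 R] by simp
  finally show ?thesis using True by simp
next
  case False
  then have "N div 2 \<ge> 1" using assms by simp
  then have "(\<Sum>k\<in>{N div 2<..R}. 1 / (real k)\<^sup>2) \<le> 1 / real (N div 2)" by (rule sum_inverse_squares_le')
  also have "\<dots> \<le> 4 / real N"
  proof -
    have "N \<le> 4 * (N div 2)" using \<open>N div 2 \<ge> 1\<close> by linarith
    then have "real N \<le> 4 * real (N div 2)" by linarith
    then show ?thesis using \<open>N div 2 \<ge> 1\<close> assms by (simp add: field_simps)
  qed
  finally show ?thesis .
qed

text \<open>The first factor bounds the number of remainder terms: at most K from the products p_l
  p_(m-l) and at most 2K, weighted by \<bar>t\<bar>, from the derivative of the exponent. The second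
  bounds the mean modulus of a product of three power sums with indices up to 2K.\<close>

definition stein_const :: "nat \<Rightarrow> real \<Rightarrow> real" where
  "stein_const K t = (real K + 2 * real K * \<bar>t\<bar>) * (2 * (real (2 * K))\<^sup>2 + 3 * real (2 * K))"

section \<open>Covariances of the squared power sums\<close>

context cue
begin

definition power_sum_sq :: "nat \<Rightarrow> 'a \<Rightarrow> real" where "power_sum_sq k \<omega> = (cmod (power_sum \<omega> (int k)))\<^sup>2"

definition mean_sq :: "nat \<Rightarrow> real" where "mean_sq k = real (min k N)"

lemma power_sum_sq_measurable [measurable]: "power_sum_sq k \<in> borel_measurable M"
  unfolding power_sum_sq_def[abs_def] by measurable

lemma power_sum_sq_nonneg [simp]: "power_sum_sq k \<omega> \<ge> 0" by (simp add: power_sum_sq_def)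

lemma power_sum_sq_bound: "\<omega> \<in> space M \<Longrightarrow> power_sum_sq k \<omega> \<le> (real N)\<^sup>2"
  unfolding power_sum_sq_def using power_sum_bound by (intro power_mono) auto

lemma power_sum_sq_integrable [simp]: "integrable M (power_sum_sq k)"
  by (rule integrable_bounded_real[where C="(real N)\<^sup>2"]) (use power_sum_sq_bound in \<open>auto simp: abs_of_nonneg\<close>)

lemma power_sum_sq_mult_integrable [simp]: "integrable M (\<lambda>\<omega>. power_sum_sq k \<omega> * power_sum_sq j \<omega>)"
proof (rule integrable_bounded_real[where C="(real N)\<^sup>2 * (real N)\<^sup>2"])
  fix \<omega> assume "\<omega> \<in> space M"
  then have "power_sum_sq k \<omega> * power_sum_sq j \<omega> \<le> (real N)\<^sup>2 * (real N)\<^sup>2" by (intro mult_mono power_sum_sq_bound) auto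
  then show "\<bar>power_sum_sq k \<omega> * power_sum_sq j \<omega>\<bar> \<le> (real N)\<^sup>2 * (real N)\<^sup>2" by (simp only: abs_of_nonneg mult_nonneg_nonneg power_sum_sq_nonneg)
qed measurable

lemma expectation_power_sum_sq: "k \<ge> 1 \<Longrightarrow> expectation (power_sum_sq k) = mean_sq k"
  unfolding power_sum_sq_def[abs_def] mean_sq_def by (rule second_moment)

text \<open>On the diagonal the variance is at most k^2 + 2 k^2. Off the diagonal it is zero for j +
  k \<le> N and at most N otherwise; the indicators record which index exceeds N/2, so that the
  bound splits into terms depending on a single index and double sums factorise.\<close>

lemma cov_bound:
  assumes kj: "k \<ge> 1" "j \<ge> 1"
  shows "expectation (\<lambda>\<omega>. (power_sum_sq j \<omega> - mean_sq j) * (power_sum_sq k \<omega> - mean_sq k)) \<le>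
     (if j = k then 3 * (real k)\<^sup>2 else (of_bool (N < 2 * k) + of_bool (N < 2 * j)) * real N)"
proof -
  have "(\<lambda>\<omega>. (power_sum_sq j \<omega> - mean_sq j) * (power_sum_sq k \<omega> - mean_sq k)) = (\<lambda>\<omega>. power_sum_sq k \<omega> * power_sum_sq j \<omega> - mean_sq k * power_sum_sq j \<omega> - mean_sq j * power_sum_sq k \<omega> + mean_sq j * mean_sq k)"
    by (auto simp: algebra_simps)
  then have e: "expectation (\<lambda>\<omega>. (power_sum_sq j \<omega> - mean_sq j) * (power_sum_sq k \<omega> - mean_sq k)) = expectation (\<lambda>\<omega>. power_sum_sq k \<omega> * power_sum_sq j \<omega>) - mean_sq j * mean_sq k"
    using kj by (simp add: expectation_power_sum_sq prob_space)
  have f: "expectation (\<lambda>\<omega>. power_sum_sq k \<omega> * power_sum_sq j \<omega>) \<le> (if j = k then 2 else 1) * (mean_sq k * mean_sq j) + real (min (j + k) N)"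
    unfolding power_sum_sq_def mean_sq_def by (rule fourth_moment(1)[OF kj])
  show ?thesis
  proof (cases "j = k")
    case True
    have "mean_sq k * mean_sq k \<le> real k * real k" by (intro mult_mono) (auto simp: mean_sq_def)
    moreover have "real (min (j + k) N) \<le> 2 * (real k * real k)"
    proof -
      have "min (j + k) N \<le> 2 * (k * k)" using True kj le_square[of k] by linarith
      then have "real (min (j + k) N) \<le> real (2 * (k * k))" by (simp only: of_nat_le_iff)
      then show ?thesis by simp
    qed
    ultimately show ?thesis using e f True by (simp add: power2_eq_square)
  next
    case False
    show ?thesis
    proof (cases "j + k \<le> N")
      case le: True
      have "expectation (\<lambda>\<omega>. power_sum_sq k \<omega> * power_sum_sq j \<omega>) = real j * real k"
      proof (cases "j < k")
        case True then show ?thesis unfolding power_sum_sq_def by (rule fourth_moment(2)[OF kj _ le])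
      next
        case F: False
        then have "expectation (\<lambda>\<omega>. power_sum_sq j \<omega> * power_sum_sq k \<omega>) = real k * real j"
          unfolding power_sum_sq_def using fourth_moment(2)[of j k] kj le False by (simp add: add.commute)
        then show ?thesis by (simp add: mult.commute)
      qed
      then show ?thesis using e le False by (simp add: mean_sq_def)
    next
      case gt: False
      then have "N < 2 * k \<or> N < 2 * j" by linarith
      then show ?thesis using e f False by (auto simp: mult.commute)
    qed
  qed
qed

text \<open>11 = 3 + 2 * 4. The diagonal yields 3/K. Off the diagonal, N times the sum of 1/k^2 over
  k > N/2 is at most 4 for every N, and the sum over the other index is at most 1/K.\<close>

lemma tail_variance:
  assumes K: "K \<ge> 1"
  shows "expectation (\<lambda>\<omega>. (\<Sum>k\<in>{K<..R}. (power_sum_sq k \<omega> - mean_sq k) / (real k)\<^sup>2)\<^sup>2) \<le> 11 / real K"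
proof -
  let ?I = "{K<..R}"
  let ?a = "\<lambda>k. 1 / (real k)\<^sup>2"
  let ?h = "\<lambda>k. of_bool (N < 2 * k) * real N :: real"
  let ?c = "\<lambda>j k. expectation (\<lambda>\<omega>. (power_sum_sq j \<omega> - mean_sq j) * (power_sum_sq k \<omega> - mean_sq k))"
  have int: "integrable M (\<lambda>\<omega>. (power_sum_sq j \<omega> - mean_sq j) * (power_sum_sq k \<omega> - mean_sq k))" for j k
    by (simp add: algebra_simps)
  have "(\<lambda>\<omega>. (\<Sum>k\<in>?I. (power_sum_sq k \<omega> - mean_sq k) / (real k)\<^sup>2)\<^sup>2) = (\<lambda>\<omega>. \<Sum>j\<in>?I. \<Sum>k\<in>?I. ?a j * ?a k * ((power_sum_sq j \<omega> - mean_sq j) * (power_sum_sq k \<omega> - mean_sq k)))"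
    unfolding power2_eq_square[of "sum _ _"] sum_product by (intro ext sum.cong refl) (simp add: field_simps)
  then have "expectation (\<lambda>\<omega>. (\<Sum>k\<in>?I. (power_sum_sq k \<omega> - mean_sq k) / (real k)\<^sup>2)\<^sup>2) = (\<Sum>j\<in>?I. \<Sum>k\<in>?I. ?a j * ?a k * ?c j k)"
    using int by (simp add: Bochner_Integration.integral_sum)
  also have "\<dots> \<le> (\<Sum>j\<in>?I. \<Sum>k\<in>?I. (if j = k then 3 * ?a k else 0) + (?a j * (?h k * ?a k) + ?h j * ?a j * ?a k))"
  proof (intro sum_mono)
    fix j k assume jk: "j \<in> ?I" "k \<in> ?I"
    then have p: "real j > 0" "real k > 0" by auto
    have "?a j * ?a k * ?c j k \<le> ?a j * ?a k * (if j = k then 3 * (real k)\<^sup>2 else (of_bool (N < 2 * k) + of_bool (N < 2 * j)) * real N)"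
      using jk by (intro mult_left_mono cov_bound) auto
    also have "\<dots> \<le> (if j = k then 3 * ?a k else 0) + (?a j * (?h k * ?a k) + ?h j * ?a j * ?a k)"
      using p by (cases "j = k") (auto simp: field_simps)
    finally show "?a j * ?a k * ?c j k \<le> (if j = k then 3 * ?a k else 0) + (?a j * (?h k * ?a k) + ?h j * ?a j * ?a k)" .
  qed
  also have "\<dots> = 3 * (\<Sum>k\<in>?I. ?a k) + 2 * ((\<Sum>j\<in>?I. ?a j) * (\<Sum>k\<in>?I. ?h k * ?a k))"
  proof -
    have a1: "(\<Sum>j\<in>?I. \<Sum>k\<in>?I. (if j = k then 3 * ?a k else 0)) = 3 * (\<Sum>k\<in>?I. ?a k)"
      unfolding sum_distrib_left by (intro sum.cong refl) (simp add: sum.delta')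
    have a2: "(\<Sum>j\<in>?I. \<Sum>k\<in>?I. ?a j * (?h k * ?a k)) = (\<Sum>j\<in>?I. ?a j) * (\<Sum>k\<in>?I. ?h k * ?a k)"
      by (rule sum_product[symmetric])
    have a3: "(\<Sum>j\<in>?I. \<Sum>k\<in>?I. ?h j * ?a j * ?a k) = (\<Sum>k\<in>?I. ?h k * ?a k) * (\<Sum>j\<in>?I. ?a j)"
      by (rule sum_product[symmetric])
    have r: "3 * x + (x * y + y * x) = 3 * x + 2 * (x * y)" for x y :: real by simp
    show ?thesis unfolding sum.distrib a1 a2 a3 by (rule r)
  qed
  also have "\<dots> \<le> 3 * (1 / real K) + 2 * ((1 / real K) * 4)"
  proof -
    have s: "(\<Sum>k\<in>?I. ?a k) \<le> 1 / real K" by (rule sum_inverse_squares_le'[OF K])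
    have "(\<Sum>k\<in>?I. ?h k * ?a k) = real N * (\<Sum>k\<in>?I. of_bool (N < 2 * k) * ?a k)"
      unfolding sum_distrib_left by (intro sum.cong refl) (simp add: ac_simps)
    also have "(\<Sum>k\<in>?I. of_bool (N < 2 * k) * ?a k) = (\<Sum>k\<in>?I \<inter> {k. N < 2 * k}. ?a k)"
    proof -
      have "(\<Sum>k\<in>?I. of_bool (N < 2 * k) * ?a k) = (\<Sum>k\<in>?I. if k \<in> {k. N < 2 * k} then ?a k else 0)"
        by (intro sum.cong refl) auto
      also have "\<dots> = (\<Sum>k\<in>?I \<inter> {k. N < 2 * k}. ?a k)" by (rule sum.inter_restrict[symmetric]) simp
      finally show ?thesis .
    qed
    also have "\<dots> \<le> (\<Sum>k\<in>{N div 2<..R}. ?a k)"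
      by (rule sum_mono2) auto
    also have "\<dots> \<le> 4 / real N" by (rule sum_inverse_squares_half[OF N])
    finally have "(\<Sum>k\<in>?I. ?h k * ?a k) \<le> 4" using N by (simp add: field_simps)
    then have "(\<Sum>j\<in>?I. ?a j) * (\<Sum>k\<in>?I. ?h k * ?a k) \<le> (1 / real K) * 4"
      using s by (intro mult_mono) (auto intro!: sum_nonneg)
    then show ?thesis using s by linarith
  qed
  finally show ?thesis by simp
qed

text \<open>The inequality x y \<le> x^2 + y^2 with x = |p_a p_b| and y = |p_c| leaves a fourth
  moment, at most 2 L^2 + 2 L, and a second moment, at most L. Nonzero indices keep the bound free
  of N, since p_0 = N.\<close>

lemma integral_triple_bound:
  assumes a: "a \<noteq> 0" "b \<noteq> 0" "c \<noteq> 0" "\<bar>a\<bar> \<le> int L" "\<bar>b\<bar> \<le> int L" "\<bar>c\<bar> \<le> int L"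
  shows "expectation (\<lambda>\<omega>. cmod (power_sum \<omega> a * power_sum \<omega> b * power_sum \<omega> c)) \<le> 2 * (real L)\<^sup>2 + 3 * real L"
    and "integrable M (\<lambda>\<omega>. cmod (power_sum \<omega> a * power_sum \<omega> b * power_sum \<omega> c))"
proof -
  have qa: "(cmod (power_sum \<omega> x))\<^sup>2 = power_sum_sq (nat \<bar>x\<bar>) \<omega>" if "\<omega> \<in> space M" for x \<omega>
  proof (cases "x \<ge> 0")
    case False
    then have "power_sum \<omega> x = cnj (power_sum \<omega> (int (nat \<bar>x\<bar>)))" using power_sum_minus[OF that, of "- x"] by simp
    then show ?thesis by (simp add: power_sum_sq_def)
  qed (simp add: power_sum_sq_def)
  let ?a = "nat \<bar>a\<bar>" let ?b = "nat \<bar>b\<bar>" let ?c = "nat \<bar>c\<bar>"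
  have pos: "?a \<ge> 1" "?b \<ge> 1" "?c \<ge> 1" and le: "?a \<le> L" "?b \<le> L" "?c \<le> L" using a by auto
  have pt: "cmod (power_sum \<omega> a * power_sum \<omega> b * power_sum \<omega> c) \<le> power_sum_sq ?a \<omega> * power_sum_sq ?b \<omega> + power_sum_sq ?c \<omega>" if w: "\<omega> \<in> space M" for \<omega>
  proof -
    have am: "x * y \<le> x\<^sup>2 + y\<^sup>2" if "x \<ge> 0" "y \<ge> 0" for x y :: real
      using sum_squares_bound[of x y] that mult_nonneg_nonneg[OF that] by linarith
    have "cmod (power_sum \<omega> a * power_sum \<omega> b * power_sum \<omega> c) = cmod (power_sum \<omega> a * power_sum \<omega> b) * cmod (power_sum \<omega> c)" by (simp add: norm_mult)
    also have "\<dots> \<le> (cmod (power_sum \<omega> a * power_sum \<omega> b))\<^sup>2 + (cmod (power_sum \<omega> c))\<^sup>2" by (rule am) auto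
    finally show ?thesis by (simp add: norm_mult power_mult_distrib qa[OF w])
  qed
  show i: "integrable M (\<lambda>\<omega>. cmod (power_sum \<omega> a * power_sum \<omega> b * power_sum \<omega> c))"
    using ev_integrable[of "Mul (Mul (Pw a) (Pw b)) (Pw c)"] by (intro integrable_norm) simp
  have "expectation (\<lambda>\<omega>. cmod (power_sum \<omega> a * power_sum \<omega> b * power_sum \<omega> c)) \<le> expectation (\<lambda>\<omega>. power_sum_sq ?a \<omega> * power_sum_sq ?b \<omega> + power_sum_sq ?c \<omega>)"
    by (rule integral_mono[OF i]) (use pt in auto)
  also have "\<dots> = expectation (\<lambda>\<omega>. power_sum_sq ?a \<omega> * power_sum_sq ?b \<omega>) + mean_sq ?c" using pos by (simp add: expectation_power_sum_sq)
  also have "expectation (\<lambda>\<omega>. power_sum_sq ?a \<omega> * power_sum_sq ?b \<omega>) \<le> (if ?b = ?a then 2 else 1) * (real (min ?a N) * real (min ?b N)) + real (min (?b + ?a) N)"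
    unfolding power_sum_sq_def by (rule fourth_moment(1)[OF pos(1,2)])
  also have "\<dots> \<le> 2 * (real L * real L) + 2 * real L"
  proof (rule add_mono)
    have "real (min ?a N) * real (min ?b N) \<le> real L * real L" using le by (intro mult_mono) auto
    moreover have "real (min ?a N) * real (min ?b N) \<ge> 0" by simp
    ultimately show "(if ?b = ?a then 2 else 1) * (real (min ?a N) * real (min ?b N)) \<le> 2 * (real L * real L)" by (simp only: split: if_splits) linarith
    show "real (min (?b + ?a) N) \<le> 2 * real L" using le by linarith
  qed
  also have "mean_sq ?c \<le> real L" using le by (simp add: mean_sq_def)
  finally show "expectation (\<lambda>\<omega>. cmod (power_sum \<omega> a * power_sum \<omega> b * power_sum \<omega> c)) \<le> 2 * (real L)\<^sup>2 + 3 * real L"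
    by (simp add: power2_eq_square)
qed

lemma integral_norm_sum_bound:
  fixes A :: "nat set" and c :: "nat \<Rightarrow> complex" and h :: "nat \<Rightarrow> 'a \<Rightarrow> complex"
  assumes that: "finite A" "\<And>k. k \<in> A \<Longrightarrow> integrable M (h k)" "\<And>k. k \<in> A \<Longrightarrow> (\<integral>\<omega>. cmod (h k \<omega>) \<partial>M) \<le> B"
    "\<And>k. k \<in> A \<Longrightarrow> cmod (c k) \<le> 1"
  shows "(\<integral>\<omega>. cmod (\<Sum>k\<in>A. c k * h k \<omega>) \<partial>M) \<le> real (card A) * B"
proof -
  have "(\<integral>\<omega>. cmod (\<Sum>k\<in>A. c k * h k \<omega>) \<partial>M) \<le> (\<integral>\<omega>. (\<Sum>k\<in>A. cmod (h k \<omega>)) \<partial>M)"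
  proof (rule integral_mono)
    show "integrable M (\<lambda>\<omega>. cmod (\<Sum>k\<in>A. c k * h k \<omega>))" using that by (intro integrable_norm Bochner_Integration.integrable_sum integrable_mult_right) auto
    show "integrable M (\<lambda>\<omega>. \<Sum>k\<in>A. cmod (h k \<omega>))" using that by (intro Bochner_Integration.integrable_sum integrable_norm) auto
    fix \<omega>
    have "cmod (\<Sum>k\<in>A. c k * h k \<omega>) \<le> (\<Sum>k\<in>A. cmod (c k * h k \<omega>))" by (rule norm_sum)
    also have "\<dots> \<le> (\<Sum>k\<in>A. cmod (h k \<omega>))" using that(4) by (intro sum_mono) (auto simp: norm_mult mult_left_le_one_le)
    finally show "cmod (\<Sum>k\<in>A. c k * h k \<omega>) \<le> (\<Sum>k\<in>A. cmod (h k \<omega>))" .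
  qed
  also have "\<dots> = (\<Sum>k\<in>A. \<integral>\<omega>. cmod (h k \<omega>) \<partial>M)"
    using that by (intro Bochner_Integration.integral_sum integrable_norm) auto
  also have "\<dots> \<le> (\<Sum>k\<in>A. B)" using that by (intro sum_mono) auto
  finally show ?thesis by simp
qed

section \<open>The truncated series in the loop equation\<close>

definition trunc_area :: "nat \<Rightarrow> 'a \<Rightarrow> real" where
  "trunc_area K \<omega> = (\<Sum>k\<in>{1..K}. power_sum_sq k \<omega> / (real k)\<^sup>2)"

definition trunc_char :: "nat \<Rightarrow> real \<Rightarrow> complex" where
  "trunc_char K t = (\<integral>\<omega>. exp (\<i> * of_real (t * trunc_area K \<omega>)) \<partial>M)"

definition trunc_expr :: "nat \<Rightarrow> trace_expr" where
  "trunc_expr K = expr_sum (map (\<lambda>k. Mul (Cst (1 / (of_nat k)\<^sup>2)) (Mul (Pw (int k)) (Pw (- int k)))) [1..<Suc K])"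

lemma ev_trunc_expr: "\<omega> \<in> space M \<Longrightarrow> ev (power_sum \<omega>) (trunc_expr K) = of_real (trunc_area K \<omega>)"
proof -
  assume w: "\<omega> \<in> space M"
  have "ev (power_sum \<omega>) (trunc_expr K) = (\<Sum>k\<in>{1..K}. 1 / (of_nat k)\<^sup>2 * (power_sum \<omega> (int k) * power_sum \<omega> (- int k)))"
    by (simp add: trunc_expr_def ev_expr_sum o_def interv_sum_list_conv_sum_set_nat atLeastLessThanSuc_atLeastAtMost del: upt_Suc)
  also have "\<dots> = (\<Sum>k\<in>{1..K}. of_real (power_sum_sq k \<omega> / (real k)\<^sup>2))"
    by (intro sum.cong refl) (simp only: cmod_power_sum_square[OF w, symmetric] power_sum_sq_def, simp)
  finally show ?thesis by (simp add: trunc_area_def)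
qed

lemma power_field_expr_sum: "ev p (power_field m (expr_sum l)) = (\<Sum>f\<leftarrow>l. ev p (power_field m f))"
  by (induction l) (auto simp: expr_sum_def)

lemma ev_power_field_trunc_expr: "ev p (power_field m (trunc_expr K)) = (\<Sum>k\<in>{1..K}. 1 / of_nat k * (p (m + int k) * p (- int k) - p (int k) * p (m - int k)))"
proof -
  have "ev p (power_field m (trunc_expr K)) = (\<Sum>k\<in>{1..K}. 1 / (of_nat k)\<^sup>2 * (of_nat k * p (m + int k) * p (- int k) + p (int k) * (- of_nat k * p (m - int k))))"
    by (simp add: trunc_expr_def power_field_expr_sum o_def interv_sum_list_conv_sum_set_nat atLeastLessThanSuc_atLeastAtMost del: upt_Suc)
  also have "\<dots> = (\<Sum>k\<in>{1..K}. 1 / of_nat k * (p (m + int k) * p (- int k) - p (int k) * p (m - int k)))"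
    by (intro sum.cong refl) (simp add: power2_eq_square field_simps)
  finally show ?thesis .
qed

definition trunc_iexp :: "nat \<Rightarrow> real \<Rightarrow> 'a \<Rightarrow> complex" where "trunc_iexp K t \<omega> = exp (\<i> * of_real (t * trunc_area K \<omega>))"

lemma norm_trunc_iexp [simp]: "cmod (trunc_iexp K t \<omega>) = 1" by (simp add: trunc_iexp_def norm_exp_eq_Re)

lemma trunc_area_measurable [measurable]: "trunc_area K \<in> borel_measurable M"
  unfolding trunc_area_def[abs_def] by measurable

lemma trunc_iexp_measurable [measurable]: "trunc_iexp K t \<in> borel_measurable M"
  unfolding trunc_iexp_def[abs_def] by measurable

text \<open>The factor p_0 = N occurs exactly three times in the loop equation: at l = 0, in the
  derivative -m p_0 of p_(-m), and at k = m in the derivative of the exponent. These form the main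
  term. All the rest are products of three power sums with nonzero indices, bounded in mean
  independently of N, so division by N makes them small.\<close>

lemma stein_identity:
  assumes m: "1 \<le> m" "m \<le> K"
  shows "cmod ((1 - \<i> * of_real t / of_nat m) * (\<integral>\<omega>. of_real (power_sum_sq m \<omega>) * trunc_iexp K t \<omega> \<partial>M) - of_nat m * trunc_char K t) \<le> stein_const K t / real N"
proof -
  define G where "G = Mul (Pw (- int m)) (Ex (Mul (Cst (\<i> * of_real t)) (trunc_expr K)))"
  define B where "B = 2 * (real (2 * K))\<^sup>2 + 3 * real (2 * K)"
  define rem1 where "rem1 \<omega> = (\<Sum>l\<in>{1..<m}. power_sum \<omega> (int l) * power_sum \<omega> (int (m - l)) * power_sum \<omega> (- int m))" for \<omega>
  define rem2 where "rem2 \<omega> = (\<Sum>k\<in>{1..K}. 1 / of_nat k * (power_sum \<omega> (int m + int k) * power_sum \<omega> (- int k) * power_sum \<omega> (- int m)))" for \<omega>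
  \<comment> \<open>The index k = m is excluded because p_(m-k) is then p_0 and belongs to the main
    term.\<close>
  define rem3 where "rem3 \<omega> = (\<Sum>k\<in>{1..K} - {m}. 1 / of_nat k * (power_sum \<omega> (int k) * power_sum \<omega> (int m - int k) * power_sum \<omega> (- int m)))" for \<omega>
  define rem where "rem \<omega> = rem1 \<omega> + \<i> * of_real t * (rem2 \<omega> - rem3 \<omega>)" for \<omega>
  have int3: "integrable M (\<lambda>\<omega>. power_sum \<omega> a * power_sum \<omega> b * power_sum \<omega> c)" for a b c
    using ev_integrable[of "Mul (Mul (Pw a) (Pw b)) (Pw c)"] by simp
  have irem: "integrable M rem"
    unfolding rem_def[abs_def] rem1_def rem2_def rem3_def by (intro Bochner_Integration.integrable_add Bochner_Integration.integrable_diff Bochner_Integration.integrable_sum integrable_mult_right int3)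
  have eint: "integrable M (\<lambda>\<omega>. f \<omega> * trunc_iexp K t \<omega>)" if "integrable M f" for f
    by (rule Bochner_Integration.integrable_bound[OF that]) (use that in \<open>auto simp: norm_mult\<close>)
  have bd3: "(\<integral>\<omega>. cmod (power_sum \<omega> a * power_sum \<omega> b * power_sum \<omega> c) \<partial>M) \<le> B"
    if "a \<noteq> 0" "b \<noteq> 0" "c \<noteq> 0" "\<bar>a\<bar> \<le> int (2 * K)" "\<bar>b\<bar> \<le> int (2 * K)" "\<bar>c\<bar> \<le> int (2 * K)" for a b c
    unfolding B_def using integral_triple_bound(1)[OF that] by simp
  have B0: "B \<ge> 0" by (simp add: B_def)
  have b1: "(\<integral>\<omega>. cmod (rem1 \<omega>) \<partial>M) \<le> real K * B"
  proof -
    have "(\<integral>\<omega>. cmod (\<Sum>l\<in>{1..<m}. 1 * (power_sum \<omega> (int l) * power_sum \<omega> (int (m - l)) * power_sum \<omega> (- int m))) \<partial>M) \<le> real (card {1..<m}) * B"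
      by (rule integral_norm_sum_bound[where h="\<lambda>l \<omega>. power_sum \<omega> (int l) * power_sum \<omega> (int (m - l)) * power_sum \<omega> (- int m)" and c="\<lambda>_. 1"]) (use m in \<open>auto intro!: int3 bd3\<close>)
    also have "\<dots> \<le> real K * B" using m B0 by (intro mult_right_mono) auto
    finally show ?thesis by (simp add: rem1_def)
  qed
  have b2: "(\<integral>\<omega>. cmod (rem2 \<omega>) \<partial>M) \<le> real K * B"
  proof -
    have "(\<integral>\<omega>. cmod (rem2 \<omega>) \<partial>M) \<le> real (card {1..K}) * B" unfolding rem2_def
      by (rule integral_norm_sum_bound[where h="\<lambda>k \<omega>. power_sum \<omega> (int m + int k) * power_sum \<omega> (- int k) * power_sum \<omega> (- int m)" and c="\<lambda>k. 1 / of_nat k"])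
        (use m in \<open>auto intro!: int3 bd3 simp: norm_divide divide_le_eq\<close>)
    then show ?thesis by simp
  qed
  have b3: "(\<integral>\<omega>. cmod (rem3 \<omega>) \<partial>M) \<le> real K * B"
  proof -
    have "(\<integral>\<omega>. cmod (rem3 \<omega>) \<partial>M) \<le> real (card ({1..K} - {m})) * B" unfolding rem3_def
      by (rule integral_norm_sum_bound[where h="\<lambda>k \<omega>. power_sum \<omega> (int k) * power_sum \<omega> (int m - int k) * power_sum \<omega> (- int m)" and c="\<lambda>k. 1 / of_nat k"])
        (use m in \<open>auto intro!: int3 bd3 simp: norm_divide divide_le_eq\<close>)
    also have "\<dots> \<le> real K * B" using m B0 by (intro mult_right_mono) auto
    finally show ?thesis .
  qed
  have i123: "integrable M rem1" "integrable M rem2" "integrable M rem3"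
    unfolding rem1_def[abs_def] rem2_def[abs_def] rem3_def[abs_def] by (intro Bochner_Integration.integrable_sum integrable_mult_right int3)+
  have brem: "(\<integral>\<omega>. cmod (rem \<omega>) \<partial>M) \<le> stein_const K t"
  proof -
    have "(\<integral>\<omega>. cmod (rem \<omega>) \<partial>M) \<le> (\<integral>\<omega>. cmod (rem1 \<omega>) + \<bar>t\<bar> * (cmod (rem2 \<omega>) + cmod (rem3 \<omega>)) \<partial>M)"
    proof (rule integral_mono)
      show "integrable M (\<lambda>\<omega>. cmod (rem1 \<omega>) + \<bar>t\<bar> * (cmod (rem2 \<omega>) + cmod (rem3 \<omega>)))"
        using i123 by (intro Bochner_Integration.integrable_add integrable_mult_right integrable_norm)
      fix \<omega>
      have "cmod (rem \<omega>) \<le> cmod (rem1 \<omega>) + cmod (\<i> * of_real t * (rem2 \<omega> - rem3 \<omega>))" unfolding rem_def by (rule norm_triangle_ineq)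
      also have "cmod (\<i> * of_real t * (rem2 \<omega> - rem3 \<omega>)) \<le> \<bar>t\<bar> * (cmod (rem2 \<omega>) + cmod (rem3 \<omega>))"
        by (simp add: norm_mult mult_left_mono norm_triangle_ineq4)
      finally show "cmod (rem \<omega>) \<le> cmod (rem1 \<omega>) + \<bar>t\<bar> * (cmod (rem2 \<omega>) + cmod (rem3 \<omega>))" by simp
    qed (use irem in auto)
    also have "\<dots> = (\<integral>\<omega>. cmod (rem1 \<omega>) \<partial>M) + \<bar>t\<bar> * ((\<integral>\<omega>. cmod (rem2 \<omega>) \<partial>M) + (\<integral>\<omega>. cmod (rem3 \<omega>) \<partial>M))"
      using i123 by simp
    also have "\<dots> \<le> real K * B + \<bar>t\<bar> * (real K * B + real K * B)"
      using b1 b2 b3 by (intro add_mono mult_left_mono) auto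
    finally show ?thesis by (simp add: stein_const_def B_def algebra_simps)
  qed
  have pt: "(\<Sum>l<m. power_sum \<omega> (int l) * power_sum \<omega> (int (m - l))) * ev (power_sum \<omega>) G + ev (power_sum \<omega>) (power_field (int m) G)
     = of_nat N * ((1 - \<i> * of_real t / of_nat m) * (of_real (power_sum_sq m \<omega>) * trunc_iexp K t \<omega>) - of_nat m * trunc_iexp K t \<omega>) + rem \<omega> * trunc_iexp K t \<omega>"
    if w: "\<omega> \<in> space M" for \<omega>
  proof -
    have q: "power_sum \<omega> (int m) * power_sum \<omega> (- int m) = of_real (power_sum_sq m \<omega>)" using cmod_power_sum_square[OF w] by (simp add: power_sum_sq_def)
    have eG: "ev (power_sum \<omega>) G = power_sum \<omega> (- int m) * trunc_iexp K t \<omega>" by (simp add: G_def trunc_iexp_def ev_trunc_expr[OF w] mult.assoc)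
    have "{..<m} = insert 0 {1..<m}" using m by auto
    then have s0: "(\<Sum>l<m. power_sum \<omega> (int l) * power_sum \<omega> (int (m - l))) = of_nat N * power_sum \<omega> (int m) + (\<Sum>l\<in>{1..<m}. power_sum \<omega> (int l) * power_sum \<omega> (int (m - l)))"
      by (simp add: power_sum_0[OF w] del: of_nat_diff)
    have r1: "rem1 \<omega> = (\<Sum>l\<in>{1..<m}. power_sum \<omega> (int l) * power_sum \<omega> (int (m - l))) * power_sum \<omega> (- int m)"
      unfolding rem1_def sum_distrib_right ..
    have shift1: "(\<Sum>l<m. power_sum \<omega> (int l) * power_sum \<omega> (int (m - l))) * ev (power_sum \<omega>) G = (of_nat N * of_real (power_sum_sq m \<omega>) + rem1 \<omega>) * trunc_iexp K t \<omega>"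
      unfolding eG s0 r1 q[symmetric] by (simp only: ring_distribs ac_simps)
    have r3: "(\<Sum>k\<in>{1..K}. 1 / of_nat k * (power_sum \<omega> (int k) * power_sum \<omega> (int m - int k) * power_sum \<omega> (- int m)))
       = of_nat N / of_nat m * of_real (power_sum_sq m \<omega>) + rem3 \<omega>"
      unfolding rem3_def q[symmetric] using m by (subst sum.remove[of _ m]) (auto simp: power_sum_0[OF w] field_simps)
    have "ev (power_sum \<omega>) (power_field (int m) (trunc_expr K)) * power_sum \<omega> (- int m) = rem2 \<omega> - (\<Sum>k\<in>{1..K}. 1 / of_nat k * (power_sum \<omega> (int k) * power_sum \<omega> (int m - int k) * power_sum \<omega> (- int m)))"
      unfolding ev_power_field_trunc_expr rem2_def sum_distrib_right sum_subtractf[symmetric] by (intro sum.cong refl) (simp add: algebra_simps)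
    then have x: "ev (power_sum \<omega>) (power_field (int m) (trunc_expr K)) * power_sum \<omega> (- int m) = rem2 \<omega> - rem3 \<omega> - of_nat N / of_nat m * of_real (power_sum_sq m \<omega>)"
      unfolding r3 by simp
    have "ev (power_sum \<omega>) (power_field (int m) G) = - of_nat m * power_sum \<omega> 0 * trunc_iexp K t \<omega> + \<i> * of_real t * (ev (power_sum \<omega>) (power_field (int m) (trunc_expr K)) * power_sum \<omega> (- int m)) * trunc_iexp K t \<omega>"
      by (simp add: G_def trunc_iexp_def ev_trunc_expr[OF w] algebra_simps)
    then have shift2: "ev (power_sum \<omega>) (power_field (int m) G) = - of_nat m * of_nat N * trunc_iexp K t \<omega> + \<i> * of_real t * (rem2 \<omega> - rem3 \<omega> - of_nat N / of_nat m * of_real (power_sum_sq m \<omega>)) * trunc_iexp K t \<omega>"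
      unfolding x power_sum_0[OF w] .
    show ?thesis unfolding shift1 shift2 rem_def by (simp add: algebra_simps)
  qed
  define J where "J = (1 - \<i> * of_real t / of_nat m) * (\<integral>\<omega>. of_real (power_sum_sq m \<omega>) * trunc_iexp K t \<omega> \<partial>M) - of_nat m * trunc_char K t"
  have ie: "integrable M (trunc_iexp K t)" by (rule integrable_const_bound[where B=1]) auto
  have iq: "integrable M (\<lambda>\<omega>. complex_of_real (power_sum_sq m \<omega>) * trunc_iexp K t \<omega>)" by (intro eint) simp
  have "0 = (\<integral>\<omega>. of_nat N * ((1 - \<i> * of_real t / of_nat m) * (of_real (power_sum_sq m \<omega>) * trunc_iexp K t \<omega>) - of_nat m * trunc_iexp K t \<omega>) + rem \<omega> * trunc_iexp K t \<omega> \<partial>M)"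
    unfolding loop_pos[of m G, symmetric] by (rule Bochner_Integration.integral_cong[OF refl]) (rule pt)
  also have "\<dots> = of_nat N * J + (\<integral>\<omega>. rem \<omega> * trunc_iexp K t \<omega> \<partial>M)"
  proof -
    have pe: "trunc_char K t = (\<integral>\<omega>. trunc_iexp K t \<omega> \<partial>M)" unfolding trunc_char_def trunc_iexp_def ..
    show ?thesis using ie iq eint[OF irem] by (simp add: J_def pe)
  qed
  finally have "of_nat N * J = - (\<integral>\<omega>. rem \<omega> * trunc_iexp K t \<omega> \<partial>M)" by (simp add: eq_neg_iff_add_eq_0)
  then have "real N * cmod J = cmod (\<integral>\<omega>. rem \<omega> * trunc_iexp K t \<omega> \<partial>M)" by (metis norm_minus_cancel norm_mult norm_of_nat)
  also have "\<dots> \<le> (\<integral>\<omega>. cmod (rem \<omega> * trunc_iexp K t \<omega>) \<partial>M)" by (rule integral_norm_bound)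
  also have "\<dots> = (\<integral>\<omega>. cmod (rem \<omega>) \<partial>M)" by (simp add: norm_mult)
  also have "\<dots> \<le> stein_const K t" by (rule brem)
  finally have "cmod J \<le> stein_const K t / real N" using N by (simp add: field_simps)
  then show ?thesis by (simp add: J_def)
qed

end

section \<open>Gaussian integrals\<close>

lemma normal_density_half: "normal_density 0 (sqrt (1 / 2)) x = exp (- x\<^sup>2) / sqrt pi"
  by (simp add: normal_density_def)

lemma gauss_integrable: "integrable lborel (\<lambda>x::real. exp (- x\<^sup>2) * x ^ k)"
proof -
  have "integrable lborel (\<lambda>x. normal_density 0 (sqrt (1 / 2)) x * (x - 0) ^ k)"
    by (rule integrable_normal_moment) simp
  then have "integrable lborel (\<lambda>x. sqrt pi * (normal_density 0 (sqrt (1 / 2)) x * (x - 0) ^ k))"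
    by (rule integrable_mult_right)
  then show ?thesis by (simp add: normal_density_half)
qed

lemma gauss_complex_integrable:
  "integrable lborel (\<lambda>x::real. of_real (x ^ k) * exp ((\<i> * of_real s - 1) * of_real (x\<^sup>2)) :: complex)"
proof (rule Bochner_Integration.integrable_bound[OF gauss_integrable[of k]])
  show "AE x in lborel. cmod (of_real (x ^ k) * exp ((\<i> * of_real s - 1) * of_real (x\<^sup>2))) \<le> norm (exp (- x\<^sup>2) * x ^ k)"
    by (simp add: norm_mult norm_exp_eq_Re norm_power mult.commute abs_mult power_abs)
qed measurable

text \<open>The derivative of x exp (c x^2), with c = i s - 1, integrates to 0 over the
  line.\<close>

lemma gauss_stein:
  defines "g \<equiv> \<lambda>s k. (\<integral>x. of_real (x ^ k) * exp ((\<i> * of_real s - 1) * of_real (x\<^sup>2)) \<partial>lborel) :: complex"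
  shows "g s 0 = 2 * (1 - \<i> * of_real s) * g s 2"
proof -
  let ?c = "\<i> * of_real s - 1 :: complex"
  define F where "F x = of_real x * exp (?c * of_real (x\<^sup>2))" for x :: real
  define f where "f x = of_real (x ^ 0) * exp (?c * of_real (x\<^sup>2)) + 2 * ?c * (of_real (x ^ 2) * exp (?c * of_real (x\<^sup>2)))" for x :: real
  have D: "(F has_vector_derivative f x) (at x)" for x
  proof -
    have "((\<lambda>z. z * exp (?c * z\<^sup>2)) has_field_derivative (exp (?c * (of_real x)\<^sup>2) + of_real x * (exp (?c * (of_real x)\<^sup>2) * (?c * (2 * of_real x))))) (at (of_real x))"
      by (auto intro!: derivative_eq_intros)
    from has_vector_derivative_real_field[OF this] show ?thesis
      unfolding F_def[abs_def] f_def by (simp add: power2_eq_square algebra_simps)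
  qed
  have "integrable lborel f" unfolding f_def
    by (intro Bochner_Integration.integrable_add integrable_mult_right gauss_complex_integrable)
  then have fint: "set_integrable lborel (einterval (- \<infinity>) \<infinity>) f" by (simp add: set_integrable_def)
  have nF: "norm (F x) = norm (x * exp (- x\<^sup>2))" for x
    by (simp add: F_def norm_mult norm_exp_eq_Re abs_mult)
  have t1: "(F \<longlongrightarrow> 0) at_top"
  proof (rule tendsto_norm_zero_cancel, unfold nF, rule tendsto_norm_zero)
    show "((\<lambda>x::real. x * exp (- x\<^sup>2)) \<longlongrightarrow> 0) at_top" by real_asymp
  qed
  have t2: "(F \<longlongrightarrow> 0) at_bot"
  proof (rule tendsto_norm_zero_cancel, unfold nF, rule tendsto_norm_zero)
    show "((\<lambda>x::real. x * exp (- x\<^sup>2)) \<longlongrightarrow> 0) at_bot" by real_asymp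
  qed
  have "(LBINT x=-\<infinity>..\<infinity>. f x) = 0 - 0"
  proof (rule interval_integral_FTC_integrable[where F=F])
    show "((F \<circ> real_of_ereal) \<longlongrightarrow> 0) (at_right (- \<infinity>))" using t2 by (simp add: ereal_tendsto_simps)
    show "((F \<circ> real_of_ereal) \<longlongrightarrow> 0) (at_left \<infinity>)" using t1 by (simp add: ereal_tendsto_simps)
    show "isCont f x" for x unfolding f_def by (intro continuous_intros)
  qed (use D fint in auto)
  then have "(\<integral>x. f x \<partial>lborel) = 0"
    by (simp add: interval_lebesgue_integral_def set_lebesgue_integral_def)
  then have "g s 0 + 2 * ?c * g s 2 = 0"
    unfolding f_def g_def
    by (subst (asm) Bochner_Integration.integral_add) (intro gauss_complex_integrable integrable_mult_right | simp only: integral_mult_right_zero)+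
  then have "g s 0 = - (2 * ?c * g s 2)" by (simp only: eq_neg_iff_add_eq_0)
  then show ?thesis by (simp add: algebra_simps)
qed

text \<open>Passing to the square avoids a choice of complex square root. By
  \<open>gauss_stein\<close> the square times 1 - i s has derivative 0, and its value at s = 0 is
  pi.\<close>

lemma gauss_square:
  "(\<integral>x. exp ((\<i> * of_real s - 1) * of_real (x\<^sup>2)) \<partial>lborel)\<^sup>2 = complex_of_real pi / (1 - \<i> * of_real s)"
proof -
  define G where "G k s = (\<integral>x. of_real (x ^ k) * exp ((\<i> * of_real s - 1) * of_real (x\<^sup>2)) \<partial>lborel :: complex)" for k and s :: real
  have deriv: "(G 0 has_vector_derivative \<i> * G 2 s) (at s)" for s
  proof -
    have "((\<lambda>s. \<integral>x. of_real (x ^ 0) * exp ((\<i> * of_real s - 1) * of_real (x\<^sup>2)) \<partial>lborel) has_vector_derivative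
      (\<integral>x. \<i> * (of_real (x ^ 2) * exp ((\<i> * of_real s - 1) * of_real (x\<^sup>2))) \<partial>lborel)) (at s)"
    proof (rule has_vector_derivative_integral_dominated[where w="\<lambda>x. exp (- x\<^sup>2) * x ^ 2" and f'="\<lambda>s x. \<i> * (of_real (x ^ 2) * exp ((\<i> * of_real s - 1) * of_real (x\<^sup>2)))"])
      show "((\<lambda>s. of_real (x ^ 0) * exp ((\<i> * of_real s - 1) * of_real (x\<^sup>2))) has_vector_derivative
        \<i> * (of_real (x ^ 2) * exp ((\<i> * of_real s - 1) * of_real (x\<^sup>2)))) (at s)" for s x :: real
      proof -
        have "((\<lambda>z. exp ((\<i> * z - 1) * of_real (x\<^sup>2))) has_field_derivative (\<i> * (of_real (x ^ 2) * exp ((\<i> * of_real s - 1) * of_real (x\<^sup>2))))) (at (of_real s))"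
          by (auto intro!: derivative_eq_intros)
        from has_vector_derivative_real_field[OF this] show ?thesis by simp
      qed
    qed (auto intro: gauss_integrable gauss_complex_integrable[of 0, simplified] simp: norm_mult norm_exp_eq_Re norm_power)
    then show ?thesis unfolding G_def by simp
  qed
  have nz: "1 - \<i> * of_real s \<noteq> 0" for s
  proof
    assume "1 - \<i> * of_real s = 0"
    then have "Re (1 - \<i> * of_real s) = 0" by (simp only: zero_complex.simps)
    then show False by simp
  qed
  have st: "G 0 s = 2 * (1 - \<i> * of_real s) * G 2 s" for s
    unfolding G_def using gauss_stein[of s] by simp
  define \<phi> where "\<phi> s = G 0 s * G 0 s * (1 - \<i> * of_real s)" for s
  have "(\<phi> has_vector_derivative 0) (at s)" for s
  proof -
    have l: "((\<lambda>s. 1 - \<i> * of_real s :: complex) has_vector_derivative (- \<i>)) (at s)"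
    proof -
      have "((\<lambda>z. 1 - \<i> * z) has_field_derivative (- \<i>)) (at (of_real s))" by (auto intro!: derivative_eq_intros)
      from has_vector_derivative_real_field[OF this] show ?thesis .
    qed
    have "(\<phi> has_vector_derivative (G 0 s * G 0 s * (- \<i>) + (G 0 s * (\<i> * G 2 s) + \<i> * G 2 s * G 0 s) * (1 - \<i> * of_real s))) (at s)"
      unfolding \<phi>_def[abs_def] by (intro has_vector_derivative_mult deriv l)
    moreover have "G 0 s * G 0 s * (- \<i>) + (G 0 s * (\<i> * G 2 s) + \<i> * G 2 s * G 0 s) * (1 - \<i> * of_real s)
       = \<i> * G 0 s * (2 * (1 - \<i> * of_real s) * G 2 s - G 0 s)" by (simp add: algebra_simps)
    moreover have "2 * (1 - \<i> * of_real s) * G 2 s - G 0 s = 0" using st[of s] by simp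
    ultimately show ?thesis by simp
  qed
  then have "\<phi> s = \<phi> 0"
  proof -
    have "norm (\<phi> s - \<phi> 0) \<le> 0 * norm (s - 0)"
      using \<open>\<And>s. (\<phi> has_vector_derivative 0) (at s)\<close>
      by (intro differentiable_bound[of UNIV \<phi> "\<lambda>t h. 0"]) (auto simp: has_vector_derivative_def onorm_zero)
    then show ?thesis by simp
  qed
  also have "\<phi> 0 = of_real pi"
  proof -
    have "(\<integral>x. normal_density 0 (sqrt (1 / 2)) x * (x - 0) ^ (2 * 0) \<partial>lborel) = fact (2 * 0) / ((2 / (sqrt (1 / 2))\<^sup>2) ^ 0 * fact 0)"
      by (rule integral_normal_moment_even) simp
    then have "(\<integral>x. exp (- x\<^sup>2) / sqrt pi \<partial>lborel) = 1" by (simp add: normal_density_half del: integral_divide_zero)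
    then have e: "(\<integral>x. exp (- x\<^sup>2) \<partial>lborel) = sqrt pi"
      unfolding integral_divide_zero by (metis divide_eq_eq mult_1 zero_neq_one)
    have "G 0 0 = (\<integral>x. complex_of_real (exp (- x\<^sup>2)) \<partial>lborel)"
      unfolding G_def by (intro Bochner_Integration.integral_cong refl) (simp add: exp_of_real[symmetric])
    also have "\<dots> = of_real (sqrt pi)" unfolding integral_complex_of_real e ..
    finally show ?thesis by (simp add: \<phi>_def flip: of_real_mult)
  qed
  finally have "G 0 s * G 0 s * (1 - \<i> * of_real s) = of_real pi" by (simp add: \<phi>_def)
  then have "(G 0 s)\<^sup>2 = of_real pi / (1 - \<i> * of_real s)" using nz[of s] by (simp add: power2_eq_square eq_divide_eq)
  then show ?thesis by (simp add: G_def)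
qed

context prob_space
begin

text \<open>|Z|^2 is exponentially distributed. By independence of the two parts its characteristic
  function is the square of one Gaussian integral, which is precisely what
  \<open>gauss_square\<close> evaluates.\<close>

lemma std_complex_gaussian_char:
  assumes Z: "std_complex_gaussian M Z"
  shows "(\<integral>\<omega>. iexp (s * (cmod (Z \<omega>))\<^sup>2) \<partial>M) = 1 / (1 - \<i> * of_real s)"
proof -
  have ind: "indep_var borel (\<lambda>\<omega>. Re (Z \<omega>)) borel (\<lambda>\<omega>. Im (Z \<omega>))"
    and d: "distributed M lborel (\<lambda>\<omega>. Re (Z \<omega>)) (normal_density 0 (sqrt (1 / 2)))" "distributed M lborel (\<lambda>\<omega>. Im (Z \<omega>)) (normal_density 0 (sqrt (1 / 2)))"
    using Z by (auto simp: std_complex_gaussian_def)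
  have rv: "random_variable borel (\<lambda>\<omega>. Re (Z \<omega>))" "random_variable borel (\<lambda>\<omega>. Im (Z \<omega>))"
    using ind by (auto dest: indep_var_rv1 indep_var_rv2)
  have ch: "char (distr M borel (\<lambda>\<omega>. (X \<omega>)\<^sup>2)) s = (\<integral>x. exp ((\<i> * of_real s - 1) * of_real (x\<^sup>2)) \<partial>lborel) / of_real (sqrt pi)"
    if dX: "distributed M lborel X (normal_density 0 (sqrt (1 / 2)))" for X
  proof -
    have [measurable]: "X \<in> borel_measurable M" using distributed_measurable[OF dX] by simp
    have "char (distr M borel (\<lambda>\<omega>. (X \<omega>)\<^sup>2)) s = (\<integral>\<omega>. iexp (s * (X \<omega>)\<^sup>2) \<partial>M)"
      unfolding char_def by (subst integral_distr) auto
    also have "\<dots> = (\<integral>x. iexp (s * x\<^sup>2) \<partial>distr M lborel X)" by (subst integral_distr) auto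
    also have "distr M lborel X = density lborel (normal_density 0 (sqrt (1 / 2)))" by (rule distributed_distr_eq_density[OF dX])
    also have "(\<integral>x. iexp (s * x\<^sup>2) \<partial>density lborel (normal_density 0 (sqrt (1 / 2)))) = (\<integral>x. normal_density 0 (sqrt (1 / 2)) x *\<^sub>R iexp (s * x\<^sup>2) \<partial>lborel)"
      by (rule integral_density) auto
    also have "\<dots> = (\<integral>x. exp ((\<i> * of_real s - 1) * of_real (x\<^sup>2)) / of_real (sqrt pi) \<partial>lborel)"
      by (intro Bochner_Integration.integral_cong refl)
        (simp add: normal_density_half scaleR_conv_of_real exp_of_real[symmetric] exp_add[symmetric] algebra_simps flip: exp_minus)
    finally show ?thesis by simp
  qed
  have ind2: "indep_var borel (\<lambda>\<omega>. (Re (Z \<omega>))\<^sup>2) borel (\<lambda>\<omega>. (Im (Z \<omega>))\<^sup>2)"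
    using indep_var_compose[OF ind, of "\<lambda>x. x\<^sup>2" borel "\<lambda>x. x\<^sup>2" borel] by (simp add: comp_def)
  have "(\<integral>\<omega>. iexp (s * (cmod (Z \<omega>))\<^sup>2) \<partial>M) = char (distr M borel (\<lambda>\<omega>. (Re (Z \<omega>))\<^sup>2 + (Im (Z \<omega>))\<^sup>2)) s"
    unfolding char_def using rv by (subst integral_distr) (auto simp: cmod_power2)
  also have "\<dots> = ((\<integral>x. exp ((\<i> * of_real s - 1) * of_real (x\<^sup>2)) \<partial>lborel) / of_real (sqrt pi))\<^sup>2"
    unfolding char_distr_add[OF ind2] ch[OF d(1)] ch[OF d(2)] by (simp add: power2_eq_square)
  also have "\<dots> = 1 / (1 - \<i> * of_real s)"
    unfolding power_divide gauss_square by (simp flip: of_real_power)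
  finally show ?thesis .
qed

lemma std_complex_gaussian_moments:
  assumes Z: "std_complex_gaussian M Z"
  shows "integrable M (\<lambda>\<omega>. (cmod (Z \<omega>))\<^sup>2)" "expectation (\<lambda>\<omega>. (cmod (Z \<omega>))\<^sup>2) = 1"
    "integrable M (\<lambda>\<omega>. ((cmod (Z \<omega>))\<^sup>2 - 1)\<^sup>2)" "expectation (\<lambda>\<omega>. ((cmod (Z \<omega>))\<^sup>2 - 1)\<^sup>2) \<le> 4"
proof -
  have d: "distributed M lborel (\<lambda>\<omega>. Re (Z \<omega>)) (normal_density 0 (sqrt (1 / 2)))" "distributed M lborel (\<lambda>\<omega>. Im (Z \<omega>)) (normal_density 0 (sqrt (1 / 2)))"
    using Z by (auto simp: std_complex_gaussian_def)
  have mom: "has_bochner_integral M (\<lambda>\<omega>. X \<omega> ^ (2 * k)) (fact (2 * k) / (4 ^ k * fact k))"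
    if dX: "distributed M lborel X (normal_density 0 (sqrt (1 / 2)))" for X k
  proof -
    have h: "has_bochner_integral lborel (\<lambda>x. normal_density 0 (sqrt (1 / 2)) x * (x - 0) ^ (2 * k)) (fact (2 * k) / ((2 / (sqrt (1 / 2))\<^sup>2) ^ k * fact k))"
      by (rule normal_moment_even) simp
    have e: "(2 / (sqrt (1 / 2))\<^sup>2) = (4::real)" by simp
    have "integrable M (\<lambda>\<omega>. X \<omega> ^ (2 * k))"
      using h by (subst distributed_integrable[OF dX, symmetric]) (auto simp: has_bochner_integral_iff)
    moreover have "(\<integral>x. normal_density 0 (sqrt (1 / 2)) x * x ^ (2 * k) \<partial>lborel) = (\<integral>\<omega>. X \<omega> ^ (2 * k) \<partial>M)"
      by (rule distributed_integral[OF dX]) auto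
    ultimately show ?thesis using h unfolding e by (simp add: has_bochner_integral_iff)
  qed
  note m2 = mom[OF d(1), of 1] mom[OF d(2), of 1] and m4 = mom[OF d(1), of 2] mom[OF d(2), of 2]
  have q: "(cmod (Z \<omega>))\<^sup>2 = Re (Z \<omega>) ^ (2 * 1) + Im (Z \<omega>) ^ (2 * 1)" for \<omega> by (simp add: cmod_power2)
  have hq: "has_bochner_integral M (\<lambda>\<omega>. (cmod (Z \<omega>))\<^sup>2) 1"
    unfolding q using has_bochner_integral_add[OF m2] by (simp add: fact_2)
  then show "integrable M (\<lambda>\<omega>. (cmod (Z \<omega>))\<^sup>2)" "expectation (\<lambda>\<omega>. (cmod (Z \<omega>))\<^sup>2) = 1"
    by (auto simp: has_bochner_integral_iff)
  \<comment> \<open>With a and b the squares of the two parts, (a + b - 1)^2 \<le> 2 (a^2 + b^2) +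
    1. Each fourth moment is 3/4, so the bound has mean 2 (3/4 + 3/4) + 1 = 4.\<close>
  define B where "B \<omega> = 2 * (Re (Z \<omega>) ^ (2 * 2) + Im (Z \<omega>) ^ (2 * 2)) + 1" for \<omega>
  have hB: "has_bochner_integral M B (2 * (fact (2 * 2) / (4 ^ 2 * fact 2) + fact (2 * 2) / (4 ^ 2 * fact 2)) + measure M (space M))"
    unfolding B_def[abs_def]
    by (intro has_bochner_integral_add has_bochner_integral_mult_right m4) (simp add: has_bochner_integral_iff)
  have le: "((cmod (Z \<omega>))\<^sup>2 - 1)\<^sup>2 \<le> B \<omega>" for \<omega>
  proof -
    let ?a = "(Re (Z \<omega>))\<^sup>2" let ?b = "(Im (Z \<omega>))\<^sup>2"
    have "(?a + ?b - 1)\<^sup>2 \<le> (?a + ?b)\<^sup>2 + 1" by (simp add: power2_eq_square algebra_simps)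
    also have "(?a + ?b)\<^sup>2 \<le> 2 * (?a\<^sup>2 + ?b\<^sup>2)" using sum_squares_bound[of ?a ?b] by (simp add: power2_sum)
    finally show ?thesis by (simp add: B_def cmod_power2)
  qed
  have [measurable]: "(\<lambda>\<omega>. (cmod (Z \<omega>))\<^sup>2) \<in> borel_measurable M" using hq by (auto simp: has_bochner_integral_iff)
  show i: "integrable M (\<lambda>\<omega>. ((cmod (Z \<omega>))\<^sup>2 - 1)\<^sup>2)"
    by (rule Bochner_Integration.integrable_bound[of M B]) (use hB le in \<open>auto simp: has_bochner_integral_iff intro: order_trans[OF _ abs_ge_self]\<close>)
  have "expectation (\<lambda>\<omega>. ((cmod (Z \<omega>))\<^sup>2 - 1)\<^sup>2) \<le> expectation B"
    by (rule integral_mono[OF i]) (use hB le in \<open>auto simp: has_bochner_integral_iff\<close>)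
  also have "\<dots> = 4" using hB by (simp add: has_bochner_integral_iff prob_space fact_numeral)
  finally show "expectation (\<lambda>\<omega>. ((cmod (Z \<omega>))\<^sup>2 - 1)\<^sup>2) \<le> 4" .
qed

text \<open>By Tonelli the sum has finite expectation and is therefore finite almost surely.\<close>

lemma AE_summable_of_expectation:
  fixes f :: "nat \<Rightarrow> 'a \<Rightarrow> real"
  assumes int: "\<And>n. integrable M (f n)" and nonneg: "\<And>n \<omega>. 0 \<le> f n \<omega>"
    and bound: "\<And>n. expectation (f n) \<le> c n" and c: "summable c"
  shows "AE \<omega> in M. summable (\<lambda>n. f n \<omega>)"
proof -
  have c0: "0 \<le> c n" for n using bound[of n] Bochner_Integration.integral_nonneg[of M "f n"] nonneg by (meson order_trans)
  have "(\<integral>\<^sup>+\<omega>. (\<Sum>n. ennreal (f n \<omega>)) \<partial>M) = (\<Sum>n. \<integral>\<^sup>+\<omega>. ennreal (f n \<omega>) \<partial>M)"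
    by (rule nn_integral_suminf) (use int in auto)
  also have "\<dots> = (\<Sum>n. ennreal (expectation (f n)))"
    by (intro suminf_cong nn_integral_eq_integral int) (use nonneg in auto)
  also have "\<dots> \<le> (\<Sum>n. ennreal (c n))" by (intro suminf_le ennreal_leI bound) auto
  also have "\<dots> = ennreal (\<Sum>n. c n)" using c0 c by (intro suminf_ennreal2) auto
  finally have "(\<integral>\<^sup>+\<omega>. (\<Sum>n. ennreal (f n \<omega>)) \<partial>M) < \<infinity>" by (simp add: order_le_less_trans)
  then have "AE \<omega> in M. (\<Sum>n. ennreal (f n \<omega>)) \<noteq> \<infinity>"
    by (intro nn_integral_PInf_AE) (use int in auto)
  then show ?thesis by (rule AE_mp) (auto intro!: AE_I2 summable_suminf_not_top nonneg)
qed

end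

section \<open>Characteristic functions\<close>

lemma norm_iexp_diff_le: "cmod (exp (\<i> * of_real x) - exp (\<i> * of_real y)) \<le> \<bar>x - y\<bar>"
proof -
  have "((\<lambda>s. exp (\<i> * of_real s)) has_vector_derivative (\<i> * exp (\<i> * of_real s))) (at s)" for s
  proof -
    have "((\<lambda>z. exp (\<i> * z)) has_field_derivative (\<i> * exp (\<i> * of_real s))) (at (of_real s))"
      by (auto intro!: derivative_eq_intros)
    from has_vector_derivative_real_field[OF this] show ?thesis .
  qed
  from norm_diff_le_vector_derivative[OF this, where C=1 and a=y and b=x] show ?thesis by (simp add: norm_mult norm_exp_eq_Re)
qed

text \<open>The reciprocal of the limiting characteristic function; all its factors have modulus at
  least 1.\<close>

definition char_denom :: "nat \<Rightarrow> real \<Rightarrow> complex" where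
  "char_denom K t = (\<Prod>m\<in>{1..K}. 1 - \<i> * of_real t / of_nat m)"

lemma norm_factor_ge: "1 \<le> cmod (1 - \<i> * of_real t / of_nat m)"
proof -
  have "Re (1 - \<i> * of_real t / of_nat m) = 1" by (simp add: Re_divide_of_nat)
  then show ?thesis using complex_Re_le_cmod by metis
qed

lemma char_denom_deriv:
  "(char_denom K has_vector_derivative char_denom K t * (\<Sum>m\<in>{1..K}. (- \<i> / of_nat m) / (1 - \<i> * of_real t / of_nat m))) (at t)"
proof (induction K)
  case 0
  have "char_denom 0 = (\<lambda>t. 1)" by (auto simp: char_denom_def)
  then show ?case by simp
next
  case (Suc K)
  let ?f = "\<lambda>t. 1 - \<i> * of_real t / of_nat (Suc K)"
  have e: "char_denom (Suc K) = (\<lambda>t. char_denom K t * ?f t)" by (auto simp: char_denom_def)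
  have f: "(?f has_vector_derivative (- \<i> / of_nat (Suc K))) (at t)"
  proof -
    have "((\<lambda>z. 1 - \<i> * z / of_nat (Suc K)) has_field_derivative (- \<i> / of_nat (Suc K))) (at (of_real t))"
      by (auto intro!: derivative_eq_intros simp del: of_nat_Suc)
    from has_vector_derivative_real_field[OF this] show ?thesis .
  qed
  have nz: "?f t \<noteq> 0" using norm_factor_ge[of t "Suc K"] by auto
  have "(char_denom (Suc K) has_vector_derivative char_denom K t * (- \<i> / of_nat (Suc K)) +
     char_denom K t * (\<Sum>m\<in>{1..K}. (- \<i> / of_nat m) / (1 - \<i> * of_real t / of_nat m)) * ?f t) (at t)"
    unfolding e by (rule has_vector_derivative_mult[OF Suc f])
  moreover have "char_denom K t * (- \<i> / of_nat (Suc K)) + char_denom K t * (\<Sum>m\<in>{1..K}. (- \<i> / of_nat m) / (1 - \<i> * of_real t / of_nat m)) * ?f t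
     = char_denom (Suc K) t * (\<Sum>m\<in>{1..Suc K}. (- \<i> / of_nat m) / (1 - \<i> * of_real t / of_nat m))"
  proof -
    have "?f t * ((- \<i> / of_nat (Suc K)) / ?f t) = - \<i> / of_nat (Suc K)" using nz by simp
    then have "char_denom K t * ?f t * ((- \<i> / of_nat (Suc K)) / ?f t) = char_denom K t * (- \<i> / of_nat (Suc K))"
      by (simp only: mult.assoc)
    moreover have "(\<Sum>m\<in>{1..Suc K}. (- \<i> / of_nat m) / (1 - \<i> * of_real t / of_nat m)) =
      (\<Sum>m\<in>{1..K}. (- \<i> / of_nat m) / (1 - \<i> * of_real t / of_nat m)) + (- \<i> / of_nat (Suc K)) / ?f t" by simp
    ultimately show ?thesis by (simp only: e distrib_left) (simp only: ac_simps)
  qed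
  ultimately show ?case by (simp only:)
qed

lemma char_denom_bound: "cmod (char_denom K t) \<le> (1 + \<bar>t\<bar>) ^ K"
proof -
  have "cmod (1 - \<i> * of_real t / of_nat m) \<le> 1 + \<bar>t\<bar>" if "m \<ge> 1" for m
  proof -
    have "cmod (1 - \<i> * of_real t / of_nat m) \<le> 1 + \<bar>t\<bar> / real m"
      using norm_triangle_ineq4[of 1 "\<i> * of_real t / of_nat m"] by (simp add: norm_divide norm_mult)
    also have "\<bar>t\<bar> / real m \<le> \<bar>t\<bar>" using that by (simp add: divide_le_eq) (metis abs_ge_zero mult.right_neutral mult_left_mono of_nat_1 of_nat_mono One_nat_def)
    finally show ?thesis by simp
  qed
  then have "(\<Prod>m\<in>{1..K}. cmod (1 - \<i> * of_real t / of_nat m)) \<le> (\<Prod>m\<in>{1..K}. 1 + \<bar>t\<bar>)"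
    by (intro prod_mono) auto
  then show ?thesis by (simp add: char_denom_def prod_norm)
qed

lemma char_denom_0: "char_denom K 0 = 1" by (simp add: char_denom_def)

lemma char_denom_nonzero: "char_denom K t \<noteq> 0"
proof -
  have "1 - \<i> * of_real t / of_nat m \<noteq> 0" for m using norm_factor_ge[of t m] by auto
  then show ?thesis by (simp add: char_denom_def)
qed

context cue
begin

lemma trunc_area_nonneg: "trunc_area K \<omega> \<ge> 0" unfolding trunc_area_def by (intro sum_nonneg) auto

lemma trunc_area_bound: assumes "\<omega> \<in> space M" shows "trunc_area K \<omega> \<le> real K * (real N)\<^sup>2"
proof -
  have "trunc_area K \<omega> \<le> (\<Sum>k\<in>{1..K}. (real N)\<^sup>2)" unfolding trunc_area_def
  proof (intro sum_mono)
    fix k assume "k \<in> {1..K}"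
    then have "power_sum_sq k \<omega> / (real k)\<^sup>2 \<le> power_sum_sq k \<omega> / 1" by (intro divide_left_mono) auto
    then show "power_sum_sq k \<omega> / (real k)\<^sup>2 \<le> (real N)\<^sup>2" using power_sum_sq_bound[OF assms, of k] by simp
  qed
  then show ?thesis by simp
qed

lemma trunc_iexp_integrable [simp]: "integrable M (trunc_iexp K t)" by (rule integrable_const_bound[where B=1]) auto

lemma power_sum_sq_trunc_iexp_integrable: "integrable M (\<lambda>\<omega>. complex_of_real (power_sum_sq m \<omega>) * trunc_iexp K t \<omega>)"
proof -
  have "integrable M (\<lambda>\<omega>. complex_of_real (power_sum_sq m \<omega>))" by simp
  then show ?thesis by (rule Bochner_Integration.integrable_bound) (auto simp: norm_mult)
qed

lemma trunc_char_deriv: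
  "(trunc_char K has_vector_derivative (\<Sum>m\<in>{1..K}. \<i> / (of_nat m)\<^sup>2 * (\<integral>\<omega>. of_real (power_sum_sq m \<omega>) * trunc_iexp K t \<omega> \<partial>M))) (at t)"
proof -
  have "((\<lambda>t. \<integral>\<omega>. trunc_iexp K t \<omega> \<partial>M) has_vector_derivative (\<integral>\<omega>. \<i> * of_real (trunc_area K \<omega>) * trunc_iexp K t \<omega> \<partial>M)) (at t)"
  proof (rule has_vector_derivative_integral[where C="real K * (real N)\<^sup>2" and f'="\<lambda>t \<omega>. \<i> * of_real (trunc_area K \<omega>) * trunc_iexp K t \<omega>"])
    show "finite_measure M" by unfold_locales
    show "((\<lambda>t. trunc_iexp K t \<omega>) has_vector_derivative \<i> * of_real (trunc_area K \<omega>) * trunc_iexp K t \<omega>) (at t)" for t \<omega>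
    proof -
      have "((\<lambda>z. exp (\<i> * (z * of_real (trunc_area K \<omega>)))) has_field_derivative (\<i> * of_real (trunc_area K \<omega>) * exp (\<i> * (of_real t * of_real (trunc_area K \<omega>))))) (at (of_real t))"
        by (auto intro!: derivative_eq_intros)
      from has_vector_derivative_real_field[OF this] show ?thesis by (simp add: trunc_iexp_def)
    qed
    show "cmod (\<i> * of_real (trunc_area K \<omega>) * trunc_iexp K t \<omega>) \<le> real K * (real N)\<^sup>2" if "\<omega> \<in> space M" for t \<omega>
      using trunc_area_bound[OF that, of K] trunc_area_nonneg[of K \<omega>] by (simp add: norm_mult)
  qed auto
  moreover have "(\<integral>\<omega>. \<i> * of_real (trunc_area K \<omega>) * trunc_iexp K t \<omega> \<partial>M) = (\<Sum>m\<in>{1..K}. \<i> / (of_nat m)\<^sup>2 * (\<integral>\<omega>. of_real (power_sum_sq m \<omega>) * trunc_iexp K t \<omega> \<partial>M))"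
  proof -
    have "(\<lambda>\<omega>. \<i> * of_real (trunc_area K \<omega>) * trunc_iexp K t \<omega>) = (\<lambda>\<omega>. \<Sum>m\<in>{1..K}. \<i> / (of_nat m)\<^sup>2 * (of_real (power_sum_sq m \<omega>) * trunc_iexp K t \<omega>))"
      by (simp add: trunc_area_def sum_distrib_left sum_distrib_right mult.assoc)
    then show ?thesis using power_sum_sq_trunc_iexp_integrable by (simp add: Bochner_Integration.integral_sum)
  qed
  moreover have "trunc_char K = (\<lambda>t. \<integral>\<omega>. trunc_iexp K t \<omega> \<partial>M)" by (simp add: trunc_char_def[abs_def] trunc_iexp_def)
  ultimately show ?thesis by simp
qed

lemma trunc_char_0: "trunc_char K 0 = 1" by (simp add: trunc_char_def prob_space)

text \<open>\<open>char_denom\<close> is an integrating factor: the product equals 1 at t = 0, and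
  its derivative is \<open>char_denom\<close> times a combination of the errors in the Stein
  identity. The loss exponential in K is harmless because K stays fixed while N grows.\<close>

theorem trunc_char_limit:
  "cmod (trunc_char K t * char_denom K t - 1) \<le> (1 + \<bar>t\<bar>) ^ K * (real K * (stein_const K t / real N)) * \<bar>t\<bar>"
proof -
  define E where "E m s = (\<integral>\<omega>. of_real (power_sum_sq m \<omega>) * trunc_iexp K s \<omega> \<partial>M)" for m s
  define D where "D s = (\<Sum>m\<in>{1..K}. \<i> / (of_nat m)\<^sup>2 * (E m s - of_nat m * trunc_char K s / (1 - \<i> * of_real s / of_nat m)))" for s
  have "((\<lambda>s. trunc_char K s * char_denom K s) has_vector_derivative char_denom K s * D s) (at s)" for s
  proof -
    have "((\<lambda>s. trunc_char K s * char_denom K s) has_vector_derivative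
      trunc_char K s * (char_denom K s * (\<Sum>m\<in>{1..K}. (- \<i> / of_nat m) / (1 - \<i> * of_real s / of_nat m))) +
      (\<Sum>m\<in>{1..K}. \<i> / (of_nat m)\<^sup>2 * E m s) * char_denom K s) (at s)"
      unfolding E_def by (rule has_vector_derivative_mult[OF trunc_char_deriv char_denom_deriv])
    moreover have "trunc_char K s * (char_denom K s * (\<Sum>m\<in>{1..K}. (- \<i> / of_nat m) / (1 - \<i> * of_real s / of_nat m))) +
      (\<Sum>m\<in>{1..K}. \<i> / (of_nat m)\<^sup>2 * E m s) * char_denom K s = char_denom K s * D s"
    proof -
      have "D s = (\<Sum>m\<in>{1..K}. \<i> / (of_nat m)\<^sup>2 * E m s + trunc_char K s * ((- \<i> / of_nat m) / (1 - \<i> * of_real s / of_nat m)))"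
        unfolding D_def by (intro sum.cong refl) (simp add: right_diff_distrib power2_eq_square)
      also have "\<dots> = (\<Sum>m\<in>{1..K}. \<i> / (of_nat m)\<^sup>2 * E m s) + trunc_char K s * (\<Sum>m\<in>{1..K}. (- \<i> / of_nat m) / (1 - \<i> * of_real s / of_nat m))"
        by (simp only: sum.distrib sum_distrib_left)
      finally show ?thesis by (simp only: distrib_left) (simp only: ac_simps)
    qed
    ultimately show ?thesis by simp
  qed
  moreover have "cmod (char_denom K s * D s) \<le> (1 + \<bar>t\<bar>) ^ K * (real K * (stein_const K t / real N))" if seg: "s \<in> closed_segment 0 t" for s
  proof -
    have s: "\<bar>s\<bar> \<le> \<bar>t\<bar>" using seg by (auto simp: closed_segment_eq_real_ivl split: if_splits)
    have CCm: "stein_const K s \<le> stein_const K t" unfolding stein_const_def using s by (intro mult_right_mono add_left_mono mult_left_mono) auto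
    have "cmod (\<i> / (of_nat m)\<^sup>2 * (E m s - of_nat m * trunc_char K s / (1 - \<i> * of_real s / of_nat m))) \<le> stein_const K t / real N"
      if m: "m \<in> {1..K}" for m
    proof -
      let ?z = "1 - \<i> * of_real s / of_nat m"
      have z: "1 \<le> cmod ?z" by (rule norm_factor_ge)
      then have z0: "?z \<noteq> 0" by auto
      \<comment> \<open>Dividing the Stein identity by its factor, of modulus at least 1, does not
        enlarge the error.\<close>
      have "E m s - of_nat m * trunc_char K s / ?z = (?z * E m s - of_nat m * trunc_char K s) / ?z" using z0 by (simp add: diff_divide_distrib)
      then have "cmod (E m s - of_nat m * trunc_char K s / ?z) = cmod (?z * E m s - of_nat m * trunc_char K s) / cmod ?z" by (simp only: norm_divide)
      also have "\<dots> \<le> cmod (?z * E m s - of_nat m * trunc_char K s) / 1" using z by (intro divide_left_mono) auto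
      also have "\<dots> \<le> stein_const K s / real N" unfolding E_def using stein_identity[of m K s] m by simp
      also have "\<dots> \<le> stein_const K t / real N" using CCm by (intro divide_right_mono) auto
      finally have b: "cmod (E m s - of_nat m * trunc_char K s / ?z) \<le> stein_const K t / real N" .
      have "1 \<le> (real m)\<^sup>2" using m by simp
      then have "cmod (\<i> / (of_nat m)\<^sup>2) \<le> 1" by (simp add: norm_divide norm_power divide_le_eq)
      then have "cmod (\<i> / (of_nat m)\<^sup>2) * cmod (E m s - of_nat m * trunc_char K s / ?z) \<le> 1 * (stein_const K t / real N)"
        using b by (intro mult_mono) auto
      then show ?thesis by (simp only: norm_mult mult_1)
    qed
    then have "cmod (D s) \<le> (\<Sum>m\<in>{1..K}. stein_const K t / real N)" unfolding D_def by (intro order_trans[OF norm_sum] sum_mono)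
    then have a1: "cmod (D s) \<le> real K * (stein_const K t / real N)" by simp
    have a2: "cmod (char_denom K s) \<le> (1 + \<bar>t\<bar>) ^ K" by (rule order_trans[OF char_denom_bound power_mono]) (use s in auto)
    have "0 \<le> (1 + \<bar>t\<bar>) ^ K" by simp
    from mult_mono[OF a2 a1 this norm_ge_zero] show "cmod (char_denom K s * D s) \<le> (1 + \<bar>t\<bar>) ^ K * (real K * (stein_const K t / real N))" by (simp only: norm_mult)
  qed
  ultimately have "cmod (trunc_char K t * char_denom K t - trunc_char K 0 * char_denom K 0) \<le> (1 + \<bar>t\<bar>) ^ K * (real K * (stein_const K t / real N)) * norm (t - 0)"
    by (rule norm_diff_le_vector_derivative)
  then show ?thesis by (simp add: trunc_char_0 char_denom_0)
qed

section \<open>The full series and its tail\<close>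

definition scaled_area :: "'a \<Rightarrow> real" where "scaled_area \<omega> = (real N)\<^sup>2 / 4 * A_CUE N (\<theta> \<omega>)"

definition scaled_mean :: real where "scaled_mean = (\<Sum>k. mean_sq (Suc k) / (real (Suc k))\<^sup>2)"

definition trunc_mean :: "nat \<Rightarrow> real" where "trunc_mean K = (\<Sum>k\<in>{1..K}. mean_sq k / (real k)\<^sup>2)"

lemma scaled_area_sums: assumes w: "\<omega> \<in> space M" shows "(\<lambda>k. power_sum_sq (Suc k) \<omega> / (real (Suc k))\<^sup>2) sums scaled_area \<omega>"
proof -
  have e: "power_sum \<omega> (int n) = (\<Sum>i\<in>{1..N}. cis (real n * \<theta> \<omega> i))" for n
    unfolding power_sum_power_sums[OF w] power_sums_def by (rule sum.reindex_bij_witness[of _ "\<lambda>i. i - 1" Suc]) auto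
  have "(\<lambda>k. (cmod (\<Sum>i\<in>{1..N}. cis (real (Suc k) * \<theta> \<omega> i)))\<^sup>2 / (real (Suc k))\<^sup>2) sums ((real N)\<^sup>2 / 4 * A_CUE N (\<theta> \<omega>))"
    by (rule A_CUE_sums[OF N]) (use eig[OF w] in \<open>auto simp: eigenangles_def\<close>)
  then show ?thesis by (simp only: scaled_area_def power_sum_sq_def e)
qed

text \<open>The eigenangles are chosen pointwise, without any measurability in \<omega>.
  Measurability comes from the series, whose terms are functions of the matrix.\<close>

lemma A_CUE_measurable: "(\<lambda>\<omega>. A_CUE N (\<theta> \<omega>)) \<in> borel_measurable M"
proof -
  have "(\<lambda>\<omega>. 4 / (real N)\<^sup>2 * (\<Sum>k. power_sum_sq (Suc k) \<omega> / (real (Suc k))\<^sup>2)) \<in> borel_measurable M" by measurable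
  moreover have "4 / (real N)\<^sup>2 * (\<Sum>k. power_sum_sq (Suc k) \<omega> / (real (Suc k))\<^sup>2) = A_CUE N (\<theta> \<omega>)" if "\<omega> \<in> space M" for \<omega>
    using scaled_area_sums[OF that] N by (simp add: sums_iff scaled_area_def field_simps)
  ultimately show ?thesis by (subst measurable_cong[where g="\<lambda>\<omega>. 4 / (real N)\<^sup>2 * (\<Sum>k. power_sum_sq (Suc k) \<omega> / (real (Suc k))\<^sup>2)"]) auto
qed

lemma scaled_area_measurable [measurable]: "scaled_area \<in> borel_measurable M"
  unfolding scaled_area_def[abs_def] using A_CUE_measurable by measurable

lemma summable_mean_sq: "summable (\<lambda>k. mean_sq (Suc k) / (real (Suc k))\<^sup>2)"
proof (rule summable_comparison_test)
  show "\<exists>N0. \<forall>n\<ge>N0. norm (mean_sq (Suc n) / (real (Suc n))\<^sup>2) \<le> real N * (1 / (real (Suc n))\<^sup>2)"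
    by (auto simp: mean_sq_def divide_right_mono intro!: exI[of _ 0])
  have "summable (\<lambda>n. 1 / (real (Suc n))\<^sup>2)" using summable_inverse_squares by (subst summable_Suc_iff)
  then show "summable (\<lambda>n. real N * (1 / (real (Suc n))\<^sup>2))" by (rule summable_mult)
qed

definition centred_term :: "nat \<Rightarrow> 'a \<Rightarrow> real" where "centred_term k \<omega> = (power_sum_sq k \<omega> - mean_sq k) / (real k)\<^sup>2"

lemma centred_term_measurable [measurable]: "centred_term k \<in> borel_measurable M" unfolding centred_term_def[abs_def] by measurable

lemma tail_tendsto:
  assumes w: "\<omega> \<in> space M"
  shows "(\<lambda>R. \<Sum>k\<in>{K<..R}. centred_term k \<omega>) \<longlonglongrightarrow> (scaled_area \<omega> - scaled_mean) - (trunc_area K \<omega> - trunc_mean K)"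
proof -
  have "(\<lambda>k. power_sum_sq (Suc k) \<omega> / (real (Suc k))\<^sup>2 - mean_sq (Suc k) / (real (Suc k))\<^sup>2) sums (scaled_area \<omega> - scaled_mean)"
    unfolding scaled_mean_def by (intro sums_diff scaled_area_sums[OF w] summable_sums summable_mean_sq)
  then have "(\<lambda>n. \<Sum>k<n. centred_term (Suc k) \<omega>) \<longlonglongrightarrow> scaled_area \<omega> - scaled_mean" by (simp add: sums_def centred_term_def diff_divide_distrib)
  moreover have "(\<Sum>k<n. centred_term (Suc k) \<omega>) = (\<Sum>k\<in>{1..n}. centred_term k \<omega>)" for n
    by (rule sum.reindex_bij_witness[of _ "\<lambda>i. i - 1" Suc]) auto
  ultimately have "(\<lambda>n. (\<Sum>k\<in>{1..n}. centred_term k \<omega>) - (trunc_area K \<omega> - trunc_mean K)) \<longlonglongrightarrow> (scaled_area \<omega> - scaled_mean) - (trunc_area K \<omega> - trunc_mean K)"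
    by (intro tendsto_diff tendsto_const) simp
  moreover have "\<forall>\<^sub>F n in sequentially. (\<Sum>k\<in>{1..n}. centred_term k \<omega>) - (trunc_area K \<omega> - trunc_mean K) = (\<Sum>k\<in>{K<..n}. centred_term k \<omega>)"
    using eventually_ge_at_top[of K]
  proof eventually_elim
    case (elim n)
    have "{1..n} = {1..K} \<union> {K<..n}" using elim by auto
    then have "(\<Sum>k\<in>{1..n}. centred_term k \<omega>) = (\<Sum>k\<in>{1..K}. centred_term k \<omega>) + (\<Sum>k\<in>{K<..n}. centred_term k \<omega>)"
      by (simp only: ) (rule sum.union_disjoint, auto)
    moreover have "(\<Sum>k\<in>{1..K}. centred_term k \<omega>) = trunc_area K \<omega> - trunc_mean K"
      by (simp add: centred_term_def trunc_area_def trunc_mean_def diff_divide_distrib sum_subtractf)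
    ultimately show ?case by simp
  qed
  ultimately show ?thesis by (rule Lim_transform_eventually)
qed

text \<open>A crude bound that grows with N: it serves as the dominating constant for letting R tend
  to infinity at fixed N.\<close>

lemma centred_term_sum_bound:
  assumes w: "\<omega> \<in> space M" and K: "K \<ge> 1"
  shows "\<bar>\<Sum>k\<in>{K<..R}. centred_term k \<omega>\<bar> \<le> (real N)\<^sup>2 + real N"
proof -
  have "\<bar>centred_term k \<omega>\<bar> \<le> ((real N)\<^sup>2 + real N) * (1 / (real k)\<^sup>2)" for k
  proof -
    have "0 \<le> mean_sq k" "mean_sq k \<le> real N" by (auto simp: mean_sq_def)
    then have "\<bar>power_sum_sq k \<omega> - mean_sq k\<bar> \<le> (real N)\<^sup>2 + real N"
      using power_sum_sq_bound[OF w, of k] power_sum_sq_nonneg[of k \<omega>] zero_le_power2[of "real N"] by linarith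
    then show ?thesis unfolding centred_term_def abs_divide by (simp add: divide_right_mono)
  qed
  then have "\<bar>\<Sum>k\<in>{K<..R}. centred_term k \<omega>\<bar> \<le> (\<Sum>k\<in>{K<..R}. ((real N)\<^sup>2 + real N) * (1 / (real k)\<^sup>2))"
    by (intro order_trans[OF sum_abs] sum_mono)
  also have "\<dots> = ((real N)\<^sup>2 + real N) * (\<Sum>k\<in>{K<..R}. 1 / (real k)\<^sup>2)" by (rule sum_distrib_left[symmetric])
  also have "\<dots> \<le> ((real N)\<^sup>2 + real N) * 1"
  proof (rule mult_left_mono)
    have "(\<Sum>k\<in>{K<..R}. 1 / (real k)\<^sup>2) \<le> 1 / real K" by (rule sum_inverse_squares_le'[OF K])
    also have "\<dots> \<le> 1" using K by simp
    finally show "(\<Sum>k\<in>{K<..R}. 1 / (real k)\<^sup>2) \<le> 1" .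
  qed auto
  finally show ?thesis by simp
qed

text \<open>The variance bound for finite sections becomes a bound in mean through |x| \<le> (s +
  x^2 / s) / 2, with s^2 the bound on the second moment; dominated convergence then removes the
  upper cutoff R.\<close>

lemma tail_L1:
  assumes K: "K \<ge> 1"
  shows "expectation (\<lambda>\<omega>. \<bar>(scaled_area \<omega> - scaled_mean) - (trunc_area K \<omega> - trunc_mean K)\<bar>) \<le> sqrt (11 / real K)"
    and "integrable M (\<lambda>\<omega>. \<bar>(scaled_area \<omega> - scaled_mean) - (trunc_area K \<omega> - trunc_mean K)\<bar>)"
proof -
  define s where "s = sqrt (11 / real K)"
  have s: "s > 0" "s\<^sup>2 = 11 / real K" using K by (auto simp: s_def)
  let ?T = "\<lambda>R \<omega>. \<Sum>k\<in>{K<..R}. centred_term k \<omega>"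
  have b: "expectation (\<lambda>\<omega>. \<bar>?T R \<omega>\<bar>) \<le> s" for R
  proof -
    have iT: "integrable M (\<lambda>\<omega>. \<bar>?T R \<omega>\<bar>)"
      by (rule integrable_bounded_real[where C="(real N)\<^sup>2 + real N"]) (use centred_term_sum_bound[OF _ K] in auto)
    have iT2: "integrable M (\<lambda>\<omega>. (?T R \<omega>)\<^sup>2)"
    proof (rule integrable_bounded_real[where C="((real N)\<^sup>2 + real N)\<^sup>2"])
      show "\<bar>(?T R \<omega>)\<^sup>2\<bar> \<le> ((real N)\<^sup>2 + real N)\<^sup>2" if "\<omega> \<in> space M" for \<omega>
        using power_mono[OF centred_term_sum_bound[OF that K, of R] abs_ge_zero, of 2] by simp
    qed measurable
    have "expectation (\<lambda>\<omega>. \<bar>?T R \<omega>\<bar>) \<le> expectation (\<lambda>\<omega>. (s + (?T R \<omega>)\<^sup>2 / s) / 2)"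
    proof (rule integral_mono[OF iT])
      show "integrable M (\<lambda>\<omega>. (s + (?T R \<omega>)\<^sup>2 / s) / 2)" using iT2 by simp
      fix \<omega>
      have "2 * \<bar>?T R \<omega>\<bar> * s \<le> \<bar>?T R \<omega>\<bar>\<^sup>2 + s\<^sup>2" by (rule sum_squares_bound)
      then show "\<bar>?T R \<omega>\<bar> \<le> (s + (?T R \<omega>)\<^sup>2 / s) / 2" using s(1) by (simp add: field_simps power2_eq_square)
    qed
    also have "\<dots> = (s + expectation (\<lambda>\<omega>. (?T R \<omega>)\<^sup>2) / s) / 2" using iT2 by (simp add: prob_space)
    also have "expectation (\<lambda>\<omega>. (?T R \<omega>)\<^sup>2) \<le> s\<^sup>2" unfolding s(2) centred_term_def by (rule tail_variance[OF K])
    then have "(s + expectation (\<lambda>\<omega>. (?T R \<omega>)\<^sup>2) / s) / 2 \<le> (s + s\<^sup>2 / s) / 2" using s(1) by (intro divide_right_mono add_left_mono) auto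
    also have "\<dots> = s" using s(1) by (simp add: power2_eq_square)
    finally show ?thesis by simp
  qed
  have lim: "(\<lambda>R. expectation (\<lambda>\<omega>. \<bar>?T R \<omega>\<bar>)) \<longlonglongrightarrow> expectation (\<lambda>\<omega>. \<bar>(scaled_area \<omega> - scaled_mean) - (trunc_area K \<omega> - trunc_mean K)\<bar>)"
    and "integrable M (\<lambda>\<omega>. \<bar>(scaled_area \<omega> - scaled_mean) - (trunc_area K \<omega> - trunc_mean K)\<bar>)"
    by (rule integral_dominated_convergence[where w="\<lambda>_. (real N)\<^sup>2 + real N"],
        use centred_term_sum_bound[OF _ K] in \<open>auto intro!: AE_I2 tendsto_rabs tail_tendsto\<close>)
      (rule integrable_dominated_convergence[where w="\<lambda>_. (real N)\<^sup>2 + real N" and s="\<lambda>R \<omega>. \<bar>?T R \<omega>\<bar>"],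
        use centred_term_sum_bound[OF _ K] in \<open>auto intro!: AE_I2 tendsto_rabs tail_tendsto\<close>)
  then show "integrable M (\<lambda>\<omega>. \<bar>(scaled_area \<omega> - scaled_mean) - (trunc_area K \<omega> - trunc_mean K)\<bar>)" by simp
  show "expectation (\<lambda>\<omega>. \<bar>(scaled_area \<omega> - scaled_mean) - (trunc_area K \<omega> - trunc_mean K)\<bar>) \<le> sqrt (11 / real K)"
    using b by (intro LIMSEQ_le_const2[OF lim]) (auto simp: s_def)
qed

text \<open>The map x \<mapsto> exp (i x) is 1-Lipschitz, so a tail small in mean changes the
  characteristic function little.\<close>

theorem char_scaled_area:
  assumes K: "K \<ge> 1"
  shows "cmod ((\<integral>\<omega>. exp (\<i> * of_real (t * (scaled_area \<omega> - scaled_mean))) \<partial>M) - exp (- \<i> * of_real (t * trunc_mean K)) * trunc_char K t) \<le> \<bar>t\<bar> * sqrt (11 / real K)"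
proof -
  have m1: "integrable M (\<lambda>\<omega>. exp (\<i> * of_real (t * (scaled_area \<omega> - scaled_mean))))"
    by (rule integrable_const_bound[where B=1]) (auto simp: norm_exp_eq_Re)
  have m2: "integrable M (\<lambda>\<omega>. exp (\<i> * of_real (t * (trunc_area K \<omega> - trunc_mean K))))"
    by (rule integrable_const_bound[where B=1]) (auto simp: norm_exp_eq_Re)
  have "exp (- \<i> * of_real (t * trunc_mean K)) * trunc_char K t = (\<integral>\<omega>. exp (- \<i> * of_real (t * trunc_mean K)) * trunc_iexp K t \<omega> \<partial>M)"
    by (simp add: trunc_char_def trunc_iexp_def)
  also have "\<dots> = (\<integral>\<omega>. exp (\<i> * of_real (t * (trunc_area K \<omega> - trunc_mean K))) \<partial>M)"
    by (rule Bochner_Integration.integral_cong[OF refl]) (simp add: trunc_iexp_def exp_add[symmetric] algebra_simps)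
  finally have "cmod ((\<integral>\<omega>. exp (\<i> * of_real (t * (scaled_area \<omega> - scaled_mean))) \<partial>M) - exp (- \<i> * of_real (t * trunc_mean K)) * trunc_char K t)
    = cmod (\<integral>\<omega>. exp (\<i> * of_real (t * (scaled_area \<omega> - scaled_mean))) - exp (\<i> * of_real (t * (trunc_area K \<omega> - trunc_mean K))) \<partial>M)"
    using m1 m2 by simp
  also have "\<dots> \<le> (\<integral>\<omega>. cmod (exp (\<i> * of_real (t * (scaled_area \<omega> - scaled_mean))) - exp (\<i> * of_real (t * (trunc_area K \<omega> - trunc_mean K)))) \<partial>M)"
    by (rule integral_norm_bound)
  also have "\<dots> \<le> (\<integral>\<omega>. \<bar>t\<bar> * \<bar>(scaled_area \<omega> - scaled_mean) - (trunc_area K \<omega> - trunc_mean K)\<bar> \<partial>M)"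
  proof (rule integral_mono)
    show "integrable M (\<lambda>\<omega>. \<bar>t\<bar> * \<bar>(scaled_area \<omega> - scaled_mean) - (trunc_area K \<omega> - trunc_mean K)\<bar>)" by (rule integrable_mult_right[OF tail_L1(2)[OF K]])
    show "cmod (exp (\<i> * of_real (t * (scaled_area \<omega> - scaled_mean))) - exp (\<i> * of_real (t * (trunc_area K \<omega> - trunc_mean K)))) \<le> \<bar>t\<bar> * \<bar>(scaled_area \<omega> - scaled_mean) - (trunc_area K \<omega> - trunc_mean K)\<bar>" for \<omega>
      using norm_iexp_diff_le[of "t * (scaled_area \<omega> - scaled_mean)" "t * (trunc_area K \<omega> - trunc_mean K)"] by (simp only: right_diff_distrib[symmetric] abs_mult)
  qed (use m1 m2 in auto)
  also have "\<dots> \<le> \<bar>t\<bar> * sqrt (11 / real K)" using tail_L1(1)[OF K] by (simp add: mult_left_mono)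
  finally show ?thesis .
qed

end

section \<open>The limiting series\<close>

text \<open>The partial sums converge along g, and within a block they deviate from the value at its
  start by at most the absolute sum of the block.\<close>

lemma summable_blocks:
  fixes a :: "nat \<Rightarrow> real"
  assumes g: "strict_mono g" "g 0 = (0::nat)"
    and D: "summable (\<lambda>n. \<Sum>j\<in>{g n..<g (Suc n)}. a j)"
    and B: "(\<lambda>n. \<Sum>j\<in>{g n..<g (Suc n)}. \<bar>a j\<bar>) \<longlonglongrightarrow> 0"
  shows "summable a"
proof -
  define T where "T m = (\<Sum>j<m. a j)" for m
  have split: "T m' = T m + (\<Sum>j\<in>{m..<m'}. a j)" if "m \<le> m'" for m m'
    unfolding T_def using sum.atLeastLessThan_concat[of 0 m m' a] that by (simp add: atLeast0LessThan)
  have Tg: "T (g n) = (\<Sum>i<n. \<Sum>j\<in>{g i..<g (Suc i)}. a j)" for n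
  proof (induction n)
    case (Suc n)
    have "g n \<le> g (Suc n)" using g(1) by (simp add: strict_mono_less_eq)
    from split[OF this] show ?case using Suc.IH by simp
  qed (simp add: T_def g)
  define L where "L = (\<Sum>n. \<Sum>j\<in>{g n..<g (Suc n)}. a j)"
  have TgL: "(\<lambda>n. T (g n)) \<longlonglongrightarrow> L" unfolding Tg L_def using summable_LIMSEQ[OF D] .
  have "T \<longlonglongrightarrow> L"
  proof (rule LIMSEQ_I)
    fix e :: real assume e: "0 < e"
    obtain n1 where n1: "\<And>n. n \<ge> n1 \<Longrightarrow> norm (T (g n) - L) < e / 2" using LIMSEQ_D[OF TgL, of "e / 2"] e by auto
    obtain n2 where n2: "\<And>n. n \<ge> n2 \<Longrightarrow> norm ((\<Sum>j\<in>{g n..<g (Suc n)}. \<bar>a j\<bar>) - 0) < e / 2" using LIMSEQ_D[OF B, of "e / 2"] e by auto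
    have "norm (T m - L) < e" if m: "m \<ge> g (max n1 n2)" for m
    proof -
      have "\<exists>n. g n \<le> m \<and> m < g (Suc n)" for m
      proof (induction m)
        case 0 then show ?case using g strict_monoD[OF g(1), of 0 1] by (intro exI[of _ 0]) auto
      next
        case (Suc m)
        then obtain n where n: "g n \<le> m" "m < g (Suc n)" by auto
        show ?case
        proof (cases "Suc m < g (Suc n)")
          case True then show ?thesis using n by (intro exI[of _ n]) auto
        next
          case False then show ?thesis using n strict_monoD[OF g(1), of "Suc n" "Suc (Suc n)"] by (intro exI[of _ "Suc n"]) auto
        qed
      qed
      then obtain n where n: "g n \<le> m" "m < g (Suc n)" by blast
      have "g (max n1 n2) < g (Suc n)" using m n by linarith
      then have nn: "n \<ge> n1" "n \<ge> n2" using g(1) by (auto simp: strict_mono_less)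
      have "\<bar>\<Sum>j\<in>{g n..<m}. a j\<bar> \<le> (\<Sum>j\<in>{g n..<m}. \<bar>a j\<bar>)" by (rule sum_abs)
      also have "\<dots> \<le> (\<Sum>j\<in>{g n..<g (Suc n)}. \<bar>a j\<bar>)" using n by (intro sum_mono2) auto
      also have "\<dots> < e / 2" using n2[OF nn(2)] by simp
      finally have "\<bar>\<Sum>j\<in>{g n..<m}. a j\<bar> < e / 2" .
      then show ?thesis using n1[OF nn(1)] split[OF n(1)] by (simp only: real_norm_def)
    qed
    then show "\<exists>no. \<forall>m\<ge>no. norm (T m - L) < e" by blast
  qed
  then show ?thesis unfolding T_def[abs_def] sums_def[symmetric] by (rule sums_summable)
qed

context prob_space
begin

text \<open>Orthogonality alone suffices for convergence along the cubes, and the blocks between consecutive cubes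
are short enough for their absolute sums to tend to zero as well.\<close>

lemma AE_summable_orthogonal:
  fixes X :: "nat \<Rightarrow> 'a \<Rightarrow> real"
  assumes int: "\<And>i j. integrable M (\<lambda>\<omega>. X i \<omega> * X j \<omega>)" and meas [measurable]: "\<And>i. X i \<in> borel_measurable M"
    and orth: "\<And>i j. i \<noteq> j \<Longrightarrow> expectation (\<lambda>\<omega>. X i \<omega> * X j \<omega>) = 0"
    and bound: "\<And>j. expectation (\<lambda>\<omega>. (X j \<omega>)\<^sup>2) \<le> 4 / (real (Suc j))\<^sup>2"
  shows "AE \<omega> in M. summable (\<lambda>j. X j \<omega>)"
proof -
  define I where "I n = {n ^ 3..<(Suc n) ^ 3}" for n :: nat
  have [simp]: "finite (I n)" for n by (simp add: I_def)
  have int2: "integrable M (\<lambda>\<omega>. (X j \<omega>)\<^sup>2)" for j using int[of j j] by (simp add: power2_eq_square)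
  have card: "real (card (I n)) \<le> 3 * (real (Suc n))\<^sup>2" for n
  proof -
    have "card (I n) = 3 * n\<^sup>2 + 3 * n + 1" by (simp add: I_def power3_eq_cube power2_eq_square algebra_simps)
    then show ?thesis by (simp add: power2_eq_square algebra_simps)
  qed
  \<comment> \<open>In the n-th block j + 1 \<ge> n^3 + 1 \<ge> (n + 1)^3 / 4; squaring gives the
    factor 16, and 64 = 4 * 16.\<close>
  have b: "4 / (real (Suc j))\<^sup>2 \<le> 64 / real (Suc n) ^ 6" if "j \<in> I n" for j n
  proof -
    define x where "x = real n"
    have "real (n ^ 3) \<le> real j" using that unfolding I_def by (metis atLeastLessThan_iff of_nat_le_iff)
    then have "x ^ 3 + 1 \<le> real (Suc j)" by (simp add: x_def)
    moreover have "(x + 1) ^ 3 \<le> 4 * (x ^ 3 + 1)"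
    proof -
      have "0 \<le> 3 * ((x - 1)\<^sup>2 * (x + 1))" by (intro mult_nonneg_nonneg) (auto simp: x_def)
      also have "\<dots> = 4 * (x ^ 3 + 1) - (x + 1) ^ 3" by (simp add: power2_eq_square power3_eq_cube algebra_simps)
      finally show ?thesis by simp
    qed
    ultimately have "(x + 1) ^ 3 \<le> 4 * real (Suc j)" by (meson mult_left_mono order_trans zero_le_numeral)
    then have "((x + 1) ^ 3)\<^sup>2 \<le> (4 * real (Suc j))\<^sup>2" by (intro power_mono) (auto simp: x_def)
    then have h: "real (Suc n) ^ 6 \<le> 16 * (real (Suc j))\<^sup>2" by (simp add: x_def add.commute power_mult_distrib del: distrib_left_numeral flip: power_mult)
    have p: "0 < real (Suc n) ^ 6" "0 < (real (Suc j))\<^sup>2" by simp_all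
    have "4 / (real (Suc j))\<^sup>2 = 64 / (16 * (real (Suc j))\<^sup>2)" by (simp del: of_nat_Suc)
    also have "\<dots> \<le> 64 / real (Suc n) ^ 6" by (intro divide_left_mono h mult_pos_pos p) auto
    finally show ?thesis .
  qed
  have sumb: "(\<Sum>j\<in>I n. expectation (\<lambda>\<omega>. (X j \<omega>)\<^sup>2)) \<le> 192 / real (Suc n) ^ 4" for n
  proof -
    have "(\<Sum>j\<in>I n. expectation (\<lambda>\<omega>. (X j \<omega>)\<^sup>2)) \<le> (\<Sum>j\<in>I n. 64 / real (Suc n) ^ 6)"
      by (intro sum_mono order_trans[OF bound b]) auto
    also have "\<dots> = real (card (I n)) * (64 / real (Suc n) ^ 6)" by simp
    also have "\<dots> \<le> 3 * (real (Suc n))\<^sup>2 * (64 / real (Suc n) ^ 6)" by (intro mult_right_mono card) auto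
    also have "\<dots> = 192 / real (Suc n) ^ 4" by (simp add: field_simps del: of_nat_Suc flip: power_add)
    finally show ?thesis .
  qed
  have summ: "summable (\<lambda>n. c * (1 / (real (Suc n))\<^sup>2))" for c :: real
    by (intro summable_mult) (use inverse_power_summable[of 2, where 'a=real] in \<open>simp add: inverse_eq_divide summable_Suc_iff[of "\<lambda>n. 1 / (real n)\<^sup>2"] del: of_nat_Suc\<close>)
  \<comment> \<open>Cauchy-Schwarz within a block: its length, at most 3 (n + 1)^2, times the second
    moments, at most 192 / (n + 1)^4, gives 576 / (n + 1)^2.\<close>
  have B: "AE \<omega> in M. summable (\<lambda>n. (\<Sum>j\<in>I n. \<bar>X j \<omega>\<bar>)\<^sup>2)"
  proof (rule AE_summable_of_expectation)
    fix n
    have le: "(\<Sum>j\<in>I n. \<bar>X j \<omega>\<bar>)\<^sup>2 \<le> 3 * (real (Suc n))\<^sup>2 * (\<Sum>j\<in>I n. (X j \<omega>)\<^sup>2)" for \<omega>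
    proof -
      have "(\<Sum>j\<in>I n. \<bar>X j \<omega>\<bar>)\<^sup>2 \<le> (\<Sum>j\<in>I n. (X j \<omega>)\<^sup>2) * real (card (I n))"
        using sum_squared_le_sum_of_squares[of "\<lambda>j. \<bar>X j \<omega>\<bar>" "I n"] by simp
      also have "\<dots> \<le> (\<Sum>j\<in>I n. (X j \<omega>)\<^sup>2) * (3 * (real (Suc n))\<^sup>2)" by (intro mult_left_mono card sum_nonneg) auto
      finally show ?thesis by (simp only: mult.commute)
    qed
    have iR: "integrable M (\<lambda>\<omega>. 3 * (real (Suc n))\<^sup>2 * (\<Sum>j\<in>I n. (X j \<omega>)\<^sup>2))"
      by (intro integrable_mult_right Bochner_Integration.integrable_sum int2)
    show i: "integrable M (\<lambda>\<omega>. (\<Sum>j\<in>I n. \<bar>X j \<omega>\<bar>)\<^sup>2)"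
      by (rule Bochner_Integration.integrable_bound[OF iR]) (use le in \<open>auto intro: order_trans[OF _ abs_ge_self]\<close>)
    have "expectation (\<lambda>\<omega>. (\<Sum>j\<in>I n. \<bar>X j \<omega>\<bar>)\<^sup>2) \<le> expectation (\<lambda>\<omega>. 3 * (real (Suc n))\<^sup>2 * (\<Sum>j\<in>I n. (X j \<omega>)\<^sup>2))"
      by (rule integral_mono[OF i iR le])
    also have "\<dots> = 3 * (real (Suc n))\<^sup>2 * (\<Sum>j\<in>I n. expectation (\<lambda>\<omega>. (X j \<omega>)\<^sup>2))"
      by (simp only: integral_mult_right_zero Bochner_Integration.integral_sum[OF int2])
    also have "\<dots> \<le> 3 * (real (Suc n))\<^sup>2 * (192 / real (Suc n) ^ 4)" by (intro mult_left_mono sumb) auto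
    also have "\<dots> = 576 * (1 / (real (Suc n))\<^sup>2)" by (simp add: field_simps del: of_nat_Suc flip: power_add)
    finally show "expectation (\<lambda>\<omega>. (\<Sum>j\<in>I n. \<bar>X j \<omega>\<bar>)\<^sup>2) \<le> 576 * (1 / (real (Suc n))\<^sup>2)" .
  qed (rule zero_le_power2 abs_ge_zero summ)+
  have D: "AE \<omega> in M. summable (\<lambda>n. \<bar>\<Sum>j\<in>I n. X j \<omega>\<bar>)"
  proof (rule AE_summable_of_expectation)
    fix n
    define p where "p = (real (Suc n))\<^sup>2"
    have p: "p > 0" by (simp add: p_def)
    have e: "(\<Sum>j\<in>I n. X j \<omega>)\<^sup>2 = (\<Sum>i\<in>I n. \<Sum>j\<in>I n. X i \<omega> * X j \<omega>)" for \<omega> by (simp add: power2_eq_square sum_product)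
    have i2: "integrable M (\<lambda>\<omega>. (\<Sum>j\<in>I n. X j \<omega>)\<^sup>2)" unfolding e by (intro Bochner_Integration.integrable_sum int)
    have "expectation (\<lambda>\<omega>. (\<Sum>j\<in>I n. X j \<omega>)\<^sup>2) = (\<Sum>i\<in>I n. \<Sum>j\<in>I n. expectation (\<lambda>\<omega>. X i \<omega> * X j \<omega>))"
      unfolding e by (subst Bochner_Integration.integral_sum; intro Bochner_Integration.integrable_sum int sum.cong refl Bochner_Integration.integral_sum)
    also have "\<dots> = (\<Sum>i\<in>I n. \<Sum>j\<in>I n. if i = j then expectation (\<lambda>\<omega>. (X i \<omega>)\<^sup>2) else 0)"
      by (intro sum.cong refl) (auto simp: orth power2_eq_square)
    also have "\<dots> = (\<Sum>i\<in>I n. expectation (\<lambda>\<omega>. (X i \<omega>)\<^sup>2))" by simp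
    also have "\<dots> \<le> 192 / real (Suc n) ^ 4" by (rule sumb)
    also have "\<dots> = 192 / p\<^sup>2" by (simp add: p_def flip: power_mult)
    finally have e2: "expectation (\<lambda>\<omega>. (\<Sum>j\<in>I n. X j \<omega>)\<^sup>2) \<le> 192 / p\<^sup>2" .
    \<comment> \<open>The weight p = (n + 1)^2 balances the two terms: a second moment of at most
      192 / p^2 turns into a first moment of at most (1 + 192) / (2 p).\<close>
    have le: "\<bar>d\<bar> \<le> 1 / (2 * p) + p / 2 * d\<^sup>2" for d :: real
    proof -
      have "0 \<le> p / 2 * (\<bar>d\<bar> - 1 / p)\<^sup>2" using p by simp
      also have "\<dots> = 1 / (2 * p) + p / 2 * d\<^sup>2 - \<bar>d\<bar>" using p by (simp add: power2_diff field_simps power2_eq_square)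
      finally show ?thesis by simp
    qed
    have iR: "integrable M (\<lambda>\<omega>. 1 / (2 * p) + p / 2 * (\<Sum>j\<in>I n. X j \<omega>)\<^sup>2)"
      by (intro Bochner_Integration.integrable_add integrable_const integrable_mult_right i2)
    show i: "integrable M (\<lambda>\<omega>. \<bar>\<Sum>j\<in>I n. X j \<omega>\<bar>)"
      by (rule Bochner_Integration.integrable_bound[OF iR]) (use le in \<open>auto intro: order_trans[OF _ abs_ge_self]\<close>)
    have "expectation (\<lambda>\<omega>. \<bar>\<Sum>j\<in>I n. X j \<omega>\<bar>) \<le> expectation (\<lambda>\<omega>. 1 / (2 * p) + p / 2 * (\<Sum>j\<in>I n. X j \<omega>)\<^sup>2)"
      by (rule integral_mono[OF i iR le])
    also have "\<dots> = 1 / (2 * p) + p / 2 * expectation (\<lambda>\<omega>. (\<Sum>j\<in>I n. X j \<omega>)\<^sup>2)"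
      using i2 by (subst Bochner_Integration.integral_add) (auto simp: prob_space)
    also have "\<dots> \<le> 1 / (2 * p) + p / 2 * (192 / p\<^sup>2)" using p e2 by (intro add_left_mono mult_left_mono) auto
    also have "\<dots> = (193 / 2) * (1 / (real (Suc n))\<^sup>2)" unfolding p_def[symmetric] using p by (simp add: field_simps power2_eq_square)
    finally show "expectation (\<lambda>\<omega>. \<bar>\<Sum>j\<in>I n. X j \<omega>\<bar>) \<le> (193 / 2) * (1 / (real (Suc n))\<^sup>2)" .
  qed (rule zero_le_power2 abs_ge_zero summ)+
  from B D show ?thesis
  proof eventually_elim
    case (elim \<omega>)
    have "(\<lambda>n. sqrt ((\<Sum>j\<in>I n. \<bar>X j \<omega>\<bar>)\<^sup>2)) \<longlonglongrightarrow> sqrt 0" by (intro tendsto_real_sqrt summable_LIMSEQ_zero elim)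
    then have b: "(\<lambda>n. \<Sum>j\<in>I n. \<bar>X j \<omega>\<bar>) \<longlonglongrightarrow> 0" by (simp add: sum_nonneg)
    have d: "summable (\<lambda>n. \<Sum>j\<in>I n. X j \<omega>)" by (rule summable_rabs_cancel[OF elim(2)])
    have m: "strict_mono (\<lambda>n::nat. n ^ 3)" by (auto simp: strict_mono_def power_strict_mono)
    show ?case by (rule summable_blocks[OF m _ d[unfolded I_def] b[unfolded I_def]]) simp
  qed
qed

text \<open>The variables are indexed from 1 and the terms of the series from 0.\<close>

lemma indep_vars_Suc:
  assumes "indep_vars (\<lambda>_. N) Y {1..}"
  shows "indep_vars (\<lambda>_. N) (\<lambda>j. Y (Suc j)) UNIV"
proof -
  let ?F = "\<lambda>i. {Y i -` A \<inter> space M | A. A \<in> sets N}"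
  have F: "\<And>i. i \<in> {1..} \<Longrightarrow> random_variable N (Y i)" "\<And>i. i \<in> {1..} \<Longrightarrow> ?F i \<subseteq> events"
    "\<And>J A. J \<subseteq> {1..} \<Longrightarrow> J \<noteq> {} \<Longrightarrow> finite J \<Longrightarrow> A \<in> Pi J ?F \<Longrightarrow> prob (\<Inter>j\<in>J. A j) = (\<Prod>j\<in>J. prob (A j))"
    using assms unfolding indep_vars_def2 indep_sets_def by blast+
  show ?thesis unfolding indep_vars_def2 indep_sets_def
  proof (intro conjI ballI allI impI)
    fix J A assume J: "J \<noteq> {}" "finite J" and A: "A \<in> Pi J (\<lambda>j. ?F (Suc j))"
    have "(\<lambda>i. A (i - 1)) \<in> Pi (Suc ` J) ?F" using A by (auto simp: Pi_iff)
    from F(3)[OF _ _ _ this] J show "prob (\<Inter>j\<in>J. A j) = (\<Prod>j\<in>J. prob (A j))"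
      by (simp add: prod.reindex image_image image_subset_iff)
  qed (rule F(1) F(2); simp)+
qed

text \<open>The terms are independent and centred, hence orthogonal, so the series converges almost
  surely. The partial sums have explicit characteristic functions, in which the centring produces
  the phase with the harmonic number, and dominated convergence yields the limit.\<close>

lemma gaussian_series:
  fixes Y :: "nat \<Rightarrow> 'a \<Rightarrow> complex"
  assumes ind: "indep_vars (\<lambda>_. borel) Y {1..}" and gauss: "\<And>j. j \<ge> 1 \<Longrightarrow> std_complex_gaussian M (Y j)"
  defines "X \<equiv> \<lambda>j \<omega>. 1 / real (Suc j) * ((cmod (Y (Suc j) \<omega>))\<^sup>2 - 1)"
  shows "AE \<omega> in M. summable (\<lambda>j. X j \<omega>)"
    and "random_variable borel (\<lambda>\<omega>. \<Sum>j. X j \<omega>)"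
    and "(\<lambda>K. exp (- \<i> * of_real (t * harm K)) / char_denom K t) \<longlonglongrightarrow> char (distr M borel (\<lambda>\<omega>. \<Sum>j. X j \<omega>)) t"
proof -
  have indX: "indep_vars (\<lambda>_. borel) X UNIV"
    unfolding X_def by (rule indep_vars_compose2[OF indep_vars_Suc[OF ind], where Y="\<lambda>j z. 1 / real (Suc j) * ((cmod z)\<^sup>2 - 1)"]) measurable
  then have meas [measurable]: "random_variable borel (X j)" for j by (auto simp: indep_vars_def)
  note mom = std_complex_gaussian_moments[OF gauss]
  have i1: "integrable M (X j)" for j unfolding X_def
    by (intro integrable_mult_right Bochner_Integration.integrable_diff mom) auto
  have z: "expectation (X j) = 0" for j unfolding X_def using mom[of "Suc j"] by (simp add: prob_space)
  have i2: "integrable M (\<lambda>\<omega>. (X j \<omega>)\<^sup>2)" for j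
    unfolding X_def power_mult_distrib by (intro integrable_mult_right mom) auto
  have v: "expectation (\<lambda>\<omega>. (X j \<omega>)\<^sup>2) \<le> 4 / (real (Suc j))\<^sup>2" for j
  proof -
    have "expectation (\<lambda>\<omega>. (X j \<omega>)\<^sup>2) = (1 / real (Suc j))\<^sup>2 * expectation (\<lambda>\<omega>. ((cmod (Y (Suc j) \<omega>))\<^sup>2 - 1)\<^sup>2)"
      unfolding X_def power_mult_distrib by (rule integral_mult_right_zero)
    also have "\<dots> \<le> (1 / real (Suc j))\<^sup>2 * 4" by (intro mult_left_mono mom) auto
    finally show ?thesis by (simp add: power_divide)
  qed
  have pair: "integrable M (\<lambda>\<omega>. X i \<omega> * X j \<omega>) \<and> expectation (\<lambda>\<omega>. X i \<omega> * X j \<omega>) = 0" if "i \<noteq> j" for i j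
  proof -
    have a: "indep_vars (\<lambda>_. borel) X {i, j}" by (rule indep_vars_subset[OF indX]) simp
    have "integrable M (\<lambda>\<omega>. \<Prod>k\<in>{i, j}. X k \<omega>)" by (rule indep_vars_integrable[OF _ a]) (auto simp: i1)
    moreover have "expectation (\<lambda>\<omega>. \<Prod>k\<in>{i, j}. X k \<omega>) = (\<Prod>k\<in>{i, j}. expectation (X k))"
      by (rule indep_vars_lebesgue_integral[OF _ a]) (auto simp: i1)
    ultimately show ?thesis using that by (simp add: z)
  qed
  show AEs: "AE \<omega> in M. summable (\<lambda>j. X j \<omega>)"
  proof (rule AE_summable_orthogonal)
    show "integrable M (\<lambda>\<omega>. X i \<omega> * X j \<omega>)" for i j
      using pair[of i j] i2[of i] by (cases "i = j") (auto simp: power2_eq_square)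
  qed (use pair v in auto)
  show rv: "random_variable borel (\<lambda>\<omega>. \<Sum>j. X j \<omega>)" by measurable
  have cX: "char (distr M borel (X j)) s = exp (- \<i> * of_real (s / real (Suc j))) / (1 - \<i> * of_real s / of_nat (Suc j))" for j s
  proof -
    have "char (distr M borel (X j)) s = (\<integral>\<omega>. iexp (s * X j \<omega>) \<partial>M)" unfolding char_def by (rule integral_distr) measurable
    also have "\<dots> = (\<integral>\<omega>. exp (- \<i> * of_real (s / real (Suc j))) * iexp (s / real (Suc j) * (cmod (Y (Suc j) \<omega>))\<^sup>2) \<partial>M)"
      by (intro Bochner_Integration.integral_cong refl) (simp add: X_def exp_add[symmetric] algebra_simps diff_divide_distrib del: of_nat_Suc)
    also have "\<dots> = exp (- \<i> * of_real (s / real (Suc j))) * (\<integral>\<omega>. iexp (s / real (Suc j) * (cmod (Y (Suc j) \<omega>))\<^sup>2) \<partial>M)"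
      by (rule integral_mult_right_zero)
    also have "(\<integral>\<omega>. iexp (s / real (Suc j) * (cmod (Y (Suc j) \<omega>))\<^sup>2) \<partial>M) = 1 / (1 - \<i> * of_real (s / real (Suc j)))"
      by (rule std_complex_gaussian_char[OF gauss]) simp
    finally show ?thesis by simp
  qed
  have cS: "char (distr M borel (\<lambda>\<omega>. \<Sum>j<K. X j \<omega>)) t = exp (- \<i> * of_real (t * harm K)) / char_denom K t" for K
  proof -
    have "char (distr M borel (\<lambda>\<omega>. \<Sum>j<K. X j \<omega>)) t = (\<Prod>j<K. char (distr M borel (X j)) t)"
      by (rule char_distr_sum[OF indep_vars_subset[OF indX]]) simp
    also have "\<dots> = (\<Prod>j<K. exp (- \<i> * of_real (t / real (Suc j)))) / (\<Prod>j<K. 1 - \<i> * of_real t / of_nat (Suc j))"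
      by (simp only: cX prod_dividef)
    also have "(\<Prod>j<K. exp (- \<i> * of_real (t / real (Suc j)))) = exp (\<Sum>j<K. - \<i> * of_real (t / real (Suc j)))"
      by (rule exp_sum[symmetric]) simp
    also have "(\<Sum>j<K. - \<i> * of_real (t / real (Suc j))) = - \<i> * of_real (t * (\<Sum>j<K. inverse (real (Suc j))))"
      by (simp add: sum_distrib_left sum_negf divide_inverse of_real_sum del: of_nat_Suc)
    also have "(\<Sum>j<K. inverse (real (Suc j))) = harm K"
      unfolding harm_def by (rule sum.reindex_bij_witness[of _ "\<lambda>i. i - 1" Suc]) auto
    also have "(\<Prod>j<K. 1 - \<i> * of_real t / of_nat (Suc j)) = char_denom K t"
      unfolding char_denom_def by (rule prod.reindex_bij_witness[of _ "\<lambda>i. i - 1" Suc]) auto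
    finally show ?thesis .
  qed
  have "(\<lambda>K. \<integral>\<omega>. iexp (t * (\<Sum>j<K. X j \<omega>)) \<partial>M) \<longlonglongrightarrow> (\<integral>\<omega>. iexp (t * (\<Sum>j. X j \<omega>)) \<partial>M)"
  proof (rule integral_dominated_convergence[where w="\<lambda>_. 1"])
    show "AE \<omega> in M. (\<lambda>K. iexp (t * (\<Sum>j<K. X j \<omega>))) \<longlonglongrightarrow> iexp (t * (\<Sum>j. X j \<omega>))"
      using AEs by eventually_elim (intro tendsto_exp tendsto_mult tendsto_const tendsto_of_real summable_LIMSEQ)
  qed (auto intro!: AE_I2)
  moreover have "(\<integral>\<omega>. iexp (t * (\<Sum>j<K. X j \<omega>)) \<partial>M) = char (distr M borel (\<lambda>\<omega>. \<Sum>j<K. X j \<omega>)) t" for K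
    unfolding char_def by (rule integral_distr[symmetric]) measurable
  moreover have "(\<integral>\<omega>. iexp (t * (\<Sum>j. X j \<omega>)) \<partial>M) = char (distr M borel (\<lambda>\<omega>. \<Sum>j. X j \<omega>)) t"
    unfolding char_def by (rule integral_distr[symmetric]) measurable
  ultimately show "(\<lambda>K. exp (- \<i> * of_real (t * harm K)) / char_denom K t) \<longlonglongrightarrow> char (distr M borel (\<lambda>\<omega>. \<Sum>j. X j \<omega>)) t"
    by (simp only: cS)
qed

end

text \<open>The terms with k \<le> N are 1/k and give the harmonic number, whence log N and Euler's
  constant. The terms with k > N are N/k^2; telescoping comparison puts their sum between N/(N+1)
  and 1, which is the origin of the summand 1.\<close>

lemma centering_tendsto:
  "(\<lambda>n. (\<Sum>k. real (min (Suc k) (Suc n)) / (real (Suc k))\<^sup>2) - (ln (real (Suc n)) + euler_mascheroni + 1)) \<longlonglongrightarrow> 0"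
proof -
  define c where "c N = (\<Sum>k. real (min (Suc k) N) / (real (Suc k))\<^sup>2)" for N
  define r where "r N = (\<Sum>k. 1 / (real (N + k + 1))\<^sup>2)" for N
  have summ: "summable (\<lambda>k. 1 / (real (N + k + 1))\<^sup>2)" for N
  proof -
    have "summable (\<lambda>k. inverse (real k ^ 2))" by (rule inverse_power_summable) simp
    from summable_ignore_initial_segment[OF this, of "N + 1"] show ?thesis by (simp add: inverse_eq_divide ac_simps)
  qed
  have ts: "(\<lambda>k. 1 / real (m + k) - 1 / real (m + Suc k)) sums (1 / real m)" for m
  proof -
    have "(\<lambda>k. 1 / real (m + k)) \<longlonglongrightarrow> 0"
      using LIMSEQ_ignore_initial_segment[OF lim_1_over_n, of m] by (simp add: add.commute)
    from telescope_sums'[OF this] show ?thesis by simp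
  qed
  have up: "r N \<le> 1 / real N" if "N \<ge> 1" for N
  proof -
    have "1 / (real (N + k + 1))\<^sup>2 \<le> 1 / real (N + k) - 1 / real (N + Suc k)" for k
    proof -
      have "0 < real (N + k)" using that by simp
      then show ?thesis by (simp add: divide_simps power2_eq_square)
    qed
    then show ?thesis unfolding r_def using sums_le[OF _ summable_sums[OF summ] ts] by blast
  qed
  have lo: "1 / real (N + 1) \<le> r N" for N
  proof -
    have "1 / real (N + 1 + k) - 1 / real (N + 1 + Suc k) \<le> 1 / (real (N + k + 1))\<^sup>2" for k
    proof -
      define x where "x = real (N + 1 + k)"
      have "x > 0" by (simp add: x_def)
      then have "1 / x - 1 / (x + 1) \<le> 1 / x\<^sup>2" by (simp add: divide_simps power2_eq_square)
      then show ?thesis by (simp add: x_def ac_simps)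
    qed
    then show ?thesis unfolding r_def using sums_le[OF _ ts summable_sums[OF summ]] by blast
  qed
  have c_eq: "c N = harm N + real N * r N" if "N \<ge> 1" for N
  proof -
    let ?f = "\<lambda>k. real (min (Suc k) N) / (real (Suc k))\<^sup>2"
    have e: "?f (k + N) = real N * (1 / (real (N + k + 1))\<^sup>2)" for k by (simp add: min_def ac_simps)
    have "summable (\<lambda>k. ?f (k + N))" unfolding e by (intro summable_mult summ)
    then have "summable ?f" by (subst (asm) summable_iff_shift[of ?f N])
    then have "c N = (\<Sum>k. ?f (k + N)) + (\<Sum>k<N. ?f k)" unfolding c_def by (rule suminf_split_initial_segment)
    also have "(\<Sum>k. ?f (k + N)) = real N * r N" unfolding e r_def by (rule suminf_mult[OF summ])
    also have "(\<Sum>k<N. ?f k) = (\<Sum>k<N. inverse (real (Suc k)))"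
      by (intro sum.cong refl) (simp add: min_def power2_eq_square field_simps del: of_nat_Suc)
    also have "\<dots> = harm N" unfolding harm_def by (rule sum.reindex_bij_witness[of _ "\<lambda>i. i - 1" Suc]) auto
    finally show ?thesis by simp
  qed
  have "(\<lambda>n. real (Suc n) * r (Suc n)) \<longlonglongrightarrow> 1"
  proof (rule tendsto_sandwich)
    show "(\<lambda>n. real (Suc n) / real (Suc n + 1)) \<longlonglongrightarrow> 1" by real_asymp
    show "\<forall>\<^sub>F n in sequentially. real (Suc n) / real (Suc n + 1) \<le> real (Suc n) * r (Suc n)"
      using mult_left_mono[OF lo, of "real (Suc n)" "Suc n" for n] by (intro always_eventually) (auto simp del: of_nat_Suc)
    show "\<forall>\<^sub>F n in sequentially. real (Suc n) * r (Suc n) \<le> 1"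
    proof (intro always_eventually allI)
      fix n show "real (Suc n) * r (Suc n) \<le> 1" using mult_left_mono[OF up[of "Suc n"], of "real (Suc n)"] by (simp del: of_nat_Suc)
    qed
  qed auto
  moreover have "(\<lambda>n. harm (Suc n) - ln (real (Suc n))) \<longlonglongrightarrow> (euler_mascheroni :: real)"
    using LIMSEQ_Suc[OF euler_mascheroni_LIMSEQ] by simp
  ultimately have "(\<lambda>n. (harm (Suc n) - ln (real (Suc n))) + real (Suc n) * r (Suc n) - (euler_mascheroni + 1)) \<longlonglongrightarrow> euler_mascheroni + 1 - (euler_mascheroni + 1)"
    by (intro tendsto_intros)
  moreover have "(harm (Suc n) - ln (real (Suc n))) + real (Suc n) * r (Suc n) - (euler_mascheroni + 1) = c (Suc n) - (ln (real (Suc n)) + euler_mascheroni + 1)" for n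
    by (simp add: c_eq del: of_nat_Suc)
  ultimately have "(\<lambda>n. c (Suc n) - (ln (real (Suc n)) + euler_mascheroni + 1)) \<longlonglongrightarrow> 0" by (simp only: diff_self)
  then show ?thesis unfolding c_def .
qed

context cue
begin

lemma trunc_mean_eq_harm: assumes "K \<le> N" shows "trunc_mean K = harm K"
  unfolding trunc_mean_def harm_def using assms by (intro sum.cong) (auto simp: mean_sq_def min_def power2_eq_square field_simps)

text \<open>For K \<le> N the truncated mean is the harmonic number of K. The comparison function
  thus depends on K and t alone and coincides with the characteristic function of the K-th partial
  sum of the Gaussian series.\<close>

lemma char_scaled_area_harm:
  assumes K: "1 \<le> K" "K \<le> N"
  shows "cmod ((\<integral>\<omega>. exp (\<i> * of_real (t * (scaled_area \<omega> - scaled_mean))) \<partial>M) - exp (- \<i> * of_real (t * harm K)) / char_denom K t)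
    \<le> \<bar>t\<bar> * sqrt (11 / real K) + (1 + \<bar>t\<bar>) ^ K * (real K * (stein_const K t / real N)) * \<bar>t\<bar>"
proof -
  have ge1: "1 \<le> cmod (char_denom K t)"
    unfolding char_denom_def prod_norm[symmetric] by (intro prod_ge_1 norm_factor_ge)
  have "cmod (trunc_char K t - 1 / char_denom K t) = cmod (trunc_char K t * char_denom K t - 1) / cmod (char_denom K t)"
    using char_denom_nonzero[of K t] by (simp add: field_simps flip: norm_divide)
  also have "\<dots> \<le> cmod (trunc_char K t * char_denom K t - 1) / 1" using ge1 by (intro divide_left_mono) auto
  also have "\<dots> \<le> (1 + \<bar>t\<bar>) ^ K * (real K * (stein_const K t / real N)) * \<bar>t\<bar>" using trunc_char_limit[of K t] by simp
  finally have 1: "cmod (exp (- \<i> * of_real (t * harm K)) * (trunc_char K t - 1 / char_denom K t)) \<le> (1 + \<bar>t\<bar>) ^ K * (real K * (stein_const K t / real N)) * \<bar>t\<bar>"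
    by (simp add: norm_mult norm_exp_eq_Re)
  have 2: "cmod ((\<integral>\<omega>. exp (\<i> * of_real (t * (scaled_area \<omega> - scaled_mean))) \<partial>M) - exp (- \<i> * of_real (t * harm K)) * trunc_char K t) \<le> \<bar>t\<bar> * sqrt (11 / real K)"
    using char_scaled_area[OF K(1), of t] unfolding trunc_mean_eq_harm[OF K(2)] .
  have "(\<integral>\<omega>. exp (\<i> * of_real (t * (scaled_area \<omega> - scaled_mean))) \<partial>M) - exp (- \<i> * of_real (t * harm K)) / char_denom K t
     = ((\<integral>\<omega>. exp (\<i> * of_real (t * (scaled_area \<omega> - scaled_mean))) \<partial>M) - exp (- \<i> * of_real (t * harm K)) * trunc_char K t) + exp (- \<i> * of_real (t * harm K)) * (trunc_char K t - 1 / char_denom K t)"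
    by (simp add: right_diff_distrib)
  then show ?thesis using norm_triangle_le[OF add_mono[OF 2 1]] by (simp only:)
qed

text \<open>Replacing the exact series of second moments by another centring a multiplies the
  characteristic function by a deterministic phase.\<close>

lemma char_shift:
  "char (distr M borel (\<lambda>\<omega>. (real N)\<^sup>2 / 4 * A_CUE N (\<theta> \<omega>) - a)) t
    = exp (\<i> * of_real (t * ((\<Sum>k. real (min (Suc k) N) / (real (Suc k))\<^sup>2) - a))) * (\<integral>\<omega>. exp (\<i> * of_real (t * (scaled_area \<omega> - scaled_mean))) \<partial>M)"
proof -
  have "char (distr M borel (\<lambda>\<omega>. scaled_area \<omega> - a)) t = (\<integral>\<omega>. iexp (t * (scaled_area \<omega> - a)) \<partial>M)"
    unfolding char_def by (rule integral_distr) measurable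
  also have "\<dots> = (\<integral>\<omega>. exp (\<i> * of_real (t * (scaled_mean - a))) * exp (\<i> * of_real (t * (scaled_area \<omega> - scaled_mean))) \<partial>M)"
    by (intro Bochner_Integration.integral_cong refl) (simp add: exp_add[symmetric] algebra_simps)
  finally show ?thesis by (simp add: scaled_area_def scaled_mean_def mean_sq_def)
qed

end

theorem theoremA1:
  fixes M :: "nat \<Rightarrow> 'a measure"
    and U :: "nat \<Rightarrow> 'a \<Rightarrow> complex mat"
    and \<theta> :: "nat \<Rightarrow> 'a \<Rightarrow> nat \<Rightarrow> real"
    and P :: "'b measure"
    and Y :: "nat \<Rightarrow> 'b \<Rightarrow> complex"
  assumes "\<And>N. N \<ge> 1 \<Longrightarrow> prob_space (M N)"
    and "\<And>N. N \<ge> 1 \<Longrightarrow> haar_distributed N (M N) (U N)"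
    and "\<And>N \<omega>. N \<ge> 1 \<Longrightarrow> \<omega> \<in> space (M N) \<Longrightarrow> eigenangles N (U N \<omega>) (\<theta> N \<omega>)"
    and "prob_space P"
    and "prob_space.indep_vars P (\<lambda>_. borel) Y {1..}"
    and "\<And>j. j \<ge> 1 \<Longrightarrow> std_complex_gaussian P (Y j)"
  shows "(\<forall>N\<ge>1. (\<lambda>\<omega>. A_CUE N (\<theta> N \<omega>)) \<in> borel_measurable (M N)) \<and>
    (AE \<omega> in P. summable (\<lambda>j. 1 / real (Suc j) * ((cmod (Y (Suc j) \<omega>))\<^sup>2 - 1))) \<and>
    weak_conv_m
      (\<lambda>N. distr (M N) borel (\<lambda>\<omega>. (real N)\<^sup>2 / 4 * A_CUE N (\<theta> N \<omega>)
                                     - (ln (real N) + euler_mascheroni + 1)))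
      (distr P borel (\<lambda>\<omega>. \<Sum>j. 1 / real (Suc j) * ((cmod (Y (Suc j) \<omega>))\<^sup>2 - 1)))"
proof (intro conjI allI impI)
  have cue: "cue N (M N) (U N) (\<theta> N)" if "N \<ge> 1" for N
    by (intro cue.intro assms that)
  show meas: "(\<lambda>\<omega>. A_CUE N (\<theta> N \<omega>)) \<in> borel_measurable (M N)" if "N \<ge> 1" for N
    by (rule cue.A_CUE_measurable[OF cue[OF that]])
  interpret P: prob_space P by fact
  note series = P.gaussian_series[OF assms(5,6)]
  show "AE \<omega> in P. summable (\<lambda>j. 1 / real (Suc j) * ((cmod (Y (Suc j) \<omega>))\<^sup>2 - 1))" by (rule series(1))
  define \<nu> where "\<nu> = distr P borel (\<lambda>\<omega>. \<Sum>j. 1 / real (Suc j) * ((cmod (Y (Suc j) \<omega>))\<^sup>2 - 1))"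
  define a where "a N = ln (real N) + euler_mascheroni + 1" for N
  define \<mu> where "\<mu> N = distr (M N) borel (\<lambda>\<omega>. (real N)\<^sup>2 / 4 * A_CUE N (\<theta> N \<omega>) - a N)" for N
  define b where "b t N = (\<integral>\<omega>. exp (\<i> * of_real (t * (cue.scaled_area N (\<theta> N) \<omega> - cue.scaled_mean N))) \<partial>M N)" for t N
  \<comment> \<open>K is fixed before N: it makes the tail small uniformly in N and brings the
    partial sums of the Gaussian series close to their limit. Only then does N grow, so that the
    Stein error D K N vanishes.\<close>
  have b_lim: "(\<lambda>n. b t (Suc n)) \<longlonglongrightarrow> char \<nu> t" for t
  proof (rule LIMSEQ_I)
    fix e :: real assume e: "0 < e"
    define \<Psi> where "\<Psi> K = exp (- \<i> * of_real (t * harm K)) / char_denom K t" for K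
    define D where "D K N = (1 + \<bar>t\<bar>) ^ K * (real K * (stein_const K t / real N)) * \<bar>t\<bar>" for K N
    have "(\<lambda>K. \<bar>t\<bar> * sqrt (11 / real K)) \<longlonglongrightarrow> \<bar>t\<bar> * sqrt 0"
      by (intro tendsto_intros lim_const_over_n)
    then have "\<forall>\<^sub>F K in sequentially. \<bar>t\<bar> * sqrt (11 / real K) < e / 3"
      using e by (intro order_tendstoD(2)) auto
    moreover have "\<forall>\<^sub>F K in sequentially. dist (\<Psi> K) (char \<nu> t) < e / 3"
      using e series(3)[of t] unfolding \<Psi>_def \<nu>_def by (intro tendstoD) auto
    ultimately have "\<forall>\<^sub>F K in sequentially. \<bar>t\<bar> * sqrt (11 / real K) < e / 3 \<and> dist (\<Psi> K) (char \<nu> t) < e / 3 \<and> 1 \<le> K"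
      using eventually_ge_at_top[of 1] by eventually_elim auto
    then obtain K where K: "\<bar>t\<bar> * sqrt (11 / real K) < e / 3" "dist (\<Psi> K) (char \<nu> t) < e / 3" "1 \<le> K"
      by (auto simp: eventually_sequentially)
    have "(\<lambda>n. D K (Suc n)) \<longlonglongrightarrow> (1 + \<bar>t\<bar>) ^ K * (real K * 0) * \<bar>t\<bar>"
      unfolding D_def by (intro tendsto_intros LIMSEQ_Suc lim_const_over_n)
    then have "\<forall>\<^sub>F n in sequentially. D K (Suc n) < e / 3" using e by (intro order_tendstoD(2)) auto
    then have "\<forall>\<^sub>F n in sequentially. norm (b t (Suc n) - char \<nu> t) < e"
      using eventually_ge_at_top[of K]
    proof eventually_elim
      case (elim n)
      have "cmod (b t (Suc n) - \<Psi> K) \<le> \<bar>t\<bar> * sqrt (11 / real K) + D K (Suc n)"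
        unfolding b_def \<Psi>_def D_def using K(3) elim by (intro cue.char_scaled_area_harm[OF cue]) auto
      then have "dist (b t (Suc n)) (\<Psi> K) < 2 * e / 3" using K(1) elim by (simp add: dist_norm)
      then show ?case using K(2) dist_triangle[of "b t (Suc n)" "char \<nu> t" "\<Psi> K"] by (simp add: dist_norm)
    qed
    then show "\<exists>no. \<forall>n\<ge>no. norm (b t (Suc n) - char \<nu> t) < e" by (simp add: eventually_sequentially)
  qed
  \<comment> \<open>The sequence is shifted by one, as the hypotheses begin at N = 1; convergence of
    the distribution functions is insensitive to the first term.\<close>
  have "weak_conv_m (\<lambda>n. \<mu> (Suc n)) \<nu>"
  proof (rule levy_continuity)
    fix n
    interpret prob_space "M (Suc n)" by (rule assms(1)) simp
    have [measurable]: "(\<lambda>\<omega>. A_CUE (Suc n) (\<theta> (Suc n) \<omega>)) \<in> borel_measurable (M (Suc n))" by (rule meas) simp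
    show "real_distribution (\<mu> (Suc n))" unfolding \<mu>_def by (rule real_distribution_distr) measurable
  next
    show "real_distribution \<nu>" unfolding \<nu>_def by (rule P.real_distribution_distr[OF series(2)])
  next
    fix t
    have "char (\<mu> (Suc n)) t = exp (\<i> * of_real (t * ((\<Sum>k. real (min (Suc k) (Suc n)) / (real (Suc k))\<^sup>2) - a (Suc n)))) * b t (Suc n)" for n
      unfolding \<mu>_def b_def by (rule cue.char_shift[OF cue]) simp
    moreover have "(\<lambda>n. exp (\<i> * of_real (t * ((\<Sum>k. real (min (Suc k) (Suc n)) / (real (Suc k))\<^sup>2) - a (Suc n)))) * b t (Suc n)) \<longlonglongrightarrow> exp (\<i> * of_real (t * 0)) * char \<nu> t"
      unfolding a_def by (intro tendsto_intros b_lim centering_tendsto)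
    ultimately show "(\<lambda>n. char (\<mu> (Suc n)) t) \<longlonglongrightarrow> char \<nu> t" by simp
  qed
  then have shifted: "(\<lambda>n. cdf (\<mu> (Suc n)) x) \<longlonglongrightarrow> cdf \<nu> x" if "isCont (cdf \<nu>) x" for x
    using that by (simp add: weak_conv_m_def weak_conv_def)
  have "weak_conv_m \<mu> \<nu>"
    unfolding weak_conv_m_def weak_conv_def by (intro allI impI, rule LIMSEQ_imp_Suc, rule shifted)
  then show "weak_conv_m
      (\<lambda>N. distr (M N) borel (\<lambda>\<omega>. (real N)\<^sup>2 / 4 * A_CUE N (\<theta> N \<omega>) - (ln (real N) + euler_mascheroni + 1)))
      (distr P borel (\<lambda>\<omega>. \<Sum>j. 1 / real (Suc j) * ((cmod (Y (Suc j) \<omega>))\<^sup>2 - 1)))"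
    unfolding \<mu>_def[abs_def] \<nu>_def a_def .
qed

end
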